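(* Let $m,p,n$ be positive integers with $p\mid m$. Let $\mathbb{F}$ be a field of characteristic zero containing a primitive $m$-th root of unity, and let $q\in\mathbb{F}\setminus\{0\}$ be an element which is not a root of unity. Let the group $G(m,p,n)$ act by $\mathbb{F}$-algebra automorphisms on $\mathbb{F}_q[x,y]^{\otimes n}$, and hence on its division ring of fractions, as specified in the context. Then there is an isomorphism of $\mathbb{F}$-algebras $$\left(\operatorname{Frac}\, \mathbb{F}_q[x,y]^{\otimes n}\right)^{G(m,p,n)}\simeq \operatorname{Frac} \left(\mathbb{F}_{q^{m/p}}[x,y]\otimes \mathbb{F}_{q^m}[x,y]^{\otimes (n-1)}\right).$$
   Context: "Algebra" means unital associative $\mathbb{F}$-algebra, and $\otimes=\otimes_{\mathbb{F}}$. For an Ore domain $A$, $\operatorname{Frac} A$ denotes its division ring of fractions. For a nonzero $t\in\mathbb{F}$, the quantum plane $\mathbb{F}_t[x,y]$ is the algebra with generators $x,y$ and defining relation $yx=t\,xy$. The tensor power $\mathbb{F}_q[x,y]^{\otimes n}$ is identified with the algebra generated by $x_1,\dots,x_n,y_1,\dots,y_n$ ($x_i,y_i$ being the generators of the $i$-th tensor factor) modulo the relations $x_ix_j=x_jx_i$, $y_iy_j=y_jy_i$, $y_ix_j=q^{\delta_{ij}}x_jy_i$ for all $i,j\in\{1,\dots,n\}$, where $\delta_{ij}$ is the Kronecker delta. It is an Ore domain. Let $\boldsymbol{\mu}_m$ be the group of all $m$-th roots of unity in $\mathbb{F}$, and let $A(m,p,n)$ be the subgroup of $(\boldsymbol{\mu}_m)^n$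 consisting of all $\alpha=(\alpha_1,\dots,\alpha_n)$ with $(\alpha_1\alpha_2\cdots\alpha_n)^{m/p}=1$. The symmetric group $S_n$ acts on $A(m,p,n)$ by permuting entries, and $G(m,p,n)=S_n\ltimes A(m,p,n)$. An element $g=(\sigma,\alpha)=\sigma\alpha\in G(m,p,n)$ (with $\sigma\in S_n$, $\alpha\in A(m,p,n)$) acts by the $\mathbb{F}$-algebra automorphism determined by $$g(x_i)=\alpha_i x_{\sigma(i)},\qquad g(y_i)=y_{\sigma(i)},\qquad i\in\{1,\dots,n\}.$$ The superscript $G(m,p,n)$ denotes the subring of elements fixed by this group. *)

theory Defs
  imports "HOL-Algebra.QuotRing" "HOL-Algebra.Module" "HOL-Algebra.Product_Groups" "HOL-Algebra.Sym_Groups"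
begin

text \<open>
  A unital associative algebra over the field \<open>'f\<close> (a type of class \<open>field\<close>) is represented by a
  record of type \<open>('f, 'a) module\<close>: a possibly noncommutative ring together with the scalar
  multiplication \<open>smult\<close>.
\<close>

section \<open>Algebras over a field\<close>

definition alg_hom :: "('f::field, 'a) module \<Rightarrow> ('f, 'b) module \<Rightarrow> ('a \<Rightarrow> 'b) set" where
  "alg_hom A B = {\<phi> \<in> ring_hom A B.
     \<forall>c. \<forall>a\<in>carrier A. \<phi> (c \<odot>\<^bsub>A\<^esub> a) = c \<odot>\<^bsub>B\<^esub> \<phi> a}"

definition alg_iso :: "('f::field, 'a) module \<Rightarrow> ('f, 'b) module \<Rightarrow> ('a \<Rightarrow> 'b) set" where
  "alg_iso A B = {\<phi> \<in> alg_hom A B. bij_betw \<phi> (carrier A) (carrier B)}"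

definition alg_isomorphic :: "('f::field, 'a) module \<Rightarrow> ('f, 'b) module \<Rightarrow> bool"
    (infix \<open>\<cong>\<^sub>a\<^sub>l\<^sub>g\<close> 50) where
  "A \<cong>\<^sub>a\<^sub>l\<^sub>g B \<longleftrightarrow> alg_iso A B \<noteq> {}"

text \<open>Automorphisms are normalised outside the carrier, so that they are determined by their
  values on the algebra.\<close>

definition alg_aut :: "('f::field, 'a) module \<Rightarrow> ('a \<Rightarrow> 'a) set" where
  "alg_aut A = alg_iso A A \<inter> extensional (carrier A)"

definition quot_alg :: "('f::field, 'a) module \<Rightarrow> 'a set \<Rightarrow> ('f, 'a set) module" where
  "quot_alg A J = ring.extend (A Quot J)
     (module.fields (\<lambda>c C. \<Union>a\<in>C. J +>\<^bsub>A\<^esub> (c \<odot>\<^bsub>A\<^esub> a)))"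

definition fixed_algebra ::
    "('g, 'm) monoid_scheme \<Rightarrow> ('g \<Rightarrow> 'a \<Rightarrow> 'a) \<Rightarrow> ('f::field, 'a) module \<Rightarrow> ('f, 'a) module" where
  "fixed_algebra G act A = A\<lparr>carrier := {a \<in> carrier A. \<forall>g\<in>carrier G. act g a = a}\<rparr>"


section \<open>Monoid algebras and presentations\<close>

definition monoid_algebra :: "('g, 'm) monoid_scheme \<Rightarrow> ('f::field, 'g \<Rightarrow> 'f) module" where
  "monoid_algebra M =
    \<lparr>carrier = {f. finite {x. f x \<noteq> 0} \<and> {x. f x \<noteq> 0} \<subseteq> carrier M},
     monoid.mult = (\<lambda>f g z. \<Sum>(x, y) \<in> {(x, y). f x \<noteq> 0 \<and> g y \<noteq> 0 \<and> x \<otimes>\<^bsub>M\<^esub> y = z}. f x * g y),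
     one = (\<lambda>z. if z = \<one>\<^bsub>M\<^esub> then 1 else 0),
     zero = (\<lambda>z. 0),
     add = (\<lambda>f g z. f z + g z),
     smult = (\<lambda>c f z. c * f z)\<rparr>"

definition basis_elt :: "'g \<Rightarrow> ('g \<Rightarrow> 'f::field)" where
  "basis_elt x = (\<lambda>z. if z = x then 1 else 0)"

definition free_monoid :: "'v list monoid" where
  "free_monoid = \<lparr>carrier = UNIV, monoid.mult = (@), one = []\<rparr>"

definition free_algebra :: "('f::field, 'v list \<Rightarrow> 'f) module" where
  "free_algebra = monoid_algebra free_monoid"


section \<open>Quantum planes\<close>

datatype plane_gen = Gx | Gy

type_synonym 'f plane = "(plane_gen list \<Rightarrow> 'f) set"

definition plane_ideal :: "'f::field \<Rightarrow> (plane_gen list \<Rightarrow> 'f) set" where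
  "plane_ideal t = Idl\<^bsub>free_algebra\<^esub>
     {basis_elt [Gy, Gx] \<ominus>\<^bsub>free_algebra\<^esub> (t \<odot>\<^bsub>free_algebra\<^esub> basis_elt [Gx, Gy])}"

definition quantum_plane :: "'f::field \<Rightarrow> ('f, 'f plane) module" where
  "quantum_plane t = quot_alg free_algebra (plane_ideal t)"

definition plane_elt :: "'f::field \<Rightarrow> plane_gen \<Rightarrow> 'f plane" where
  "plane_elt t v = plane_ideal t +>\<^bsub>free_algebra\<^esub> basis_elt [v]"


section \<open>Tensor products of finite families of algebras\<close>

text \<open>
  \<open>\<Otimes>\<^sub>i\<^sub>\<in>\<^sub>I A i\<close> is the vector space spanned by all tuples of the product of the \<open>A i\<close> modulo
  multilinearity, with componentwise multiplication of tuples. As tuples form a monoid, this is the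
  quotient of the monoid algebra by the multilinearity relations, whose linear span is already a
  two-sided ideal.
\<close>

definition multilinear_rels ::
    "'i set \<Rightarrow> ('i \<Rightarrow> ('f::field, 'a) module) \<Rightarrow> (('i \<Rightarrow> 'a) \<Rightarrow> 'f) set" where
  "multilinear_rels I A =
     (let F = monoid_algebra (product_group I A) in
      {basis_elt (v(i := a \<oplus>\<^bsub>A i\<^esub> b)) \<ominus>\<^bsub>F\<^esub> (basis_elt (v(i := a)) \<oplus>\<^bsub>F\<^esub> basis_elt (v(i := b)))
        | v i a b. v \<in> (\<Pi>\<^sub>E i\<in>I. carrier (A i)) \<and> i \<in> I \<and> a \<in> carrier (A i) \<and> b \<in> carrier (A i)}
      \<union>
      {basis_elt (v(i := c \<odot>\<^bsub>A i\<^esub> a)) \<ominus>\<^bsub>F\<^esub> (c \<odot>\<^bsub>F\<^esub> basis_elt (v(i := a)))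
        | v i a c. v \<in> (\<Pi>\<^sub>E i\<in>I. carrier (A i)) \<and> i \<in> I \<and> a \<in> carrier (A i)})"

definition tensor_ideal ::
    "'i set \<Rightarrow> ('i \<Rightarrow> ('f::field, 'a) module) \<Rightarrow> (('i \<Rightarrow> 'a) \<Rightarrow> 'f) set" where
  "tensor_ideal I A = Idl\<^bsub>monoid_algebra (product_group I A)\<^esub> (multilinear_rels I A)"

definition tensor_alg ::
    "'i set \<Rightarrow> ('i \<Rightarrow> ('f::field, 'a) module) \<Rightarrow> ('f, (('i \<Rightarrow> 'a) \<Rightarrow> 'f) set) module" where
  "tensor_alg I A = quot_alg (monoid_algebra (product_group I A)) (tensor_ideal I A)"

definition pure_tensor ::
    "'i set \<Rightarrow> ('i \<Rightarrow> ('f::field, 'a) module) \<Rightarrow> ('i \<Rightarrow> 'a) \<Rightarrow> (('i \<Rightarrow> 'a) \<Rightarrow> 'f) set" where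
  "pure_tensor I A v =
     tensor_ideal I A +>\<^bsub>monoid_algebra (product_group I A)\<^esub> basis_elt (restrict v I)"

definition factor_incl ::
    "'i set \<Rightarrow> ('i \<Rightarrow> ('f::field, 'a) module) \<Rightarrow> 'i \<Rightarrow> 'a \<Rightarrow> (('i \<Rightarrow> 'a) \<Rightarrow> 'f) set" where
  "factor_incl I A i a = pure_tensor I A (\<lambda>j. if j = i then a else \<one>\<^bsub>A j\<^esub>)"


section \<open>Division rings of fractions of Ore domains\<close>

text \<open>
  The fraction \<open>frac A a s\<close> stands for \<open>a s\<^sup>-\<^sup>1\<close>. Two fractions \<open>a s\<^sup>-\<^sup>1\<close> and \<open>b t\<^sup>-\<^sup>1\<close> agree iff they agree
  after passing to a common denominator \<open>s u = t v \<noteq> 0\<close>. The sum is \<open>(a u + b v) (s u)\<^sup>-\<^sup>1\<close> for such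
  \<open>u, v\<close>. The product is \<open>(a u) (t v)\<^sup>-\<^sup>1\<close> where \<open>s\<^sup>-\<^sup>1 b = u v\<^sup>-\<^sup>1\<close>, that is, \<open>s u = b v\<close> with \<open>v \<noteq> 0\<close>.
  As for quotient rings in the library, an operation on classes is the union over all choices of
  representatives; all these choices give the same class if \<open>A\<close> is an Ore domain.
\<close>

definition frac_pairs :: "('f::field, 'a) module \<Rightarrow> ('a \<times> 'a) set" where
  "frac_pairs A = carrier A \<times> (carrier A - {\<zero>\<^bsub>A\<^esub>})"

definition frac :: "('f::field, 'a) module \<Rightarrow> 'a \<Rightarrow> 'a \<Rightarrow> ('a \<times> 'a) set" where
  "frac A a s = {(b, t) \<in> frac_pairs A. \<exists>u\<in>carrier A. \<exists>v\<in>carrier A.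
     s \<otimes>\<^bsub>A\<^esub> u = t \<otimes>\<^bsub>A\<^esub> v \<and> s \<otimes>\<^bsub>A\<^esub> u \<noteq> \<zero>\<^bsub>A\<^esub> \<and> a \<otimes>\<^bsub>A\<^esub> u = b \<otimes>\<^bsub>A\<^esub> v}"

definition Frac :: "('f::field, 'a) module \<Rightarrow> ('f, ('a \<times> 'a) set) module" where
  "Frac A =
    \<lparr>carrier = {frac A a s | a s. (a, s) \<in> frac_pairs A},
     monoid.mult = (\<lambda>P Q. \<Union>{frac A (a \<otimes>\<^bsub>A\<^esub> u) (t \<otimes>\<^bsub>A\<^esub> v) | a s b t u v.
        (a, s) \<in> P \<and> (b, t) \<in> Q \<and> u \<in> carrier A \<and> v \<in> carrier A \<and>
        s \<otimes>\<^bsub>A\<^esub> u = b \<otimes>\<^bsub>A\<^esub> v \<and> v \<noteq> \<zero>\<^bsub>A\<^esub>}),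
     one = frac A \<one>\<^bsub>A\<^esub> \<one>\<^bsub>A\<^esub>,
     zero = frac A \<zero>\<^bsub>A\<^esub> \<one>\<^bsub>A\<^esub>,
     add = (\<lambda>P Q. \<Union>{frac A (a \<otimes>\<^bsub>A\<^esub> u \<oplus>\<^bsub>A\<^esub> b \<otimes>\<^bsub>A\<^esub> v) (s \<otimes>\<^bsub>A\<^esub> u) | a s b t u v.
        (a, s) \<in> P \<and> (b, t) \<in> Q \<and> u \<in> carrier A \<and> v \<in> carrier A \<and>
        s \<otimes>\<^bsub>A\<^esub> u = t \<otimes>\<^bsub>A\<^esub> v \<and> s \<otimes>\<^bsub>A\<^esub> u \<noteq> \<zero>\<^bsub>A\<^esub>}),
     smult = (\<lambda>c P. \<Union>{frac A (c \<odot>\<^bsub>A\<^esub> a) s | a s. (a, s) \<in> P})\<rparr>"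

text \<open>The extension of an automorphism of \<open>A\<close> to \<open>Frac A\<close>, sending \<open>a s\<^sup>-\<^sup>1\<close> to \<open>\<phi>(a) \<phi>(s)\<^sup>-\<^sup>1\<close>.\<close>

definition Frac_map ::
    "('f::field, 'a) module \<Rightarrow> ('a \<Rightarrow> 'a) \<Rightarrow> ('a \<times> 'a) set \<Rightarrow> ('a \<times> 'a) set" where
  "Frac_map A \<phi> P = \<Union>{frac A (\<phi> a) (\<phi> s) | a s. (a, s) \<in> P}"


section \<open>The groups \<open>G(m,p,n)\<close> and their action\<close>

definition A_tuples :: "nat \<Rightarrow> nat \<Rightarrow> nat \<Rightarrow> (nat \<Rightarrow> 'f::field) set" where
  "A_tuples m p n =
     {\<alpha> \<in> {1..n} \<rightarrow>\<^sub>E {z. z ^ m = 1}. (\<Prod>i\<in>{1..n}. \<alpha> i) ^ (m div p) = 1}"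

text \<open>
  The pair \<open>(\<sigma>, \<alpha>)\<close> stands for the product \<open>\<sigma>\<alpha>\<close>, which first scales by \<open>\<alpha>\<close> and then permutes. Hence
  \<open>(\<sigma>\<alpha>)(\<tau>\<beta>) = (\<sigma>\<tau>)(\<tau>\<^sup>-\<^sup>1\<alpha>\<tau> \<beta>)\<close>, where the \<open>i\<close>-th entry of \<open>\<tau>\<^sup>-\<^sup>1\<alpha>\<tau>\<close> is \<open>\<alpha>\<^bsub>\<tau>(i)\<^esub>\<close>.
\<close>

definition G_group :: "nat \<Rightarrow> nat \<Rightarrow> nat \<Rightarrow> ((nat \<Rightarrow> nat) \<times> (nat \<Rightarrow> 'f::field)) monoid" where
  "G_group m p n =
    \<lparr>carrier = carrier (sym_group n) \<times> A_tuples m p n,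
     monoid.mult = (\<lambda>(\<sigma>, \<alpha>) (\<tau>, \<beta>). (\<sigma> \<circ> \<tau>, \<lambda>i\<in>{1..n}. \<alpha> (\<tau> i) * \<beta> i)),
     one = (id, \<lambda>i\<in>{1..n}. 1)\<rparr>"

type_synonym 'f tensor_plane = "((nat \<Rightarrow> 'f plane) \<Rightarrow> 'f) set"

definition plane_power :: "'f::field \<Rightarrow> nat \<Rightarrow> ('f, 'f tensor_plane) module" where
  "plane_power q n = tensor_alg {1..n} (\<lambda>_. quantum_plane q)"

definition power_gen :: "'f::field \<Rightarrow> nat \<Rightarrow> plane_gen \<Rightarrow> nat \<Rightarrow> 'f tensor_plane" where
  "power_gen q n v i = factor_incl {1..n} (\<lambda>_. quantum_plane q) i (plane_elt q v)"

definition G_act ::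
    "'f::field \<Rightarrow> nat \<Rightarrow> (nat \<Rightarrow> nat) \<times> (nat \<Rightarrow> 'f) \<Rightarrow> 'f tensor_plane \<Rightarrow> 'f tensor_plane" where
  "G_act q n = (\<lambda>(\<sigma>, \<alpha>). THE \<phi>. \<phi> \<in> alg_aut (plane_power q n) \<and>
     (\<forall>i\<in>{1..n}.
        \<phi> (power_gen q n Gx i) = \<alpha> i \<odot>\<^bsub>plane_power q n\<^esub> power_gen q n Gx (\<sigma> i) \<and>
        \<phi> (power_gen q n Gy i) = power_gen q n Gy (\<sigma> i)))"

definition G_act_Frac ::
    "'f::field \<Rightarrow> nat \<Rightarrow> (nat \<Rightarrow> nat) \<times> (nat \<Rightarrow> 'f)
      \<Rightarrow> ('f tensor_plane \<times> 'f tensor_plane) set \<Rightarrow> ('f tensor_plane \<times> 'f tensor_plane) set" where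
  "G_act_Frac q n g = Frac_map (plane_power q n) (G_act q n g)"


section \<open>Roots of unity\<close>

definition root_of_unity :: "'f::field \<Rightarrow> bool" where
  "root_of_unity z \<longleftrightarrow> (\<exists>k>0. z ^ k = 1)"

definition primitive_root_of_unity :: "nat \<Rightarrow> 'f::field \<Rightarrow> bool" where
  "primitive_root_of_unity m z \<longleftrightarrow> z ^ m = 1 \<and> (\<forall>k. 0 < k \<and> k < m \<longrightarrow> z ^ k \<noteq> 1)"

end

theory Submission
  imports Defs Complex_Main "HOL-Library.Function_Algebras" "HOL-Computational_Algebra.Primes"
begin

text \<open>
  Let \<open>D\<close> be the division ring of fractions of the algebra of the \<open>x\<^sub>i\<close>, \<open>y\<^sub>i\<close>, realised in a ring
  of linear operators in which the nonzero elements of that algebra are units. Put \<open>X\<^sub>i = x\<^sub>i\<^sup>m\<close>,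
  \<open>t = q\<^sup>m\<close>, \<open>A(z) = \<Prod>\<^sub>i (z - X\<^sub>i)\<close> and let \<open>C(z)\<close> be the polynomial of degree less than \<open>n\<close>
  obtained by Lagrange interpolation, with \<open>C(X\<^sub>i)\<close> equal to \<open>y\<^sub>i\<close> up to a twist. The coefficients
  of \<open>A\<close> and of \<open>C\<close> are invariant, those of \<open>A\<close> commute, those of \<open>C\<close> commute, and \<open>A(z)\<close> and
  \<open>C(w)\<close> satisfy quadratic exchange relations. A step of the Euclidean algorithm for the pair
  \<open>(A, C)\<close> preserves these relations and splits off a pair of elements that commute up to the factor
  \<open>t\<close> and commute with what remains. Hence the invariants \<open>A\<^sub>k\<close>, \<open>C\<^sub>k\<close> can be traded for \<open>n\<close>
  mutually commuting such pairs; in the first one the constant term \<open>A\<^sub>0\<close> may be replaced with its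
  \<open>p\<close>-th root \<open>e = (x\<^sub>1 \<dots> x\<^sub>n)\<^bsup>m/p\<^esup>\<close>, which is invariant as well and turns the factor \<open>q\<^sup>m\<close> into
  \<open>q\<^bsup>m/p\<^esup>\<close>.

  These elements generate all invariants: starting with the division ring that they generate and
  adjoining \<open>x\<^sub>1, \<dots>, x\<^sub>n\<close> one after the other, one exhausts \<open>D\<close>, and the degree of each step is at
  most the length of the orbit of \<open>x\<^sub>j\<close> under the stabilizer of the previous ones. So a polynomial
  in \<open>x\<^sub>j\<close> that is invariant takes the same value at as many commuting points as its formal degree
  allows, and it is constant.
\<close>

section \<open>Units and division subalgebras\<close>

text \<open>Two facts replace any argument about algebraic independence. If units
  \<open>a i\<close>, \<open>b i\<close> commute up to scalars that are not roots of unity, and all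
  other pairs commute, then their monomials are eigenvectors of conjugations with different
  eigenvalues, hence linearly independent; so \<open>n\<close> such pairs generating the invariants
  already embed the target algebra. And the degrees in the tower, \<open>m (n - j + 1)\<close> for
  \<open>j < n\<close> and \<open>m / p\<close> for \<open>j = n\<close>, multiply to
  \<open>m^n n! / p\<close>, the order of the group. The order of the argument matters. The
  Euclidean algorithm could stop early and leave fewer than \<open>n\<close> pairs. This is excluded
  by the invariant element \<open>y_1 ... y_n\<close>, conjugation by which multiplies every
  \<open>X_i\<close> by \<open>t\<close>; but to use it one must know that it lies in the division
  ring generated by the coefficients. Hence generation is proved before the factorization. Working
  in one ambient ring turns both sides of the isomorphism into subsets of this ring, and there they
  are compared as sets.\<close>

definition invt :: "'r::ring_1 \<Rightarrow> bool" where
  "invt u \<longleftrightarrow> (\<exists>v. u * v = 1 \<and> v * u = 1)"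

text \<open>The value 0 at non-units makes the inverse total: 0 is its own \<open>rinv\<close>, so
  closure of a division subalgebra under \<open>rinv\<close> needs no exception for zero.\<close>

definition rinv :: "'r::ring_1 \<Rightarrow> 'r" where
  "rinv u = (if invt u then (THE v. u * v = 1 \<and> v * u = 1) else 0)"

lemma rinv_eqI:
  assumes "u * v = 1" "v * u = (1::'r::ring_1)"
  shows "rinv u = v"
proof -
  have "(THE w. u * w = 1 \<and> w * u = 1) = v"
    by (rule the_equality) (use assms in \<open>metis mult.assoc mult.left_neutral mult.right_neutral\<close>)+
  then show ?thesis unfolding rinv_def invt_def using assms by auto
qed

lemma invtI: "u * v = 1 \<Longrightarrow> v * u = 1 \<Longrightarrow> invt u"
  unfolding invt_def by blast

lemma right_rinv [simp]: "invt u \<Longrightarrow> u * rinv u = 1"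
  and left_rinv [simp]: "invt u \<Longrightarrow> rinv u * u = 1"
  unfolding invt_def using rinv_eqI by metis+

lemma right_rinv_assoc [simp]: "invt u \<Longrightarrow> u * (rinv u * a) = a"
  and left_rinv_assoc [simp]: "invt u \<Longrightarrow> rinv u * (u * a) = a"
  by (simp_all flip: mult.assoc)

lemma invt_rinv [simp]: "invt u \<Longrightarrow> invt (rinv u)"
  by (rule invtI[of _ u]) auto

lemma rinv_not_invt: "\<not> invt u \<Longrightarrow> rinv u = 0"
  by (simp add: rinv_def)

lemma invt_1 [simp]: "invt 1"
  by (rule invtI[of _ 1]) auto

lemma rinv_1 [simp]: "rinv 1 = 1"
  by (rule rinv_eqI) auto

lemma not_invt_0 [simp]: "\<not> invt (0::'r::ring_1)"
  unfolding invt_def by auto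

lemma invt_neq_0: "invt u \<Longrightarrow> u \<noteq> 0"
  by auto

lemma invt_mult [simp]: "invt u \<Longrightarrow> invt v \<Longrightarrow> invt (u * v)"
  by (rule invtI[of _ "rinv v * rinv u"]) (simp_all add: mult.assoc)

lemma rinv_mult: "invt u \<Longrightarrow> invt v \<Longrightarrow> rinv (u * v) = rinv v * rinv u"
  by (rule rinv_eqI) (simp_all add: mult.assoc)

lemma invt_cancel_left: "invt u \<Longrightarrow> u * a = u * b \<longleftrightarrow> a = b"
  by (metis left_rinv_assoc)

lemma invt_cancel_right: "invt u \<Longrightarrow> a * u = b * u \<longleftrightarrow> a = b"
  by (metis mult.assoc mult.right_neutral right_rinv)

lemma invt_mult_eq_0 [simp]: "invt u \<Longrightarrow> u * a = 0 \<longleftrightarrow> a = 0" "invt u \<Longrightarrow> a * u = 0 \<longleftrightarrow> a = 0"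
  using invt_cancel_left[of u a 0] invt_cancel_right[of u a 0] by auto

lemma invt_power [simp]: "invt u \<Longrightarrow> invt (u ^ k)"
  by (induction k) auto

lemma rinv_commute: "a * u = u * a \<Longrightarrow> a * rinv u = rinv u * a"
proof (cases "invt u")
  case True
  assume "a * u = u * a"
  then have "rinv u * (a * u) * rinv u = rinv u * (u * a) * rinv u" by simp
  then show ?thesis using True by (simp add: mult.assoc)
qed (simp add: rinv_not_invt)

lemma invt_prod_list: "(\<And>x. x \<in> set xs \<Longrightarrow> invt x) \<Longrightarrow> invt (prod_list xs)"
  by (induction xs) auto

text \<open>The ambient algebra occupies a whole type, so that ring identities can be normalised;
  algebras given as records only enter through homomorphisms into it.\<close>

locale assoc_algebra = vector_space scale
  for scale :: "'f::field \<Rightarrow> 'r::ring_1 \<Rightarrow> 'r" (infixr \<open>*s\<close> 75) +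
  assumes mult_scale_left [simp]: "c *s a * b = c *s (a * b)"
    and mult_scale_right [simp]: "a * c *s b = c *s (a * b)"
begin

lemma invt_scale [simp]: "c \<noteq> 0 \<Longrightarrow> invt u \<Longrightarrow> invt (c *s u)"
  by (rule invtI[of _ "inverse c *s rinv u"]) simp_all

lemma rinv_twist:
  assumes "a * u = c *s (u * a)" "invt u" "c \<noteq> 0"
  shows "a * rinv u = inverse c *s (rinv u * a)"
proof -
  have "rinv u * (a * u) * rinv u = c *s (rinv u * (u * a) * rinv u)"
    using assms by simp
  then have "rinv u * a = c *s (a * rinv u)"
    by (simp only: mult.assoc left_rinv_assoc[OF assms(2)] right_rinv[OF assms(2)] mult_1_right)
  then show ?thesis using assms by simp
qed

definition subalg :: "'r set \<Rightarrow> bool" where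
  "subalg S \<longleftrightarrow> (\<forall>c. c *s 1 \<in> S) \<and> (\<forall>a\<in>S. \<forall>b\<in>S. a + b \<in> S \<and> a * b \<in> S)"

lemma subalg_add: "subalg S \<Longrightarrow> a \<in> S \<Longrightarrow> b \<in> S \<Longrightarrow> a + b \<in> S"
  and subalg_mult: "subalg S \<Longrightarrow> a \<in> S \<Longrightarrow> b \<in> S \<Longrightarrow> a * b \<in> S"
  and subalg_scalar: "subalg S \<Longrightarrow> c *s 1 \<in> S"
  by (auto simp: subalg_def)

lemma subalg_scale: "subalg S \<Longrightarrow> a \<in> S \<Longrightarrow> c *s a \<in> S"
  using subalg_mult[of S "c *s 1" a] by (simp add: subalg_scalar)

lemma subalg_1: "subalg S \<Longrightarrow> 1 \<in> S"
  using subalg_scalar[of S 1] by simp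

lemma subalg_0: "subalg S \<Longrightarrow> 0 \<in> S"
  using subalg_scalar[of S 0] by simp

lemma subalg_uminus: "subalg S \<Longrightarrow> a \<in> S \<Longrightarrow> - a \<in> S"
  using subalg_scale[of S a "-1"] by (simp add: scale_minus_left)

lemma subalg_diff: "subalg S \<Longrightarrow> a \<in> S \<Longrightarrow> b \<in> S \<Longrightarrow> a - b \<in> S"
  using subalg_add[of S a "- b"] by (simp add: subalg_uminus)

lemma subalg_sum: "subalg S \<Longrightarrow> (\<And>i. i \<in> I \<Longrightarrow> f i \<in> S) \<Longrightarrow> (\<Sum>i\<in>I. f i) \<in> S"
  by (induction I rule: infinite_finite_induct) (auto intro: subalg_add subalg_0)

lemma subalg_power: "subalg S \<Longrightarrow> a \<in> S \<Longrightarrow> a ^ k \<in> S"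
  by (induction k) (auto intro: subalg_mult subalg_1)

lemma subalg_prod_list: "subalg S \<Longrightarrow> (\<And>x. x \<in> set xs \<Longrightarrow> x \<in> S) \<Longrightarrow> prod_list xs \<in> S"
  by (induction xs) (auto intro: subalg_mult subalg_1)

lemmas subalg_closed = subalg_add subalg_mult subalg_scale subalg_1 subalg_0 subalg_uminus
  subalg_diff subalg_sum subalg_power subalg_prod_list

text \<open>The ambient ring may have zero divisors, so nonzero members are required to be units of
  the whole ring, with inverses inside the subalgebra.\<close>

definition divsub :: "'r set \<Rightarrow> bool" where
  "divsub D \<longleftrightarrow> subalg D \<and> (\<forall>a\<in>D. a \<noteq> 0 \<longrightarrow> invt a) \<and> (\<forall>a\<in>D. rinv a \<in> D)"

lemma divsub_subalg: "divsub D \<Longrightarrow> subalg D"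
  and divsub_invt: "divsub D \<Longrightarrow> a \<in> D \<Longrightarrow> a \<noteq> 0 \<Longrightarrow> invt a"
  and divsub_rinv: "divsub D \<Longrightarrow> a \<in> D \<Longrightarrow> rinv a \<in> D"
  by (auto simp: divsub_def)

text \<open>Closure under \<open>rinv\<close> by itself does not make nonzero elements units; the
  set is a division subalgebra as soon as the generators lie in one
  (\<open>divsub_dgen\<close>).\<close>

inductive_set dgen :: "'r set \<Rightarrow> 'r set" for S where
  dgen_base: "a \<in> S \<Longrightarrow> a \<in> dgen S"
| dgen_scalar: "c *s 1 \<in> dgen S"
| dgen_add: "a \<in> dgen S \<Longrightarrow> b \<in> dgen S \<Longrightarrow> a + b \<in> dgen S"
| dgen_mult: "a \<in> dgen S \<Longrightarrow> b \<in> dgen S \<Longrightarrow> a * b \<in> dgen S"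
| dgen_rinv: "a \<in> dgen S \<Longrightarrow> rinv a \<in> dgen S"

lemma subalg_dgen: "subalg (dgen S)"
  by (auto simp: subalg_def intro: dgen.intros)

lemma dgen_subset: "divsub D \<Longrightarrow> S \<subseteq> D \<Longrightarrow> dgen S \<subseteq> D"
proof
  fix a assume "divsub D" "S \<subseteq> D" "a \<in> dgen S"
  from this(3) show "a \<in> D"
    by (induction rule: dgen.induct)
      (use \<open>divsub D\<close> \<open>S \<subseteq> D\<close> in \<open>auto intro: subalg_scalar subalg_add subalg_mult divsub_rinv divsub_subalg\<close>)
qed

lemma dgen_subset_dgen: "S \<subseteq> dgen T \<Longrightarrow> dgen S \<subseteq> dgen T"
proof
  fix a assume "S \<subseteq> dgen T" "a \<in> dgen S"
  from this(2) show "a \<in> dgen T"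
    by (induction rule: dgen.induct) (use \<open>S \<subseteq> dgen T\<close> in \<open>auto intro: dgen.intros\<close>)
qed

lemma dgen_mono: "S \<subseteq> T \<Longrightarrow> dgen S \<subseteq> dgen T"
  by (rule dgen_subset_dgen) (auto intro: dgen_base)

lemma divsub_dgen: "divsub D \<Longrightarrow> S \<subseteq> D \<Longrightarrow> divsub (dgen S)"
  using dgen_subset[of D S] by (auto simp: divsub_def subalg_dgen intro: dgen_rinv)

lemma dgen_commute:
  assumes "a \<in> dgen S" "\<And>s. s \<in> S \<Longrightarrow> z * s = s * z"
  shows "z * a = a * z"
  using assms(1)
proof (induction rule: dgen.induct)
  case (dgen_mult a b)
  then show ?case by (metis mult.assoc)
qed (auto simp: assms(2) rinv_commute distrib_left distrib_right)

end

section \<open>Linear algebra over a division subalgebra\<close>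

context assoc_algebra
begin

text \<open>Gaussian elimination over a division ring with more rows than columns: scalars act on
  the left, a pivot row clears column \<open>j\<close>, and the induction continues with one row and
  one column less.\<close>

lemma left_dependent:
  assumes "divsub Q" "finite I" "finite K" "card I < card K"
    and "\<And>k i. k \<in> K \<Longrightarrow> i \<in> I \<Longrightarrow> a k i \<in> Q"
  shows "\<exists>c. (\<forall>k\<in>K. c k \<in> Q) \<and> (\<exists>k\<in>K. c k \<noteq> 0) \<and> (\<forall>i\<in>I. (\<Sum>k\<in>K. c k * a k i) = 0)"
  using assms(2-)
proof (induction I arbitrary: K a rule: finite_induct)
  case empty
  then obtain k where "k \<in> K" by fastforce
  then show ?case using divsub_subalg[OF assms(1)] by (intro exI[of _ "\<lambda>_. 1"]) (auto intro: subalg_1)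
next
  case (insert j I)
  note sub = divsub_subalg[OF assms(1)]
  show ?case
  proof (cases "\<forall>k\<in>K. a k j = 0")
    case True
    obtain c where "\<forall>k\<in>K. c k \<in> Q" "\<exists>k\<in>K. c k \<noteq> 0" "\<forall>i\<in>I. (\<Sum>k\<in>K. c k * a k i) = 0"
    proof -
      have "card I < card K" using insert.prems insert.hyps by simp
      then show ?thesis using insert.IH[of K a] insert.prems that by auto
    qed
    then show ?thesis using True by (intro exI[of _ c]) auto
  next
    case False
    then obtain p where p: "p \<in> K" "a p j \<noteq> 0" by blast
    define K' where "K' = K - {p}"
    define r where "r k = a k j * rinv (a p j)" for k
    have r: "r k \<in> Q" if "k \<in> K" for k
      unfolding r_def using insert.prems p that assms(1) sub by (auto intro!: subalg_mult divsub_rinv)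
    have inv: "invt (a p j)" using p insert.prems assms(1) by (auto intro: divsub_invt)
    have K': "K = insert p K'" "p \<notin> K'" "finite K'" using p insert.prems by (auto simp: K'_def)
    obtain c where c: "\<forall>k\<in>K'. c k \<in> Q" "\<exists>k\<in>K'. c k \<noteq> 0"
      "\<forall>i\<in>I. (\<Sum>k\<in>K'. c k * (a k i - r k * a p i)) = 0"
    proof -
      have "card I < card K'" using insert.prems(2) insert.hyps K' by simp
      moreover have "a k i - r k * a p i \<in> Q" if "k \<in> K'" "i \<in> I" for k i
        using that insert.prems(3) K' r p sub by (intro subalg_diff subalg_mult) auto
      ultimately show ?thesis using insert.IH[of K' "\<lambda>k i. a k i - r k * a p i"] K'(3) that by blast
    qed
    \<comment> \<open>This coefficient of the pivot row turns the relation among the reduced rows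
      into one among the original rows.\<close>
    define c' where "c' k = (if k = p then - (\<Sum>k\<in>K'. c k * r k) else c k)" for k
    have sum: "(\<Sum>k\<in>K. c' k * a k i) = (\<Sum>k\<in>K'. c k * (a k i - r k * a p i))" for i
    proof -
      have "(\<Sum>k\<in>K'. c' k * a k i) = (\<Sum>k\<in>K'. c k * a k i)"
        using K' by (intro sum.cong) (auto simp: c'_def)
      then show ?thesis using K'
        by (simp add: c'_def sum_subtractf right_diff_distrib sum_distrib_right mult.assoc)
    qed
    have "(\<Sum>k\<in>K. c' k * a k j) = 0"
      unfolding sum r_def using inv by (simp add: mult.assoc)
    moreover have "c' k \<in> Q" if "k \<in> K" for k
      using that K' c r sub by (auto simp: c'_def intro!: subalg_uminus subalg_sum subalg_mult)
    moreover have "\<exists>k\<in>K. c' k \<noteq> 0" using c(2) K' by (auto simp: c'_def)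
    ultimately show ?thesis using c(3) sum by (intro exI[of _ c']) auto
  qed
qed

definition lspan :: "'r set \<Rightarrow> 'i set \<Rightarrow> ('i \<Rightarrow> 'r) \<Rightarrow> 'r set" where
  "lspan Q I e = {\<Sum>i\<in>I. c i * e i | c. \<forall>i\<in>I. c i \<in> Q}"

lemma lspan_add:
  assumes "divsub Q" "a \<in> lspan Q I e" "b \<in> lspan Q I e"
  shows "a + b \<in> lspan Q I e"
proof -
  obtain c d where "\<forall>i\<in>I. c i \<in> Q" "\<forall>i\<in>I. d i \<in> Q" "a = (\<Sum>i\<in>I. c i * e i)" "b = (\<Sum>i\<in>I. d i * e i)"
    using assms by (auto simp: lspan_def)
  then show ?thesis using divsub_subalg[OF assms(1)] unfolding lspan_def
    by (intro CollectI exI[of _ "\<lambda>i. c i + d i"]) (auto simp: distrib_right sum.distrib intro: subalg_add)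
qed

lemma lspan_mult:
  assumes "divsub Q" "q \<in> Q" "a \<in> lspan Q I e"
  shows "q * a \<in> lspan Q I e"
proof -
  obtain c where "\<forall>i\<in>I. c i \<in> Q" "a = (\<Sum>i\<in>I. c i * e i)"
    using assms by (auto simp: lspan_def)
  then show ?thesis using divsub_subalg[OF assms(1)] assms(2) unfolding lspan_def
    by (intro CollectI exI[of _ "\<lambda>i. q * c i"]) (auto simp: sum_distrib_left mult.assoc intro: subalg_mult)
qed

lemma lspan_zero: "divsub Q \<Longrightarrow> 0 \<in> lspan Q I e"
  unfolding lspan_def by (intro CollectI exI[of _ "\<lambda>i. 0"]) (auto intro: subalg_0 divsub_subalg)

lemma lspan_sum:
  assumes "divsub Q" "\<And>k. k \<in> K \<Longrightarrow> a k \<in> lspan Q I e"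
  shows "(\<Sum>k\<in>K. a k) \<in> lspan Q I e"
  using assms(2) by (induction K rule: infinite_finite_induct) (auto intro: lspan_zero lspan_add assms(1))

text \<open>Among \<open>\<mu>, \<mu>s, \<mu>s\<^sup>2, \<dots>\<close> there is a linear dependence over \<open>Q\<close>; divide it by the lowest
  power of \<open>s\<close> that occurs.\<close>

lemma lspan_rinv:
  assumes Q: "divsub Q" and fin: "finite I" and s: "\<And>a. a \<in> lspan Q I e \<Longrightarrow> a * s \<in> lspan Q I e"
    and \<mu>: "\<mu> \<in> lspan Q I e"
  shows "\<mu> * rinv s \<in> lspan Q I e"
proof (cases "invt s")
  case True
  define N where "N = card I"
  have pow: "\<mu> * s ^ k \<in> lspan Q I e" for k
  proof (induction k)
    case (Suc k)
    from s[OF Suc] show ?case by (simp add: mult.assoc power_commutes)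
  qed (use \<mu> in simp)
  then have "\<forall>k. \<exists>c. (\<forall>i\<in>I. c i \<in> Q) \<and> \<mu> * s ^ k = (\<Sum>i\<in>I. c i * e i)"
    unfolding lspan_def by blast
  then obtain a where a: "\<And>k i. i \<in> I \<Longrightarrow> a k i \<in> Q" "\<And>k. \<mu> * s ^ k = (\<Sum>i\<in>I. a k i * e i)"
    by metis
  obtain c where c: "\<forall>k\<in>{..N}. c k \<in> Q" "\<exists>k\<in>{..N}. c k \<noteq> 0"
    "\<forall>i\<in>I. (\<Sum>k\<in>{..N}. c k * a k i) = 0"
    using left_dependent[OF Q fin, of "{..N}" a] a by (auto simp: N_def)
  have "(\<Sum>k\<le>N. c k * (\<mu> * s ^ k)) = (\<Sum>i\<in>I. (\<Sum>k\<le>N. c k * a k i) * e i)"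
    by (simp add: a(2) sum_distrib_left sum_distrib_right mult.assoc sum.swap[of _ I])
  also have "\<dots> = 0" using c(3) by simp
  finally have rel: "(\<Sum>k\<le>N. c k * (\<mu> * s ^ k)) = 0" .
  define l where "l = (LEAST k. c k \<noteq> 0)"
  have l: "c l \<noteq> 0" "\<And>k. k < l \<Longrightarrow> c k = 0"
    using c(2) LeastI_ex[of "\<lambda>k. c k \<noteq> 0"] unfolding l_def by (auto dest: not_less_Least)
  have lN: "l \<le> N" using c(2) l by (meson atMost_iff le_trans not_less)
  have "(\<Sum>k\<le>N. c k * (\<mu> * s ^ k)) = (\<Sum>k\<in>{l..N}. c k * (\<mu> * s ^ k))"
    by (rule sum.mono_neutral_right) (auto simp: l(2))
  also have "\<dots> = c l * (\<mu> * s ^ l) + (\<Sum>k\<in>{Suc l..N}. c k * (\<mu> * s ^ k))"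
    using lN by (simp add: sum.atLeast_Suc_atMost)
  also have "(\<Sum>k\<in>{Suc l..N}. c k * (\<mu> * s ^ k)) = (\<Sum>k\<in>{Suc l..N}. c k * (\<mu> * s ^ (k - Suc l))) * s ^ Suc l"
    unfolding sum_distrib_right
    by (intro sum.cong refl) (simp add: mult.assoc flip: power_add power_Suc)
  finally have "(c l * (\<mu> * rinv s) + (\<Sum>k\<in>{Suc l..N}. c k * (\<mu> * s ^ (k - Suc l)))) * s ^ Suc l = 0"
    using rel True by (simp add: distrib_right mult.assoc)
  then have "c l * (\<mu> * rinv s) = - (\<Sum>k\<in>{Suc l..N}. c k * (\<mu> * s ^ (k - Suc l)))"
    using True by (simp add: eq_neg_iff_add_eq_0 del: power_Suc)
  then have "\<mu> * rinv s = rinv (c l) * (- (\<Sum>k\<in>{Suc l..N}. c k * (\<mu> * s ^ (k - Suc l))))"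
    using divsub_invt[OF Q, of "c l"] c(1) lN l(1) by (metis atMost_iff left_rinv_assoc)
  also have "\<dots> = (- rinv (c l)) * (\<Sum>k\<in>{Suc l..N}. c k * (\<mu> * s ^ (k - Suc l)))" by simp
  also have "\<dots> \<in> lspan Q I e"
    using c(1) lN Q
    by (intro lspan_mult lspan_sum pow subalg_uminus divsub_rinv divsub_subalg) auto
  finally show ?thesis .
qed (use Q in \<open>simp add: rinv_not_invt lspan_zero\<close>)

text \<open>The tower law for left spans: expanding the coefficients of the powers of
  \<open>x\<close> leaves the products \<open>e i * x ^ k\<close> as a spanning family.\<close>

lemma lspan_tower:
  fixes Q :: "'r set" and e :: "'i \<Rightarrow> 'r" and x :: 'r and N :: nat
  assumes "finite I"
  shows "{\<Sum>k<N. c k * x ^ k | c. \<forall>k<N. c k \<in> lspan Q I e}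
     = lspan Q (I \<times> {..<N}) (\<lambda>(i, k). e i * x ^ k)" (is "?L = ?R")
proof (intro equalityI subsetI)
  fix r assume "r \<in> ?L"
  then obtain c where c: "r = (\<Sum>k<N. c k * x ^ k)" "\<forall>k<N. c k \<in> lspan Q I e" by blast
  then have "\<forall>k\<in>{..<N}. \<exists>d. (\<forall>i\<in>I. d i \<in> Q) \<and> c k = (\<Sum>i\<in>I. d i * e i)"
    unfolding lspan_def by fastforce
  then obtain d where d: "\<And>k. k < N \<Longrightarrow> (\<forall>i\<in>I. d k i \<in> Q) \<and> c k = (\<Sum>i\<in>I. d k i * e i)"
    by (metis bchoice lessThan_iff)
  have "r = (\<Sum>k<N. \<Sum>i\<in>I. d k i * (e i * x ^ k))"
    unfolding c(1) by (intro sum.cong refl) (use d in \<open>simp add: sum_distrib_right mult.assoc\<close>)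
  also have "\<dots> = (\<Sum>(i, k)\<in>I \<times> {..<N}. d k i * (e i * x ^ k))"
    by (subst sum.swap) (simp add: sum.cartesian_product)
  finally show "r \<in> ?R" unfolding lspan_def using d
    by (intro CollectI exI[of _ "\<lambda>(i, k). d k i"]) (auto simp: case_prod_unfold)
next
  fix r assume "r \<in> ?R"
  then obtain c where c: "r = (\<Sum>p\<in>I \<times> {..<N}. c p * (case p of (i, k) \<Rightarrow> e i * x ^ k))"
    "\<forall>p\<in>I \<times> {..<N}. c p \<in> Q" unfolding lspan_def by blast
  have "r = (\<Sum>i\<in>I. \<Sum>k<N. c (i, k) * (e i * x ^ k))"
    unfolding c(1) by (simp add: sum.cartesian_product case_prod_unfold)
  also have "\<dots> = (\<Sum>k<N. (\<Sum>i\<in>I. c (i, k) * e i) * x ^ k)"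
    by (subst sum.swap) (simp add: sum_distrib_right mult.assoc)
  finally show "r \<in> ?L" using c(2) unfolding lspan_def
    by (intro CollectI exI[of _ "\<lambda>k. \<Sum>i\<in>I. c (i, k) * e i"]) auto
qed

end

text \<open>For commuting points with invertible differences the usual bound on the number of roots
  survives noncommutative coefficients: at a root \<open>w\<close> the factor \<open>z - w\<close>
  splits off on the right, and the quotient still vanishes at the other points.\<close>

lemma commuting_roots:
  fixes c :: "nat \<Rightarrow> 'r::ring_1"
  assumes "finite Z" "card Z = N"
    and "\<And>y z. y \<in> Z \<Longrightarrow> z \<in> Z \<Longrightarrow> y * z = z * y"
    and "\<And>y z. y \<in> Z \<Longrightarrow> z \<in> Z \<Longrightarrow> y \<noteq> z \<Longrightarrow> invt (y - z)"
    and "\<And>z. z \<in> Z \<Longrightarrow> (\<Sum>k<N. c k * z ^ k) = 0"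
  shows "\<forall>k<N. c k = 0"
  using assms
proof (induction N arbitrary: Z c)
  case (Suc N)
  obtain w Z' where Z: "Z = insert w Z'" "w \<notin> Z'" "card Z' = N" "finite Z'"
    using Suc.prems by (metis card_Suc_eq finite_insert)
  \<comment> \<open>Coefficients of the quotient after division by \<open>z - w\<close> on the
    right.\<close>
  define d where "d l = (\<Sum>k\<in>{l<..N}. c k * w ^ (k - Suc l))" for l
  have "(\<Sum>l<N. d l * z ^ l) = 0" if z: "z \<in> Z'" for z
  proof -
    have comm: "z * w = w * z" and inv: "invt (z - w)" using Suc.prems Z z by auto
    have pow: "z ^ k - w ^ k = (\<Sum>l<k. w ^ (k - Suc l) * z ^ l) * (z - w)" for k
    proof (induction k)
      case (Suc k)
      have "(\<Sum>l<Suc k. w ^ (Suc k - Suc l) * z ^ l) = w * (\<Sum>l<k. w ^ (k - Suc l) * z ^ l) + z ^ k"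
      proof -
        have "w ^ (k - l) * z ^ l = w * (w ^ (k - Suc l) * z ^ l)" if "l < k" for l
        proof -
          have "k - l = Suc (k - Suc l)" using that by simp
          then show ?thesis by (simp only: power_Suc mult.assoc)
        qed
        then show ?thesis by (simp add: sum_distrib_left)
      qed
      then have "(\<Sum>l<Suc k. w ^ (Suc k - Suc l) * z ^ l) * (z - w) = w * (z ^ k - w ^ k) + z ^ k * (z - w)"
        by (simp only: distrib_right mult.assoc Suc)
      also have "\<dots> = z ^ Suc k - w ^ Suc k"
      proof -
        have "z ^ k * w = w * z ^ k" using power_commuting_commutes[OF comm] by simp
        then show ?thesis by (simp add: right_diff_distrib power_commutes)
      qed
      finally show ?case by simp
    qed simp
    have "0 = (\<Sum>k<Suc N. c k * z ^ k) - (\<Sum>k<Suc N. c k * w ^ k)" using Suc.prems(5) Z z by simp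
    also have "\<dots> = (\<Sum>k<Suc N. c k * (z ^ k - w ^ k))" by (simp add: sum_subtractf right_diff_distrib)
    also have "\<dots> = (\<Sum>k<Suc N. \<Sum>l<k. c k * w ^ (k - Suc l) * z ^ l) * (z - w)"
      by (simp only: pow sum_distrib_right sum_distrib_left mult.assoc)
    also have "(\<Sum>k<Suc N. \<Sum>l<k. c k * w ^ (k - Suc l) * z ^ l) = (\<Sum>l<N. d l * z ^ l)"
      unfolding d_def sum_distrib_right
      by (subst (1 2) sum.Sigma) (auto intro!: sum.reindex_bij_witness[of _ "\<lambda>(a, b). (b, a)" "\<lambda>(a, b). (b, a)"])
    finally show ?thesis using inv by simp
  qed
  then have d0: "\<forall>l<N. d l = 0" using Suc.IH[of Z' d] Suc.prems Z by auto
  \<comment> \<open>The vanishing quotient determines the \<open>c\<close> from the top degree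
    downwards; only \<open>c 0\<close> is left, and it equals the value at \<open>w\<close>.\<close>
  have c0: "c (Suc l) = 0" if "l < N" for l
    using that
  proof (induction "N - l" arbitrary: l rule: less_induct)
    case less
    have "d l = c (Suc l) + (\<Sum>k\<in>{Suc l<..N}. c k * w ^ (k - Suc l))"
    proof -
      have "{l<..N} = insert (Suc l) {Suc l<..N}" using less.prems by auto
      then show ?thesis by (simp add: d_def)
    qed
    moreover have "(\<Sum>k\<in>{Suc l<..N}. c k * w ^ (k - Suc l)) = 0"
    proof (rule sum.neutral, safe)
      fix k assume k: "k \<in> {Suc l<..N}"
      then have "c (Suc (k - 1)) = 0" using less.hyps[of "k - 1"] by auto
      then show "c k * w ^ (k - Suc l) = 0" using k by auto
    qed
    ultimately show ?case using d0 less.prems by simp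
  qed
  have "(\<Sum>k<Suc N. c k * w ^ k) = c 0" unfolding sum.lessThan_Suc_shift using c0 by simp
  then have "c 0 = 0" using Suc.prems(5) Z by simp
  then show ?case using c0 by (metis less_Suc_eq_0_disj)
qed simp

section \<open>Linear relations in vector spaces\<close>

context vector_space
begin

text \<open>Different pairs may be separated by different operators. Applying
  \<open>f - ev \<nu>\<close> kills the term of \<open>\<nu>\<close> and shows that the coefficients
  vanish wherever \<open>ev\<close> differs from \<open>ev \<nu>\<close>; what remains is a relation
  on a smaller set.\<close>

lemma eigenvectors_independent:
  assumes "finite S" "\<And>\<mu>. \<mu> \<in> S \<Longrightarrow> v \<mu> \<noteq> 0"
    and "\<And>\<mu> \<nu>. \<mu> \<in> S \<Longrightarrow> \<nu> \<in> S \<Longrightarrow> \<mu> \<noteq> \<nu> \<Longrightarrow> \<exists>f ev. (\<forall>x y. f (x + y) = f x + f y) \<and> (\<forall>c x. f (scale c x) = scale c (f x)) \<and>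
        (\<forall>\<kappa>\<in>S. f (v \<kappa>) = scale (ev \<kappa>) (v \<kappa>)) \<and> ev \<mu> \<noteq> ev \<nu>"
    and "(\<Sum>\<mu>\<in>S. scale (c \<mu>) (v \<mu>)) = 0"
  shows "\<forall>\<mu>\<in>S. c \<mu> = 0"
  using assms
proof (induction "card S" arbitrary: S c rule: less_induct)
  case less
  show ?case
  proof (cases "\<exists>\<mu>\<in>S. \<exists>\<nu>\<in>S. \<mu> \<noteq> \<nu>")
    case False
    then consider "S = {}" | \<mu> where "S = {\<mu>}" by blast
    then show ?thesis using less.prems by cases auto
  next
    case True
    then obtain \<mu> \<nu> where mn: "\<mu> \<in> S" "\<nu> \<in> S" "\<mu> \<noteq> \<nu>" by blast
    obtain f ev where f: "\<And>x y. f (x + y) = f x + f y" "\<And>c x. f (scale c x) = scale c (f x)"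
      "\<And>\<kappa>. \<kappa> \<in> S \<Longrightarrow> f (v \<kappa>) = scale (ev \<kappa>) (v \<kappa>)" "ev \<mu> \<noteq> ev \<nu>"
      using less.prems(3)[OF mn] by blast
    have f0: "f 0 = 0" using f(2)[of 0 0] by simp
    have fsum: "f (\<Sum>\<kappa>\<in>T. g \<kappa>) = (\<Sum>\<kappa>\<in>T. f (g \<kappa>))" for T and g :: "'c \<Rightarrow> 'b"
      by (induction T rule: infinite_finite_induct) (auto simp: f(1) f0)
    have "0 = f (\<Sum>\<kappa>\<in>S. scale (c \<kappa>) (v \<kappa>)) - scale (ev \<nu>) (\<Sum>\<kappa>\<in>S. scale (c \<kappa>) (v \<kappa>))"
      using less.prems(4) f0 by simp
    also have "\<dots> = (\<Sum>\<kappa>\<in>S. scale (c \<kappa> * (ev \<kappa> - ev \<nu>)) (v \<kappa>))"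
      unfolding fsum scale_sum_right sum_subtractf[symmetric]
      by (intro sum.cong refl) (simp add: f scale_left_diff_distrib algebra_simps)
    also have "\<dots> = (\<Sum>\<kappa>\<in>S - {\<nu>}. scale (c \<kappa> * (ev \<kappa> - ev \<nu>)) (v \<kappa>))"
      by (rule sum.mono_neutral_right) (use less.prems in auto)
    finally have rel: "(\<Sum>\<kappa>\<in>S - {\<nu>}. scale (c \<kappa> * (ev \<kappa> - ev \<nu>)) (v \<kappa>)) = 0" by simp
    have sub: "\<forall>\<mu>\<in>U. d \<mu> = 0" if "U \<subset> S" "(\<Sum>\<mu>\<in>U. scale (d \<mu>) (v \<mu>)) = 0" for U d
    proof (rule less.hyps)
      show "card U < card S" using that less.prems(1) by (simp add: psubset_card_mono)
      show "finite U" using that less.prems(1) by (auto intro: finite_subset)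
      show "v \<mu> \<noteq> 0" if "\<mu> \<in> U" for \<mu> using that \<open>U \<subset> S\<close> less.prems(2) by blast
      show "\<exists>f ev. (\<forall>x y. f (x + y) = f x + f y) \<and> (\<forall>c x. f (scale c x) = scale c (f x)) \<and>
        (\<forall>\<kappa>\<in>U. f (v \<kappa>) = scale (ev \<kappa>) (v \<kappa>)) \<and> ev \<mu> \<noteq> ev \<nu>" if "\<mu> \<in> U" "\<nu> \<in> U" "\<mu> \<noteq> \<nu>" for \<mu> \<nu>
      proof -
        have "\<mu> \<in> S" "\<nu> \<in> S" using that \<open>U \<subset> S\<close> by auto
        from less.prems(3)[OF this that(3)] obtain f ev where *: "(\<forall>x y. f (x + y) = f x + f y) \<and> (\<forall>c x. f (scale c x) = scale c (f x)) \<and>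
        (\<forall>\<kappa>\<in>S. f (v \<kappa>) = scale (ev \<kappa>) (v \<kappa>)) \<and> ev \<mu> \<noteq> ev \<nu>" by blast
        show ?thesis by (rule exI[of _ f], rule exI[of _ ev]) (use * \<open>U \<subset> S\<close> in auto)
      qed
    qed (rule that(2))
    have *: "\<forall>\<kappa>\<in>S - {\<nu>}. c \<kappa> * (ev \<kappa> - ev \<nu>) = 0"
      by (rule sub[OF _ rel]) (use mn in auto)
    \<comment> \<open>The vectors that \<open>f\<close> does not distinguish from
      \<open>\<nu>\<close>; since \<open>\<mu>\<close> is not among them, the induction hypothesis
      applies.\<close>
    define T where "T = {\<kappa>\<in>S. ev \<kappa> = ev \<nu>}"
    have cT: "c \<kappa> = 0" if "\<kappa> \<in> S - T" for \<kappa> using * that mn by (auto simp: T_def)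
    have "T \<subset> S" using mn f(4) by (auto simp: T_def)
    have "(\<Sum>\<kappa>\<in>T. scale (c \<kappa>) (v \<kappa>)) = (\<Sum>\<kappa>\<in>S. scale (c \<kappa>) (v \<kappa>))"
      by (rule sum.mono_neutral_left) (use less.prems cT in \<open>auto simp: T_def\<close>)
    then have "\<forall>\<mu>\<in>T. c \<mu> = 0"
      using less.prems(4) by (intro sub[OF \<open>T \<subset> S\<close>]) simp
    then show ?thesis using cT by blast
  qed
qed

text \<open>The vectors form a family rather than a set: two equal members give a relation at once,
  otherwise the dimension bound applies.\<close>

lemma exists_linear_relation:
  assumes "finite I" "finite T" "card T < card I" "\<And>i. i \<in> I \<Longrightarrow> v i \<in> span T"
  shows "\<exists>c. (\<exists>i\<in>I. c i \<noteq> 0) \<and> (\<Sum>i\<in>I. scale (c i) (v i)) = 0"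
proof (cases "inj_on v I")
  case True
  have "\<not> independent (v ` I)"
  proof
    assume "independent (v ` I)"
    from independent_span_bound[OF assms(2) this] have "card (v ` I) \<le> card T" using assms by blast
    then show False using assms card_image[OF True] by simp
  qed
  then obtain u where u: "\<exists>w\<in>v ` I. u w \<noteq> 0" "(\<Sum>w\<in>v ` I. scale (u w) w) = 0"
    using dependent_finite[of "v ` I"] assms(1) by auto
  then show ?thesis using sum.reindex[OF True, of "\<lambda>w. scale (u w) w"]
    by (intro exI[of _ "u \<circ> v"]) auto
next
  case False
  then obtain i j where ij: "i \<in> I" "j \<in> I" "i \<noteq> j" "v i = v j" by (auto simp: inj_on_def)
  define c where "c k = (if k = i then 1 else if k = j then - 1 else (0::'a))" for k
  have "(\<Sum>k\<in>I. scale (c k) (v k)) = (\<Sum>k\<in>{i, j}. scale (c k) (v k))"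
    by (rule sum.mono_neutral_right) (use ij assms in \<open>auto simp: c_def\<close>)
  also have "\<dots> = 0" using ij by (simp add: c_def)
  finally show ?thesis using ij by (intro exI[of _ c]) (auto simp: c_def)
qed

end

section \<open>The Euclidean algorithm for Lax pairs\<close>

text \<open>Coefficients of \<open>z f(z)\<close>, when \<open>f\<close> lists those of a generating
  function \<open>f(z)\<close>.\<close>

definition prev :: "(nat \<Rightarrow> 'a::zero) \<Rightarrow> nat \<Rightarrow> 'a" where
  "prev f i = (case i of 0 \<Rightarrow> 0 | Suc k \<Rightarrow> f k)"

lemma prev_simps [simp]: "prev f 0 = 0" "prev f (Suc k) = f k"
  by (auto simp: prev_def)

context assoc_algebra
begin

lemma twist_rinv_left:
  assumes "u * a = c *s (a * u)" "invt u" "c \<noteq> 0"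
  shows "rinv u * a = inverse c *s (a * rinv u)"
proof -
  have "c *s (rinv u * a) = rinv u * (c *s (a * u)) * rinv u"
    using assms(2) by (simp add: mult.assoc)
  also have "\<dots> = rinv u * (u * a) * rinv u" using assms(1) by simp
  also have "\<dots> = a * rinv u" using assms(2) by simp
  finally have "inverse c *s c *s (rinv u * a) = inverse c *s (a * rinv u)" by simp
  then show ?thesis using assms(3) by simp
qed

lemma commute_rinv_left: "u * a = a * u \<Longrightarrow> rinv u * a = a * rinv u"
  using rinv_commute[of a u] by simp

text \<open>Conjugation by \<open>u\<close> multiplies \<open>Y\<close> by \<open>t\<close> and
  fixes \<open>Z\<close>. The commutator of the sums splits into a part \<open>U\<close> of weight
  \<open>t\<close> and a part \<open>W\<close> of weight \<open>t^2\<close>, while the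
  \<open>Z\<close> part vanishes; as \<open>t\<close> and \<open>t^2\<close> differ,
  \<open>U + W = 0\<close> forces \<open>W = 0\<close>.\<close>

lemma split_commute:
  fixes X Y Z :: "nat \<Rightarrow> 'r"
  assumes X: "\<And>i. X i = Y i + Z i"
    and XX: "\<And>i j. X i * X j = X j * X i" and ZZ: "\<And>i j. Z i * Z j = Z j * Z i"
    and uZ: "\<And>i. u * Z i = Z i * u" and uY: "\<And>i. u * Y i = t *s (Y i * u)"
    and t: "t \<noteq> 0" "t \<noteq> 1" and u: "invt u"
  shows "Y i * Y j = Y j * Y i"
proof -
  define U where "U = Y i * Z j - Z j * Y i + (Z i * Y j - Y j * Z i)"
  define W where "W = Y i * Y j - Y j * Y i"
  have "U + W = 0" using XX[of i j] ZZ[of i j] by (simp add: X U_def W_def algebra_simps)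
  have uZ': "u * (Z i * b) = Z i * (u * b)" for i b using uZ by (metis mult.assoc)
  have uY': "u * (Y i * b) = t *s (Y i * (u * b))" for i b
    using uY by (metis mult.assoc mult_scale_left)
  have "u * U = t *s (U * u)"
    by (simp add: U_def algebra_simps uZ uY uZ' uY')
  moreover have "u * W = (t * t) *s (W * u)"
    by (simp add: W_def algebra_simps uY uY')
  ultimately have "u * (U + W) = t *s (U * u) + (t * t) *s (W * u)"
    by (simp add: distrib_left)
  then have "t *s (U * u) + (t * t) *s (W * u) = 0" using \<open>U + W = 0\<close> by simp
  moreover have "U = - W" using \<open>U + W = 0\<close> by (simp add: eq_neg_iff_add_eq_0)
  ultimately have "(t * t - t) *s (W * u) = 0" by (simp add: scale_left_diff_distrib)
  moreover have "t * t - t \<noteq> 0" using t by simp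
  ultimately have "W * u = 0" using scale_eq_0_iff by blast
  then have "W = 0" using u by simp
  then show ?thesis by (simp add: W_def)
qed

text \<open>The two families of relations are the coefficients of
  \<open>(z - w) C(w) A(z) = (z - tw) A(z) C(w) - (1 - t) z A(w) C(z)\<close> and of
  \<open>t (z - w) A(w) C(z) = (z - tw) C(z) A(w) - (1 - t) w C(w) A(z)\<close> for the generating functions
  \<open>A(z) = \<Sum>i. A i z^i\<close> and \<open>C(z) = \<Sum>i. C i z^i\<close>. They are equivalent, but a step of the
  Euclidean algorithm turns each of them into the other one, so that it is convenient to carry both.\<close>

definition lax :: "'r set \<Rightarrow> 'f \<Rightarrow> nat \<Rightarrow> (nat \<Rightarrow> 'r) \<Rightarrow> (nat \<Rightarrow> 'r) \<Rightarrow> bool" where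
  "lax D t n A C \<longleftrightarrow> (\<forall>i. A i \<in> D \<and> C i \<in> D) \<and>
     (\<forall>i j. A i * A j = A j * A i) \<and> (\<forall>i j. C i * C j = C j * C i) \<and>
     A n = 1 \<and> (\<forall>i>n. A i = 0) \<and> (\<forall>i\<ge>n. C i = 0) \<and>
     (\<forall>i j. C j * prev A i - prev C j * A i
        = prev A i * C j - t *s (A i * prev C j) - (1 - t) *s (A j * prev C i)) \<and>
     (\<forall>i j. t *s (A j * prev C i) - t *s (prev A j * C i)
        = prev C i * A j - t *s (C i * prev A j) - (1 - t) *s (prev C j * A i))"

end

locale lax_pair = assoc_algebra scale
  for scale :: "'f::field \<Rightarrow> 'r::ring_1 \<Rightarrow> 'r" (infixr \<open>*s\<close> 75) +
  fixes D :: "'r set" and t :: 'f and n :: nat and A C :: "nat \<Rightarrow> 'r"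
  assumes D: "divsub D" and t: "t \<noteq> 0" "t \<noteq> 1" and lax: "lax D t (Suc n) A C"
    and A0: "A 0 \<noteq> 0" and C_nonzero: "\<exists>i. C i \<noteq> 0"
begin

text \<open>In terms of generating functions: \<open>A'(z)\<close> is \<open>C(z)\<close> made
  monic, \<open>R(z) = A(z) - z A'(z)\<close> loses the top coefficient of \<open>A\<close>,
  \<open>R'(z)\<close> is \<open>R(z)\<close> with constant term normalised to 1, and
  \<open>z C'(z) = R'(z) - A'(0)^-1 A'(z)\<close>. Division thus takes place at both ends, and
  \<open>A\<close> and \<open>C\<close> can be recovered from \<open>\<rho>\<close>,
  \<open>A 0\<close>, \<open>A'\<close> and \<open>C'\<close>.\<close>

definition "\<rho> = C n"
definition "A' i = rinv \<rho> * C i"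
definition "R i = A i - prev A' i"
definition "R' i = rinv (A 0) * R i"
definition "C' i = R' (Suc i) - rinv (A' 0) * A' (Suc i)"

lemma mem: "A i \<in> D" "C i \<in> D"
  and AA: "A i * A j = A j * A i" and CC: "C i * C j = C j * C i"
  and A_lead: "A (Suc n) = 1" and A_high: "i > Suc n \<Longrightarrow> A i = 0" and C_high: "i > n \<Longrightarrow> C i = 0"
  and form1: "C j * prev A i - prev C j * A i
        = prev A i * C j - t *s (A i * prev C j) - (1 - t) *s (A j * prev C i)"
  and form2: "t *s (A j * prev C i) - t *s (prev A j * C i)
        = prev C i * A j - t *s (C i * prev A j) - (1 - t) *s (prev C j * A i)"
  using lax unfolding lax_def by auto

lemma t1: "1 - t \<noteq> 0" using t by simp

lemma a_unit: "invt (A 0)"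
  using divsub_invt[OF D] mem A0 by blast

text \<open>The relation at the top index \<open>j = n + 1\<close>, where \<open>A\<close> is 1 and
  \<open>C\<close> vanishes.\<close>

lemma rho_A: "\<rho> * A i = t *s (A i * \<rho>) + (1 - t) *s prev C i"
  using form1[of "Suc n" i] by (simp add: C_high A_lead \<rho>_def algebra_simps)

text \<open>By \<open>rho_A\<close> a vanishing top coefficient would make all of \<open>C\<close>
  vanish; so \<open>C\<close> has degree exactly \<open>n\<close>.\<close>

lemma rho_unit: "invt \<rho>"
proof -
  have "\<rho> \<noteq> 0"
  proof
    assume "\<rho> = 0"
    then have "(1 - t) *s prev C (Suc i) = 0" for i using rho_A[of "Suc i"] by simp
    then have "C i = 0" for i using t1 by simp
    then show False using C_nonzero by blast
  qed
  then show ?thesis using divsub_invt[OF D] mem \<rho>_def by metis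
qed

text \<open>The first relation at \<open>j = 0\<close> does for the constant term what
  \<open>rho_A\<close> does for the top coefficient.\<close>

lemma C0_unit: "invt (C 0)"
proof -
  have "C 0 \<noteq> 0"
  proof
    assume "C 0 = 0"
    then have "(1 - t) *s (A 0 * C i) = 0" for i using form1[of 0 "Suc i"] by simp
    then have "C i = 0" for i using t1 a_unit by simp
    then show False using C_nonzero by blast
  qed
  then show ?thesis using divsub_invt[OF D] mem by metis
qed

lemma C_a: "C i * A 0 = t *s (A 0 * C i)"
  using form1[of "Suc i" 0] by simp

lemma C_eq: "C i = \<rho> * A' i"
  unfolding A'_def using rho_unit by simp

lemma A'_rho: "A' i * \<rho> = \<rho> * A' i"
  unfolding A'_def \<rho>_def using CC[of i n] rho_unit unfolding \<rho>_def by (simp add: mult.assoc)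

lemma C_rinv_rho: "C i * rinv \<rho> = rinv \<rho> * C i"
  unfolding \<rho>_def by (rule rinv_commute) (rule CC)

lemma A'_A': "A' i * A' j = A' j * A' i"
proof -
  have "A' i * A' j = rinv \<rho> * (rinv \<rho> * (C i * C j))"
    unfolding A'_def by (simp add: mult.assoc) (metis C_rinv_rho mult.assoc)
  also have "\<dots> = A' j * A' i"
    unfolding A'_def CC[of i j] by (simp add: mult.assoc) (metis C_rinv_rho mult.assoc)
  finally show ?thesis .
qed

lemma A'_lead: "A' n = 1" and A'_high: "i > n \<Longrightarrow> A' i = 0"
  using rho_unit C_high by (auto simp: A'_def simp flip: \<rho>_def)

lemma A'0_unit: "invt (A' 0)"
  unfolding A'_def using C0_unit rho_unit by simp

lemma prev_A'_rho: "prev A' i * \<rho> = \<rho> * prev A' i" by (cases i) (auto simp: A'_rho)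

lemma prev_C_eq: "prev C i = \<rho> * prev A' i" by (cases i) (auto simp: C_eq)

lemma A_eq: "A i = prev A' i + R i" by (simp add: R_def)

text \<open>Subtracting \<open>z A'(z)\<close> from \<open>A(z)\<close> removes exactly the
  inhomogeneous term of \<open>rho_A\<close>; the remainder is an eigenvector of conjugation by
  \<open>\<rho>\<close>.\<close>

lemma rho_R: "\<rho> * R i = t *s (R i * \<rho>)"
  using rho_A[of i] prev_A'_rho[of i] by (simp add: A_eq prev_C_eq algebra_simps)

lemma R_rho: "R i * \<rho> = inverse t *s (\<rho> * R i)"
  using t by (simp add: rho_R)

lemma R_0: "R 0 = A 0" by (simp add: R_def)

lemma R_high: "i > n \<Longrightarrow> R i = 0"
proof -
  assume "i > n"
  then obtain k where k: "i = Suc k" "k \<ge> n" by (cases i) auto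
  then show ?thesis by (cases "k = n") (auto simp: R_def A_lead A'_lead A_high A'_high)
qed

lemma R_eq: "R i = A 0 * R' i" unfolding R'_def using a_unit by simp

lemma R'_0: "R' 0 = 1" unfolding R'_def R_0 using a_unit by simp

lemma R'_high: "i > n \<Longrightarrow> R' i = 0" unfolding R'_def by (simp add: R_high)

text \<open>The hypotheses hold for \<open>e = A 0\<close> with \<open>s = t\<close>. Among the invariants of \<open>G(m,p,n)\<close> the
  element \<open>A 0\<close> has, up to a scalar, a \<open>p\<close>-th root \<open>e\<close>, with \<open>s\<^sup>p = t\<close>.\<close>

context
  fixes e :: 'r and s :: 'f
  assumes s: "s \<noteq> 0" and eA: "\<And>i. e * A i = A i * e" and eC: "\<And>i. C i * e = s *s (e * C i)"
begin

lemma e_A': "e * A' i = A' i * e"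
proof -
  have "rinv \<rho> * e = inverse s *s (e * rinv \<rho>)"
    by (rule twist_rinv_left) (use eC rho_unit s \<rho>_def in auto)
  moreover have "A' i * e = s *s (rinv \<rho> * e * C i)" by (simp add: A'_def mult.assoc eC)
  ultimately show ?thesis using s by (simp add: A'_def mult.assoc)
qed

lemma e_R': "e * R' i = R' i * e"
proof -
  have "e * prev A' i = prev A' i * e" by (cases i) (auto simp: e_A')
  then have "e * R i = R i * e" by (simp add: R_def algebra_simps eA)
  moreover have "e * rinv (A 0) = rinv (A 0) * e" by (rule rinv_commute) (rule eA)
  ultimately show ?thesis unfolding R'_def by (metis mult.assoc)
qed

lemma e_C': "e * C' i = C' i * e"
proof -
  have "e * rinv (A' 0) = rinv (A' 0) * e" by (rule rinv_commute) (rule e_A')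
  then have "e * (rinv (A' 0) * A' (Suc i)) = rinv (A' 0) * A' (Suc i) * e"
    by (metis mult.assoc e_A')
  then show ?thesis unfolding C'_def by (simp add: algebra_simps e_R')
qed

end

lemmas a_A' = e_A'[where e = "A 0" and s = t, OF t(1) AA C_a]
  and a_R' = e_R'[where e = "A 0" and s = t, OF t(1) AA C_a]
  and a_C' = e_C'[where e = "A 0" and s = t, OF t(1) AA C_a]

lemma rho_a: "\<rho> * A 0 = t *s (A 0 * \<rho>)"
  unfolding \<rho>_def by (rule C_a)

text \<open>\<open>R i\<close> and \<open>A 0\<close> have the same weight \<open>t\<close> under
  conjugation by \<open>\<rho>\<close>, and it cancels in the quotient.\<close>

lemma rho_R': "\<rho> * R' i = R' i * \<rho>"
proof -
  have "\<rho> * rinv (A 0) = inverse t *s (rinv (A 0) * \<rho>)"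
    by (rule rinv_twist) (use rho_a a_unit t in auto)
  then have "\<rho> * R' i = inverse t *s (rinv (A 0) * (\<rho> * R i))"
    unfolding R'_def by (metis mult.assoc mult_scale_left)
  then show ?thesis using t by (simp add: rho_R R'_def mult.assoc)
qed

lemma rinv_A'0_A': "rinv (A' 0) * A' i = A' i * rinv (A' 0)"
  by (rule commute_rinv_left) (rule A'_A')

lemma rho_C': "\<rho> * C' i = C' i * \<rho>"
proof -
  have "\<rho> * rinv (A' 0) = rinv (A' 0) * \<rho>" by (rule rinv_commute) (simp add: A'_rho)
  then have "\<rho> * (rinv (A' 0) * A' (Suc i)) = rinv (A' 0) * A' (Suc i) * \<rho>"
    by (metis mult.assoc A'_rho)
  then show ?thesis unfolding C'_def by (simp add: algebra_simps rho_R')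
qed

text \<open>\<open>A = R + z A'\<close> is the decomposition by weight under conjugation by
  \<open>\<rho>\<close>, so commutativity of \<open>A\<close> and of \<open>A'\<close> passes to
  \<open>R\<close>.\<close>

lemma R_R: "R i * R j = R j * R i"
proof (rule split_commute[of A R "prev A'" \<rho> t])
  show "A i = R i + prev A' i" for i by (simp add: R_def)
  show "prev A' i * prev A' j = prev A' j * prev A' i" for i j
    by (cases i; cases j) (auto simp: A'_A')
qed (simp_all add: AA rho_R prev_A'_rho rho_unit t)

lemma a_R: "A 0 * R i = R i * A 0"
  using R_R[of 0 i] by (simp add: R_0)

lemma R'_R': "R' i * R' j = R' j * R' i"
proof -
  have "R i * rinv (A 0) = rinv (A 0) * R i" for i by (rule rinv_commute) (simp add: a_R)
  then have "R' i * R' j = rinv (A 0) * (rinv (A 0) * (R i * R j))" for i j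
    unfolding R'_def by (metis mult.assoc)
  then show ?thesis by (simp add: R_R)
qed

text \<open>Each product occurring in the relations of the pair is written as \<open>\<rho>\<close>
  times an expression in \<open>A'\<close> and \<open>R\<close>; the relations can then be divided
  by \<open>\<rho>\<close>.\<close>

lemma rho_pull:
  "C j * prev A i = \<rho> * (A' j * prev (prev A') i + A' j * prev R i)"
  "prev C j * A i = \<rho> * (prev A' j * prev A' i + prev A' j * R i)"
  "prev A i * C j = \<rho> * (A' j * prev (prev A') i + inverse t *s (prev R i * A' j))"
  "A i * prev C j = \<rho> * (prev A' j * prev A' i + inverse t *s (R i * prev A' j))"
proof -
  have pA: "prev A i = prev (prev A') i + prev R i" by (cases i) (auto simp: A_eq)
  have pR: "prev R i * \<rho> = inverse t *s (\<rho> * prev R i)" by (cases i) (auto simp: R_rho)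
  have ppA: "prev (prev A') i * \<rho> = \<rho> * prev (prev A') i" by (cases i) (auto simp: prev_A'_rho)
  have cA: "A' j * prev (prev A') i = prev (prev A') i * A' j" "prev A' j * prev A' i = prev A' i * prev A' j"
    by (auto simp: prev_def A'_A' split: nat.splits)
  show "C j * prev A i = \<rho> * (A' j * prev (prev A') i + A' j * prev R i)"
    by (simp add: pA C_eq distrib_left mult.assoc)
  show "prev C j * A i = \<rho> * (prev A' j * prev A' i + prev A' j * R i)"
    by (simp add: A_eq prev_C_eq distrib_left mult.assoc)
  have "prev A i * C j = prev (prev A') i * \<rho> * A' j + prev R i * \<rho> * A' j"
    by (simp add: pA C_eq distrib_right mult.assoc)
  then show "prev A i * C j = \<rho> * (A' j * prev (prev A') i + inverse t *s (prev R i * A' j))"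
    by (simp only: ppA pR cA distrib_left mult_scale_right mult_scale_left mult.assoc)
  have "A i * prev C j = prev A' i * \<rho> * prev A' j + R i * \<rho> * prev A' j"
    by (simp add: A_eq prev_C_eq distrib_right mult.assoc)
  then show "A i * prev C j = \<rho> * (prev A' j * prev A' i + inverse t *s (R i * prev A' j))"
    by (simp only: prev_A'_rho R_rho cA distrib_left mult_scale_right mult_scale_left mult.assoc)
qed

lemma prev_C_A: "prev C i * A j = \<rho> * (prev A' j * prev A' i + prev A' i * R j)"
  and A_prev_C: "A j * prev C i = \<rho> * (prev A' j * prev A' i + inverse t *s (R j * prev A' i))"
proof -
  have cA: "prev A' j * prev A' i = prev A' i * prev A' j"
    by (auto simp: prev_def A'_A' split: nat.splits)
  show "prev C i * A j = \<rho> * (prev A' j * prev A' i + prev A' i * R j)"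
    "A j * prev C i = \<rho> * (prev A' j * prev A' i + inverse t *s (R j * prev A' i))"
    by (simp_all only: rho_pull cA)
qed

text \<open>What the first relation of the old pair becomes after cancelling \<open>\<rho>\<close>;
  it will yield the second relation of the new pair.\<close>

lemma AR1: "t *s (A' j * prev R i) - t *s (prev A' j * R i)
    = prev R i * A' j - t *s (R i * prev A' j) - (1 - t) *s (R j * prev A' i)"
proof -
  let ?P = "A' j * prev (prev A') i" and ?Q = "prev A' j * prev A' i"
  have "\<rho> * ((?P + A' j * prev R i) - (?Q + prev A' j * R i))
      = \<rho> * ((?P + inverse t *s (prev R i * A' j)) - t *s (?Q + inverse t *s (R i * prev A' j))
          - (1 - t) *s (?Q + inverse t *s (R j * prev A' i)))"
    using form1[of j i] by (simp only: rho_pull(1,2)[of j i] rho_pull(3,4)[of i j] A_prev_C[of j i]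
     right_diff_distrib mult_scale_right)
  then have "(?P + A' j * prev R i) - (?Q + prev A' j * R i)
      = (?P + inverse t *s (prev R i * A' j)) - t *s (?Q + inverse t *s (R i * prev A' j))
          - (1 - t) *s (?Q + inverse t *s (R j * prev A' i))"
    using invt_cancel_left[OF rho_unit] by blast
  then have "A' j * prev R i - prev A' j * R i
      = inverse t *s (prev R i * A' j) - R i * prev A' j - (1 - t) *s inverse t *s (R j * prev A' i)"
    using t(1) by (simp add: scale_right_distrib scale_left_diff_distrib)
  then have "t *s (A' j * prev R i - prev A' j * R i)
      = t *s (inverse t *s (prev R i * A' j) - R i * prev A' j - (1 - t) *s inverse t *s (R j * prev A' i))"
    by simp
  then show ?thesis using t(1) by (simp add: scale_right_diff_distrib mult.left_commute[of t])
qed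

text \<open>The counterpart of \<open>AR1\<close>: the second relation of the old pair, which will
  yield the first relation of the new pair.\<close>

lemma AR2: "R j * prev A' i - prev R j * A' i
    = prev A' i * R j - t *s (A' i * prev R j) - (1 - t) *s (prev A' j * R i)"
proof -
  let ?P = "A' i * prev (prev A') j" and ?Q = "prev A' j * prev A' i"
  have "\<rho> * (t *s (?Q + inverse t *s (R j * prev A' i)) - t *s (?P + inverse t *s (prev R j * A' i)))
      = \<rho> * ((?Q + prev A' i * R j) - t *s (?P + A' i * prev R j) - (1 - t) *s (?Q + prev A' j * R i))"
    using form2[of j i] by (simp only: rho_pull(1)[of i j] rho_pull(2,3)[of j i] A_prev_C[of j i] prev_C_A[of i j]
     right_diff_distrib mult_scale_right)
  then have "t *s (?Q + inverse t *s (R j * prev A' i)) - t *s (?P + inverse t *s (prev R j * A' i))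
      = (?Q + prev A' i * R j) - t *s (?P + A' i * prev R j) - (1 - t) *s (?Q + prev A' j * R i)"
    using invt_cancel_left[OF rho_unit] by blast
  then show ?thesis
    using t(1) by (simp add: scale_right_distrib scale_left_diff_distrib scale_right_diff_distrib)
qed

lemma prev_R: "prev R i = A 0 * prev R' i"
  by (cases i) (auto simp: R_eq)

lemma AR'1: "t *s (A' j * prev R' i) - t *s (prev A' j * R' i)
    = prev R' i * A' j - t *s (R' i * prev A' j) - (1 - t) *s (R' j * prev A' i)"
proof -
  have pull: "A' j * (A 0 * b) = A 0 * (A' j * b)" "prev A' j * (A 0 * b) = A 0 * (prev A' j * b)" for b
    by (simp_all add: prev_def a_A' flip: mult.assoc split: nat.splits)
  have "A 0 * (t *s (A' j * prev R' i) - t *s (prev A' j * R' i))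
    = A 0 * (prev R' i * A' j - t *s (R' i * prev A' j) - (1 - t) *s (R' j * prev A' i))"
    using AR1[of j i] by (simp only: prev_R R_eq pull mult.assoc right_diff_distrib mult_scale_right)
  then show ?thesis using invt_cancel_left[OF a_unit] by blast
qed

lemma AR'2: "R' j * prev A' i - prev R' j * A' i
    = prev A' i * R' j - t *s (A' i * prev R' j) - (1 - t) *s (prev A' j * R' i)"
proof -
  have pull: "A' i * (A 0 * b) = A 0 * (A' i * b)" "prev A' i * (A 0 * b) = A 0 * (prev A' i * b)" for b i
    by (simp_all add: prev_def a_A' flip: mult.assoc split: nat.splits)
  have "A 0 * (R' j * prev A' i - prev R' j * A' i)
    = A 0 * (prev A' i * R' j - t *s (A' i * prev R' j) - (1 - t) *s (prev A' j * R' i))"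
    using AR2[of j i] by (simp only: prev_R R_eq pull mult.assoc right_diff_distrib mult_scale_right)
  then show ?thesis using invt_cancel_left[OF a_unit] by blast
qed

definition "b = rinv (A' 0)"

lemma b_A': "A' i * b = b * A' i"
  by (simp add: b_def rinv_A'0_A')

lemma R'_split: "R' i = prev C' i + b * A' i"
  by (cases i) (auto simp: C'_def b_def R'_0 A'0_unit)

lemma prev_R'_split: "prev R' i = prev (prev C') i + b * prev A' i"
  by (cases i) (auto simp: R'_split)

lemma b_pull: "A' i * (b * c) = b * (A' i * c)" "prev A' i * (b * c) = b * (prev A' i * c)"
  by (simp_all add: prev_def b_A' flip: mult.assoc split: nat.splits)

text \<open>This is \<open>C_a\<close> for the new pair. It has to be known before
  \<open>lax_step\<close>, because it is the weight needed to prove that the \<open>C'\<close>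
  commute.\<close>

lemma C'_a': "C' i * A' 0 = t *s (A' 0 * C' i)"
proof -
  have "t *s (A' 0 * R' k) = R' k * A' 0 - (1 - t) *s A' k" for k
    using AR'1[of 0 "Suc k"] by (simp add: R'_0)
  then have R'a: "R' k * A' 0 = t *s (A' 0 * R' k) + (1 - t) *s A' k" for k
    by (simp add: algebra_simps)
  have "b * A' (Suc i) * A' 0 = A' (Suc i)" "A' 0 * (b * A' (Suc i)) = A' (Suc i)"
    unfolding b_def using A'0_unit by (simp_all add: mult.assoc A'_A'[of _ 0])
  then show ?thesis
    by (simp add: C'_def left_diff_distrib right_diff_distrib R'a scale_left_diff_distrib
        scale_right_diff_distrib flip: b_def)
qed

lemma C'_high: "i \<ge> n \<Longrightarrow> C' i = 0"
  by (simp add: C'_def R'_high A'_high)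

text \<open>The same weight argument as for \<open>R\<close>, now with \<open>A' 0\<close> as the
  conjugating element and \<open>R' = z C' + b A'\<close> as the splitting.\<close>

lemma C'_C': "C' i * C' j = C' j * C' i"
proof -
  have bA: "(b * A' i) * (b * A' j) = (b * A' j) * (b * A' i)" for i j
    by (simp add: mult.assoc b_pull A'_A'[of i j])
  have "prev C' (Suc i) * prev C' (Suc j) = prev C' (Suc j) * prev C' (Suc i)"
  proof (rule split_commute[of R' "prev C'" "\<lambda>i. b * A' i" "A' 0" "inverse t"])
    show "A' 0 * (b * A' i) = b * A' i * A' 0" for i
      by (simp add: b_pull mult.assoc A'_A'[of i 0])
    show "A' 0 * prev C' i = inverse t *s (prev C' i * A' 0)" for i
      using t by (cases i) (auto simp: C'_a')
  qed (use t in \<open>simp_all add: R'_split bA A'0_unit R'_R' flip: R'_split\<close>)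
  then show ?thesis by simp
qed

lemma lax_step: "lax D t n A' C'"
proof -
  have sub: "subalg D" using D by (rule divsub_subalg)
  have A'D: "A' i \<in> D" for i
    unfolding A'_def \<rho>_def using D mem sub by (auto intro: subalg_mult divsub_rinv)
  have "R i \<in> D" for i unfolding R_def using sub mem A'D by (cases i) (auto intro: subalg_diff subalg_0)
  then have R'D: "R' i \<in> D" for i
    unfolding R'_def using D mem sub by (auto intro: subalg_mult divsub_rinv)
  then have C'D: "C' i \<in> D" for i
    unfolding C'_def using D A'D sub by (auto intro!: subalg_mult divsub_rinv subalg_diff)
  have cA: "A' i * prev A' j = prev A' j * A' i" "prev A' i * prev A' j = prev A' j * prev A' i" for i j
    by (auto simp: prev_def A'_A' split: nat.splits)
  \<comment> \<open>Insert \<open>R' = z C' + b A'\<close>: the contributions of the commuting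
    family \<open>A'\<close> cancel, and taking the index \<open>Suc j\<close> divides by
    \<open>z\<close>.\<close>
  have f1: "C' j * prev A' i - prev C' j * A' i
        = prev A' i * C' j - t *s (A' i * prev C' j) - (1 - t) *s (A' j * prev C' i)" for i j
  proof -
    have "prev C' (Suc j) * prev A' i - prev (prev C') (Suc j) * A' i
        = prev A' i * prev C' (Suc j) - t *s (A' i * prev (prev C') (Suc j)) - (1 - t) *s (prev A' (Suc j) * prev C' i)"
      using AR'2[of "Suc j" i] unfolding R'_split[of i] R'_split[of "Suc j"] prev_R'_split[of "Suc j"]
      by (simp add: distrib_left distrib_right scale_right_distrib b_pull mult.assoc cA A'_A'[of j i]
          scale_left_diff_distrib del: prev_simps)
    then show ?thesis by simp
  qed
  have f2: "t *s (A' j * prev C' i) - t *s (prev A' j * C' i)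
        = prev C' i * A' j - t *s (C' i * prev A' j) - (1 - t) *s (prev C' j * A' i)" for i j
    using AR'1[of j "Suc i"] unfolding R'_split[of "Suc i"] R'_split[of j] prev_R'_split[of "Suc i"]
    by (simp add: distrib_left distrib_right scale_right_distrib b_pull mult.assoc cA A'_A'[of i j]
          scale_left_diff_distrib)
  show ?thesis unfolding lax_def
    using A'D C'D A'_A' C'_C' A'_lead A'_high C'_high f1 f2 by blast
qed

text \<open>The step can be undone by ring operations and inverses, so old and new coefficients
  generate the same set. The parameter \<open>G\<close> carries along the pairs that were split off
  before.\<close>

lemma dgen_step:
  "dgen (G \<union> {\<rho>, A 0} \<union> range A' \<union> range C') = dgen (G \<union> {A 0} \<union> range A \<union> range C)" (is "dgen ?S = dgen ?T")
proof
  have base: "g \<in> dgen ?T" if "g \<in> ?T" for g using that by (rule dgen_base)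
  have A'T: "A' i \<in> dgen ?T" for i
    unfolding A'_def \<rho>_def by (intro dgen_mult dgen_rinv base) auto
  have AT: "A i \<in> dgen ?T" for i by (rule base) auto
  moreover have "prev A' i \<in> dgen ?T" for i
    using A'T subalg_0[OF subalg_dgen] by (cases i) simp_all
  ultimately have "R i \<in> dgen ?T" for i
    unfolding R_def by (intro subalg_diff[OF subalg_dgen])
  then have "R' i \<in> dgen ?T" for i
    unfolding R'_def by (intro dgen_mult dgen_rinv AT)
  then have "C' i \<in> dgen ?T" for i
    unfolding C'_def by (intro subalg_diff[OF subalg_dgen] dgen_mult dgen_rinv A'T)
  then show "dgen ?S \<subseteq> dgen ?T"
    using A'T base by (intro dgen_subset_dgen) (auto simp: \<rho>_def)
next
  have base: "g \<in> dgen ?S" if "g \<in> ?S" for g using that by (rule dgen_base)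
  have "C i \<in> dgen ?S" for i unfolding C_eq[of i] by (intro dgen_mult base) auto
  moreover have "A i \<in> dgen ?S" for i
  proof -
    have "A' j \<in> dgen ?S" "C' j \<in> dgen ?S" "A 0 \<in> dgen ?S" for j by (rule base; auto)+
    moreover from this have "prev A' i \<in> dgen ?S" "prev C' i \<in> dgen ?S"
      using subalg_0[OF subalg_dgen] by (cases i; simp)+
    ultimately show ?thesis unfolding A_eq[of i] R_eq[of i] R'_split[of i] b_def
      by (intro dgen_add dgen_mult dgen_rinv)
  qed
  ultimately show "dgen ?T \<subseteq> dgen ?S"
    using base by (intro dgen_subset_dgen) auto
qed

text \<open>The hypothesis on \<open>A\<close> says \<open>Y A(z) = t^(n+1) A(z/t) Y\<close>. All
  operations of the step respect this grading, whatever the scalar \<open>s\<close> for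
  \<open>C\<close> is; the factor \<open>inverse t\<close> for \<open>C'\<close> comes from the
  division by \<open>z\<close>.\<close>

lemma weight_step:
  assumes YA: "\<And>i. t ^ i *s (Y * A i) = t ^ Suc n *s (A i * Y)"
    and YC: "\<And>i. t ^ i *s (Y * C i) = s *s (C i * Y)" and s: "s \<noteq> 0"
  shows "t ^ i *s (Y * A' i) = t ^ n *s (A' i * Y)"
    and "t ^ i *s (Y * C' i) = inverse t *s (C' i * Y)"
proof -
  have div: "Y * a = (s / t ^ i) *s (a * Y)" if "t ^ i *s (Y * a) = s *s (a * Y)" for a s and i :: nat
  proof -
    have "inverse (t ^ i) *s t ^ i *s (Y * a) = (s / t ^ i) *s (a * Y)"
      unfolding that by (simp add: divide_inverse mult.commute)
    then show ?thesis using t by simp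
  qed
  have Yrinv: "Y * rinv u = inverse c *s (rinv u * Y)" if "Y * u = c *s (u * Y)" "invt u" "c \<noteq> 0" for u c
    by (rule rinv_twist) (use that in auto)
  have Yrho: "Y * rinv \<rho> = (t ^ n / s) *s (rinv \<rho> * Y)"
    using Yrinv[OF div[OF YC[of n]]] rho_unit s t by (simp flip: \<rho>_def)
  have YA': "Y * A' i = (t ^ n / t ^ i) *s (A' i * Y)" for i
  proof -
    have "Y * A' i = (Y * rinv \<rho>) * C i" by (simp add: A'_def mult.assoc)
    also have "\<dots> = (t ^ n / s) *s (rinv \<rho> * (Y * C i))" unfolding Yrho by (simp add: mult.assoc)
    also have "Y * C i = (s / t ^ i) *s (C i * Y)" by (rule div[OF YC])
    finally show ?thesis using s by (simp add: A'_def mult.assoc)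
  qed
  then show "t ^ i *s (Y * A' i) = t ^ n *s (A' i * Y)" using t by simp
  have YR: "Y * R i = (t ^ Suc n / t ^ i) *s (R i * Y)" for i
  proof -
    have "Y * A i = (t ^ Suc n / t ^ i) *s (A i * Y)" by (rule div[OF YA])
    moreover have "Y * prev A' i = (t ^ Suc n / t ^ i) *s (prev A' i * Y)"
      using t by (cases i) (auto simp: YA')
    ultimately show ?thesis by (simp add: R_def left_diff_distrib right_diff_distrib scale_right_diff_distrib)
  qed
  have Ya: "Y * rinv (A 0) = inverse (t ^ Suc n) *s (rinv (A 0) * Y)"
    using Yrinv[OF div[OF YA[of 0]]] a_unit t by simp
  have YR': "Y * R' i = (1 / t ^ i) *s (R' i * Y)" for i
  proof -
    have "Y * R' i = (Y * rinv (A 0)) * R i" by (simp add: R'_def mult.assoc)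
    also have "\<dots> = inverse (t ^ Suc n) *s (rinv (A 0) * (Y * R i))"
      unfolding Ya by (simp add: mult.assoc)
    also have "\<dots> = (inverse (t ^ Suc n) * (t ^ Suc n / t ^ i)) *s (R' i * Y)"
      by (simp only: YR mult_scale_right scale_scale R'_def mult.assoc)
    also have "inverse (t ^ Suc n) * (t ^ Suc n / t ^ i) = 1 / t ^ i" using t by (simp add: field_simps)
    finally show ?thesis .
  qed
  have Yb: "Y * rinv (A' 0) = inverse (t ^ n) *s (rinv (A' 0) * Y)"
    using Yrinv[OF YA'[of 0]] A'0_unit t by simp
  have "Y * (rinv (A' 0) * A' (Suc i)) = (Y * rinv (A' 0)) * A' (Suc i)" by (simp add: mult.assoc)
  also have "\<dots> = inverse (t ^ n) *s (rinv (A' 0) * (Y * A' (Suc i)))"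
    unfolding Yb by (simp add: mult.assoc)
  also have "\<dots> = (1 / t ^ Suc i) *s (rinv (A' 0) * A' (Suc i) * Y)"
    using t by (simp add: YA' mult.assoc divide_inverse)
  finally have "Y * C' i = (1 / t ^ Suc i) *s (C' i * Y)"
    by (simp add: C'_def left_diff_distrib right_diff_distrib scale_right_diff_distrib YR')
  then show "t ^ i *s (Y * C' i) = inverse t *s (C' i * Y)"
    using t by (simp add: divide_inverse)
qed

end

section \<open>Iteration of the Euclidean step\<close>

context assoc_algebra
begin

text \<open>The hypotheses on \<open>Y\<close> prevent the algorithm from stopping early: when \<open>C\<close> vanishes, \<open>A 0\<close>
  commutes with all generators, but not with \<open>Y\<close>.\<close>

lemma lax_factorization:
  assumes D: "divsub D" and t: "t \<noteq> 0" "\<And>k. k > 0 \<Longrightarrow> t ^ k \<noteq> 1"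
    and "lax D t n A C" "A 0 \<noteq> 0" "G \<subseteq> D"
    and "\<And>g i. g \<in> G \<Longrightarrow> g * A i = A i * g" "\<And>g i. g \<in> G \<Longrightarrow> g * C i = C i * g"
    and "Y \<in> dgen (G \<union> range A \<union> range C)" "invt Y" "s \<noteq> 0"
    and "\<And>i. t ^ i *s (Y * A i) = t ^ n *s (A i * Y)" "\<And>i. t ^ i *s (Y * C i) = s *s (C i * Y)"
  shows "\<exists>\<rho> a. (\<forall>i<n. \<rho> i \<in> D \<and> a i \<in> D \<and> \<rho> i \<noteq> 0 \<and> a i \<noteq> 0 \<and> \<rho> i * a i = t *s (a i * \<rho> i)) \<and>
    (\<forall>i<n. \<forall>j<n. i \<noteq> j \<longrightarrow> \<rho> i * a j = a j * \<rho> i \<and> \<rho> i * \<rho> j = \<rho> j * \<rho> i \<and> a i * a j = a j * a i) \<and>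
    (\<forall>i<n. \<forall>g\<in>G. g * \<rho> i = \<rho> i * g \<and> g * a i = a i * g) \<and>
    dgen (G \<union> \<rho> ` {..<n} \<union> a ` {..<n}) = dgen (G \<union> range A \<union> range C)"
  using assms(4-)
proof (induction n arbitrary: A C G s)
  case 0
  have "A i = (if i = 0 then 1 else 0)" "C i = 0" for i
    using 0(1) by (auto simp: lax_def)
  then have "dgen (G \<union> range A \<union> range C) \<subseteq> dgen G"
    by (intro dgen_subset_dgen) (auto intro: dgen_base subalg_0 subalg_1 subalg_dgen)
  moreover have "dgen G \<subseteq> dgen (G \<union> range A \<union> range C)" by (rule dgen_mono) auto
  ultimately show ?case by simp
next
  case (Suc n)
  have mem: "A i \<in> D" for i using Suc.prems(1) by (auto simp: lax_def)
  have "\<exists>i. C i \<noteq> 0"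
  proof (rule ccontr)
    assume "\<not> ?thesis"
    then have "A 0 * Y = Y * A 0"
      using Suc.prems(1,4) by (intro dgen_commute[OF Suc.prems(6)]) (auto simp: lax_def)
    then have "t ^ Suc n *s (A 0 * Y) = 1 *s (A 0 * Y)" using Suc.prems(9)[of 0] by simp
    then have "A 0 * Y = 0" using t(2)[of "Suc n"] by (simp only: scale_cancel_right) simp
    then show False using Suc.prems by simp
  qed
  then interpret lax_pair scale D t n A C
    using D t(1) t(2)[of 1] Suc.prems by unfold_locales auto
  \<comment> \<open>The pair just split off joins the elements that commute with the remaining Lax
    pair.\<close>
  let ?G = "G \<union> {\<rho>, A 0}"
  have "\<rho> \<in> D" using Suc.prems(1) by (auto simp: lax_def \<rho>_def)
  have gC: "C i * g = 1 *s (g * C i)" if "g \<in> G" for g i using Suc.prems(5) that by simp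
  have comm: "g * A' i = A' i * g" "g * C' i = C' i * g" if "g \<in> ?G" for g i
    using that a_A'[of i] A'_rho[of i] rho_C'[of i] a_C'[of i]
      e_A'[where s = 1, OF _ Suc.prems(4) gC] e_C'[where s = 1, OF _ Suc.prems(4) gC] by auto
  have gen: "dgen (?G \<union> range A' \<union> range C') = dgen (G \<union> range A \<union> range C)"
  proof -
    have "G \<union> {A 0} \<union> range A \<union> range C = G \<union> range A \<union> range C" by auto
    then show ?thesis using dgen_step[of G] by simp
  qed
  have "invt (A' 0)" by (rule A'0_unit)
  then have "A' 0 \<noteq> 0" by (rule invt_neq_0)
  have "\<exists>\<rho>' a'. (\<forall>i<n. \<rho>' i \<in> D \<and> a' i \<in> D \<and> \<rho>' i \<noteq> 0 \<and> a' i \<noteq> 0 \<and> \<rho>' i * a' i = t *s (a' i * \<rho>' i)) \<and>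
    (\<forall>i<n. \<forall>j<n. i \<noteq> j \<longrightarrow> \<rho>' i * a' j = a' j * \<rho>' i \<and> \<rho>' i * \<rho>' j = \<rho>' j * \<rho>' i \<and> a' i * a' j = a' j * a' i) \<and>
    (\<forall>i<n. \<forall>g\<in>?G. g * \<rho>' i = \<rho>' i * g \<and> g * a' i = a' i * g) \<and>
    dgen (?G \<union> \<rho>' ` {..<n} \<union> a' ` {..<n}) = dgen (?G \<union> range A' \<union> range C')"
  proof (rule Suc.IH[OF lax_step \<open>A' 0 \<noteq> 0\<close>])
    show "?G \<subseteq> D" using \<open>\<rho> \<in> D\<close> mem Suc.prems by auto
    show "Y \<in> dgen (?G \<union> range A' \<union> range C')" unfolding gen by (rule Suc.prems)
    show "t ^ i *s (Y * A' i) = t ^ n *s (A' i * Y)" "t ^ i *s (Y * C' i) = inverse t *s (C' i * Y)" for i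
      by (rule weight_step[OF Suc.prems(9,10,8)])+
  qed (use comm t Suc.prems in auto)
  then obtain \<rho>' a' where *: "\<forall>i<n. \<rho>' i \<in> D \<and> a' i \<in> D \<and> \<rho>' i \<noteq> 0 \<and> a' i \<noteq> 0 \<and> \<rho>' i * a' i = t *s (a' i * \<rho>' i)"
    "\<forall>i<n. \<forall>j<n. i \<noteq> j \<longrightarrow> \<rho>' i * a' j = a' j * \<rho>' i \<and> \<rho>' i * \<rho>' j = \<rho>' j * \<rho>' i \<and> a' i * a' j = a' j * a' i"
    "\<forall>i<n. \<forall>g\<in>?G. g * \<rho>' i = \<rho>' i * g \<and> g * a' i = a' i * g"
    "dgen (?G \<union> \<rho>' ` {..<n} \<union> a' ` {..<n}) = dgen (?G \<union> range A' \<union> range C')"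
    by blast
  define \<rho>'' where "\<rho>'' = \<rho>'(n := \<rho>)"
  define a'' where "a'' = a'(n := A 0)"
  have gC0: "g * \<rho> = \<rho> * g" if "g \<in> G" for g using Suc.prems(5) that by (simp add: \<rho>_def)
  have img: "?G \<union> \<rho>' ` {..<n} \<union> a' ` {..<n} = G \<union> \<rho>'' ` {..<Suc n} \<union> a'' ` {..<Suc n}"
    by (auto simp: \<rho>''_def a''_def lessThan_Suc image_iff)
  have nz: "\<rho> \<noteq> 0" using rho_unit by (rule invt_neq_0)
  show ?case
  proof (rule exI[of _ \<rho>''], rule exI[of _ a''], intro conjI allI impI ballI)
    show "dgen (G \<union> \<rho>'' ` {..<Suc n} \<union> a'' ` {..<Suc n}) = dgen (G \<union> range A \<union> range C)"
      using *(4) gen img by simp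
  qed (use *(1-3) \<open>\<rho> \<in> D\<close> nz mem Suc.prems(2,4) rho_a gC0 in
      \<open>auto simp: \<rho>''_def a''_def less_Suc_eq\<close>)
qed

end

section \<open>Series with rational exponents and their operators\<close>

text \<open>A monomial \<open>x^a y^b\<close> of the quantum torus is made to act on functions of a positive rational
  number as a weighted multiplicative shift, where distinct monomials shift by distinct rationals.
  On functions vanishing near \<open>0\<close> (and on nonpositive numbers) every nonzero
  linear combination of such shifts is invertible, because one can solve for the term with the
  least shift. This yields a ring, as a type that does not depend on \<open>q\<close> and \<open>n\<close>, in which the
  nonzero elements of \<open>\<F>\<^sub>q[x,y]\<^sup>\<otimes>\<^sup>n\<close> are units.\<close>

typedef (overloaded) ('f::zero) series = "{v :: rat \<Rightarrow> 'f. \<exists>C>0. \<forall>k<C. v k = 0}"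
  morphisms coeff Abs_series
  by (intro exI[of _ "\<lambda>_. 0"] CollectI exI[of _ 1]) auto

setup_lifting type_definition_series

lemma coeff_bound: "\<exists>C>0. \<forall>k<C. coeff v k = 0"
  using coeff[of v] by simp

lemma coeff_nonpos: "k \<le> 0 \<Longrightarrow> coeff v k = 0"
  using coeff_bound[of v] by fastforce

instantiation series :: (ab_group_add) ab_group_add
begin

lift_definition zero_series :: "'a series" is "\<lambda>_. 0"
  by (intro exI[of _ 1]) auto

lift_definition plus_series :: "'a series \<Rightarrow> 'a series \<Rightarrow> 'a series" is "\<lambda>u v k. u k + v k"
  subgoal for u v
    by (elim exE, rename_tac C D, rule_tac x = "min C D" in exI) auto
  done

lift_definition uminus_series :: "'a series \<Rightarrow> 'a series" is "\<lambda>u k. - u k"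
  by auto

lift_definition minus_series :: "'a series \<Rightarrow> 'a series \<Rightarrow> 'a series" is "\<lambda>u v k. u k - v k"
  subgoal for u v
    by (elim exE, rename_tac C D, rule_tac x = "min C D" in exI) auto
  done

instance by standard (transfer; force)+

end

lift_definition scale_series :: "'f::field \<Rightarrow> 'f series \<Rightarrow> 'f series" is "\<lambda>c v k. c * v k"
  by auto

lift_definition single_series :: "'f::field series" is "\<lambda>k. if k = 1 then 1 else 0"
  by (intro exI[of _ 1]) auto

lemma coeff_plus: "coeff (u + v) k = coeff u k + coeff v k"
  by transfer simp

lemma coeff_scale: "coeff (scale_series c u) k = c * coeff u k"
  by transfer simp

lemma coeff_zero: "coeff 0 k = 0"
  by transfer simp

lemma series_eqI: "(\<And>k. coeff u k = coeff v k) \<Longrightarrow> u = v"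
  by transfer auto

lemma scale_series_add: "scale_series c (u + v) = scale_series c u + scale_series c v"
  by (rule series_eqI) (simp add: coeff_plus coeff_scale distrib_left)

typedef (overloaded) ('f::field) operator =
  "{T :: 'f series \<Rightarrow> 'f series. (\<forall>u v. T (u + v) = T u + T v) \<and> (\<forall>c u. T (scale_series c u) = scale_series c (T u))}"
  morphisms app Abs_operator
  by (rule exI[of _ id]) auto

setup_lifting type_definition_operator

lemma app_plus: "app T (u + v) = app T u + app T v"
  and app_scale: "app T (scale_series c u) = scale_series c (app T u)"
  using app[of T] by auto

lemma app_diff: "app T (u - v) = app T u - app T v"
  using app_plus[of T "u - v" v] by simp

lemma scale_series_uminus: "scale_series c (- u) = - scale_series c (u :: 'f::field series)"
  and scale_series_diff: "scale_series c (u - v) = scale_series c u - scale_series c v"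
  and scale_series_0: "scale_series c 0 = 0"
  by (transfer; auto simp: algebra_simps)+

instantiation operator :: (field) ring_1
begin

lift_definition zero_operator :: "'a operator" is "\<lambda>_. 0"
  by (simp add: scale_series_0)
lift_definition one_operator :: "'a operator" is "\<lambda>u. u"
  by simp
lift_definition plus_operator :: "'a operator \<Rightarrow> 'a operator \<Rightarrow> 'a operator" is "\<lambda>S T u. S u + T u"
  by (simp add: scale_series_add)
lift_definition uminus_operator :: "'a operator \<Rightarrow> 'a operator" is "\<lambda>S u. - S u"
  by (simp add: scale_series_uminus)
lift_definition minus_operator :: "'a operator \<Rightarrow> 'a operator \<Rightarrow> 'a operator" is "\<lambda>S T u. S u - T u"
  by (simp add: scale_series_diff)
lift_definition times_operator :: "'a operator \<Rightarrow> 'a operator \<Rightarrow> 'a operator" is "\<lambda>S T u. S (T u)"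
  by simp

instance
proof
  show "(0 :: 'a operator) \<noteq> 1"
  proof
    assume "(0 :: 'a operator) = 1"
    then have "app (0 :: 'a operator) single_series = app 1 single_series" by simp
    then have "coeff (0 :: 'a series) 1 = coeff (single_series :: 'a series) 1"
      by (simp add: zero_operator.rep_eq one_operator.rep_eq)
    then show False by (simp add: single_series.rep_eq coeff_zero)
  qed
qed (transfer; force simp: fun_eq_iff algebra_simps)+

end

lift_definition scale_operator :: "'f::field \<Rightarrow> 'f operator \<Rightarrow> 'f operator" is "\<lambda>c T u. scale_series c (T u)"
  apply (auto simp: scale_series_add)
  apply (rule series_eqI)
  apply (simp add: coeff_scale)
  done

lemma app_simps: "app (S + T) u = app S u + app T u" "app (S * T) u = app S (app T u)"
  "app 1 u = u" "app (scale_operator c S) u = scale_series c (app S u)" "app 0 u = 0"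
  by (transfer; simp)+

lemma operator_eqI: "(\<And>u k. coeff (app S u) k = coeff (app T u) k) \<Longrightarrow> S = T"
  by (metis app_inject ext series_eqI)

interpretation operator: assoc_algebra "scale_operator :: 'f::field \<Rightarrow> 'f operator \<Rightarrow> 'f operator"
  by unfold_locales
    (auto intro!: operator_eqI simp: app_simps coeff_plus coeff_scale algebra_simps app_scale)

lemma app_sum: "coeff (app (\<Sum>i\<in>I. scale_operator (c i) (T i)) u) k = (\<Sum>i\<in>I. c i * coeff (app (T i) u) k)"
  by (induction I rule: infinite_finite_induct) (auto simp: app_simps coeff_zero coeff_plus coeff_scale)

lemma invt_operator:
  assumes "\<And>u. app T u = 0 \<Longrightarrow> u = 0" "\<And>v. \<exists>u. app T u = v"
  shows "invt T"
proof -
  have inj: "u = v" if "app T u = app T v" for u v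
    using assms(1)[of "u - v"] that by (simp add: app_diff)
  define g where "g v = (SOME u. app T u = v)" for v
  have g: "app T (g v) = v" for v unfolding g_def using assms(2) by (rule someI_ex)
  have lin: "g (u + v) = g u + g v" "g (scale_series c u) = scale_series c (g u)" for u v c
    by (rule inj; simp add: app_plus app_scale g)+
  have app_g: "app (Abs_operator g) u = g u" for u
    using Abs_operator_inverse[of g] lin by simp
  have gT: "g (app T u) = u" for u by (rule inj) (simp add: g)
  show ?thesis
    by (rule invtI[of _ "Abs_operator g"]; rule operator_eqI) (simp_all add: app_simps app_g g gT)
qed

section \<open>Weighted shifts\<close>

lemma rat_power_unbounded:
  fixes \<mu> c x :: rat
  assumes "\<mu> > 1" "c > 0"
  shows "\<exists>N. x < c * \<mu> ^ N"
proof -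
  have bern: "1 + of_nat N * (\<mu> - 1) \<le> \<mu> ^ N" for N
  proof (induction N)
    case (Suc N)
    have "0 \<le> of_nat N * ((\<mu> - 1) * (\<mu> - 1))" using assms by (intro mult_nonneg_nonneg) auto
    then have "1 + of_nat (Suc N) * (\<mu> - 1) \<le> (1 + of_nat N * (\<mu> - 1)) * \<mu>"
      by (simp add: algebra_simps)
    also have "\<dots> \<le> \<mu> ^ N * \<mu>" using Suc assms by (intro mult_right_mono) auto
    finally show ?case by (simp add: mult.commute)
  qed simp
  obtain N where "x / (c * (\<mu> - 1)) < of_nat N" using reals_Archimedean2 by blast
  then have "x < c * (of_nat N * (\<mu> - 1))" using assms by (simp add: field_simps)
  also have "\<dots> \<le> c * \<mu> ^ N" using bern[of N] assms by (intro mult_left_mono) auto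
  finally show ?thesis by blast
qed

text \<open>Describes the equation that the sum over \<open>i\<close> of
  \<open>\<chi> i (k / r i) * v (k / r i)\<close> equals \<open>f k\<close>. The index
  \<open>i0\<close> with the least shift is dominant: solving for its term expresses
  \<open>v\<close> at a point through values at strictly smaller points.\<close>

locale shift_system =
  fixes I :: "'i set" and i0 :: 'i and r :: "'i \<Rightarrow> rat" and \<chi> :: "'i \<Rightarrow> rat \<Rightarrow> 'f::field"
  assumes fin: "finite I" and i0: "i0 \<in> I" and pos: "\<And>i. i \<in> I \<Longrightarrow> r i > 0"
    and less: "\<And>i. i \<in> I \<Longrightarrow> i \<noteq> i0 \<Longrightarrow> r i0 < r i"
    and lead: "\<And>k. k > 0 \<Longrightarrow> \<chi> i0 k \<noteq> 0"
begin

lemma gap: "\<exists>\<mu>>1. \<forall>i\<in>I - {i0}. \<mu> \<le> r i / r i0"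
proof -
  \<comment> \<open>The element 2 keeps the set nonempty when \<open>i0\<close> is the only
    index.\<close>
  let ?M = "insert 2 ((\<lambda>i. r i / r i0) ` (I - {i0}))"
  have "Min ?M > 1" using fin less pos i0 by (subst Min_gr_iff) auto
  moreover have "Min ?M \<le> r i / r i0" if "i \<in> I - {i0}" for i
    using fin that by (intro Min_le) auto
  ultimately show ?thesis by blast
qed

lemma sum_split: "(\<Sum>i\<in>I. g i) = g i0 + (\<Sum>i\<in>I - {i0}. g i)"
  using fin i0 by (simp add: sum.remove)

text \<open>A solution vanishing below \<open>C \<mu>^N\<close> also vanishes below
  \<open>C \<mu>^(N+1)\<close>, because all arguments other than the leading one are smaller by a
  factor of at least \<open>\<mu> > 1\<close>.\<close>

lemma unique:
  assumes C: "C > 0" "\<And>k. k < C \<Longrightarrow> w k = 0"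
    and eq: "\<And>k. (\<Sum>i\<in>I. \<chi> i (k / r i) * w (k / r i)) = 0"
  shows "w k = 0"
proof -
  obtain \<mu> where \<mu>: "\<mu> > 1" "\<And>i. i \<in> I - {i0} \<Longrightarrow> \<mu> \<le> r i / r i0" using gap by blast
  have "\<forall>k < C * \<mu> ^ N. w k = 0" for N
  proof (induction N)
    case (Suc N)
    show ?case
    proof (intro allI impI)
      fix k assume k: "k < C * \<mu> ^ Suc N"
      show "w k = 0"
      proof (cases "k \<le> 0")
        case False
        have "w (k * r i0 / r i) = 0" if i: "i \<in> I - {i0}" for i
        proof -
          have "\<mu> * r i0 \<le> r i" using \<mu>(2)[OF i] pos[OF i0] by (simp add: field_simps)
          then have "k * (\<mu> * r i0) \<le> k * r i" using False by (intro mult_left_mono) auto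
          then have "k * r i0 / r i \<le> k / \<mu>" using \<mu>(1) pos i False by (simp add: field_simps)
          also have "\<dots> < C * \<mu> ^ N" using k \<mu>(1) by (simp add: field_simps)
          finally show ?thesis using Suc by blast
        qed
        then have "\<chi> i0 k * w k = 0"
          using eq[of "k * r i0"] pos[OF i0] unfolding sum_split by simp
        then show ?thesis using lead False by simp
      qed (use C in auto)
    qed
  qed (use C in auto)
  then show ?thesis using rat_power_unbounded[OF \<mu>(1) C(1)] by blast
qed

text \<open>Iterates the equation solved for the leading term. After \<open>N\<close> rounds the
  values below \<open>B \<mu>^N\<close> no longer change, so the limit is reached at each point
  after finitely many rounds.\<close>

lemma solvable:
  assumes C: "C > 0" "\<And>k. k < C \<Longrightarrow> f k = 0"
  shows "\<exists>v. (\<exists>C>0. \<forall>k<C. v k = 0) \<and> (\<forall>k. (\<Sum>i\<in>I. \<chi> i (k / r i) * v (k / r i)) = f k)"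
proof -
  obtain \<mu> where \<mu>: "\<mu> > 1" "\<And>i. i \<in> I - {i0} \<Longrightarrow> \<mu> \<le> r i / r i0" using gap by blast
  define B where "B = C / r i0"
  have B: "B > 0" using C pos[OF i0] by (simp add: B_def)
  \<comment> \<open>The equation at \<open>k * r i0\<close> solved for \<open>v k\<close>; the other
    arguments of \<open>v\<close> are at most \<open>k / \<mu>\<close>.\<close>
  define \<Phi> where "\<Phi> v k = (if k \<le> 0 then 0
    else (f (k * r i0) - (\<Sum>i\<in>I - {i0}. \<chi> i (k * r i0 / r i) * v (k * r i0 / r i))) / \<chi> i0 k)" for v k
  have less: "k * r i0 / r i \<le> k / \<mu>" if "i \<in> I - {i0}" "k > 0" for i k
  proof -
    have "\<mu> * r i0 \<le> r i" using \<mu>(2)[OF that(1)] pos[OF i0] by (simp add: field_simps)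
    then have "k * (\<mu> * r i0) \<le> k * r i" using that by (intro mult_left_mono) auto
    then show ?thesis using \<mu>(1) pos that by (simp add: field_simps)
  qed
  have \<Phi>_cong: "\<Phi> u k = \<Phi> v k" if "\<And>j. j \<le> k / \<mu> \<Longrightarrow> u j = v j" for u v k
    unfolding \<Phi>_def using that less by (auto intro!: arg_cong2[where f = "(/)"] arg_cong2[where f = "(-)"] sum.cong)
  define s where "s N = (\<Phi> ^^ N) (\<lambda>_. 0)" for N
  have s_Suc: "s (Suc N) = \<Phi> (s N)" for N by (simp add: s_def)
  have s_low: "s N k = 0" if "k < B" for N k
    using that
  proof (induction N arbitrary: k)
    case (Suc N)
    have "s N (k * r i0 / r i) = 0" if "i \<in> I - {i0}" "k > 0" for i
    proof (rule Suc.IH)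
      have "k * r i0 / r i \<le> k / \<mu>" using less that by simp
      also have "\<dots> < k" using \<mu>(1) that by (simp add: field_simps)
      finally show "k * r i0 / r i < B" using Suc.prems by simp
    qed
    moreover have "f (k * r i0) = 0" using C Suc.prems pos[OF i0] by (simp add: B_def field_simps)
    ultimately show ?case by (simp add: s_Suc \<Phi>_def)
  qed (simp add: s_def)
  have stable: "s M k = s N k" if "N \<le> M" "k < B * \<mu> ^ N" for M N k
    using that
  proof (induction N arbitrary: M k)
    case (Suc N)
    obtain M' where M: "M = Suc M'" "N \<le> M'" using Suc.prems by (cases M) auto
    have "\<Phi> (s M') k = \<Phi> (s N) k"
    proof (rule \<Phi>_cong)
      fix j assume "j \<le> k / \<mu>"
      also have "k / \<mu> < B * \<mu> ^ N" using Suc.prems \<mu>(1) by (simp add: field_simps)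
      finally show "s M' j = s N j" by (rule Suc.IH[OF M(2)])
    qed
    then show ?case by (simp add: M s_Suc)
  qed (auto simp: s_low)
  define v where "v k = s (SOME N. k < B * \<mu> ^ N) k" for k
  have v_eq: "v k = s N k" if "k < B * \<mu> ^ N" for k N
  proof -
    have *: "k < B * \<mu> ^ (SOME N. k < B * \<mu> ^ N)" using that by (rule someI[of "\<lambda>N. k < B * \<mu> ^ N"])
    show ?thesis unfolding v_def
      using stable[OF _ *, of N] stable[OF _ that, of "SOME N. k < B * \<mu> ^ N"] by (metis nat_le_linear)
  qed
  have v_low: "v k = 0" if "k < B" for k
    using v_eq[of k 0] that by (simp add: s_low)
  have v_fix: "v k = \<Phi> v k" for k
  proof -
    obtain N where N: "k < B * \<mu> ^ N" using rat_power_unbounded[OF \<mu>(1) B] by blast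
    have "B * \<mu> ^ N \<le> B * \<mu> ^ Suc N" using B \<mu>(1) by (intro mult_left_mono power_increasing) auto
    then have "v k = \<Phi> (s N) k" using v_eq[of k "Suc N"] N by (simp add: s_Suc)
    also have "\<dots> = \<Phi> v k"
    proof (cases "k \<le> 0")
      case False
      show ?thesis
      proof (rule \<Phi>_cong)
        fix j assume "j \<le> k / \<mu>"
        also have "k / \<mu> < k" using \<mu>(1) False by (simp add: field_simps)
        finally show "s N j = v j" using N v_eq[of j N] by simp
      qed
    qed (simp add: \<Phi>_def)
    finally show ?thesis .
  qed
  have "(\<Sum>i\<in>I. \<chi> i (k / r i) * v (k / r i)) = f k" for k
  proof (cases "k \<le> 0")
    case True
    then have "v (k / r i) = 0" if "i \<in> I" for i
      using v_low[of "k / r i"] pos[OF that] B divide_nonpos_pos[of k "r i"] by simp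
    then show ?thesis using C True by simp
  next
    case False
    define j where "j = k / r i0"
    have j: "k = j * r i0" "j > 0" using False pos[OF i0] by (auto simp: j_def)
    have "\<chi> i0 j * v j = f k - (\<Sum>i\<in>I - {i0}. \<chi> i (k / r i) * v (k / r i))"
      using v_fix[of j] lead[of j] j by (simp add: \<Phi>_def)
    then show ?thesis unfolding sum_split by (simp flip: j_def)
  qed
  then show ?thesis using v_low B by blast
qed

end

text \<open>Series are supported on positive rationals, so only there must the weight be
  nonzero.\<close>

definition wshift :: "rat \<Rightarrow> 'f::field operator \<Rightarrow> bool" where
  "wshift r T \<longleftrightarrow> r > 0 \<and> (\<exists>\<chi>. (\<forall>k>0. \<chi> k \<noteq> 0) \<and> (\<forall>u k. coeff (app T u) k = \<chi> (k / r) * coeff u (k / r)))"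

lemma wshift_1: "wshift 1 1"
  unfolding wshift_def by (auto simp: app_simps intro!: exI[of _ "\<lambda>_. 1"])

lemma wshift_mult:
  assumes "wshift r S" "wshift s T"
  shows "wshift (r * s) (S * T)"
proof -
  obtain \<chi> \<xi> where "r > 0" "s > 0" "\<forall>k>0. \<chi> k \<noteq> 0" "\<forall>k>0. \<xi> k \<noteq> 0"
    "\<And>u k. coeff (app S u) k = \<chi> (k / r) * coeff u (k / r)"
    "\<And>u k. coeff (app T u) k = \<xi> (k / s) * coeff u (k / s)"
    using assms unfolding wshift_def by blast
  then show ?thesis unfolding wshift_def
    by (intro conjI exI[of _ "\<lambda>k. \<chi> (s * k) * \<xi> k"]) (auto simp: app_simps)
qed

lemma wshift_power: "wshift r S \<Longrightarrow> wshift (r ^ k) (S ^ k)"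
  by (induction k) (auto intro: wshift_1 wshift_mult)

lemma wshift_prod_list:
  "(\<And>i. i \<in> set is \<Longrightarrow> wshift (r i) (S i)) \<Longrightarrow> wshift (prod_list (map r is)) (prod_list (map S is))"
  by (induction "is") (auto intro: wshift_1 wshift_mult)

text \<open>Distinct shifts have a strict minimum, which serves as the leading term of a
  \<open>shift_system\<close>; uniqueness and solvability give a bijective operator.\<close>

lemma invt_sum_wshift:
  fixes c :: "'i \<Rightarrow> 'f::field"
  assumes fin: "finite I" "I \<noteq> {}" and T: "\<And>i. i \<in> I \<Longrightarrow> wshift (r i) (T i)"
    and inj: "inj_on r I" and c: "\<And>i. i \<in> I \<Longrightarrow> c i \<noteq> 0"
  shows "invt (\<Sum>i\<in>I. scale_operator (c i) (T i))"
proof -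
  define i0 where "i0 = arg_min_on r I"
  have i0: "i0 \<in> I" "\<And>i. i \<in> I \<Longrightarrow> r i0 \<le> r i"
    unfolding i0_def using arg_min_if_finite(1)[OF fin] arg_min_least[OF fin] by auto
  have "\<forall>i\<in>I. \<exists>\<chi>. (\<forall>k>0. \<chi> k \<noteq> 0) \<and> (\<forall>u k. coeff (app (T i) u) k = \<chi> (k / r i) * coeff u (k / r i))"
    using T unfolding wshift_def by blast
  then obtain \<chi> where \<chi>: "\<And>i k. i \<in> I \<Longrightarrow> k > 0 \<Longrightarrow> \<chi> i k \<noteq> 0"
    "\<And>i u k. i \<in> I \<Longrightarrow> coeff (app (T i) u) k = \<chi> i (k / r i) * coeff u (k / r i)"
    by metis
  interpret shift_system I i0 r "\<lambda>i k. c i * \<chi> i k"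
  proof
    show "r i0 < r i" if "i \<in> I" "i \<noteq> i0" for i
      using that i0 inj_onD[OF inj, of i0 i] by fastforce
  qed (use fin i0 T \<chi> c in \<open>auto simp: wshift_def\<close>)
  let ?T = "\<Sum>i\<in>I. scale_operator (c i) (T i)"
  have app: "coeff (app ?T u) k = (\<Sum>i\<in>I. c i * \<chi> i (k / r i) * coeff u (k / r i))" for u k
    unfolding app_sum by (intro sum.cong) (auto simp: \<chi>(2) mult.assoc)
  show ?thesis
  proof (rule invt_operator)
    fix u assume *: "app ?T u = 0"
    obtain C where C: "C > 0" "\<And>k. k < C \<Longrightarrow> coeff u k = 0" using coeff_bound by blast
    show "u = 0"
      by (rule series_eqI, unfold coeff_zero, rule unique[OF C]) (use app[of u] in \<open>simp_all add: * coeff_zero\<close>)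
  next
    fix f :: "'f series"
    obtain C where C: "C > 0" "\<And>k. k < C \<Longrightarrow> coeff f k = 0" using coeff_bound by blast
    obtain v where v: "\<exists>C>0. \<forall>k<C. v k = 0" "\<And>k. (\<Sum>i\<in>I. c i * \<chi> i (k / r i) * v (k / r i)) = coeff f k"
      using solvable[of C "coeff f"] C by blast
    have "coeff (Abs_series v) = v" using v(1) by (intro Abs_series_inverse) simp
    then have "app ?T (Abs_series v) = f" by (intro series_eqI) (simp add: app v(2))
    then show "\<exists>u. app ?T u = f" by blast
  qed
qed

section \<open>Construction and commutation of weighted shifts\<close>

lift_definition shift_series :: "rat \<Rightarrow> (rat \<Rightarrow> 'f::field) \<Rightarrow> 'f series \<Rightarrow> 'f series"
  is "\<lambda>r \<chi> v k. if r > 0 then \<chi> (k / r) * v (k / r) else 0"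
  subgoal for r \<chi> v
  proof (cases "r > 0")
    case True
    assume "\<exists>C>0. \<forall>k<C. v k = 0"
    then obtain C where "C > 0" "\<And>k. k < C \<Longrightarrow> v k = 0" by blast
    then show ?thesis using True by (intro exI[of _ "C * r"]) (auto simp: field_simps)
  qed (auto intro: exI[of _ 1])
  done

lift_definition shift :: "rat \<Rightarrow> (rat \<Rightarrow> 'f::field) \<Rightarrow> 'f operator" is shift_series
  by (auto intro!: series_eqI simp: coeff_plus coeff_scale shift_series.rep_eq algebra_simps)

lemma coeff_shift: "r > 0 \<Longrightarrow> coeff (app (shift r \<chi>) u) k = \<chi> (k / r) * coeff u (k / r)"
  by (simp add: shift.rep_eq shift_series.rep_eq)

lemma wshift_shift: "r > 0 \<Longrightarrow> (\<And>k. k > 0 \<Longrightarrow> \<chi> k \<noteq> 0) \<Longrightarrow> wshift r (shift r \<chi>)"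
  unfolding wshift_def using coeff_shift by blast

lemma shift_mult_shift:
  assumes "r > 0" "s > 0" "\<And>k. k > 0 \<Longrightarrow> \<chi> (s * k) * \<xi> k = c * (\<xi>' (r * k) * \<chi>' k)"
  shows "shift r \<chi> * shift s \<xi> = scale_operator c (shift s \<xi>' * shift r \<chi>')"
proof (rule operator_eqI)
  fix u k
  show "coeff (app (shift r \<chi> * shift s \<xi>) u) k = coeff (app (scale_operator c (shift s \<xi>' * shift r \<chi>')) u) k"
  proof (cases "k > 0")
    case True
    define j where "j = k / (r * s)"
    have j: "j > 0" "k / r = s * j" "k / s = r * j" "k / r / s = j" "k / s / r = j"
      using assms True by (auto simp: j_def field_simps)
    then show ?thesis using assms
      by (simp add: app_simps coeff_scale coeff_shift mult.assoc[symmetric])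
  next
    case False
    then have "k / r / s \<le> 0" "k / s / r \<le> 0" using assms by (auto simp: divide_le_0_iff zero_le_divide_iff)
    then show ?thesis using assms by (simp add: app_simps coeff_scale coeff_shift coeff_nonpos)
  qed
qed

section \<open>Valuations of positive rationals\<close>

definition val :: "nat \<Rightarrow> rat \<Rightarrow> int" where
  "val p r = (THE z. \<exists>a b. a > 0 \<and> b > 0 \<and> r = of_nat a / of_nat b \<and> z = int (multiplicity p a) - int (multiplicity p b))"

lemma val_eq:
  assumes p: "prime p" and "a > 0" "b > 0" "r = of_nat a / of_nat b"
  shows "val p r = int (multiplicity p a) - int (multiplicity p b)"
  unfolding val_def
proof (rule the_equality)
  fix z assume "\<exists>c d. c > 0 \<and> d > 0 \<and> r = of_nat c / of_nat d \<and> z = int (multiplicity p c) - int (multiplicity p d)"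
  then obtain c d where cd: "c > 0" "d > 0" "r = of_nat c / of_nat d" "z = int (multiplicity p c) - int (multiplicity p d)"
    by blast
  have "(of_nat (a * d) :: rat) = of_nat (c * b)" using assms cd by (simp add: field_simps)
  then have "a * d = c * b" by (simp only: of_nat_eq_iff)
  then have "multiplicity p a + multiplicity p d = multiplicity p c + multiplicity p b"
    using assms cd prime_elem_multiplicity_mult_distrib[of p] by (metis less_numeral_extra(3) prime_imp_prime_elem)
  then show "z = int (multiplicity p a) - int (multiplicity p b)" using cd by simp
qed (use assms in blast)

lemma pos_rat_cases:
  assumes "(r::rat) > 0"
  obtains a b where "a > 0" "b > 0" "r = of_nat a / of_nat b"
proof -
  obtain x y where xy: "r = Fract x y" "y > 0" by (cases r) auto
  then have "x > 0" using assms by (simp add: zero_less_Fract_iff)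
  then show ?thesis using xy that[of "nat x" "nat y"] by (simp add: Fract_of_int_quotient)
qed

lemma val_mult:
  assumes p: "prime p" and "r > 0" "s > 0"
  shows "val p (r * s) = val p r + val p s"
proof -
  obtain a b where r: "a > 0" "b > 0" "r = of_nat a / of_nat b" using assms(2) by (rule pos_rat_cases)
  obtain c d where s: "c > 0" "d > 0" "s = of_nat c / of_nat d" using assms(3) by (rule pos_rat_cases)
  have "r * s = of_nat (a * c) / of_nat (b * d)" using r s by simp
  then have "val p (r * s) = int (multiplicity p (a * c)) - int (multiplicity p (b * d))"
    using r s by (intro val_eq[OF p]) auto
  then show ?thesis using val_eq[OF p r] val_eq[OF p s] r s p
    by (simp add: prime_elem_multiplicity_mult_distrib)
qed

lemma val_1: "prime p \<Longrightarrow> val p 1 = 0"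
  using val_eq[of p 1 1 1] by simp

lemma val_power: "prime p \<Longrightarrow> r > 0 \<Longrightarrow> val p (r ^ k) = int k * val p r"
  by (induction k) (auto simp: val_1 val_mult algebra_simps)

lemma prod_list_pos: "(\<And>x. x \<in> set xs \<Longrightarrow> x > (0::rat)) \<Longrightarrow> prod_list xs > 0"
  by (induction xs) auto

lemma val_prod_list: "prime p \<Longrightarrow> (\<And>x. x \<in> set xs \<Longrightarrow> x > 0) \<Longrightarrow> val p (prod_list xs) = sum_list (map (val p) xs)"
  by (induction xs) (auto simp: val_1 val_mult prod_list_pos)

lemma val_prime: "prime p \<Longrightarrow> prime q \<Longrightarrow> val p (of_nat q) = (if p = q then 1 else 0)"
  using val_eq[of p q 1 "of_nat q"] prime_gt_0_nat[of q] by (auto simp: prime_multiplicity_other multiplicity_self)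

section \<open>Families of q-commuting units\<close>

lemma prod_list_mult_comm:
  fixes f g :: "'i \<Rightarrow> 'r::monoid_mult"
  assumes "distinct xs" "\<And>i j. i \<in> set xs \<Longrightarrow> j \<in> set xs \<Longrightarrow> i \<noteq> j \<Longrightarrow> f i * g j = g j * f i"
  shows "prod_list (map f xs) * prod_list (map g xs) = prod_list (map (\<lambda>i. f i * g i) xs)"
  using assms
proof (induction xs)
  case (Cons x xs)
  have "prod_list (map f ys) * g x = g x * prod_list (map f ys)" if "set ys \<subseteq> set xs" for ys
    using that
  proof (induction ys)
    case (Cons y ys)
    have "f y * g x = g x * f y" using Cons.prems Cons.prems \<open>distinct (x # xs)\<close>
      by (intro \<open>\<And>i j. i \<in> set (x # xs) \<Longrightarrow> j \<in> set (x # xs) \<Longrightarrow> i \<noteq> j \<Longrightarrow> f i * g j = g j * f i\<close>) auto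
    then show ?case using Cons by simp (metis mult.assoc)
  qed simp
  from this[of xs] have "prod_list (map f xs) * (g x * b) = g x * (prod_list (map f xs) * b)" for b
    by (metis mult.assoc order_refl)
  then show ?case using Cons by (simp add: mult.assoc)
qed simp

context assoc_algebra
begin

lemma prod_list_scale:
  "prod_list (map (\<lambda>i. c i *s f i) xs) = prod_list (map c xs) *s prod_list (map f xs)"
  by (induction xs) auto

lemma prod_list_twist:
  assumes "distinct xs" "i \<in> set xs" "z * f i = c *s (f i * z)"
    and "\<And>j. j \<in> set xs \<Longrightarrow> j \<noteq> i \<Longrightarrow> z * f j = f j * z"
  shows "z * prod_list (map f xs) = c *s (prod_list (map f xs) * z)"
proof -
  have comm: "z * prod_list (map f ys) = prod_list (map f ys) * z" if "set ys \<subseteq> set xs - {i}" for ys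
    using that
  proof (induction ys)
    case (Cons y ys)
    then have "z * f y = f y * z" using assms(4) by auto
    then show ?case using Cons by simp (metis mult.assoc)
  qed simp
  obtain ys zs where xs: "xs = ys @ i # zs" using assms(2) by (auto simp: in_set_conv_decomp)
  then have "set ys \<subseteq> set xs - {i}" "set zs \<subseteq> set xs - {i}" using assms(1) by auto
  then have "z * prod_list (map f ys) = prod_list (map f ys) * z" "z * prod_list (map f zs) = prod_list (map f zs) * z"
    by (auto intro: comm)
  then have "z * (prod_list (map f ys) * b) = prod_list (map f ys) * (z * b)"
    "z * (f i * b) = c *s (f i * (z * b))" "z * prod_list (map f zs) = prod_list (map f zs) * z" for b
    using assms(3) by (simp_all flip: mult.assoc)
  then show ?thesis by (simp add: xs mult.assoc)
qed

lemma subspace_subalg: "subalg S \<Longrightarrow> subspace S"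
  by (auto simp: subspace_def intro: subalg_closed)

lemma span_mult_right:
  assumes "r \<in> span X" "\<And>x. x \<in> X \<Longrightarrow> x * m \<in> span Y"
  shows "r * m \<in> span Y"
  using assms(1)
  by (induction rule: span_induct_alt) (auto simp: distrib_right span_zero intro!: span_add span_scale assms(2))

lemma span_mult_left:
  assumes "r \<in> span X" "\<And>x. x \<in> X \<Longrightarrow> m * x \<in> span Y"
  shows "m * r \<in> span Y"
  using assms(1)
  by (induction rule: span_induct_alt) (auto simp: distrib_left span_zero intro!: span_add span_scale assms(2))

end

text \<open>Polynomial growth: for a suitable side \<open>k\<close>, enlarging a box by a fixed
  amount does not double its number of lattice points. This is the counting behind the Ore
  condition.\<close>

lemma power_ratio_bound: "\<exists>k. (c + k + 1) ^ N < 2 * (k + 1 :: nat) ^ N"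
proof -
  \<comment> \<open>Chosen so that \<open>N c / (K + c) < 1/2\<close>, which is what the Bernoulli
    inequality needs; \<open>K\<close> is \<open>k + 1\<close> for \<open>k = 2 N c\<close>.\<close>
  define K :: real where "K = 2 * real N * real c + 1"
  have K: "K > 0" unfolding K_def by (intro add_nonneg_pos mult_nonneg_nonneg) auto
  have pos: "K + c > 0" using K by simp
  have "2 * (real N * real c) < K + c" unfolding K_def by simp
  then have "1 / 2 < 1 + real N * (- c / (K + c))" using pos by (simp add: field_simps)
  also have "\<dots> \<le> (1 + - c / (K + c)) ^ N"
    by (rule Bernoulli_inequality) (use K pos in \<open>simp add: field_simps\<close>)
  also have "1 + - c / (K + c) = K / (K + c)" using pos by (simp add: field_simps)
  finally have "(K + c) ^ N < 2 * K ^ N" using pos by (simp add: power_divide field_simps)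
  then have "real ((c + 2 * N * c + 1) ^ N) < real (2 * (2 * N * c + 1) ^ N)"
    by (simp add: K_def algebra_simps)
  then have "(c + 2 * N * c + 1) ^ N < 2 * (2 * N * c + 1) ^ N" by (simp only: of_nat_less_iff)
  then show ?thesis by blast
qed

text \<open>The scalar may depend on the index because the family on the target side has
  \<open>q^(m/p)\<close> in the first factor and \<open>q^m\<close> in the others.\<close>

locale qfamily = assoc_algebra scale
  for scale :: "'f::field \<Rightarrow> 'r::ring_1 \<Rightarrow> 'r" (infixr \<open>*s\<close> 75) +
  fixes n :: nat and t :: "nat \<Rightarrow> 'f" and a b :: "nat \<Rightarrow> 'r"
  assumes unit_ab: "\<And>i. i \<in> {1..n} \<Longrightarrow> invt (a i)" "\<And>i. i \<in> {1..n} \<Longrightarrow> invt (b i)"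
    and b_a: "\<And>i. i \<in> {1..n} \<Longrightarrow> b i * a i = t i *s (a i * b i)"
    and comm_ab: "\<And>i j. i \<in> {1..n} \<Longrightarrow> j \<in> {1..n} \<Longrightarrow> i \<noteq> j \<Longrightarrow>
        a i * a j = a j * a i \<and> b i * b j = b j * b i \<and> b i * a j = a j * b i"
begin

definition blk :: "nat \<Rightarrow> nat \<times> nat \<Rightarrow> 'r" where
  "blk i e = a i ^ fst e * b i ^ snd e"

definition mon :: "(nat \<Rightarrow> nat \<times> nat) \<Rightarrow> 'r" where
  "mon \<mu> = prod_list (map (\<lambda>i. blk i (\<mu> i)) [1..<Suc n])"

lemma mon_cong: "(\<And>i. i \<in> {1..n} \<Longrightarrow> \<mu> i = \<nu> i) \<Longrightarrow> mon \<mu> = mon \<nu>"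
  unfolding mon_def by (intro arg_cong[where f = prod_list] map_cong) auto

lemma invt_mon: "invt (mon \<mu>)"
  unfolding mon_def by (intro invt_prod_list) (auto simp: blk_def unit_ab)

lemma t_nonzero: "i \<in> {1..n} \<Longrightarrow> t i \<noteq> 0"
  using b_a[of i] unit_ab[of i] invt_neq_0[of "b i * a i"] by fastforce

lemma b_a_pow: assumes "i \<in> {1..n}" shows "b i * a i ^ k = t i ^ k *s (a i ^ k * b i)"
proof (induction k)
  case (Suc k)
  have "b i * a i ^ Suc k = t i *s (a i * (b i * a i ^ k))"
    using b_a[OF assms] by (simp flip: mult.assoc)
  then show ?case by (simp add: Suc mult.assoc)
qed simp

lemma b_pow_a_pow: assumes "i \<in> {1..n}" shows "b i ^ l * a i ^ k = t i ^ (k * l) *s (a i ^ k * b i ^ l)"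
proof (induction l)
  case (Suc l)
  have "b i ^ Suc l * a i ^ k = t i ^ (k * l) *s (b i * a i ^ k * b i ^ l)"
    using Suc by (simp add: mult.assoc)
  then show ?case by (simp add: b_a_pow[OF assms] mult.assoc power_add mult.commute)
qed simp

lemma blk_mult:
  assumes "i \<in> {1..n}"
  shows "blk i e * blk i e' = t i ^ (fst e' * snd e) *s blk i (fst e + fst e', snd e + snd e')"
proof -
  have "b i ^ l * (a i ^ k * c) = t i ^ (k * l) *s (a i ^ k * (b i ^ l * c))" for k l c
    using b_pow_a_pow[OF assms, of l k] by (simp flip: mult.assoc)
  then show ?thesis unfolding blk_def by (simp add: mult.assoc power_add)
qed

lemma commute_power: "x * y = y * x \<Longrightarrow> x ^ k * y ^ l = y ^ l * (x :: 'r) ^ k"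
  using power_commuting_commutes by metis

lemma blk_comm:
  assumes "i \<in> {1..n}" "j \<in> {1..n}" "i \<noteq> j"
  shows "blk i e * blk j e' = blk j e' * blk i e"
proof -
  have *: "a i ^ k * a j ^ l = a j ^ l * a i ^ k" "b i ^ k * b j ^ l = b j ^ l * b i ^ k"
    "b i ^ k * a j ^ l = a j ^ l * b i ^ k" "a i ^ k * b j ^ l = b j ^ l * a i ^ k" for k l
    using comm_ab[of i j] comm_ab[of j i] assms by (auto intro!: commute_power)
  show ?thesis unfolding blk_def by (metis (no_types, opaque_lifting) * mult.assoc)
qed

definition esum :: "(nat \<Rightarrow> nat \<times> nat) \<Rightarrow> (nat \<Rightarrow> nat \<times> nat) \<Rightarrow> nat \<Rightarrow> nat \<times> nat" where
  "esum \<mu> \<nu> = (\<lambda>i\<in>{1..n}. (fst (\<mu> i) + fst (\<nu> i), snd (\<mu> i) + snd (\<nu> i)))"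

lemma mon_mult: "\<exists>c. mon \<mu> * mon \<nu> = c *s mon (esum \<mu> \<nu>)"
proof -
  have "mon \<mu> * mon \<nu> = prod_list (map (\<lambda>i. blk i (\<mu> i) * blk i (\<nu> i)) [1..<Suc n])"
    unfolding mon_def by (rule prod_list_mult_comm) (auto simp: blk_comm)
  also have "\<dots> = prod_list (map (\<lambda>i. t i ^ (fst (\<nu> i) * snd (\<mu> i)) *s blk i (esum \<mu> \<nu> i)) [1..<Suc n])"
    by (intro arg_cong[where f = prod_list] map_cong) (auto simp: blk_mult esum_def)
  also have "\<dots> = prod_list (map (\<lambda>i. t i ^ (fst (\<nu> i) * snd (\<mu> i))) [1..<Suc n]) *s mon (esum \<mu> \<nu>)"
    unfolding mon_def by (rule prod_list_scale)
  finally show ?thesis by blast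
qed

definition Expo :: "(nat \<Rightarrow> nat \<times> nat) set" where
  "Expo = (\<Pi>\<^sub>E i\<in>{1..n}. UNIV)"

definition Box :: "nat \<Rightarrow> (nat \<Rightarrow> nat \<times> nat) set" where
  "Box k = (\<Pi>\<^sub>E i\<in>{1..n}. {..k} \<times> {..k})"

definition W :: "'r set" where
  "W = span (mon ` Expo)"

lemma Box_Expo: "Box k \<subseteq> Expo"
  by (auto simp: Box_def Expo_def)

lemma Box_mono: "k \<le> l \<Longrightarrow> Box k \<subseteq> Box l"
  unfolding Box_def by (intro PiE_mono) auto

lemma finite_Box: "finite (Box k)"
  unfolding Box_def by (intro finite_PiE) auto

lemma card_Box: "card (Box k) = (k + 1) ^ (2 * n)"
  unfolding Box_def by (subst card_PiE) (auto simp: power2_eq_square power_mult)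

lemma mon_in_W: "mon \<mu> \<in> W"
proof -
  have "mon \<mu> = mon (restrict \<mu> {1..n})" by (rule mon_cong) auto
  then show ?thesis unfolding W_def by (auto intro!: span_base simp: Expo_def)
qed

lemma subalg_W: "subalg W"
proof -
  have "mon (\<lambda>_. (0, 0)) = 1" by (simp add: mon_def blk_def del: upt_Suc) (induction n, auto)
  then have one: "c *s 1 \<in> W" for c using mon_in_W unfolding W_def by (metis span_scale)
  have mm: "mon \<mu> * mon \<nu> \<in> W" for \<mu> \<nu>
  proof -
    obtain c where "mon \<mu> * mon \<nu> = c *s mon (esum \<mu> \<nu>)" using mon_mult by blast
    then show ?thesis using mon_in_W[of "esum \<mu> \<nu>"] unfolding W_def by (simp add: span_scale)
  qed
  have mr: "mon \<mu> * r \<in> W" if "r \<in> W" for \<mu> r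
    using that unfolding W_def by (rule span_mult_left) (use mm in \<open>auto simp: W_def\<close>)
  have "r * s \<in> W" if "r \<in> W" "s \<in> W" for r s
    using that(1) unfolding W_def by (rule span_mult_right) (use mr that(2) in \<open>auto simp: W_def\<close>)
  then show ?thesis unfolding subalg_def using one by (auto simp: W_def span_add)
qed

lemma mon_single:
  assumes "i \<in> {1..n}"
  shows "mon (\<lambda>j. if j = i then (1, 0) else (0, 0)) = a i"
    and "mon (\<lambda>j. if j = i then (0, 1) else (0, 0)) = b i"
proof -
  have *: "prod_list (map (\<lambda>j. if j = i then x else 1) xs) = x" if "i \<in> set xs" "distinct xs" for xs and x :: 'r
    using that
  proof (induction xs)
    case (Cons y ys)
    have "prod_list (map (\<lambda>j. if j = i then x else 1) zs) = 1" if "i \<notin> set zs" for zs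
      using that by (induction zs) auto
    then show ?case using Cons by auto
  qed simp
  have i: "i \<in> set [1..<Suc n]" using assms by auto
  have "mon (\<lambda>j. if j = i then (1, 0) else (0, 0)) = prod_list (map (\<lambda>j. if j = i then a i else 1) [1..<Suc n])"
    "mon (\<lambda>j. if j = i then (0, 1) else (0, 0)) = prod_list (map (\<lambda>j. if j = i then b i else 1) [1..<Suc n])"
    unfolding mon_def blk_def by (intro arg_cong[where f = prod_list] map_cong; auto)+
  then show "mon (\<lambda>j. if j = i then (1, 0) else (0, 0)) = a i"
    "mon (\<lambda>j. if j = i then (0, 1) else (0, 0)) = b i"
    using *[OF i distinct_upt] by simp_all
qed

text \<open>Conjugation by \<open>b i\<close> reads off the exponent of \<open>a i\<close> in a
  monomial as an eigenvalue; in the next lemma the inverse of \<open>a i\<close> does the same for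
  the exponent of \<open>b i\<close>.\<close>

lemma b_mon: assumes "i \<in> {1..n}" shows "b i * mon \<mu> = t i ^ fst (\<mu> i) *s (mon \<mu> * b i)"
  unfolding mon_def
proof (rule prod_list_twist)
  show "b i * blk i (\<mu> i) = t i ^ fst (\<mu> i) *s (blk i (\<mu> i) * b i)"
  proof -
    have "b i * (a i ^ k * c) = t i ^ k *s (a i ^ k * (b i * c))" for k c
      using b_a_pow[OF assms, of k] by (simp flip: mult.assoc)
    then show ?thesis unfolding blk_def by (simp add: mult.assoc power_commutes)
  qed
  fix j assume "j \<in> set [1..<Suc n]" "j \<noteq> i"
  then show "b i * blk j (\<mu> j) = blk j (\<mu> j) * b i"
    using blk_comm[of i j "(0, 1)"] assms by (auto simp: blk_def)
qed (use assms in auto)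

lemma rinv_a_mon: assumes "i \<in> {1..n}" shows "rinv (a i) * mon \<mu> = t i ^ snd (\<mu> i) *s (mon \<mu> * rinv (a i))"
  unfolding mon_def
proof (rule prod_list_twist)
  have "b i ^ l * a i = t i ^ l *s (a i * b i ^ l)" for l using b_pow_a_pow[OF assms, of l 1] by simp
  then have "rinv (a i) * (b i ^ l * a i) * rinv (a i) = t i ^ l *s (b i ^ l * rinv (a i))" for l
    using unit_ab assms by simp
  then have "rinv (a i) * b i ^ l = t i ^ l *s (b i ^ l * rinv (a i))" for l
    using unit_ab assms by (simp add: mult.assoc)
  moreover have "a i ^ k * rinv (a i) = rinv (a i) * a i ^ k" for k
    by (rule rinv_commute) (rule power_commutes)
  ultimately show "rinv (a i) * blk i (\<mu> i) = t i ^ snd (\<mu> i) *s (blk i (\<mu> i) * rinv (a i))"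
    unfolding blk_def by (metis mult.assoc mult_scale_right)
  fix j assume "j \<in> set [1..<Suc n]" "j \<noteq> i"
  then have "blk j (\<mu> j) * a i = a i * blk j (\<mu> j)"
    using blk_comm[of i j "(1, 0)"] assms by (auto simp: blk_def)
  then show "rinv (a i) * blk j (\<mu> j) = blk j (\<mu> j) * rinv (a i)" by (rule rinv_commute[symmetric])
qed (use assms in auto)

end

locale generic_qfamily = qfamily scale n t a b
  for scale :: "'f::field \<Rightarrow> 'r::ring_1 \<Rightarrow> 'r" (infixr \<open>*s\<close> 75) and n t a b +
  assumes generic: "\<And>i. i \<in> {1..n} \<Longrightarrow> \<not> root_of_unity (t i)"
begin

lemma t_pow_inj: "i \<in> {1..n} \<Longrightarrow> t i ^ k = t i ^ l \<Longrightarrow> k = l"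
proof (induction k l rule: linorder_wlog)
  case (le k l)
  show ?case
  proof (rule ccontr)
    assume "k \<noteq> l"
    have "t i ^ k * t i ^ (l - k) = t i ^ k * 1" using le by (metis le_add_diff_inverse mult.right_neutral power_add)
    then have "t i ^ (l - k) = 1" using t_nonzero[OF le(2)] by (simp only: mult_cancel_left) simp
    then show False using generic[OF le(2)] le(1) \<open>k \<noteq> l\<close> unfolding root_of_unity_def
      by (meson zero_less_diff le_neq_implies_less)
  qed
qed auto

text \<open>Two different exponents differ at some index, and conjugation by \<open>b i\<close> or
  by the inverse of \<open>a i\<close> then has different eigenvalues on the two monomials, as
  \<open>t i\<close> is not a root of unity.\<close>

lemma mon_independent:
  assumes "finite S" "S \<subseteq> Expo" "(\<Sum>\<mu>\<in>S. c \<mu> *s mon \<mu>) = 0"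
  shows "\<forall>\<mu>\<in>S. c \<mu> = 0"
proof (rule eigenvectors_independent[OF assms(1) _ _ assms(3)])
  show "mon \<mu> \<noteq> 0" for \<mu> using invt_mon by (rule invt_neq_0)
  fix \<mu> \<nu> assume "\<mu> \<in> S" "\<nu> \<in> S" "\<mu> \<noteq> \<nu>"
  then obtain i where i: "i \<in> {1..n}" "\<mu> i \<noteq> \<nu> i"
    using PiE_ext[of \<mu> "{1..n}" "\<lambda>_. UNIV" \<nu>] assms(2) unfolding Expo_def by blast
  have units: "invt (a i)" "invt (b i)" using unit_ab i by auto
  consider "fst (\<mu> i) \<noteq> fst (\<nu> i)" | "snd (\<mu> i) \<noteq> snd (\<nu> i)" using i by (meson prod_eqI)
  then show "\<exists>f ev. (\<forall>x y. f (x + y) = f x + f y) \<and> (\<forall>c x. f (c *s x) = c *s f x) \<and>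
        (\<forall>\<kappa>\<in>S. f (mon \<kappa>) = ev \<kappa> *s mon \<kappa>) \<and> ev \<mu> \<noteq> ev \<nu>"
  proof cases
    case 1
    then show ?thesis using t_pow_inj[OF i(1)] units
      by (intro exI[of _ "\<lambda>r. b i * r * rinv (b i)"] exI[of _ "\<lambda>\<kappa>. t i ^ fst (\<kappa> i)"])
        (auto simp: distrib_left distrib_right b_mon[OF i(1)] mult.assoc)
  next
    case 2
    then show ?thesis using t_pow_inj[OF i(1)] units
      by (intro exI[of _ "\<lambda>r. rinv (a i) * r * a i"] exI[of _ "\<lambda>\<kappa>. t i ^ snd (\<kappa> i)"])
        (auto simp: distrib_left distrib_right rinv_a_mon[OF i(1)] mult.assoc)
  qed
qed

lemma W_in_Box: assumes "r \<in> W" shows "\<exists>c. r \<in> span (mon ` Box c)"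
proof -
  have mono: "span (mon ` Box c) \<subseteq> span (mon ` Box d)" if "c \<le> d" for c d
    using that by (intro span_mono image_mono Box_mono)
  show ?thesis using assms unfolding W_def
  proof (induction rule: span_induct_alt)
    case base
    then show ?case using span_zero by blast
  next
    case (step c x y)
    then obtain \<mu> d where \<mu>: "x = mon \<mu>" "\<mu> \<in> Expo" "y \<in> span (mon ` Box d)" by blast
    define e where "e = Max (insert 0 ((\<lambda>i. max (fst (\<mu> i)) (snd (\<mu> i))) ` {1..n}))"
    have "max (fst (\<mu> i)) (snd (\<mu> i)) \<le> e" if "i \<in> {1..n}" for i
      unfolding e_def using that by (intro Max_ge) auto
    then have "\<mu> \<in> Box e" using \<mu>(2) unfolding Box_def Expo_def
      by (auto simp: PiE_def Pi_def mem_Times_iff)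
    then have "c *s x + y \<in> span (mon ` Box (max d e))"
      using mono[of d "max d e"] mono[of e "max d e"] \<mu> by (intro span_add span_scale) (auto intro: span_base)
    then show ?case by blast
  qed
qed

text \<open>The number of monomials in a box grows polynomially with its side, so \<open>r W\<close> and \<open>s W\<close> must meet.\<close>

lemma ore:
  assumes unit: "\<And>r. r \<in> W \<Longrightarrow> r \<noteq> 0 \<Longrightarrow> invt r"
    and rs: "r \<in> W" "s \<in> W" "r \<noteq> 0" "s \<noteq> 0"
  shows "\<exists>u\<in>W. \<exists>v\<in>W. r * u = s * v \<and> r * u \<noteq> 0"
proof -
  obtain c1 c2 where c12: "r \<in> span (mon ` Box c1)" "s \<in> span (mon ` Box c2)"
    using W_in_Box rs by blast
  define c where "c = max c1 c2"
  have c: "r \<in> span (mon ` Box c)" "s \<in> span (mon ` Box c)"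
    using c12 span_mono[OF image_mono[OF Box_mono[of c1 c]]] span_mono[OF image_mono[OF Box_mono[of c2 c]]]
    by (auto simp: c_def)
  obtain k where k: "(c + k + 1) ^ (2 * n) < 2 * (k + 1) ^ (2 * n)" using power_ratio_bound by blast
  \<comment> \<open>The flag tells whether the monomial is multiplied by \<open>r\<close> or by
    \<open>s\<close>: these are \<open>2 (k+1)^(2n)\<close> vectors in the span of at most
    \<open>(c+k+1)^(2n)\<close> monomials, so they are dependent.\<close>
  define g where "g p = (if snd p then r else s) * mon (fst p)" for p :: "(nat \<Rightarrow> nat \<times> nat) \<times> bool"
  let ?I = "Box k \<times> (UNIV :: bool set)"
  have mm: "mon \<mu> * mon \<nu> \<in> span (mon ` Box (c + k))" if "\<mu> \<in> Box c" "\<nu> \<in> Box k" for \<mu> \<nu>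
  proof -
    have "fst (\<mu> i) \<le> c \<and> snd (\<mu> i) \<le> c \<and> fst (\<nu> i) \<le> k \<and> snd (\<nu> i) \<le> k" if "i \<in> {1..n}" for i
      using \<open>\<mu> \<in> Box c\<close> \<open>\<nu> \<in> Box k\<close> PiE_mem[OF _ that] unfolding Box_def
      by (metis (no_types, lifting) SigmaE atMost_iff fst_conv snd_conv)
    then have "esum \<mu> \<nu> \<in> Box (c + k)" unfolding Box_def esum_def by (auto intro!: add_mono)
    moreover obtain d where "mon \<mu> * mon \<nu> = d *s mon (esum \<mu> \<nu>)" using mon_mult by blast
    ultimately show ?thesis by (simp add: span_scale span_base)
  qed
  have gin: "g p \<in> span (mon ` Box (c + k))" if "p \<in> ?I" for p
    unfolding g_def
  proof (rule span_mult_right[where X = "mon ` Box c"])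
    show "(if snd p then r else s) \<in> span (mon ` Box c)" using c by simp
    show "x * mon (fst p) \<in> span (mon ` Box (c + k))" if "x \<in> mon ` Box c" for x
      using that \<open>p \<in> ?I\<close> mm by auto
  qed
  have "card (mon ` Box (c + k)) \<le> card (Box (c + k))" using finite_Box by (rule card_image_le)
  then have "card (mon ` Box (c + k)) < card ?I"
    using k by (simp add: card_cartesian_product card_Box card_UNIV_bool)
  with exists_linear_relation[of ?I "mon ` Box (c + k)" g] gin finite_Box obtain d
    where d: "\<exists>p\<in>?I. d p \<noteq> 0" "(\<Sum>p\<in>?I. d p *s g p) = 0" by auto
  define u where "u = (\<Sum>\<nu>\<in>Box k. d (\<nu>, True) *s mon \<nu>)"
  define v where "v = (\<Sum>\<nu>\<in>Box k. d (\<nu>, False) *s mon \<nu>)"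
  have uv: "u \<in> W" "v \<in> W" unfolding u_def v_def
    by (auto intro!: subalg_sum[OF subalg_W] subalg_scale[OF subalg_W] mon_in_W)
  have "(\<Sum>p\<in>?I. d p *s g p) = (\<Sum>\<nu>\<in>Box k. \<Sum>\<beta>\<in>UNIV. d (\<nu>, \<beta>) *s g (\<nu>, \<beta>))"
    by (simp add: sum.cartesian_product)
  also have "\<dots> = r * u + s * v"
    by (simp add: UNIV_bool u_def v_def g_def sum_distrib_left sum.distrib)
  finally have rel: "r * u + s * v = 0" using d(2) by simp
  \<comment> \<open>Otherwise \<open>u\<close> and \<open>v\<close> both vanish, as \<open>r\<close>
    and \<open>s\<close> are units, and independence of the monomials makes the relation
    trivial.\<close>
  have "r * u \<noteq> 0"
  proof
    assume "r * u = 0"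
    then have "u = 0" "v = 0" using rel unit rs by auto
    then have "\<forall>\<nu>\<in>Box k. d (\<nu>, True) = 0" "\<forall>\<nu>\<in>Box k. d (\<nu>, False) = 0"
      using mon_independent[OF finite_Box Box_Expo] unfolding u_def v_def by metis+
    then show False using d(1) by (metis (full_types) SigmaE)
  qed
  moreover have "r * u = s * (- v)" using rel by (simp add: eq_neg_iff_add_eq_0)
  ultimately show ?thesis using uv subalg_uminus[OF subalg_W] by metis
qed

end

section \<open>The quantum torus as an algebra of operators\<close>

definition pr :: "nat \<Rightarrow> nat" where
  "pr = enumerate {p. prime p}"

lemma prime_pr [simp]: "prime (pr i)"
  using enumerate_in_set[OF primes_infinite, of i] by (simp add: pr_def)

lemma pr_eq_iff [simp]: "pr i = pr j \<longleftrightarrow> i = j"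
  using strict_mono_enumerate[OF primes_infinite] by (auto simp: pr_def strict_mono_eq)

lemma pr_pos [simp]: "pr i > 0"
  using prime_gt_0_nat[OF prime_pr] by simp

definition x_op :: "nat \<Rightarrow> 'f::field operator" where
  "x_op i = shift (of_nat (pr (2 * i))) (\<lambda>_. 1)"

text \<open>Each index owns two primes. The weight counts the factors \<open>pr (2 * i)\<close> of
  the argument; \<open>x_op i\<close> adds one such factor, and this produces the \<open>q\<close>
  when \<open>y_op q i\<close> is moved past it.\<close>

definition y_op :: "'f \<Rightarrow> nat \<Rightarrow> 'f::field operator" where
  "y_op q i = shift (of_nat (pr (Suc (2 * i)))) (\<lambda>k. q powi val (pr (2 * i)) k)"

lemma even_odd_neq [simp]: "2 * i \<noteq> Suc (2 * j)" "Suc (2 * j) \<noteq> 2 * (i :: nat)"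
  by presburger+

lemma val_pr [simp]: "val (pr i) (of_nat (pr j)) = (if i = j then 1 else 0)"
  by (auto simp: val_prime)

lemma wshift_x_op: "wshift (of_nat (pr (2 * i))) (x_op i)"
  unfolding x_op_def by (intro wshift_shift) auto

lemma wshift_y_op: "q \<noteq> 0 \<Longrightarrow> wshift (of_nat (pr (Suc (2 * i)))) (y_op q i)"
  unfolding y_op_def by (intro wshift_shift) auto

lemma invt_wshift: "wshift r T \<Longrightarrow> invt T"
  using invt_sum_wshift[of "{()}" "\<lambda>_. r" "\<lambda>_. T" "\<lambda>_. 1"] by simp

lemma operator_qfamily:
  assumes "q \<noteq> 0"
  shows "qfamily scale_operator n (\<lambda>_. q) x_op (y_op q)"
proof
  show "invt (x_op i :: 'a operator)" "invt (y_op q i)" for i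
    using wshift_x_op wshift_y_op[OF assms] by (auto intro: invt_wshift)
  have yx: "y_op q i * x_op j = scale_operator (if i = j then q else 1) (x_op j * y_op q i)" for i j
    unfolding x_op_def y_op_def
    by (rule shift_mult_shift) (auto simp: val_mult power_int_add assms)
  show "y_op q i * x_op i = scale_operator q (x_op i * y_op q i)" for i using yx[of i i] by simp
  have "x_op i * x_op j = scale_operator 1 (x_op j * x_op i)" for i j
    unfolding x_op_def by (rule shift_mult_shift) auto
  moreover have "y_op q i * y_op q j = scale_operator 1 (y_op q j * y_op q i)" for i j
    unfolding y_op_def by (rule shift_mult_shift) (auto simp: val_mult assms power_int_add)
  ultimately show "x_op i * x_op j = x_op j * x_op i \<and> y_op q i * y_op q j = y_op q j * y_op q i
      \<and> y_op q i * x_op j = x_op j * y_op q i" if "i \<noteq> j" for i j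
    using yx[of i j] that by simp
qed

text \<open>By unique factorization the exponents of a monomial are the valuations of its total
  shift. Distinct monomials therefore have distinct shifts, and \<open>invt_sum_wshift\<close>
  applies.\<close>

lemma operator_W_invt:
  assumes q: "q \<noteq> 0" and r: "r \<in> qfamily.W scale_operator n x_op (y_op q)" "r \<noteq> 0"
  shows "invt r"
proof -
  interpret qfamily scale_operator n "\<lambda>_. q" x_op "y_op q" by (rule operator_qfamily[OF q])
  define R :: "nat \<Rightarrow> nat \<times> nat \<Rightarrow> rat"
    where "R i e = of_nat (pr (2 * i)) ^ fst e * of_nat (pr (Suc (2 * i))) ^ snd e" for i e
  define P :: "(nat \<Rightarrow> nat \<times> nat) \<Rightarrow> rat" where "P \<mu> = prod_list (map (\<lambda>i. R i (\<mu> i)) [1..<Suc n])" for \<mu>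
  have "wshift (R i e) (blk i e)" for i e
    unfolding R_def blk_def by (intro wshift_mult wshift_power wshift_x_op wshift_y_op q)
  then have shift: "wshift (P \<mu>) (mon \<mu>)" for \<mu>
    unfolding P_def mon_def by (intro wshift_prod_list) auto
  have Rpos: "R i e > 0" for i e unfolding R_def by simp
  have val_R: "val (pr (2 * i)) (R j e) = (if i = j then int (fst e) else 0)"
    "val (pr (Suc (2 * i))) (R j e) = (if i = j then int (snd e) else 0)" for i j e
    by (auto simp: R_def val_mult val_power)
  have val_P: "val (pr (2 * i)) (P \<mu>) = int (fst (\<mu> i))" "val (pr (Suc (2 * i))) (P \<mu>) = int (snd (\<mu> i))"
    if "i \<in> {1..n}" for i \<mu>
  proof -
    have "val (pr (2 * i)) (P \<mu>) = (\<Sum>j\<leftarrow>[1..<Suc n]. if i = j then int (fst (\<mu> j)) else 0)"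
      "val (pr (Suc (2 * i))) (P \<mu>) = (\<Sum>j\<leftarrow>[1..<Suc n]. if i = j then int (snd (\<mu> j)) else 0)"
      unfolding P_def by (subst val_prod_list; auto simp: Rpos val_R o_def simp del: upt_Suc)+
    moreover have "(\<Sum>j\<leftarrow>[1..<Suc n]. if i = j then h j else 0) = (\<Sum>j\<in>{1..<Suc n}. if i = j then h j else 0)"
      for h :: "nat \<Rightarrow> int"
      by (subst sum_list_distinct_conv_sum_set) auto
    ultimately show "val (pr (2 * i)) (P \<mu>) = int (fst (\<mu> i))" "val (pr (Suc (2 * i))) (P \<mu>) = int (snd (\<mu> i))"
      using that by (auto simp del: upt_Suc)
  qed
  have inj: "inj_on P Expo"
  proof (rule inj_onI)
    fix \<mu> \<nu> assume *: "\<mu> \<in> Expo" "\<nu> \<in> Expo" "P \<mu> = P \<nu>"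
    show "\<mu> = \<nu>"
    proof (rule PiE_ext[OF *(1,2)[unfolded Expo_def]])
      fix i assume i: "i \<in> {1..n}"
      show "\<mu> i = \<nu> i" using val_P[OF i, of \<mu>] val_P[OF i, of \<nu>] *(3) by (intro prod_eqI) auto
    qed
  qed
  have injm: "inj_on P S" if "S \<subseteq> Expo" for S using inj that by (rule inj_on_subset)
  obtain T u where T: "finite T" "T \<subseteq> mon ` Expo" "r = (\<Sum>w\<in>T. scale_operator (u w) w)"
    using r(1) unfolding W_def operator.span_explicit by blast
  then obtain S where S: "S \<subseteq> Expo" "inj_on mon S" "mon ` S = T"
    using subset_image_inj[of T mon Expo] by blast
  define S' where "S' = {\<mu>\<in>S. u (mon \<mu>) \<noteq> 0}"
  have finS: "finite S" using S T by (metis finite_imageD)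
  have "r = (\<Sum>\<mu>\<in>S. scale_operator (u (mon \<mu>)) (mon \<mu>))"
    using T S by (metis (no_types, lifting) sum.reindex_cong)
  also have "\<dots> = (\<Sum>\<mu>\<in>S'. scale_operator (u (mon \<mu>)) (mon \<mu>))"
    unfolding S'_def using finS by (intro sum.mono_neutral_right) auto
  finally have r_eq: "r = (\<Sum>\<mu>\<in>S'. scale_operator (u (mon \<mu>)) (mon \<mu>))" .
  then have "S' \<noteq> {}" using r(2) by auto
  then show ?thesis unfolding r_eq
    using finS S(1) by (intro invt_sum_wshift[of _ P] shift injm) (auto simp: S'_def)
qed

section \<open>Monoid algebras and quotient algebras\<close>

lemma fun_sum_apply: "(\<Sum>i\<in>I. f i) z = (\<Sum>i\<in>I. f i z)" for f :: "'i \<Rightarrow> 'a \<Rightarrow> 'b::comm_monoid_add"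
  by (induction I rule: infinite_finite_induct) auto

abbreviation fscale :: "'f::field \<Rightarrow> ('g \<Rightarrow> 'f) \<Rightarrow> 'g \<Rightarrow> 'f" where
  "fscale c f \<equiv> (\<lambda>z. c * f z)"

interpretation fs: vector_space "fscale :: 'f::field \<Rightarrow> ('g \<Rightarrow> 'f) \<Rightarrow> 'g \<Rightarrow> 'f"
  by unfold_locales (auto simp: fun_eq_iff algebra_simps)

abbreviation supp :: "('g \<Rightarrow> 'f::zero) \<Rightarrow> 'g set" where
  "supp f \<equiv> {x. f x \<noteq> 0}"

definition lin :: "('f::zero \<Rightarrow> 'b \<Rightarrow> 'b) \<Rightarrow> ('g \<Rightarrow> 'b) \<Rightarrow> ('g \<Rightarrow> 'f) \<Rightarrow> 'b::comm_monoid_add" where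
  "lin scale h f = (\<Sum>x\<in>supp f. scale (f x) (h x))"

context vector_space
begin

lemma lin_superset: "finite S \<Longrightarrow> supp f \<subseteq> S \<Longrightarrow> lin scale h f = (\<Sum>x\<in>S. scale (f x) (h x))"
  unfolding lin_def by (rule sum.mono_neutral_left) auto

lemma lin_cong: "(\<And>x. f x \<noteq> 0 \<Longrightarrow> h x = k x) \<Longrightarrow> lin scale h f = lin scale k f"
  unfolding lin_def by (rule sum.cong) auto

lemma lin_add:
  assumes "finite (supp f)" "finite (supp g)"
  shows "lin scale h (f + g) = lin scale h f + lin scale h g"
proof -
  let ?S = "supp f \<union> supp g"
  have "lin scale h (f + g) = (\<Sum>x\<in>?S. scale ((f + g) x) (h x))" by (rule lin_superset) (use assms in auto)
  moreover have "lin scale h f = (\<Sum>x\<in>?S. scale (f x) (h x))" by (rule lin_superset) (use assms in auto)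
  moreover have "lin scale h g = (\<Sum>x\<in>?S. scale (g x) (h x))" by (rule lin_superset) (use assms in auto)
  ultimately show ?thesis by (simp add: scale_left_distrib sum.distrib)
qed

lemma lin_scale: "lin scale h (fscale c f) = scale c (lin scale h f)"
proof (cases "c = 0")
  case False
  then show ?thesis by (simp add: lin_def scale_sum_right)
qed (simp add: lin_def)

lemma lin_basis: "lin scale h (basis_elt x) = h x"
  using lin_superset[of "{x}" "basis_elt x" h] by (auto simp: basis_elt_def)

lemma lin_zero: "lin scale h 0 = 0" "lin scale h (\<lambda>_. 0) = 0"
  by (simp_all add: lin_def)

lemma lin_fun_add: "lin scale (\<lambda>x. h x + k x) f = lin scale h f + lin scale k f"
  by (simp add: lin_def scale_right_distrib sum.distrib)

lemma lin_lin:
  assumes "finite (supp f)" "\<And>x. f x \<noteq> 0 \<Longrightarrow> finite (supp (k x))"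
  shows "lin scale h (lin fscale k f) = lin scale (\<lambda>x. lin scale h (k x)) f"
proof -
  have "finite (supp (\<Sum>x\<in>S. fscale (f x) (k x))) \<and>
      lin scale h (\<Sum>x\<in>S. fscale (f x) (k x)) = (\<Sum>x\<in>S. scale (f x) (lin scale h (k x)))"
    if "finite S" "S \<subseteq> supp f" for S
    using that
  proof (induction S rule: finite_induct)
    case (insert x S)
    have fin: "finite (supp (fscale (f x) (k x)))"
      by (rule finite_subset[OF _ assms(2)[of x]]) (use insert in auto)
    have "supp (fscale (f x) (k x) + (\<Sum>x\<in>S. fscale (f x) (k x)))
        \<subseteq> supp (fscale (f x) (k x)) \<union> supp (\<Sum>x\<in>S. fscale (f x) (k x))" by auto
    moreover have "finite \<dots>" using fin insert by simp
    ultimately have "finite (supp (fscale (f x) (k x) + (\<Sum>x\<in>S. fscale (f x) (k x))))"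
      by (rule finite_subset)
    moreover have "finite (supp (\<Sum>x\<in>S. fscale (f x) (k x)))"
      "lin scale h (\<Sum>x\<in>S. fscale (f x) (k x)) = (\<Sum>x\<in>S. scale (f x) (lin scale h (k x)))"
      using insert by auto
    ultimately show ?case
      by (simp only: sum.insert[OF insert.hyps(1,2)] lin_add[OF fin] lin_scale simp_thms)
  qed (simp add: lin_zero)
  then show ?thesis using assms(1) unfolding lin_def lin_def[of scale "\<lambda>x. lin scale h (k x)"] by blast
qed

end

lemma lin_basis_id: "finite (supp f) \<Longrightarrow> lin fscale basis_elt f = f"
proof
  fix z assume "finite (supp f)"
  then show "lin fscale basis_elt f z = f z"
    unfolding lin_def fun_sum_apply
    by (cases "f z = 0") (auto simp: basis_elt_def if_distrib cong: if_cong)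
qed

lemma supp_basis: "supp (basis_elt x :: 'g \<Rightarrow> 'f::field) = {x}"
  by (auto simp: basis_elt_def)

lemma monoid_algebra_simps:
  "f \<in> carrier (monoid_algebra M) \<longleftrightarrow> finite (supp f) \<and> supp f \<subseteq> carrier M"
  "f \<oplus>\<^bsub>monoid_algebra M\<^esub> g = f + g" "c \<odot>\<^bsub>monoid_algebra M\<^esub> f = fscale c f"
  "\<one>\<^bsub>monoid_algebra M\<^esub> = basis_elt \<one>\<^bsub>M\<^esub>" "\<zero>\<^bsub>monoid_algebra M\<^esub> = 0"
  by (auto simp: monoid_algebra_def basis_elt_def fun_eq_iff)

lemma fun_subset_supp:
  "supp (f + g) \<subseteq> supp f \<union> supp (g :: 'g \<Rightarrow> 'f::field)" "supp (fscale c f) \<subseteq> supp f"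
  by auto

lemma carrier_subspace: "fs.subspace (carrier (monoid_algebra M))"
proof (rule fs.subspaceI)
  fix f g :: "'b \<Rightarrow> 'a" and c assume *: "f \<in> carrier (monoid_algebra M)" "g \<in> carrier (monoid_algebra M)"
  show "f + g \<in> carrier (monoid_algebra M)"
    using * finite_subset[OF fun_subset_supp(1)[of f g]] fun_subset_supp(1)[of f g]
    unfolding monoid_algebra_simps by blast
next
  fix f :: "'b \<Rightarrow> 'a" and c assume *: "f \<in> carrier (monoid_algebra M)"
  show "fscale c f \<in> carrier (monoid_algebra M)"
    using * finite_subset[OF fun_subset_supp(2)[of c f]] fun_subset_supp(2)[of c f]
    unfolding monoid_algebra_simps by blast
qed (simp add: monoid_algebra_simps)

lemma basis_carrier: "x \<in> carrier M \<Longrightarrow> basis_elt x \<in> carrier (monoid_algebra M)"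
  by (simp add: monoid_algebra_simps supp_basis)

lemma lin_carrier:
  "(\<And>x. f x \<noteq> 0 \<Longrightarrow> k x \<in> carrier (monoid_algebra M)) \<Longrightarrow> lin fscale k f \<in> carrier (monoid_algebra M)"
  unfolding lin_def
  by (intro fs.subspace_sum fs.subspace_scale carrier_subspace) auto

lemma monoid_algebra_induct [consumes 1, case_names basis add scale zero]:
  assumes "f \<in> carrier (monoid_algebra M)"
    and "\<And>x. x \<in> carrier M \<Longrightarrow> P (basis_elt x)"
    and "\<And>f g. f \<in> carrier (monoid_algebra M) \<Longrightarrow> g \<in> carrier (monoid_algebra M) \<Longrightarrow> P f \<Longrightarrow> P g \<Longrightarrow> P (f + g)"
    and "\<And>c f. f \<in> carrier (monoid_algebra M) \<Longrightarrow> P f \<Longrightarrow> P (fscale c f)"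
    and "P 0"
  shows "P f"
proof -
  have fin: "finite (supp f)" "supp f \<subseteq> carrier M" using assms(1) by (auto simp: monoid_algebra_simps)
  have sub: "(\<Sum>x\<in>S. fscale (f x) (basis_elt x)) \<in> carrier (monoid_algebra M)" if "S \<subseteq> supp f" for S
    using that fin by (intro fs.subspace_sum fs.subspace_scale carrier_subspace basis_carrier) auto
  have "P (\<Sum>x\<in>S. fscale (f x) (basis_elt x))" if "finite S" "S \<subseteq> supp f" for S
    using that
  proof (induction S rule: finite_induct)
    case (insert x S)
    have x: "x \<in> carrier M" using insert fin by auto
    have "P (fscale (f x) (basis_elt x) + (\<Sum>x\<in>S. fscale (f x) (basis_elt x)))"
      using insert x by (intro assms(2-4) sub basis_carrier fs.subspace_scale[OF carrier_subspace]) auto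
    then show ?case by (simp only: sum.insert[OF insert.hyps])
  qed (use assms(5) in simp)
  from this[OF fin(1)] show ?thesis using lin_basis_id[OF fin(1)] by (simp add: lin_def)
qed

text \<open>Convolution as an iterated linear extension from the basis, which reduces associativity
  and the unit laws to those of the monoid.\<close>

lemma mult_eq_lin:
  assumes "f \<in> carrier (monoid_algebra M)" "g \<in> carrier (monoid_algebra M)"
  shows "f \<otimes>\<^bsub>monoid_algebra M\<^esub> g = lin fscale (\<lambda>x. lin fscale (\<lambda>y. basis_elt (x \<otimes>\<^bsub>M\<^esub> y)) g) f"
proof
  fix z
  have fin: "finite (supp f)" "finite (supp g)" using assms by (auto simp: monoid_algebra_simps)
  have "(f \<otimes>\<^bsub>monoid_algebra M\<^esub> g) z
      = (\<Sum>(x, y) \<in> {(x, y). f x \<noteq> 0 \<and> g y \<noteq> 0 \<and> x \<otimes>\<^bsub>M\<^esub> y = z}. f x * g y)"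
    by (simp add: monoid_algebra_def)
  also have "\<dots> = (\<Sum>(x, y) \<in> supp f \<times> supp g. f x * g y * basis_elt (x \<otimes>\<^bsub>M\<^esub> y) z)"
    using fin by (intro sum.mono_neutral_cong_left) (auto simp: basis_elt_def split: if_splits)
  also have "\<dots> = (\<Sum>x\<in>supp f. \<Sum>y\<in>supp g. f x * g y * basis_elt (x \<otimes>\<^bsub>M\<^esub> y) z)"
    by (simp add: sum.cartesian_product)
  also have "\<dots> = lin fscale (\<lambda>x. lin fscale (\<lambda>y. basis_elt (x \<otimes>\<^bsub>M\<^esub> y)) g) f z"
    by (simp add: lin_def fun_sum_apply sum_distrib_left mult.assoc)
  finally show "(f \<otimes>\<^bsub>monoid_algebra M\<^esub> g) z = lin fscale (\<lambda>x. lin fscale (\<lambda>y. basis_elt (x \<otimes>\<^bsub>M\<^esub> y)) g) f z" .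
qed

context
  fixes M :: "('g, 'm) monoid_scheme"
  assumes M: "Group.monoid M"
begin

interpretation M: Group.monoid M by (rule M)

lemma mult_carrier:
  assumes "f \<in> carrier (monoid_algebra M)" "g \<in> carrier (monoid_algebra M)"
  shows "f \<otimes>\<^bsub>monoid_algebra M\<^esub> g \<in> carrier (monoid_algebra M)"
  unfolding mult_eq_lin[OF assms]
  using assms by (intro lin_carrier basis_carrier M.m_closed) (auto simp: monoid_algebra_simps)

lemma finite_supp_inner: "g \<in> carrier (monoid_algebra M) \<Longrightarrow> f x \<noteq> 0 \<Longrightarrow> f \<in> carrier (monoid_algebra M) \<Longrightarrow>
   finite (supp (lin fscale (\<lambda>y. basis_elt (x \<otimes>\<^bsub>M\<^esub> y)) g))"
proof -
  assume *: "g \<in> carrier (monoid_algebra M)" "f x \<noteq> 0" "f \<in> carrier (monoid_algebra M)"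
  have "lin fscale (\<lambda>y. basis_elt (x \<otimes>\<^bsub>M\<^esub> y)) g \<in> carrier (monoid_algebra M)"
    using * by (intro lin_carrier basis_carrier M.m_closed) (auto simp: monoid_algebra_simps)
  then show ?thesis by (simp add: monoid_algebra_simps)
qed

end

lemma (in vector_space) lin_mult:
  assumes M: "Group.monoid M"
    and f: "f \<in> carrier (monoid_algebra M)" and g: "g \<in> carrier (monoid_algebra M)"
  shows "lin scale h (f \<otimes>\<^bsub>monoid_algebra M\<^esub> g) = lin scale (\<lambda>x. lin scale (\<lambda>y. h (x \<otimes>\<^bsub>M\<^esub> y)) g) f"
proof -
  have "lin scale h (f \<otimes>\<^bsub>monoid_algebra M\<^esub> g) = lin scale (\<lambda>x. lin scale h (lin fscale (\<lambda>y. basis_elt (x \<otimes>\<^bsub>M\<^esub> y)) g)) f"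
    unfolding mult_eq_lin[OF f g]
    by (rule lin_lin) (use f g finite_supp_inner[OF M g _ f] in \<open>auto simp: monoid_algebra_simps\<close>)
  also have "\<dots> = lin scale (\<lambda>x. lin scale (\<lambda>y. h (x \<otimes>\<^bsub>M\<^esub> y)) g) f"
    by (rule lin_cong, subst lin_lin) (use g in \<open>auto simp: monoid_algebra_simps supp_basis lin_basis\<close>)
  finally show ?thesis .
qed

context
  fixes M :: "('g, 'm) monoid_scheme"
  assumes M: "Group.monoid M"
begin

interpretation M: Group.monoid M by (rule M)

lemma mult_assoc:
  assumes f: "f \<in> carrier (monoid_algebra M)" and g: "g \<in> carrier (monoid_algebra M)" and k: "k \<in> carrier (monoid_algebra M)"
  shows "f \<otimes>\<^bsub>monoid_algebra M\<^esub> g \<otimes>\<^bsub>monoid_algebra M\<^esub> k = f \<otimes>\<^bsub>monoid_algebra M\<^esub> (g \<otimes>\<^bsub>monoid_algebra M\<^esub> k)"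
proof -
  have "f \<otimes>\<^bsub>monoid_algebra M\<^esub> g \<otimes>\<^bsub>monoid_algebra M\<^esub> k
      = lin fscale (\<lambda>x. lin fscale (\<lambda>y. lin fscale (\<lambda>z. basis_elt (x \<otimes>\<^bsub>M\<^esub> y \<otimes>\<^bsub>M\<^esub> z)) k) g) f"
    by (simp only: mult_eq_lin[OF mult_carrier[OF M f g] k] fs.lin_mult[OF M f g])
  also have "\<dots> = lin fscale (\<lambda>x. lin fscale (\<lambda>y. lin fscale (\<lambda>z. basis_elt (x \<otimes>\<^bsub>M\<^esub> (y \<otimes>\<^bsub>M\<^esub> z))) k) g) f"
    using f g k by (intro fs.lin_cong arg_cong[where f = basis_elt] M.m_assoc) (auto simp: monoid_algebra_simps)
  also have "\<dots> = f \<otimes>\<^bsub>monoid_algebra M\<^esub> (g \<otimes>\<^bsub>monoid_algebra M\<^esub> k)"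
    by (simp only: mult_eq_lin[OF f mult_carrier[OF M g k]] fs.lin_mult[OF M g k])
  finally show ?thesis .
qed

lemma basis_mult: "x \<in> carrier M \<Longrightarrow> y \<in> carrier M \<Longrightarrow> basis_elt x \<otimes>\<^bsub>monoid_algebra M\<^esub> basis_elt y = basis_elt (x \<otimes>\<^bsub>M\<^esub> y)"
  by (simp add: mult_eq_lin basis_carrier fs.lin_basis)

lemma one_mult: assumes f: "f \<in> carrier (monoid_algebra M)"
  shows "basis_elt \<one>\<^bsub>M\<^esub> \<otimes>\<^bsub>monoid_algebra M\<^esub> f = f" "f \<otimes>\<^bsub>monoid_algebra M\<^esub> basis_elt \<one>\<^bsub>M\<^esub> = f"
proof -
  have fin: "finite (supp f)" and sub: "supp f \<subseteq> carrier M" using f by (auto simp: monoid_algebra_simps)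
  have "lin fscale (\<lambda>y. basis_elt (\<one>\<^bsub>M\<^esub> \<otimes>\<^bsub>M\<^esub> y)) f = lin fscale basis_elt f"
    "lin fscale (\<lambda>y. basis_elt (y \<otimes>\<^bsub>M\<^esub> \<one>\<^bsub>M\<^esub>)) f = lin fscale basis_elt f"
    using sub by (auto intro!: fs.lin_cong)
  then show "basis_elt \<one>\<^bsub>M\<^esub> \<otimes>\<^bsub>monoid_algebra M\<^esub> f = f" "f \<otimes>\<^bsub>monoid_algebra M\<^esub> basis_elt \<one>\<^bsub>M\<^esub> = f"
    using f by (simp_all add: mult_eq_lin basis_carrier fs.lin_basis lin_basis_id[OF fin])
qed

end

text \<open>Scalar multiplication is multiplication by \<open>c \<odot> \<one>\<close>; so two-sided
  ideals are stable under scalars, and the scalar action passes to quotients.\<close>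

locale ralg = ring A for A :: "('f::field, 'a) module" (structure) +
  assumes smult_closed [simp]: "a \<in> carrier A \<Longrightarrow> c \<odot> a \<in> carrier A"
    and smult_eq: "a \<in> carrier A \<Longrightarrow> c \<odot> a = (c \<odot> \<one>) \<otimes> a"

lemma ralg_monoid_algebra:
  assumes M: "Group.monoid M"
  shows "ralg (monoid_algebra M :: ('f::field, 'g \<Rightarrow> 'f) module)" (is "ralg ?A")
proof -
  interpret M: Group.monoid M by (rule M)
  have "abelian_group ?A"
  proof (rule abelian_groupI)
    fix f assume f: "f \<in> carrier ?A"
    show "\<exists>g\<in>carrier ?A. g \<oplus>\<^bsub>?A\<^esub> f = \<zero>\<^bsub>?A\<^esub>"
      using fs.subspace_scale[OF carrier_subspace f, of "-1"]
      by (intro bexI[of _ "fscale (-1) f"]) (auto simp: monoid_algebra_simps(2-) fun_eq_iff)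
  qed (auto simp: monoid_algebra_simps(2-) add_ac intro: fs.subspace_add[OF carrier_subspace] fs.subspace_0[OF carrier_subspace])
  moreover have "Group.monoid ?A"
    by (rule monoidI) (auto simp: mult_carrier[OF M] mult_assoc[OF M] one_mult[OF M] basis_carrier monoid_algebra_simps(2-))
  moreover have "(f \<oplus>\<^bsub>?A\<^esub> g) \<otimes>\<^bsub>?A\<^esub> k = f \<otimes>\<^bsub>?A\<^esub> k \<oplus>\<^bsub>?A\<^esub> g \<otimes>\<^bsub>?A\<^esub> k"
    "k \<otimes>\<^bsub>?A\<^esub> (f \<oplus>\<^bsub>?A\<^esub> g) = k \<otimes>\<^bsub>?A\<^esub> f \<oplus>\<^bsub>?A\<^esub> k \<otimes>\<^bsub>?A\<^esub> g"
    if "f \<in> carrier ?A" "g \<in> carrier ?A" "k \<in> carrier ?A" for f g k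
    using that fs.subspace_add[OF carrier_subspace that(1,2)]
    by (simp_all add: monoid_algebra_simps(2-) mult_eq_lin fs.lin_add fs.lin_fun_add)
       (simp_all add: monoid_algebra_simps(1) fs.lin_add fs.lin_fun_add)
  ultimately have "ring ?A" by (intro ringI)
  moreover have "c \<odot>\<^bsub>?A\<^esub> f \<in> carrier ?A" if "f \<in> carrier ?A" for c f
    using fs.subspace_scale[OF carrier_subspace that] by (simp add: monoid_algebra_simps(2-))
  moreover have "c \<odot>\<^bsub>?A\<^esub> f = (c \<odot>\<^bsub>?A\<^esub> \<one>\<^bsub>?A\<^esub>) \<otimes>\<^bsub>?A\<^esub> f" if f: "f \<in> carrier ?A" for c f
  proof -
    have "basis_elt \<one>\<^bsub>M\<^esub> \<in> carrier ?A" by (simp add: basis_carrier)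
    from fs.subspace_scale[OF carrier_subspace this]
    have "fscale c (basis_elt \<one>\<^bsub>M\<^esub>) \<otimes>\<^bsub>?A\<^esub> f = fscale c (basis_elt \<one>\<^bsub>M\<^esub> \<otimes>\<^bsub>?A\<^esub> f)"
      using f by (simp add: mult_eq_lin basis_carrier fs.lin_scale)
    then show ?thesis using f by (simp add: monoid_algebra_simps(2-) one_mult[OF M])
  qed
  ultimately show ?thesis by (intro ralg.intro ralg_axioms.intro)
qed

section \<open>Quotients of algebras by ideals\<close>

lemma quot_alg_simps:
  "carrier (quot_alg A J) = a_rcosets\<^bsub>A\<^esub> J" "monoid.mult (quot_alg A J) = rcoset_mult A J"
  "\<one>\<^bsub>quot_alg A J\<^esub> = J +>\<^bsub>A\<^esub> \<one>\<^bsub>A\<^esub>" "\<zero>\<^bsub>quot_alg A J\<^esub> = J" "add (quot_alg A J) = set_add A"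
  "c \<odot>\<^bsub>quot_alg A J\<^esub> C = (\<Union>a\<in>C. J +>\<^bsub>A\<^esub> (c \<odot>\<^bsub>A\<^esub> a))"
  by (simp_all add: quot_alg_def ring.extend_def module.fields_def FactRing_def)

locale ralg_ideal = ralg A + ideal J A for A :: "('f::field, 'a) module" (structure) and J
begin

abbreviation "\<pi> a \<equiv> J +> a"
abbreviation "Q \<equiv> quot_alg A J"

lemma pi_hom:
  assumes "a \<in> carrier A" "b \<in> carrier A"
  shows "\<pi> a \<oplus>\<^bsub>Q\<^esub> \<pi> b = \<pi> (a \<oplus> b)" "\<pi> a \<otimes>\<^bsub>Q\<^esub> \<pi> b = \<pi> (a \<otimes> b)"
  using assms by (simp_all add: quot_alg_simps a_rcos_sum rcoset_mult_add)

lemma pi_eq_iff: "a \<in> carrier A \<Longrightarrow> b \<in> carrier A \<Longrightarrow> \<pi> a = \<pi> b \<longleftrightarrow> a \<ominus> b \<in> J"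
  using quotient_eq_iff_same_a_r_cos[OF ideal_axioms] by metis

text \<open>The union in the definition of the quotient is over equal cosets: for \<open>b\<close>
  in the class of \<open>a\<close>, the element \<open>c \<odot> b \<ominus> c \<odot> a\<close>
  lies in the ideal.\<close>

lemma pi_smult: assumes "a \<in> carrier A" shows "c \<odot>\<^bsub>Q\<^esub> \<pi> a = \<pi> (c \<odot> a)"
proof -
  have "\<pi> (c \<odot> b) = \<pi> (c \<odot> a)" if b: "b \<in> \<pi> a" for b
  proof -
    have bc: "b \<in> carrier A" using b assms a_elemrcos_carrier by blast
    have "b \<ominus> a \<in> J" using a_rcos_module_minus[OF ring_axioms assms bc] b by blast
    then have "(c \<odot> \<one>) \<otimes> (b \<ominus> a) \<in> J" by (rule I_l_closed) simp
    moreover have "(c \<odot> \<one>) \<otimes> (b \<ominus> a) = c \<odot> b \<ominus> c \<odot> a"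
    proof -
      define s where "s = c \<odot> \<one>"
      have s: "s \<in> carrier A" by (simp add: s_def)
      have "c \<odot> b = s \<otimes> b" "c \<odot> a = s \<otimes> a" using bc assms by (simp_all add: s_def smult_eq[symmetric])
      then show ?thesis using s bc assms unfolding s_def[symmetric]
        by (simp add: minus_eq r_distr r_minus)
    qed
    ultimately show ?thesis using pi_eq_iff bc assms by simp
  qed
  then show ?thesis
    unfolding quot_alg_simps by (intro UN_constant_eq[of a]) (auto intro: a_rcos_self[OF assms])
qed

lemma carrier_Q: "carrier Q = \<pi> ` carrier A"
  by (auto simp: quot_alg_simps A_RCOSETS_defs a_r_coset_def)

lemma pi_carrier [simp]: "a \<in> carrier A \<Longrightarrow> \<pi> a \<in> carrier Q"
  by (simp add: carrier_Q)

lemma ralg_Q: "ralg Q"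
proof -
  interpret FR: ring "A Quot J" by (rule quotient_is_ring)
  have "abelian_group Q"
  proof (rule abelian_groupI)
    show "\<exists>y\<in>carrier Q. y \<oplus>\<^bsub>Q\<^esub> x = \<zero>\<^bsub>Q\<^esub>" if "x \<in> carrier Q" for x
      using FR.add.l_inv_ex that by (simp add: quot_alg_simps FactRing_def)
  qed (use FR.add.m_closed FR.add.m_assoc FR.add.m_comm FR.add.one_closed FR.add.l_one in
      \<open>auto simp: quot_alg_simps FactRing_def\<close>)
  moreover have "Group.monoid Q"
    using FR.m_closed FR.m_assoc FR.one_closed FR.l_one FR.r_one
    by (intro monoidI) (auto simp: quot_alg_simps FactRing_def)
  ultimately have "ring Q"
    using FR.l_distr FR.r_distr by (intro ringI) (auto simp: quot_alg_simps FactRing_def)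
  then show ?thesis
  proof (intro ralg.intro ralg_axioms.intro)
    fix C c assume "C \<in> carrier Q"
    then obtain a where a: "C = \<pi> a" "a \<in> carrier A" by (auto simp: carrier_Q)
    then show "c \<odot>\<^bsub>Q\<^esub> C \<in> carrier Q" by (simp add: pi_smult)
    show "c \<odot>\<^bsub>Q\<^esub> C = (c \<odot>\<^bsub>Q\<^esub> \<one>\<^bsub>Q\<^esub>) \<otimes>\<^bsub>Q\<^esub> C"
      using a smult_eq[of a c] by (simp add: pi_smult pi_hom quot_alg_simps(3) flip: smult_eq)
  qed
qed

lemma pi_one: "\<pi> \<one> = \<one>\<^bsub>Q\<^esub>"
  by (simp add: quot_alg_simps)

end

section \<open>Homomorphisms from algebras into the ambient ring\<close>

context assoc_algebra
begin

definition rhom :: "('f, 'a) module \<Rightarrow> ('a \<Rightarrow> 'r) \<Rightarrow> bool" where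
  "rhom A \<chi> \<longleftrightarrow> \<chi> \<one>\<^bsub>A\<^esub> = 1 \<and> (\<forall>a\<in>carrier A. \<forall>b\<in>carrier A. \<chi> (a \<oplus>\<^bsub>A\<^esub> b) = \<chi> a + \<chi> b \<and> \<chi> (a \<otimes>\<^bsub>A\<^esub> b) = \<chi> a * \<chi> b)
     \<and> (\<forall>c. \<forall>a\<in>carrier A. \<chi> (c \<odot>\<^bsub>A\<^esub> a) = c *s \<chi> a)"

lemma rhomD:
  assumes "rhom A \<chi>"
  shows "\<chi> \<one>\<^bsub>A\<^esub> = 1" "a \<in> carrier A \<Longrightarrow> b \<in> carrier A \<Longrightarrow> \<chi> (a \<oplus>\<^bsub>A\<^esub> b) = \<chi> a + \<chi> b"
    "a \<in> carrier A \<Longrightarrow> b \<in> carrier A \<Longrightarrow> \<chi> (a \<otimes>\<^bsub>A\<^esub> b) = \<chi> a * \<chi> b"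
    "a \<in> carrier A \<Longrightarrow> \<chi> (c \<odot>\<^bsub>A\<^esub> a) = c *s \<chi> a"
  using assms by (auto simp: rhom_def)

lemma rhom_zero_minus:
  assumes A: "ralg A" and \<chi>: "rhom A \<chi>"
  shows "\<chi> \<zero>\<^bsub>A\<^esub> = 0" and "a \<in> carrier A \<Longrightarrow> \<chi> (\<ominus>\<^bsub>A\<^esub> a) = - \<chi> a"
    and "a \<in> carrier A \<Longrightarrow> b \<in> carrier A \<Longrightarrow> \<chi> (a \<ominus>\<^bsub>A\<^esub> b) = \<chi> a - \<chi> b"
proof -
  interpret ralg A by (rule A)
  show z: "\<chi> \<zero>\<^bsub>A\<^esub> = 0" using rhomD(2)[OF \<chi>, of "\<zero>\<^bsub>A\<^esub>" "\<zero>\<^bsub>A\<^esub>"] by simp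
  show m: "\<chi> (\<ominus>\<^bsub>A\<^esub> a) = - \<chi> a" if "a \<in> carrier A" for a
    using rhomD(2)[OF \<chi>, of "\<ominus>\<^bsub>A\<^esub> a" a] that z by (simp add: l_neg eq_neg_iff_add_eq_0)
  show "\<chi> (a \<ominus>\<^bsub>A\<^esub> b) = \<chi> a - \<chi> b" if "a \<in> carrier A" "b \<in> carrier A"
    using rhomD(2)[OF \<chi>, of a "\<ominus>\<^bsub>A\<^esub> b"] that m by (simp add: a_minus_def)
qed

lemma rhom_lin:
  fixes M :: "('g, 'm) monoid_scheme"
  assumes M: "Group.monoid M" and "h \<one>\<^bsub>M\<^esub> = 1"
    and "\<And>x y. x \<in> carrier M \<Longrightarrow> y \<in> carrier M \<Longrightarrow> h (x \<otimes>\<^bsub>M\<^esub> y) = h x * h y"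
  shows "rhom (monoid_algebra M) (lin scale h)"
  unfolding rhom_def
proof (intro conjI ballI allI)
  fix f g :: "'g \<Rightarrow> 'f" assume f: "f \<in> carrier (monoid_algebra M)" and g: "g \<in> carrier (monoid_algebra M)"
  have "lin scale h (f \<otimes>\<^bsub>monoid_algebra M\<^esub> g) = lin scale (\<lambda>x. lin scale (\<lambda>y. h x * h y) g) f"
    unfolding lin_mult[OF M f g] using assms f g
    by (intro lin_cong) (auto simp: monoid_algebra_simps subset_iff)
  also have "\<dots> = lin scale h f * lin scale h g"
    by (simp add: lin_def sum_distrib_left sum_distrib_right scale_sum_right)
       (subst sum.swap, simp add: mult.commute)
  finally show "lin scale h (f \<otimes>\<^bsub>monoid_algebra M\<^esub> g) = lin scale h f * lin scale h g" .
qed (use assms in \<open>auto simp: monoid_algebra_simps lin_basis lin_add lin_scale\<close>)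

text \<open>Universal property of a presentation: the kernel of \<open>\<chi>\<close> is an ideal
  containing the relations, so \<open>\<chi>\<close> is constant on cosets and can be read off from
  any representative.\<close>

lemma rhom_quot:
  assumes A: "ralg A" and \<chi>: "rhom A \<chi>" and S: "S \<subseteq> carrier A" "\<And>s. s \<in> S \<Longrightarrow> \<chi> s = 0"
  shows "\<exists>\<chi>'. rhom (quot_alg A (Idl\<^bsub>A\<^esub> S)) \<chi>' \<and> (\<forall>a\<in>carrier A. \<chi>' (Idl\<^bsub>A\<^esub> S +>\<^bsub>A\<^esub> a) = \<chi> a)"
proof -
  interpret ralg A by (rule A)
  interpret ralg_ideal A "Idl\<^bsub>A\<^esub> S"
    by (intro ralg_ideal.intro A genideal_ideal S)
  note z = rhom_zero_minus[OF A \<chi>]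
  have "ideal {a \<in> carrier A. \<chi> a = 0} A"
  proof (rule idealI[OF ring_axioms])
    show "subgroup {a \<in> carrier A. \<chi> a = 0} (add_monoid A)"
      by (rule add.subgroupI) (auto simp: rhomD[OF \<chi>] z(1) z(2) simp flip: a_inv_def intro: exI[of _ "\<zero>\<^bsub>A\<^esub>"])
  qed (auto simp: rhomD[OF \<chi>])
  then have ker: "\<chi> a = 0" if "a \<in> Idl\<^bsub>A\<^esub> S" for a
    using genideal_minimal[of "{a \<in> carrier A. \<chi> a = 0}" S] S that by blast
  define \<chi>' where "\<chi>' C = \<chi> (SOME a. a \<in> carrier A \<and> C = \<pi> a)" for C
  have \<chi>': "\<chi>' (\<pi> a) = \<chi> a" if a: "a \<in> carrier A" for a
  proof -
    define b where "b = (SOME b. b \<in> carrier A \<and> \<pi> a = \<pi> b)"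
    have "b \<in> carrier A \<and> \<pi> a = \<pi> b" unfolding b_def by (rule someI[of _ a]) (use a in simp)
    then have "b \<in> carrier A" "a \<ominus>\<^bsub>A\<^esub> b \<in> Idl\<^bsub>A\<^esub> S" using pi_eq_iff a by auto
    then have "\<chi> a = \<chi> b" using ker z(3)[of a b] a by simp
    then show ?thesis by (simp add: \<chi>'_def b_def)
  qed
  have "rhom Q \<chi>'"
    unfolding rhom_def carrier_Q
    by (auto simp: pi_hom pi_smult \<chi>' rhomD[OF \<chi>] simp flip: pi_one)
  then show ?thesis using \<chi>' by blast
qed

end

section \<open>Quantum planes\<close>

declare One_nat_def [simp del]

lemma free_monoid_simps [simp]:
  "carrier free_monoid = UNIV" "monoid.mult free_monoid = (@)" "\<one>\<^bsub>free_monoid\<^esub> = []"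
  by (simp_all add: free_monoid_def)

lemma monoid_free: "Group.monoid free_monoid"
  by (rule monoidI) auto

lemma ralg_free: "ralg free_algebra"
  unfolding free_algebra_def by (rule ralg_monoid_algebra[OF monoid_free])

abbreviation word :: "plane_gen list \<Rightarrow> plane_gen list \<Rightarrow> 'f::field" where
  "word w \<equiv> basis_elt w"

lemma word_carrier [simp]: "word w \<in> carrier free_algebra"
  unfolding free_algebra_def by (simp add: basis_carrier)

lemma free_algebra_simps:
  "f \<oplus>\<^bsub>free_algebra\<^esub> g = f + g" "c \<odot>\<^bsub>free_algebra\<^esub> f = fscale c f" "\<one>\<^bsub>free_algebra\<^esub> = word []"
  by (simp_all add: free_algebra_def monoid_algebra_simps)

lemma word_scale_carrier [simp]: "fscale c (word w) \<in> carrier free_algebra"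
  using ralg.smult_closed[OF ralg_free word_carrier] by (simp add: free_algebra_simps)

lemma word_mult: "word v \<otimes>\<^bsub>free_algebra\<^esub> word w = word (v @ w)"
  unfolding free_algebra_def using basis_mult[OF monoid_free] by simp

lemma word_mult_scale: "word v \<otimes>\<^bsub>free_algebra\<^esub> fscale c (word w) = fscale c (word (v @ w))"
  using mult_eq_lin[of "word v" free_monoid "fscale c (word w)"] word_carrier[of v] word_scale_carrier[of c w]
  unfolding free_algebra_def by (simp add: fs.lin_basis fs.lin_scale)

abbreviation plane_rel :: "'f::field \<Rightarrow> plane_gen list \<Rightarrow> 'f" where
  "plane_rel t \<equiv> word [Gy, Gx] \<ominus>\<^bsub>free_algebra\<^esub> (t \<odot>\<^bsub>free_algebra\<^esub> word [Gx, Gy])"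

lemma plane_rel_carrier: "plane_rel t \<in> carrier free_algebra"
proof -
  interpret ralg free_algebra by (rule ralg_free)
  show ?thesis by simp
qed

lemma ralg_ideal_plane: "ralg_ideal free_algebra (plane_ideal t)"
  unfolding plane_ideal_def
  by (intro ralg_ideal.intro ralg_free ring.genideal_ideal ralg.axioms(1)) (use plane_rel_carrier in auto)

definition plane_mon :: "'f::field \<Rightarrow> nat \<times> nat \<Rightarrow> 'f plane" where
  "plane_mon t e = plane_ideal t +>\<^bsub>free_algebra\<^esub> word (replicate (fst e) Gx @ replicate (snd e) Gy)"

lemma plane_elt_eq: "plane_elt t Gx = plane_mon t (1, 0)" "plane_elt t Gy = plane_mon t (0, 1)"
  by (simp_all add: plane_elt_def plane_mon_def One_nat_def)

context
  fixes t :: "'f::field"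
begin

interpretation P: ralg_ideal free_algebra "plane_ideal t" by (rule ralg_ideal_plane)

lemma ralg_plane: "ralg (quantum_plane t)"
  unfolding quantum_plane_def by (rule P.ralg_Q)

lemma plane_mon_carrier [simp]: "plane_mon t e \<in> carrier (quantum_plane t)"
  unfolding plane_mon_def quantum_plane_def by simp

lemma plane_mon_0: "plane_mon t (0, 0) = \<one>\<^bsub>quantum_plane t\<^esub>"
  unfolding plane_mon_def quantum_plane_def by (simp add: free_algebra_simps flip: P.pi_one)

lemma plane_mon_Suc:
  "plane_mon t (Suc k, l) = plane_mon t (1, 0) \<otimes>\<^bsub>quantum_plane t\<^esub> plane_mon t (k, l)"
  "plane_mon t (0, Suc l) = plane_mon t (0, 1) \<otimes>\<^bsub>quantum_plane t\<^esub> plane_mon t (0, l)"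
  unfolding plane_mon_def quantum_plane_def by (simp_all add: P.pi_hom word_mult One_nat_def)

lemma pi_mult_cong: "P.\<pi> f = P.\<pi> g \<Longrightarrow> f \<in> carrier free_algebra \<Longrightarrow> g \<in> carrier free_algebra \<Longrightarrow>
    P.\<pi> (word w \<otimes>\<^bsub>free_algebra\<^esub> f) = P.\<pi> (word w \<otimes>\<^bsub>free_algebra\<^esub> g)"
  by (simp flip: P.pi_hom(2))

lemma pi_yx: "P.\<pi> (word (Gy # Gx # w)) = P.\<pi> (fscale t (word (Gx # Gy # w)))"
proof -
  have "plane_rel t \<in> plane_ideal t"
    unfolding plane_ideal_def by (rule P.genideal_self') (rule plane_rel_carrier)
  then have "P.\<pi> (word [Gy, Gx]) = P.\<pi> (t \<odot>\<^bsub>free_algebra\<^esub> word [Gx, Gy])"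
    by (subst P.pi_eq_iff) auto
  then have "P.\<pi> (word [Gy, Gx]) \<otimes>\<^bsub>P.Q\<^esub> P.\<pi> (word w) = (t \<odot>\<^bsub>P.Q\<^esub> P.\<pi> (word [Gx, Gy])) \<otimes>\<^bsub>P.Q\<^esub> P.\<pi> (word w)"
    by (simp add: P.pi_smult)
  also have "\<dots> = t \<odot>\<^bsub>P.Q\<^esub> (P.\<pi> (word [Gx, Gy]) \<otimes>\<^bsub>P.Q\<^esub> P.\<pi> (word w))"
  proof -
    interpret Q: ralg P.Q by (rule P.ralg_Q)
    have c: "P.\<pi> (word v) \<in> carrier P.Q" for v by simp
    show ?thesis using Q.smult_eq[OF c[of "[Gx, Gy]"]] Q.smult_eq[OF Q.m_closed[OF c[of "[Gx, Gy]"] c[of w]]] c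
      by (simp add: Q.m_assoc)
  qed
  finally show ?thesis by (simp add: P.pi_hom word_mult P.pi_smult free_algebra_simps)
qed

lemma pi_yx_power: "P.\<pi> (word (Gy # replicate k Gx @ w)) = P.\<pi> (fscale (t ^ k) (word (replicate k Gx @ Gy # w)))"
proof (induction k)
  case (Suc k)
  have "P.\<pi> (word (Gy # replicate (Suc k) Gx @ w)) = t \<odot>\<^bsub>P.Q\<^esub> P.\<pi> (word ([Gx] @ (Gy # replicate k Gx @ w)))"
    by (simp add: pi_yx P.pi_smult free_algebra_simps)
  also have "P.\<pi> (word ([Gx] @ (Gy # replicate k Gx @ w)))
      = P.\<pi> (word [Gx] \<otimes>\<^bsub>free_algebra\<^esub> fscale (t ^ k) (word (replicate k Gx @ Gy # w)))"
    unfolding word_mult[of "[Gx]", symmetric] by (rule pi_mult_cong[OF Suc]) auto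
  also have "t \<odot>\<^bsub>P.Q\<^esub> \<dots> = P.\<pi> (fscale t (fscale (t ^ k) (word ([Gx] @ replicate k Gx @ Gy # w))))"
    by (simp only: word_mult_scale P.pi_smult[OF word_scale_carrier] free_algebra_simps)
  also have "fscale t (fscale (t ^ k) (word ([Gx] @ replicate k Gx @ Gy # w)))
      = fscale (t ^ Suc k) (word (replicate (Suc k) Gx @ Gy # w))"
    by (simp add: fun_eq_iff)
  finally show ?case .
qed (simp add: fun_eq_iff)

text \<open>Normal ordering: moving each letter \<open>Gy\<close> to the right past the letters
  \<open>Gx\<close> costs only scalars. Independence of the ordered monomials is not proved here; it
  will come from the representation by operators.\<close>

lemma plane_span [consumes 1, case_names add scale mon]:
  assumes C: "C \<in> carrier (quantum_plane t)"
    and add: "\<And>C D. C \<in> carrier (quantum_plane t) \<Longrightarrow> D \<in> carrier (quantum_plane t) \<Longrightarrow> P C \<Longrightarrow> P D \<Longrightarrow> P (C \<oplus>\<^bsub>quantum_plane t\<^esub> D)"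
    and scale: "\<And>c C. C \<in> carrier (quantum_plane t) \<Longrightarrow> P C \<Longrightarrow> P (c \<odot>\<^bsub>quantum_plane t\<^esub> C)"
    and mon: "\<And>e. P (plane_mon t e)"
  shows "P C"
proof -
  have monc: "P (P.\<pi> (fscale c (word (replicate k Gx @ replicate l Gy))))" for c k l
    using scale[OF plane_mon_carrier mon, of c "(k, l)"]
    unfolding plane_mon_def quantum_plane_def by (simp add: P.pi_smult free_algebra_simps)
  have word: "\<exists>c k l. P.\<pi> (word w) = P.\<pi> (fscale c (word (replicate k Gx @ replicate l Gy)))" for w
  proof (induction w)
    case Nil
    show ?case by (rule exI[of _ 1], rule exI[of _ 0], rule exI[of _ 0]) simp
  next
    case (Cons g w)
    then obtain c k l where ckl: "P.\<pi> (word w) = P.\<pi> (fscale c (word (replicate k Gx @ replicate l Gy)))" by blast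
    have eq: "P.\<pi> (word (g # w)) = P.\<pi> (fscale c (word (g # replicate k Gx @ replicate l Gy)))"
      using pi_mult_cong[OF ckl, of "[g]"] by (simp add: word_mult word_mult_scale)
    show ?case
    proof (cases g)
      case Gx
      then show ?thesis using eq by (intro exI[of _ c] exI[of _ "Suc k"] exI[of _ l]) simp
    next
      case Gy
      have "P.\<pi> (word (g # w)) = c \<odot>\<^bsub>P.Q\<^esub> P.\<pi> (word (Gy # replicate k Gx @ replicate l Gy))"
        using eq by (simp add: Gy P.pi_smult free_algebra_simps)
      also have "\<dots> = P.\<pi> (fscale (c * t ^ k) (word (replicate k Gx @ replicate (Suc l) Gy)))"
      proof -
        have "fscale c (fscale (t ^ k) (word (replicate k Gx @ Gy # replicate l Gy)))
            = fscale (c * t ^ k) (word (replicate k Gx @ replicate (Suc l) Gy))" by (simp add: fun_eq_iff)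
        then show ?thesis
          by (simp only: pi_yx_power P.pi_smult[OF word_scale_carrier] free_algebra_simps(2))
      qed
      finally show ?thesis by (rule exI[of _ "c * t ^ k", OF exI[of _ k, OF exI[of _ "Suc l"]]])
    qed
  qed
  obtain f where f: "f \<in> carrier free_algebra" "C = P.\<pi> f"
    using C by (auto simp: quantum_plane_def P.carrier_Q)
  have "P (P.\<pi> f)"
    using f(1) unfolding free_algebra_def
  proof (induction rule: monoid_algebra_induct)
    case (basis w)
    then show ?case using word[of w] monc unfolding free_algebra_def by metis
  next
    case (add f g)
    then have fg: "f \<in> carrier free_algebra" "g \<in> carrier free_algebra" "P (P.\<pi> f)" "P (P.\<pi> g)"
      by (simp_all only: free_algebra_def)
    have "P (P.\<pi> f \<oplus>\<^bsub>quantum_plane t\<^esub> P.\<pi> g)"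
      by (rule assms(2)) (use fg in \<open>simp_all add: quantum_plane_def\<close>)
    then show ?case
      by (simp only: quantum_plane_def P.pi_hom(1)[OF fg(1,2)] free_algebra_simps(1)) (simp only: free_algebra_def)
  next
    case (scale c f)
    then have f: "f \<in> carrier free_algebra" "P (P.\<pi> f)" by (simp_all only: free_algebra_def)
    have "P (c \<odot>\<^bsub>quantum_plane t\<^esub> P.\<pi> f)"
      by (rule assms(3)) (use f in \<open>simp_all add: quantum_plane_def\<close>)
    then show ?case
      by (simp only: quantum_plane_def P.pi_smult[OF f(1)] free_algebra_simps(2)) (simp only: free_algebra_def)
  next
    case zero
    have "fscale 0 (word []) = 0" by (simp add: fun_eq_iff)
    then show ?case using monc[of 0 0 0] unfolding free_algebra_def by simp
  qed
  then show ?thesis using f by simp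
qed

end

context assoc_algebra
begin

lemma plane_hom:
  assumes "b * a = t *s (a * b)"
  shows "\<exists>\<chi>. rhom (quantum_plane t) \<chi> \<and> (\<forall>e. \<chi> (plane_mon t e) = a ^ fst e * b ^ snd e)"
proof -
  define h where "h w = prod_list (map (\<lambda>g. case g of Gx \<Rightarrow> a | Gy \<Rightarrow> b) w)" for w
  have h: "rhom free_algebra (lin scale h)"
    unfolding free_algebra_def by (rule rhom_lin[OF monoid_free]) (auto simp: h_def)
  have "lin scale h (plane_rel t) = 0"
    by (subst rhom_zero_minus(3)[OF ralg_free h])
       (simp_all add: ralg.smult_closed[OF ralg_free] rhomD(4)[OF h] lin_basis h_def assms)
  then obtain \<chi> where \<chi>: "rhom (quantum_plane t) \<chi>"
    "\<And>f. f \<in> carrier free_algebra \<Longrightarrow> \<chi> (plane_ideal t +>\<^bsub>free_algebra\<^esub> f) = lin scale h f"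
    using rhom_quot[OF ralg_free h, of "{plane_rel t}"] plane_rel_carrier
    unfolding quantum_plane_def plane_ideal_def by auto
  have pow: "prod_list (replicate k x) = x ^ k" for k and x :: 'r
    by (induction k) auto
  have "\<chi> (plane_mon t e) = a ^ fst e * b ^ snd e" for e
    unfolding plane_mon_def by (simp add: \<chi>(2) lin_basis h_def pow)
  then show ?thesis using \<chi>(1) by blast
qed

end

section \<open>Tensor products of quantum planes\<close>

lemma monoid_product_group:
  assumes "\<And>i. i \<in> I \<Longrightarrow> Group.monoid (A i)"
  shows "Group.monoid (product_group I A)"
  using assms
  by (intro monoidI) (auto simp: monoid.m_closed monoid.m_assoc monoid.one_closed monoid.l_one monoid.r_one
      intro!: restrict_ext PiE_ext[of _ I _ _] simp: PiE_iff extensional_def fun_eq_iff)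

lemma monoid_ralg: "ralg A \<Longrightarrow> Group.monoid A"
  by (simp add: ralg_def ring_def)

context
  fixes n :: nat and t :: "nat \<Rightarrow> 'f::field"
begin

abbreviation "PG \<equiv> product_group {1..n} (\<lambda>i. quantum_plane (t i))"
abbreviation "TI \<equiv> tensor_ideal {1..n} (\<lambda>i. quantum_plane (t i))"
abbreviation "TA \<equiv> tensor_alg {1..n} (\<lambda>i. quantum_plane (t i))"

definition tclass :: "(nat \<Rightarrow> 'f plane) \<Rightarrow> ((nat \<Rightarrow> 'f plane) \<Rightarrow> 'f) set" where
  "tclass v = TI +>\<^bsub>monoid_algebra PG\<^esub> basis_elt v"

definition tmon :: "(nat \<Rightarrow> nat \<times> nat) \<Rightarrow> ((nat \<Rightarrow> 'f plane) \<Rightarrow> 'f) set" where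
  "tmon \<mu> = tclass (\<lambda>i\<in>{1..n}. plane_mon (t i) (\<mu> i))"

lemma monoid_PG: "Group.monoid PG"
  by (intro monoid_product_group monoid_ralg ralg_plane)

lemma ralg_PG: "ralg (monoid_algebra PG :: ('f, _) module)"
  by (rule ralg_monoid_algebra[OF monoid_PG])

lemma rels_carrier: "multilinear_rels {1..n} (\<lambda>i. quantum_plane (t i)) \<subseteq> carrier (monoid_algebra PG)"
proof -
  interpret MA: ralg "monoid_algebra PG :: ('f, _) module" by (rule ralg_PG)
  have up: "v(i := x) \<in> carrier PG" if "v \<in> carrier PG" "i \<in> {1..n}" "x \<in> carrier (quantum_plane (t i))" for v i x
    using that by (auto simp: PiE_iff extensional_def)
  have closed: "a \<oplus>\<^bsub>quantum_plane s\<^esub> b \<in> carrier (quantum_plane s)" "c \<odot>\<^bsub>quantum_plane s\<^esub> a \<in> carrier (quantum_plane s)"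
    if "a \<in> carrier (quantum_plane s)" "b \<in> carrier (quantum_plane s)" for a b c and s :: 'f
  proof -
    interpret ralg "quantum_plane s" by (rule ralg_plane)
    show "a \<oplus>\<^bsub>quantum_plane s\<^esub> b \<in> carrier (quantum_plane s)" "c \<odot>\<^bsub>quantum_plane s\<^esub> a \<in> carrier (quantum_plane s)"
      using that by auto
  qed
  show ?thesis
    unfolding multilinear_rels_def Let_def
    by (safe; intro MA.minus_closed MA.a_closed MA.smult_closed basis_carrier up)
       (auto intro: closed simp del: carrier_product_group simp flip: carrier_product_group[of "{1..n}" "\<lambda>i. quantum_plane (t i)"])
qed

lemma ralg_ideal_TI: "ralg_ideal (monoid_algebra PG) TI"
  unfolding tensor_ideal_def
  by (intro ralg_ideal.intro ralg_PG ring.genideal_ideal ralg.axioms(1) rels_carrier)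

interpretation T: ralg_ideal "monoid_algebra PG" TI by (rule ralg_ideal_TI)

lemma TA_eq: "TA = T.Q"
  by (simp add: tensor_alg_def)

lemma ralg_TA: "ralg TA"
  unfolding TA_eq by (rule T.ralg_Q)

lemma tclass_carrier: "v \<in> carrier PG \<Longrightarrow> tclass v \<in> carrier TA"
  unfolding TA_eq tclass_def by (intro T.pi_carrier basis_carrier)

lemma plane_mon_PG: "(\<lambda>i\<in>{1..n}. plane_mon (t i) (\<mu> i)) \<in> carrier PG"
  by auto

lemma tmon_carrier: "tmon \<mu> \<in> carrier TA"
  unfolding tmon_def by (intro tclass_carrier plane_mon_PG)

lemma tclass_mult:
  "v \<in> carrier PG \<Longrightarrow> w \<in> carrier PG \<Longrightarrow> tclass v \<otimes>\<^bsub>TA\<^esub> tclass w = tclass (v \<otimes>\<^bsub>PG\<^esub> w)"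
  unfolding TA_eq tclass_def by (simp add: T.pi_hom basis_carrier basis_mult[OF monoid_PG] del: carrier_product_group mult_product_group)

lemma tmon_one: "tmon (\<lambda>_. (0, 0)) = \<one>\<^bsub>TA\<^esub>"
  unfolding TA_eq T.pi_one[symmetric] tmon_def tclass_def
  by (simp add: plane_mon_0 monoid_algebra_simps)

lemma PG_upd: "v \<in> carrier PG \<Longrightarrow> i \<in> {1..n} \<Longrightarrow> x \<in> carrier (quantum_plane (t i)) \<Longrightarrow> v(i := x) \<in> carrier PG"
  by (auto simp: PiE_iff extensional_def)

lemma tclass_add:
  assumes "v \<in> carrier PG" "i \<in> {1..n}" "a \<in> carrier (quantum_plane (t i))" "b \<in> carrier (quantum_plane (t i))"
  shows "tclass (v(i := a \<oplus>\<^bsub>quantum_plane (t i)\<^esub> b)) = tclass (v(i := a)) \<oplus>\<^bsub>TA\<^esub> tclass (v(i := b))"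
proof -
  interpret Pi: ralg "quantum_plane (t i)" by (rule ralg_plane)
  have "basis_elt (v(i := a \<oplus>\<^bsub>quantum_plane (t i)\<^esub> b)) \<ominus>\<^bsub>monoid_algebra PG\<^esub>
      (basis_elt (v(i := a)) \<oplus>\<^bsub>monoid_algebra PG\<^esub> basis_elt (v(i := b))) \<in> multilinear_rels {1..n} (\<lambda>i. quantum_plane (t i))" (is "?r \<in> _")
    unfolding multilinear_rels_def Let_def using assms by auto
  then have "?r \<in> TI" unfolding tensor_ideal_def using T.genideal_self[OF rels_carrier] by blast
  moreover have c: "basis_elt (v(i := x)) \<in> carrier (monoid_algebra PG)" if "x \<in> carrier (quantum_plane (t i))" for x
    by (intro basis_carrier PG_upd assms(1,2) that)
  ultimately have "T.\<pi> (basis_elt (v(i := a \<oplus>\<^bsub>quantum_plane (t i)\<^esub> b)))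
      = T.\<pi> (basis_elt (v(i := a)) \<oplus>\<^bsub>monoid_algebra PG\<^esub> basis_elt (v(i := b)))"
    using assms(3,4) by (intro T.pi_eq_iff[THEN iffD2] T.add.m_closed c Pi.a_closed)
  then show ?thesis unfolding TA_eq tclass_def by (simp only: T.pi_hom[OF c[OF assms(3)] c[OF assms(4)]])
qed

lemma tclass_smult:
  assumes "v \<in> carrier PG" "i \<in> {1..n}" "a \<in> carrier (quantum_plane (t i))"
  shows "tclass (v(i := c \<odot>\<^bsub>quantum_plane (t i)\<^esub> a)) = c \<odot>\<^bsub>TA\<^esub> tclass (v(i := a))"
proof -
  interpret Pi: ralg "quantum_plane (t i)" by (rule ralg_plane)
  have "basis_elt (v(i := c \<odot>\<^bsub>quantum_plane (t i)\<^esub> a)) \<ominus>\<^bsub>monoid_algebra PG\<^esub>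
      (c \<odot>\<^bsub>monoid_algebra PG\<^esub> basis_elt (v(i := a))) \<in> multilinear_rels {1..n} (\<lambda>i. quantum_plane (t i))" (is "?r \<in> _")
    unfolding multilinear_rels_def Let_def
    by (rule UnI2, rule CollectI, rule exI[of _ v], rule exI[of _ i], rule exI[of _ a], rule exI[of _ c])
       (use assms in auto)
  then have "?r \<in> TI" unfolding tensor_ideal_def using T.genideal_self[OF rels_carrier] by blast
  moreover have c: "basis_elt (v(i := x)) \<in> carrier (monoid_algebra PG)" if "x \<in> carrier (quantum_plane (t i))" for x
    by (intro basis_carrier PG_upd assms(1,2) that)
  ultimately have "T.\<pi> (basis_elt (v(i := c \<odot>\<^bsub>quantum_plane (t i)\<^esub> a)))
      = T.\<pi> (c \<odot>\<^bsub>monoid_algebra PG\<^esub> basis_elt (v(i := a)))"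
    using assms(3) by (intro T.pi_eq_iff[THEN iffD2] T.smult_closed c Pi.smult_closed)
  then show ?thesis unfolding TA_eq tclass_def by (simp only: T.pi_smult[OF c[OF assms(3)]])
qed

lemma tensor_span [consumes 1, case_names add scale mon]:
  assumes C: "C \<in> carrier TA"
    and add: "\<And>C D. C \<in> carrier TA \<Longrightarrow> D \<in> carrier TA \<Longrightarrow> P C \<Longrightarrow> P D \<Longrightarrow> P (C \<oplus>\<^bsub>TA\<^esub> D)"
    and scale: "\<And>c C. C \<in> carrier TA \<Longrightarrow> P C \<Longrightarrow> P (c \<odot>\<^bsub>TA\<^esub> C)"
    and mon: "\<And>\<mu>. P (tmon \<mu>)"
  shows "P C"
proof -
  \<comment> \<open>Induction on the number \<open>k\<close> of leading entries that may be
    arbitrary; the entries after them are monomials already, and multilinearity expands one more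
    entry at a time.\<close>
  have pure: "P (tclass v)" if "k \<le> n" "v \<in> carrier PG" "\<forall>i\<in>{k<..n}. \<exists>e. v i = plane_mon (t i) e" for k v
    using that
  proof (induction k arbitrary: v)
    case 0
    then obtain \<mu> where "\<forall>i\<in>{0<..n}. v i = plane_mon (t i) (\<mu> i)" by metis
    then have "v = (\<lambda>i\<in>{1..n}. plane_mon (t i) (\<mu> i))"
      using 0(2) by (auto simp: PiE_iff extensional_def fun_eq_iff)
    then have "tclass v = tmon \<mu>" by (simp only: tmon_def)
    then show ?case using mon by (simp only:)
  next
    case (Suc k)
    have i: "Suc k \<in> {1..n}" using Suc by auto
    then have "v (Suc k) \<in> carrier (quantum_plane (t (Suc k)))" using Suc.prems by auto
    then have "P (tclass (v(Suc k := v (Suc k))))"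
    proof (induction rule: plane_span)
      case (add C D)
      then show ?case using tclass_add[OF Suc.prems(2) i] PG_upd[OF Suc.prems(2) i] tclass_carrier assms(2) by metis
    next
      case (scale c C)
      then show ?case using tclass_smult[OF Suc.prems(2) i] PG_upd[OF Suc.prems(2) i] tclass_carrier assms(3) by metis
    next
      case (mon e)
      have "\<forall>j\<in>{k<..n}. \<exists>e'. (v(Suc k := plane_mon (t (Suc k)) e)) j = plane_mon (t j) e'"
      proof
        fix j assume j: "j \<in> {k<..n}"
        show "\<exists>e'. (v(Suc k := plane_mon (t (Suc k)) e)) j = plane_mon (t j) e'"
          using Suc.prems(3) j by (cases "j = Suc k") (auto simp del: split_paired_Ex)
      qed
      moreover have "k \<le> n" using Suc.prems(1) by simp
      ultimately show ?case by (intro Suc.IH PG_upd[OF Suc.prems(2) i plane_mon_carrier])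
    qed
    then show ?case by simp
  qed
  obtain f where f: "f \<in> carrier (monoid_algebra PG)" "C = T.\<pi> f"
    using C unfolding TA_eq T.carrier_Q by blast
  have "P (T.\<pi> f)"
    using f(1)
  proof (induction rule: monoid_algebra_induct)
    case (basis v)
    then show ?case using pure[of n v] by (simp add: tclass_def)
  next
    case (add f g)
    have "P (T.\<pi> f \<oplus>\<^bsub>TA\<^esub> T.\<pi> g)"
      by (rule assms(2)) (use add in \<open>simp_all add: TA_eq\<close>)
    then show ?case by (simp only: TA_eq T.pi_hom(1)[OF add(1,2)] monoid_algebra_simps(2))
  next
    case (scale c f)
    have "P (c \<odot>\<^bsub>TA\<^esub> T.\<pi> f)"
      by (rule assms(3)) (use scale in \<open>simp_all add: TA_eq\<close>)
    then show ?case by (simp only: TA_eq T.pi_smult[OF scale(1)] monoid_algebra_simps(3))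
  next
    case zero
    have "T.\<pi> (0 \<odot>\<^bsub>monoid_algebra PG\<^esub> basis_elt (\<lambda>i\<in>{1..n}. plane_mon (t i) (0, 0))) = 0 \<odot>\<^bsub>TA\<^esub> tmon (\<lambda>_. (0, 0))"
      unfolding TA_eq tmon_def tclass_def by (rule T.pi_smult[symmetric]) (intro basis_carrier plane_mon_PG)
    moreover have "0 \<odot>\<^bsub>monoid_algebra PG\<^esub> basis_elt (\<lambda>i\<in>{1..n}. plane_mon (t i) (0, 0)) = (0 :: _ \<Rightarrow> 'f)"
      by (simp add: monoid_algebra_simps fun_eq_iff)
    ultimately show ?case using assms(3)[OF tmon_carrier mon, of 0 "\<lambda>_. (0, 0)"] by (simp only:)
  qed
  then show ?thesis using f by simp
qed

definition gen :: "plane_gen \<Rightarrow> nat \<Rightarrow> ((nat \<Rightarrow> 'f plane) \<Rightarrow> 'f) set" where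
  "gen v i = factor_incl {1..n} (\<lambda>i. quantum_plane (t i)) i (plane_elt (t i) v)"

lemma gen_eq:
  "gen Gx i = tmon (\<lambda>j. if j = i then (1, 0) else (0, 0))"
  "gen Gy i = tmon (\<lambda>j. if j = i then (0, 1) else (0, 0))"
  unfolding gen_def factor_incl_def pure_tensor_def tmon_def tclass_def plane_elt_eq
  by (intro arg_cong[where f = "\<lambda>v. TI +>\<^bsub>monoid_algebra PG\<^esub> basis_elt v"] restrict_ext; simp add: plane_mon_0)+

lemma gen_carrier: "gen v i \<in> carrier TA"
  by (cases v) (simp_all add: gen_eq tmon_carrier)

lemma tmon_cong: "(\<And>i. i \<in> {1..n} \<Longrightarrow> \<mu> i = \<nu> i) \<Longrightarrow> tmon \<mu> = tmon \<nu>"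
  unfolding tmon_def by (intro arg_cong[where f = tclass] restrict_ext) simp

lemma tmon_mult:
  assumes "\<And>i. i \<in> {1..n} \<Longrightarrow> plane_mon (t i) (\<mu> i) \<otimes>\<^bsub>quantum_plane (t i)\<^esub> plane_mon (t i) (\<nu> i) = plane_mon (t i) (\<kappa> i)"
  shows "tmon \<mu> \<otimes>\<^bsub>TA\<^esub> tmon \<nu> = tmon \<kappa>"
  unfolding tmon_def tclass_mult[OF plane_mon_PG plane_mon_PG]
  using assms by (intro arg_cong[where f = tclass]) (auto simp: fun_eq_iff)

lemma one_mult_plane: "\<one>\<^bsub>quantum_plane s\<^esub> \<otimes>\<^bsub>quantum_plane s\<^esub> plane_mon s e = plane_mon s (e :: nat \<times> nat)"
proof -
  interpret ralg "quantum_plane s" by (rule ralg_plane)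
  show ?thesis by simp
qed

text \<open>Builds a monomial from the generators by left multiplications without any scalar, so
  that homomorphisms can be compared on generators.\<close>

lemma tmon_induct [case_names one x y]:
  assumes "P (tmon (\<lambda>_. (0, 0)))"
    and "\<And>i \<mu>. i \<in> {1..n} \<Longrightarrow> P (tmon \<mu>) \<Longrightarrow> P (gen Gx i \<otimes>\<^bsub>TA\<^esub> tmon \<mu>)"
    and "\<And>i \<mu>. i \<in> {1..n} \<Longrightarrow> P (tmon \<mu>) \<Longrightarrow> P (gen Gy i \<otimes>\<^bsub>TA\<^esub> tmon \<mu>)"
  shows "P (tmon \<mu>)"
proof (induction "\<Sum>i\<in>{1..n}. fst (\<mu> i) + snd (\<mu> i)" arbitrary: \<mu> rule: less_induct)
  case less
  \<comment> \<open>In each factor the powers of \<open>x\<close> stand to the left of those of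
    \<open>y\<close>; so a \<open>y\<close> is split off on the left only when no \<open>x\<close>
    is left.\<close>
  consider i where "i \<in> {1..n}" "fst (\<mu> i) > 0" | i where "i \<in> {1..n}" "snd (\<mu> i) > 0" "\<forall>i\<in>{1..n}. fst (\<mu> i) = 0"
    | "\<forall>i\<in>{1..n}. \<mu> i = (0, 0)"
    by (metis neq0_conv prod.collapse)
  then show ?case
  proof cases
    case 1
    define \<nu> where "\<nu> = \<mu>(i := (fst (\<mu> i) - 1, snd (\<mu> i)))"
    have "(\<Sum>i\<in>{1..n}. fst (\<nu> i) + snd (\<nu> i)) < (\<Sum>i\<in>{1..n}. fst (\<mu> i) + snd (\<mu> i))"
      by (rule sum_strict_mono_ex1) (use 1 in \<open>auto simp: \<nu>_def\<close>)
    then have "P (gen Gx i \<otimes>\<^bsub>TA\<^esub> tmon \<nu>)" using less assms(2) 1 by blast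
    moreover have "gen Gx i \<otimes>\<^bsub>TA\<^esub> tmon \<nu> = tmon \<mu>"
      unfolding gen_eq using 1 plane_mon_Suc(1)[of "t i" "fst (\<mu> i) - 1" "snd (\<mu> i)"]
      by (intro tmon_mult) (auto simp: \<nu>_def plane_mon_0 one_mult_plane)
    ultimately show ?thesis by simp
  next
    case 2
    define \<nu> where "\<nu> = \<mu>(i := (0, snd (\<mu> i) - 1))"
    have "(\<Sum>i\<in>{1..n}. fst (\<nu> i) + snd (\<nu> i)) < (\<Sum>i\<in>{1..n}. fst (\<mu> i) + snd (\<mu> i))"
      by (rule sum_strict_mono_ex1) (use 2 in \<open>auto simp: \<nu>_def\<close>)
    then have "P (gen Gy i \<otimes>\<^bsub>TA\<^esub> tmon \<nu>)" using less assms(3) 2 by blast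
    moreover have "\<mu> i = (0, Suc (snd (\<mu> i) - 1))" using 2 by (intro prod_eqI) auto
    then have "gen Gy i \<otimes>\<^bsub>TA\<^esub> tmon \<nu> = tmon \<mu>"
      unfolding gen_eq using 2 plane_mon_Suc(2)[of "t i" "snd (\<mu> i) - 1"]
      by (intro tmon_mult) (auto simp: \<nu>_def plane_mon_0 one_mult_plane)
    ultimately show ?thesis by simp
  next
    case 3
    then have "tmon \<mu> = tmon (\<lambda>_. (0, 0))" by (intro tmon_cong) auto
    then show ?thesis using assms(1) by simp
  qed
qed

end

context assoc_algebra
begin

lemma tensor_hom_unique:
  assumes \<chi>: "rhom (TA n t) \<chi>" and \<chi>': "rhom (TA n t) \<chi>'"
    and gen: "\<And>i v. i \<in> {1..n} \<Longrightarrow> \<chi> (gen n t v i) = \<chi>' (gen n t v i)"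
    and C: "C \<in> carrier (TA n t)"
  shows "\<chi> C = \<chi>' C"
  using C
proof (induction rule: tensor_span)
  case (mon \<mu>)
  show ?case
  proof (induction rule: tmon_induct)
    case one
    then show ?case by (simp add: tmon_one rhomD(1)[OF \<chi>] rhomD(1)[OF \<chi>'])
  qed (simp_all add: rhomD(3)[OF \<chi>] rhomD(3)[OF \<chi>'] gen gen_carrier tmon_carrier)
qed (simp_all add: rhomD[OF \<chi>] rhomD[OF \<chi>'])

text \<open>The ordered product depends on its \<open>i\<close>-th entry only through
  \<open>l * _ * r\<close>, and hence is linear in it.\<close>

lemma prod_list_upd:
  assumes "distinct xs" "i \<in> set xs"
  shows "\<exists>l r. \<forall>x. prod_list (map (\<lambda>j. \<chi> j ((v(i := x)) j)) xs) = l * \<chi> i x * (r :: 'r)"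
proof -
  obtain ys zs where xs: "xs = ys @ i # zs" using assms(2) by (auto simp: in_set_conv_decomp)
  then have "i \<notin> set ys" "i \<notin> set zs" using assms(1) by auto
  then have "map (\<lambda>j. \<chi> j ((v(i := x)) j)) ys = map (\<lambda>j. \<chi> j (v j)) ys"
    "map (\<lambda>j. \<chi> j ((v(i := x)) j)) zs = map (\<lambda>j. \<chi> j (v j)) zs" for x
    by (auto intro!: map_cong)
  then show ?thesis
    by (simp only: xs map_append prod_list.append list.map(2) prod_list.Cons fun_upd_same flip: mult.assoc) blast
qed

end

context qfamily
begin

text \<open>The homomorphisms on the single factors have commuting images because the generators
  commute; so their ordered product is multiplicative on tuples, and it respects the multilinearity
  relations.\<close>

lemma tensor_hom: "\<exists>\<psi>. rhom (TA n t) \<psi> \<and> (\<forall>\<mu>. \<psi> (tmon n t \<mu>) = mon \<mu>)"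
proof -
  have "\<forall>i\<in>{1..n}. \<exists>\<chi>. rhom (quantum_plane (t i)) \<chi> \<and> (\<forall>e. \<chi> (plane_mon (t i) e) = blk i e)"
    using plane_hom b_a unfolding blk_def by blast
  then obtain \<chi> where \<chi>: "\<And>i. i \<in> {1..n} \<Longrightarrow> rhom (quantum_plane (t i)) (\<chi> i)"
    "\<And>i e. i \<in> {1..n} \<Longrightarrow> \<chi> i (plane_mon (t i) e) = blk i e"
    by metis
  have comm: "\<chi> i x * \<chi> j y = \<chi> j y * \<chi> i x"
    if ij: "i \<in> {1..n}" "j \<in> {1..n}" "i \<noteq> j" and "x \<in> carrier (quantum_plane (t i))" "y \<in> carrier (quantum_plane (t j))" for i j x y
    using that(4)
  proof (induction rule: plane_span)
    case (mon e)
    from that(5) show ?case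
    proof (induction rule: plane_span)
      case (mon e')
      then show ?case using \<chi>(2) blk_comm ij by simp
    qed (simp_all add: rhomD[OF \<chi>(1)[OF ij(2)]] distrib_left distrib_right)
  qed (simp_all add: rhomD[OF \<chi>(1)[OF ij(1)]] that(5) distrib_left distrib_right)
  define h where "h v = prod_list (map (\<lambda>i. \<chi> i (v i)) [1..<Suc n])" for v
  have h_rhom: "rhom (monoid_algebra (PG n t)) (lin scale h)"
  proof (rule rhom_lin[OF monoid_PG])
    have "map (\<lambda>i. \<chi> i (\<one>\<^bsub>PG n t\<^esub> i)) [1..<Suc n] = map (\<lambda>_. 1) [1..<Suc n]"
      using \<chi>(1) by (intro map_cong) (auto simp: rhomD(1))
    then show "h \<one>\<^bsub>PG n t\<^esub> = 1" unfolding h_def by (simp only:) (induction n, auto)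
    fix v w assume vw: "v \<in> carrier (PG n t)" "w \<in> carrier (PG n t)"
    have "h v * h w = prod_list (map (\<lambda>i. \<chi> i (v i) * \<chi> i (w i)) [1..<Suc n])"
      unfolding h_def using vw by (intro prod_list_mult_comm comm) (auto simp: PiE_iff)
    also have "\<dots> = h (v \<otimes>\<^bsub>PG n t\<^esub> w)"
      unfolding h_def using vw \<chi>(1)
      by (intro arg_cong[where f = prod_list] map_cong) (auto simp: rhomD(3) PiE_iff)
    finally show "h (v \<otimes>\<^bsub>PG n t\<^esub> w) = h v * h w" by simp
  qed
  have upd: "h (v(i := x \<oplus>\<^bsub>quantum_plane (t i)\<^esub> y)) = h (v(i := x)) + h (v(i := y))"
    "h (v(i := c \<odot>\<^bsub>quantum_plane (t i)\<^esub> x)) = c *s h (v(i := x))"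
    if "i \<in> {1..n}" "x \<in> carrier (quantum_plane (t i))" "y \<in> carrier (quantum_plane (t i))" for v i x y c
  proof -
    have i: "i \<in> set [1..<Suc n]" using that(1) by auto
    obtain l r where "\<forall>x. h (v(i := x)) = l * \<chi> i x * r"
      using prod_list_upd[OF distinct_upt i, of \<chi> v] unfolding h_def by blast
    then show "h (v(i := x \<oplus>\<^bsub>quantum_plane (t i)\<^esub> y)) = h (v(i := x)) + h (v(i := y))"
      "h (v(i := c \<odot>\<^bsub>quantum_plane (t i)\<^esub> x)) = c *s h (v(i := x))"
      using that rhomD[OF \<chi>(1)[OF that(1)]] by (simp_all add: distrib_left distrib_right)
  qed
  interpret MA: ralg "monoid_algebra (PG n t) :: ('f, _) module" by (rule ralg_PG)
  have rels: "lin scale h r = 0" if "r \<in> multilinear_rels {1..n} (\<lambda>i. quantum_plane (t i))" for r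
  proof -
    have closed: "x \<oplus>\<^bsub>quantum_plane (t i)\<^esub> y \<in> carrier (quantum_plane (t i))" "c \<odot>\<^bsub>quantum_plane (t i)\<^esub> x \<in> carrier (quantum_plane (t i))"
      if "x \<in> carrier (quantum_plane (t i))" "y \<in> carrier (quantum_plane (t i))" for x y c i
    proof -
      interpret ralg "quantum_plane (t i)" by (rule ralg_plane)
      show "x \<oplus>\<^bsub>quantum_plane (t i)\<^esub> y \<in> carrier (quantum_plane (t i))" "c \<odot>\<^bsub>quantum_plane (t i)\<^esub> x \<in> carrier (quantum_plane (t i))"
        using that by auto
    qed
    have bc: "basis_elt (v(i := x)) \<in> carrier (monoid_algebra (PG n t))"
      if "v \<in> carrier (PG n t)" "i \<in> {1..n}" "x \<in> carrier (quantum_plane (t i))" for v i x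
      by (intro basis_carrier PG_upd that)
    from that consider
      v i x y where "v \<in> carrier (PG n t)" "i \<in> {1..n}" "x \<in> carrier (quantum_plane (t i))" "y \<in> carrier (quantum_plane (t i))"
        "r = basis_elt (v(i := x \<oplus>\<^bsub>quantum_plane (t i)\<^esub> y)) \<ominus>\<^bsub>monoid_algebra (PG n t)\<^esub>
          (basis_elt (v(i := x)) \<oplus>\<^bsub>monoid_algebra (PG n t)\<^esub> basis_elt (v(i := y)))"
    | v i x c where "v \<in> carrier (PG n t)" "i \<in> {1..n}" "x \<in> carrier (quantum_plane (t i))"
        "r = basis_elt (v(i := c \<odot>\<^bsub>quantum_plane (t i)\<^esub> x)) \<ominus>\<^bsub>monoid_algebra (PG n t)\<^esub>
          (c \<odot>\<^bsub>monoid_algebra (PG n t)\<^esub> basis_elt (v(i := x)))"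
      unfolding multilinear_rels_def Let_def by auto
    then show ?thesis
    proof cases
      case 1
      then show ?thesis
        by (simp add: rhom_zero_minus(3)[OF ralg_PG h_rhom] rhomD(2)[OF h_rhom] bc closed lin_basis upd(1) del: carrier_product_group)
    next
      case 2
      then show ?thesis
        by (simp add: rhom_zero_minus(3)[OF ralg_PG h_rhom] rhomD(4)[OF h_rhom] bc closed lin_basis upd(2) del: carrier_product_group)
    qed
  qed
  obtain \<psi> where \<psi>: "rhom (TA n t) \<psi>"
    "\<And>f. f \<in> carrier (monoid_algebra (PG n t)) \<Longrightarrow> \<psi> (TI n t +>\<^bsub>monoid_algebra (PG n t)\<^esub> f) = lin scale h f"
    using rhom_quot[OF ralg_PG h_rhom rels_carrier rels] unfolding tensor_alg_def tensor_ideal_def by blast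
  have "\<psi> (tmon n t \<mu>) = mon \<mu>" for \<mu>
  proof -
    have "\<psi> (tmon n t \<mu>) = h (\<lambda>i\<in>{1..n}. plane_mon (t i) (\<mu> i))"
      unfolding tmon_def tclass_def by (subst \<psi>(2)) (auto intro: basis_carrier plane_mon_PG simp: lin_basis simp del: carrier_product_group)
    also have "\<dots> = mon \<mu>"
      unfolding h_def mon_def by (intro arg_cong[where f = prod_list] map_cong) (auto simp: \<chi>(2))
    finally show ?thesis .
  qed
  then show ?thesis using \<psi>(1) by blast
qed

end

section \<open>Faithfulness of the representation\<close>

context generic_qfamily
begin

text \<open>The spanning monomials of the tensor product are sent to linearly independent elements,
  which gives injectivity and, at the same time, a basis of the tensor product.\<close>

lemma tensor_embedding:
  "\<exists>\<psi>. rhom (TA n t) \<psi> \<and> inj_on \<psi> (carrier (TA n t)) \<and> \<psi> ` carrier (TA n t) = W \<and>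
    (\<forall>i\<in>{1..n}. \<psi> (gen n t Gx i) = a i \<and> \<psi> (gen n t Gy i) = b i)"
proof -
  obtain \<psi> where \<psi>: "rhom (TA n t) \<psi>" "\<And>\<mu>. \<psi> (tmon n t \<mu>) = mon \<mu>" using tensor_hom by blast
  interpret TA: ralg "TA n t" by (rule ralg_TA)
  interpret TI: ralg_ideal "monoid_algebra (PG n t)" "TI n t" by (rule ralg_ideal_TI)
  \<comment> \<open>Lifts of the monomials to the monoid algebra, whose elements are functions;
    linear combinations are formed there before passing to classes.\<close>
  define N where "N \<mu> = (basis_elt (\<lambda>i\<in>{1..n}. plane_mon (t i) (\<mu> i)) :: (nat \<Rightarrow> 'f plane) \<Rightarrow> 'f)" for \<mu>
  have NC: "fs.span (range N) \<subseteq> carrier (monoid_algebra (PG n t))"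
    by (rule fs.span_minimal[OF _ carrier_subspace]) (auto simp: N_def simp del: carrier_product_group intro: basis_carrier plane_mon_PG)
  have rep: "\<exists>w\<in>fs.span (range N). C = TI.\<pi> w" if "C \<in> carrier (TA n t)" for C
    using that
  proof (induction rule: tensor_span)
    case (add C D)
    then obtain v w where *: "v \<in> fs.span (range N)" "w \<in> fs.span (range N)" "C = TI.\<pi> v" "D = TI.\<pi> w" by blast
    then have "v \<in> carrier (monoid_algebra (PG n t))" "w \<in> carrier (monoid_algebra (PG n t))" using NC by blast+
    then have "C \<oplus>\<^bsub>TA n t\<^esub> D = TI.\<pi> (v + w)"
      by (simp only: tensor_alg_def *(3,4) TI.pi_hom(1) monoid_algebra_simps(2))
    then show ?case using fs.span_add * by blast
  next
    case (scale c C)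
    then obtain v where *: "v \<in> fs.span (range N)" "C = TI.\<pi> v" by blast
    then have "v \<in> carrier (monoid_algebra (PG n t))" using NC by blast
    then have "c \<odot>\<^bsub>TA n t\<^esub> C = TI.\<pi> (fscale c v)"
      by (simp only: tensor_alg_def *(2) TI.pi_smult monoid_algebra_simps(3))
    then show ?case using fs.span_scale * by blast
  next
    case (mon \<mu>)
    show ?case unfolding tmon_def tclass_def N_def by (rule bexI[OF _ fs.span_base[of "N \<mu>"], unfolded N_def]) auto
  qed
  have inj0: "C = \<zero>\<^bsub>TA n t\<^esub>" if C: "C \<in> carrier (TA n t)" "\<psi> C = 0" for C
  proof -
    obtain w where w: "w \<in> fs.span (range N)" "C = TI.\<pi> w" using rep C by blast
    have N_restrict: "N \<mu> = N (restrict \<mu> {1..n})" for \<mu>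
      unfolding N_def by (intro arg_cong[where f = basis_elt] restrict_ext) simp
    have "N \<mu> \<in> N ` Expo" for \<mu>
      by (subst N_restrict) (auto simp: Expo_def)
    then have "range N = N ` Expo" by blast
    then have "w \<in> fs.span (N ` Expo)" using w(1) by simp
    then obtain V u where V: "finite V" "V \<subseteq> N ` Expo" "w = (\<Sum>v\<in>V. fscale (u v) v)"
      unfolding fs.span_explicit mem_Collect_eq by (elim exE conjE) (rule that)
    \<comment> \<open>\<open>N\<close> is not known to be injective on exponents, so one exponent is
      chosen for each vector that occurs.\<close>
    then obtain S where S: "S \<subseteq> Expo" "inj_on N S" "N ` S = V"
      using subset_image_inj[of V N Expo] by blast
    have finS: "finite S" using S V by (metis finite_imageD)
    have w_eq: "w = (\<Sum>\<mu>\<in>S. fscale (u (N \<mu>)) (N \<mu>))"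
      unfolding V(3) S(3)[symmetric] by (subst sum.reindex[OF S(2)]) simp
    have part: "(\<Sum>\<mu>\<in>U. fscale (u (N \<mu>)) (N \<mu>)) \<in> carrier (monoid_algebra (PG n t)) \<and>
        \<psi> (TI.\<pi> (\<Sum>\<mu>\<in>U. fscale (u (N \<mu>)) (N \<mu>))) = (\<Sum>\<mu>\<in>U. u (N \<mu>) *s mon \<mu>)" if "finite U" for U
      using that
    proof (induction U rule: finite_induct)
      case empty
      have "TI.\<pi> 0 = \<zero>\<^bsub>TA n t\<^esub>"
        unfolding tensor_alg_def quot_alg_simps monoid_algebra_simps(5)[symmetric, where M = "PG n t"]
        by (rule TI.a_coset_add_zero[OF TI.a_subset])
      then show ?case
        using rhom_zero_minus(1)[OF ralg_TA \<psi>(1)] fs.subspace_0[OF carrier_subspace, of "PG n t"]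
        by (simp only: sum.empty simp_thms)
    next
      case (insert \<mu> U)
      have Nc: "N \<mu> \<in> carrier (monoid_algebra (PG n t))" using NC fs.span_base[of "N \<mu>" "range N"] by blast
      let ?S = "\<Sum>\<mu>\<in>U. fscale (u (N \<mu>)) (N \<mu>)"
      have "TI.\<pi> (fscale (u (N \<mu>)) (N \<mu>) + ?S) = (u (N \<mu>) \<odot>\<^bsub>TA n t\<^esub> tmon n t \<mu>) \<oplus>\<^bsub>TA n t\<^esub> TI.\<pi> ?S"
        using Nc insert.IH fs.subspace_scale[OF carrier_subspace Nc]
        unfolding tensor_alg_def tmon_def tclass_def N_def[symmetric]
        by (simp add: TI.pi_smult TI.pi_hom monoid_algebra_simps(2,3))
      moreover have "TI.\<pi> ?S \<in> carrier (TA n t)"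
        unfolding tensor_alg_def using insert.IH by (intro TI.pi_carrier) simp
      ultimately have "\<psi> (TI.\<pi> (fscale (u (N \<mu>)) (N \<mu>) + ?S)) = u (N \<mu>) *s mon \<mu> + (\<Sum>\<mu>\<in>U. u (N \<mu>) *s mon \<mu>)"
        using insert.IH tmon_carrier[of n t \<mu>] by (simp add: rhomD[OF \<psi>(1)] \<psi>(2))
      moreover have "fscale (u (N \<mu>)) (N \<mu>) + ?S \<in> carrier (monoid_algebra (PG n t))"
        using fs.subspace_add[OF carrier_subspace fs.subspace_scale[OF carrier_subspace Nc]] insert.IH by blast
      ultimately show ?case by (simp only: sum.insert[OF insert.hyps])
    qed
    have "(\<Sum>\<mu>\<in>S. u (N \<mu>) *s mon \<mu>) = 0" using part[OF finS] C(2) w(2) w_eq by simp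
    from mon_independent[OF finS S(1) this] have "w = (\<Sum>\<mu>\<in>S. fscale 0 (N \<mu>))"
      unfolding w_eq by (intro sum.cong) auto
    also have "\<dots> = \<zero>\<^bsub>monoid_algebra (PG n t)\<^esub>" by (simp add: monoid_algebra_simps fun_eq_iff fun_sum_apply)
    finally have "C = TI n t +>\<^bsub>monoid_algebra (PG n t)\<^esub> \<zero>\<^bsub>monoid_algebra (PG n t)\<^esub>" using w(2) by simp
    also have "\<dots> = \<zero>\<^bsub>TA n t\<^esub>"
      unfolding tensor_alg_def quot_alg_simps by (rule TI.a_coset_add_zero[OF TI.a_subset])
    finally show ?thesis .
  qed
  have inj: "inj_on \<psi> (carrier (TA n t))"
  proof (rule inj_onI)
    fix C D assume *: "C \<in> carrier (TA n t)" "D \<in> carrier (TA n t)" "\<psi> C = \<psi> D"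
    then have "C \<ominus>\<^bsub>TA n t\<^esub> D = \<zero>\<^bsub>TA n t\<^esub>"
      by (intro inj0) (simp_all add: rhom_zero_minus(3)[OF ralg_TA \<psi>(1)])
    moreover have "C = (C \<ominus>\<^bsub>TA n t\<^esub> D) \<oplus>\<^bsub>TA n t\<^esub> D"
      using * by (simp add: TA.minus_eq TA.a_assoc TA.l_neg)
    ultimately show "C = D" using * by simp
  qed
  have "\<psi> C \<in> W" if "C \<in> carrier (TA n t)" for C
    using that
  proof (induction rule: tensor_span)
    case (mon \<mu>)
    then show ?case using \<psi>(2) mon_in_W by simp
  qed (simp_all add: rhomD[OF \<psi>(1)] subalg_add[OF subalg_W] subalg_scale[OF subalg_W])
  moreover have "W \<subseteq> \<psi> ` carrier (TA n t)"
    unfolding W_def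
  proof (rule span_minimal)
    show "mon ` Expo \<subseteq> \<psi> ` carrier (TA n t)" using \<psi>(2) tmon_carrier by (metis image_eqI image_subsetI)
    show "subspace (\<psi> ` carrier (TA n t))"
    proof (rule subspaceI)
      show "0 \<in> \<psi> ` carrier (TA n t)"
        using rhom_zero_minus(1)[OF ralg_TA \<psi>(1)] TA.zero_closed by (metis image_eqI)
    qed (auto simp flip: rhomD[OF \<psi>(1)])
  qed
  ultimately have "\<psi> ` carrier (TA n t) = W" by blast
  moreover have "\<psi> (gen n t Gx i) = a i \<and> \<psi> (gen n t Gy i) = b i" if "i \<in> {1..n}" for i
    using mon_single[OF that] by (simp add: gen_eq \<psi>(2))
  ultimately show ?thesis using \<psi>(1) inj by blast
qed

end

section \<open>Division rings of fractions inside an ambient ring\<close>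

context assoc_algebra
begin

definition represents :: "('a \<Rightarrow> 'r) \<Rightarrow> ('f, 'a) module \<Rightarrow> 'r set \<Rightarrow> bool" where
  "represents \<Phi> C S \<longleftrightarrow> bij_betw \<Phi> (carrier C) S \<and> \<one>\<^bsub>C\<^esub> \<in> carrier C \<and> \<Phi> \<one>\<^bsub>C\<^esub> = 1 \<and>
    (\<forall>x\<in>carrier C. \<forall>y\<in>carrier C. x \<oplus>\<^bsub>C\<^esub> y \<in> carrier C \<and> x \<otimes>\<^bsub>C\<^esub> y \<in> carrier C \<and>
       \<Phi> (x \<oplus>\<^bsub>C\<^esub> y) = \<Phi> x + \<Phi> y \<and> \<Phi> (x \<otimes>\<^bsub>C\<^esub> y) = \<Phi> x * \<Phi> y) \<and>
    (\<forall>c. \<forall>x\<in>carrier C. c \<odot>\<^bsub>C\<^esub> x \<in> carrier C \<and> \<Phi> (c \<odot>\<^bsub>C\<^esub> x) = c *s \<Phi> x)"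

text \<open>The two sides of the theorem are never mapped to each other directly; both are
  identified with the same subset of the ambient ring.\<close>

lemma represents_isomorphic:
  assumes 1: "represents \<Phi> C S" and 2: "represents \<Psi> D S"
  shows "C \<cong>\<^sub>a\<^sub>l\<^sub>g D"
proof -
  have b1: "bij_betw \<Phi> (carrier C) S" and b2: "bij_betw \<Psi> (carrier D) S"
    using 1 2 by (auto simp: represents_def)
  define \<phi> where "\<phi> = inv_into (carrier D) \<Psi> \<circ> \<Phi>"
  have bij: "bij_betw \<phi> (carrier C) (carrier D)"
    unfolding \<phi>_def by (rule bij_betw_trans[OF b1 bij_betw_inv_into[OF b2]])
  have D: "\<phi> x \<in> carrier D" if "x \<in> carrier C" for x using bij that by (auto simp: bij_betw_def)
  have \<Psi>: "\<Psi> (\<phi> x) = \<Phi> x" if "x \<in> carrier C" for x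
    using that b1 b2 unfolding \<phi>_def bij_betw_def by (auto intro!: f_inv_into_f)
  have inj: "y = z" if "\<Psi> y = \<Psi> z" "y \<in> carrier D" "z \<in> carrier D" for y z
    using b2 that by (auto simp: bij_betw_def inj_on_def)
  have "\<phi> \<in> alg_hom C D"
    unfolding alg_hom_def ring_hom_def
    using 1 2 D \<Psi> unfolding represents_def by (auto intro!: inj)
  then show ?thesis using bij unfolding alg_isomorphic_def alg_iso_def by blast
qed

end

text \<open>The right Ore condition gives common denominators, and nonzero elements become units, so
  every fraction has a value in the ambient ring. This serves for the embedding itself and for its
  twists by group elements.\<close>

locale ore_hom = assoc_algebra scale + ralg A
  for scale :: "'f::field \<Rightarrow> 'r::ring_1 \<Rightarrow> 'r" (infixr \<open>*s\<close> 75) and A :: "('f, 'a) module" (structure) +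
  fixes \<psi> :: "'a \<Rightarrow> 'r"
  assumes \<psi>: "rhom A \<psi>"
    and unit: "\<And>a. a \<in> carrier A \<Longrightarrow> a \<noteq> \<zero> \<Longrightarrow> invt (\<psi> a)"
    and ore: "\<And>s t. s \<in> carrier A \<Longrightarrow> t \<in> carrier A \<Longrightarrow> s \<noteq> \<zero> \<Longrightarrow> t \<noteq> \<zero> \<Longrightarrow>
        \<exists>u\<in>carrier A. \<exists>v\<in>carrier A. s \<otimes> u = t \<otimes> v \<and> s \<otimes> u \<noteq> \<zero>"
begin

lemmas hom = rhomD[OF \<psi>] rhom_zero_minus[OF ralg_axioms \<psi>]

lemma \<psi>_eq_0_iff: "a \<in> carrier A \<Longrightarrow> \<psi> a = 0 \<longleftrightarrow> a = \<zero>"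
  using unit hom(5) invt_neq_0 by metis

lemma nonzero_mult: "a \<in> carrier A \<Longrightarrow> b \<in> carrier A \<Longrightarrow> a \<otimes> b \<noteq> \<zero> \<longleftrightarrow> a \<noteq> \<zero> \<and> b \<noteq> \<zero>"
  by (metis hom(3) invt_mult invt_neq_0 l_null m_closed r_null unit \<psi>_eq_0_iff)

lemma nonzero_factor: "s \<in> carrier A \<Longrightarrow> s \<otimes> u \<noteq> \<zero> \<Longrightarrow> u \<noteq> \<zero>"
  by auto

definition fv :: "'a \<Rightarrow> 'a \<Rightarrow> 'r" where
  "fv a s = \<psi> a * rinv (\<psi> s)"

lemma frac_pairs_iff: "(a, s) \<in> frac_pairs A \<longleftrightarrow> a \<in> carrier A \<and> s \<in> carrier A \<and> s \<noteq> \<zero>"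
  by (auto simp: frac_pairs_def)

lemma fv_cancel:
  assumes "(a, s) \<in> frac_pairs A" "u \<in> carrier A" "u \<noteq> \<zero>"
  shows "fv (a \<otimes> u) (s \<otimes> u) = fv a s"
  using assms unfolding fv_def frac_pairs_iff
  by (simp add: hom rinv_mult unit mult.assoc)

lemma fv_mult:
  assumes "(a, s) \<in> frac_pairs A" "(b, t) \<in> frac_pairs A" "u \<in> carrier A" "v \<in> carrier A"
    "s \<otimes> u = b \<otimes> v" "v \<noteq> \<zero>"
  shows "fv (a \<otimes> u) (t \<otimes> v) = fv a s * fv b t"
proof -
  have inv: "invt (\<psi> s)" "invt (\<psi> t)" "invt (\<psi> v)" using assms unit by (auto simp: frac_pairs_iff)
  have "\<psi> s * \<psi> u = \<psi> b * \<psi> v" using assms by (simp add: frac_pairs_iff flip: hom(3))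
  then have "rinv (\<psi> s) * (\<psi> s * \<psi> u) * rinv (\<psi> v) = rinv (\<psi> s) * (\<psi> b * \<psi> v) * rinv (\<psi> v)" by simp
  then have "\<psi> u * rinv (\<psi> v) = rinv (\<psi> s) * \<psi> b" using inv by (simp add: mult.assoc)
  then have "\<psi> a * (\<psi> u * rinv (\<psi> v)) * rinv (\<psi> t) = \<psi> a * (rinv (\<psi> s) * \<psi> b) * rinv (\<psi> t)" by simp
  then show ?thesis using assms inv unfolding fv_def frac_pairs_iff
    by (simp add: hom rinv_mult mult.assoc)
qed

lemma fv_add:
  assumes "(a, s) \<in> frac_pairs A" "(b, t) \<in> frac_pairs A" "u \<in> carrier A" "v \<in> carrier A"
    "s \<otimes> u = t \<otimes> v" "s \<otimes> u \<noteq> \<zero>"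
  shows "fv (a \<otimes> u \<oplus> b \<otimes> v) (s \<otimes> u) = fv a s + fv b t"
proof -
  have uv: "u \<noteq> \<zero>" "v \<noteq> \<zero>"
    using nonzero_factor[of s u] nonzero_factor[of t v] assms by (simp_all add: frac_pairs_iff)
  have "fv (a \<otimes> u \<oplus> b \<otimes> v) (s \<otimes> u) = fv (a \<otimes> u) (s \<otimes> u) + fv (b \<otimes> v) (t \<otimes> v)"
    using assms by (simp add: fv_def frac_pairs_iff hom distrib_right)
  then show ?thesis using fv_cancel[OF assms(1,3) uv(1)] fv_cancel[OF assms(2,4) uv(2)] assms(5) by simp
qed

lemma fv_smult: "(a, s) \<in> frac_pairs A \<Longrightarrow> fv (c \<odot> a) s = c *s fv a s"
  by (simp add: fv_def frac_pairs_iff hom)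

lemma fv_rinv: "(a, s) \<in> frac_pairs A \<Longrightarrow> a \<noteq> \<zero> \<Longrightarrow> rinv (fv a s) = fv s a \<and> invt (fv a s)"
  unfolding fv_def frac_pairs_iff
  by (intro conjI rinv_eqI invtI[of _ "\<psi> s * rinv (\<psi> a)"]) (auto simp: unit mult.assoc)

lemma one_nonzero: "\<one> \<noteq> \<zero>"
  using hom(1,5) by (metis zero_neq_one)

lemma fv_one: "fv a \<one> = \<psi> a"
  by (simp add: fv_def hom)

definition Fr :: "'r set" where
  "Fr = {fv a s | a s. (a, s) \<in> frac_pairs A}"

lemma FrI: "(a, s) \<in> frac_pairs A \<Longrightarrow> fv a s \<in> Fr"
  unfolding Fr_def by blast

lemma FrE:
  assumes "x \<in> Fr"
  obtains a s where "(a, s) \<in> frac_pairs A" "x = fv a s"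
  using assms unfolding Fr_def by blast

lemma FrE2:
  assumes "x \<in> Fr" "y \<in> Fr"
  obtains a s b t where "(a, s) \<in> frac_pairs A" "(b, t) \<in> frac_pairs A" "x = fv a s" "y = fv b t"
  using FrE[OF assms(1)] FrE[OF assms(2)] by metis

lemma common_denominator:
  assumes "(a, s) \<in> frac_pairs A" "(b, t) \<in> frac_pairs A"
  obtains u v where "u \<in> carrier A" "v \<in> carrier A" "s \<otimes> u = t \<otimes> v" "s \<otimes> u \<noteq> \<zero>"
  using assms ore unfolding frac_pairs_iff by metis

lemma common_numerator:
  assumes "(a, s) \<in> frac_pairs A" "(b, t) \<in> frac_pairs A"
  obtains u v where "u \<in> carrier A" "v \<in> carrier A" "s \<otimes> u = b \<otimes> v" "v \<noteq> \<zero>"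
proof (cases "b = \<zero>")
  case True
  show ?thesis by (rule that[of \<zero> \<one>]) (use assms True one_nonzero in \<open>auto simp: frac_pairs_iff\<close>)
next
  case False
  then obtain u v where *: "u \<in> carrier A" "v \<in> carrier A" "s \<otimes> u = b \<otimes> v" "s \<otimes> u \<noteq> \<zero>"
    using assms ore unfolding frac_pairs_iff by metis
  then have "v \<noteq> \<zero>" using assms nonzero_mult[of b v] by (auto simp: frac_pairs_iff)
  then show ?thesis using that * by blast
qed

lemma fv_eq_if:
  assumes "(a, s) \<in> frac_pairs A" "(b, t) \<in> frac_pairs A" "u \<in> carrier A" "v \<in> carrier A"
    "s \<otimes> u = t \<otimes> v" "s \<otimes> u \<noteq> \<zero>" "a \<otimes> u = b \<otimes> v"
  shows "fv a s = fv b t"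
proof -
  have uv: "u \<noteq> \<zero>" "v \<noteq> \<zero>"
    using nonzero_factor[of s u] nonzero_factor[of t v] assms by (simp_all add: frac_pairs_iff)
  then show ?thesis using fv_cancel[OF assms(1,3)] fv_cancel[OF assms(2,4)] assms by simp
qed

lemma divsub_Fr: "divsub Fr"
  unfolding divsub_def subalg_def
proof (intro conjI allI ballI impI)
  fix c show "c *s 1 \<in> Fr"
    unfolding Fr_def using one_nonzero
    by (intro CollectI exI[of _ "c \<odot> \<one>"] exI[of _ \<one>]) (auto simp: frac_pairs_iff fv_one hom)
next
  fix x y assume xy: "x \<in> Fr" "y \<in> Fr"
  obtain a s b t where *: "(a, s) \<in> frac_pairs A" "(b, t) \<in> frac_pairs A" "x = fv a s" "y = fv b t"
    using xy by (rule FrE2)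
  obtain u v where uv: "u \<in> carrier A" "v \<in> carrier A" "s \<otimes> u = t \<otimes> v" "s \<otimes> u \<noteq> \<zero>"
    using common_denominator *(1,2) by blast
  then have "(a \<otimes> u \<oplus> b \<otimes> v, s \<otimes> u) \<in> frac_pairs A" using * by (auto simp: frac_pairs_iff)
  then show "x + y \<in> Fr" using fv_add[OF *(1,2) uv] FrI * by metis
  obtain u v where uv: "u \<in> carrier A" "v \<in> carrier A" "s \<otimes> u = b \<otimes> v" "v \<noteq> \<zero>"
    using common_numerator *(1,2) by blast
  then have "(a \<otimes> u, t \<otimes> v) \<in> frac_pairs A" using * nonzero_mult[of t v] by (simp add: frac_pairs_iff)
  then show "x * y \<in> Fr" using fv_mult[OF *(1,2) uv] FrI * by metis
next
  fix x assume x: "x \<in> Fr"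
  then obtain a s where *: "(a, s) \<in> frac_pairs A" "x = fv a s" by (auto simp: Fr_def)
  have "x = 0" if "a = \<zero>" using * that by (simp add: fv_def hom)
  then show "invt x" if "x \<noteq> 0" using fv_rinv * that by metis
  show "rinv x \<in> Fr"
  proof (cases "a = \<zero>")
    case True
    then have "rinv x = x" using * by (simp add: fv_def hom rinv_not_invt)
    then show ?thesis using x by simp
  next
    case False
    then show ?thesis using fv_rinv * unfolding Fr_def frac_pairs_iff by blast
  qed
qed

lemma \<psi>_in_Fr: "a \<in> carrier A \<Longrightarrow> \<psi> a \<in> Fr"
  unfolding Fr_def using one_nonzero fv_one[of a]
  by (intro CollectI exI[of _ a] exI[of _ \<one>]) (auto simp: frac_pairs_iff)

end

locale ore_embedding = ore_hom scale A \<psi>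
  for scale :: "'f::field \<Rightarrow> 'r::ring_1 \<Rightarrow> 'r" (infixr \<open>*s\<close> 75)
    and A :: "('f, 'a) module" (structure) and \<psi> :: "'a \<Rightarrow> 'r" +
  assumes inj: "inj_on \<psi> (carrier A)"
begin

definition fib :: "'r \<Rightarrow> ('a \<times> 'a) set" where
  "fib r = {(b, t) \<in> frac_pairs A. fv b t = r}"

lemma frac_common:
  assumes "(a, s) \<in> frac_pairs A" "(b, t) \<in> frac_pairs A" "fv a s = fv b t"
  shows "\<exists>u\<in>carrier A. \<exists>v\<in>carrier A. s \<otimes> u = t \<otimes> v \<and> s \<otimes> u \<noteq> \<zero> \<and> a \<otimes> u = b \<otimes> v"
proof -
  obtain u v where uv: "u \<in> carrier A" "v \<in> carrier A" "s \<otimes> u = t \<otimes> v" "s \<otimes> u \<noteq> \<zero>"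
    using common_denominator assms by blast
  have inv: "invt (\<psi> s)" "invt (\<psi> t)" using assms unit by (auto simp: frac_pairs_iff)
  have "fv a s * \<psi> (s \<otimes> u) = fv b t * \<psi> (t \<otimes> v)" using assms uv by simp
  then have "\<psi> (a \<otimes> u) = \<psi> (b \<otimes> v)"
    using assms uv(1,2) inv by (simp add: fv_def hom frac_pairs_iff mult.assoc)
  then have "a \<otimes> u = b \<otimes> v" using inj assms uv by (auto simp: inj_on_def frac_pairs_iff)
  then show ?thesis using uv by blast
qed

text \<open>An equivalence class of fractions is a fibre of the value map: equal values give equal
  numerators over a common denominator, by injectivity of \<open>\<psi>\<close>.\<close>

lemma frac_eq_fib:
  assumes "(a, s) \<in> frac_pairs A"
  shows "frac A a s = fib (fv a s)"
proof (intro equalityI subsetI; clarify)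
  fix b t assume "(b, t) \<in> frac A a s"
  then obtain u v where "(b, t) \<in> frac_pairs A" "u \<in> carrier A" "v \<in> carrier A"
    "s \<otimes> u = t \<otimes> v" "s \<otimes> u \<noteq> \<zero>" "a \<otimes> u = b \<otimes> v" unfolding frac_def by blast
  then show "(b, t) \<in> fib (fv a s)" using fv_eq_if[OF assms, of b t u v] by (simp add: fib_def)
next
  fix b t assume "(b, t) \<in> fib (fv a s)"
  then have bt: "(b, t) \<in> frac_pairs A" "fv a s = fv b t" by (auto simp: fib_def)
  then show "(b, t) \<in> frac A a s" unfolding frac_def using frac_common[OF assms] by blast
qed

definition \<Phi> :: "('a \<times> 'a) set \<Rightarrow> 'r" where
  "\<Phi> P = (THE r. P = fib r \<and> r \<in> Fr)"

lemma \<Phi>_fib: "r \<in> Fr \<Longrightarrow> \<Phi> (fib r) = r"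
  unfolding \<Phi>_def
proof (rule the_equality)
  fix r' assume "r \<in> Fr" "fib r = fib r' \<and> r' \<in> Fr"
  moreover from this obtain a s where "(a, s) \<in> fib r" by (auto simp: Fr_def fib_def)
  ultimately have "(a, s) \<in> fib r'" "(a, s) \<in> fib r" by auto
  then show "r' = r" by (auto simp: fib_def)
qed simp

lemma carrier_Frac: "carrier (Frac A) = fib ` Fr"
  by (force simp: Frac_def Fr_def frac_eq_fib)

lemma union_fib:
  assumes "\<F> \<noteq> {}" "\<And>F. F \<in> \<F> \<Longrightarrow> F = fib r"
  shows "\<Union>\<F> = fib r"
  using assms by blast

lemma fib_mem: "(a, s) \<in> fib r \<Longrightarrow> (a, s) \<in> frac_pairs A \<and> fv a s = r"
  by (simp add: fib_def)

lemma fib_nonempty: "r \<in> Fr \<Longrightarrow> \<exists>a s. (a, s) \<in> fib r"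
  by (auto simp: fib_def Fr_def)

text \<open>Each operation is a union over choices of representatives. The Ore condition provides at
  least one choice, and every choice yields the same fibre, so the union is that fibre.\<close>

lemma Frac_ops:
  assumes r: "r \<in> Fr" and r': "r' \<in> Fr"
  shows "fib r \<otimes>\<^bsub>Frac A\<^esub> fib r' = fib (r * r')"
    and "fib r \<oplus>\<^bsub>Frac A\<^esub> fib r' = fib (r + r')"
    and "c \<odot>\<^bsub>Frac A\<^esub> fib r = fib (c *s r)"
    and "\<one>\<^bsub>Frac A\<^esub> = fib 1"
proof -
  obtain a s b t where as: "(a, s) \<in> fib r" "(b, t) \<in> fib r'" using r r' fib_nonempty by metis
  have "(\<Union>{frac A (a \<otimes> u) (t \<otimes> v) | a s b t u v. (a, s) \<in> fib r \<and> (b, t) \<in> fib r' \<and>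
      u \<in> carrier A \<and> v \<in> carrier A \<and> s \<otimes> u = b \<otimes> v \<and> v \<noteq> \<zero>}) = fib (r * r')"
  proof (rule union_fib)
    obtain u v where "u \<in> carrier A" "v \<in> carrier A" "s \<otimes> u = b \<otimes> v" "v \<noteq> \<zero>"
      using common_numerator fib_mem as by metis
    then show "{frac A (a \<otimes> u) (t \<otimes> v) | a s b t u v. (a, s) \<in> fib r \<and> (b, t) \<in> fib r' \<and>
      u \<in> carrier A \<and> v \<in> carrier A \<and> s \<otimes> u = b \<otimes> v \<and> v \<noteq> \<zero>} \<noteq> {}" using as by blast
  next
    fix F assume "F \<in> {frac A (a \<otimes> u) (t \<otimes> v) | a s b t u v. (a, s) \<in> fib r \<and> (b, t) \<in> fib r' \<and>
      u \<in> carrier A \<and> v \<in> carrier A \<and> s \<otimes> u = b \<otimes> v \<and> v \<noteq> \<zero>}"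
    then obtain a s b t u v where *: "F = frac A (a \<otimes> u) (t \<otimes> v)" "(a, s) \<in> fib r" "(b, t) \<in> fib r'"
      "u \<in> carrier A" "v \<in> carrier A" "s \<otimes> u = b \<otimes> v" "v \<noteq> \<zero>" by blast
    then have "(a \<otimes> u, t \<otimes> v) \<in> frac_pairs A"
      using fib_mem[OF *(2)] fib_mem[OF *(3)] nonzero_mult[of t v] by (simp add: frac_pairs_iff)
    then show "F = fib (r * r')" using * fib_mem fv_mult[of a s b t u v] by (simp add: frac_eq_fib)
  qed
  then show "fib r \<otimes>\<^bsub>Frac A\<^esub> fib r' = fib (r * r')" by (simp add: Frac_def)
  have "(\<Union>{frac A (a \<otimes> u \<oplus> b \<otimes> v) (s \<otimes> u) | a s b t u v. (a, s) \<in> fib r \<and> (b, t) \<in> fib r' \<and>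
      u \<in> carrier A \<and> v \<in> carrier A \<and> s \<otimes> u = t \<otimes> v \<and> s \<otimes> u \<noteq> \<zero>}) = fib (r + r')"
  proof (rule union_fib)
    obtain u v where "u \<in> carrier A" "v \<in> carrier A" "s \<otimes> u = t \<otimes> v" "s \<otimes> u \<noteq> \<zero>"
      using common_denominator fib_mem as by metis
    then show "{frac A (a \<otimes> u \<oplus> b \<otimes> v) (s \<otimes> u) | a s b t u v. (a, s) \<in> fib r \<and> (b, t) \<in> fib r' \<and>
      u \<in> carrier A \<and> v \<in> carrier A \<and> s \<otimes> u = t \<otimes> v \<and> s \<otimes> u \<noteq> \<zero>} \<noteq> {}" using as by blast
  next
    fix F assume "F \<in> {frac A (a \<otimes> u \<oplus> b \<otimes> v) (s \<otimes> u) | a s b t u v. (a, s) \<in> fib r \<and> (b, t) \<in> fib r' \<and>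
      u \<in> carrier A \<and> v \<in> carrier A \<and> s \<otimes> u = t \<otimes> v \<and> s \<otimes> u \<noteq> \<zero>}"
    then obtain a s b t u v where *: "F = frac A (a \<otimes> u \<oplus> b \<otimes> v) (s \<otimes> u)" "(a, s) \<in> fib r" "(b, t) \<in> fib r'"
      "u \<in> carrier A" "v \<in> carrier A" "s \<otimes> u = t \<otimes> v" "s \<otimes> u \<noteq> \<zero>" by blast
    then have "(a \<otimes> u \<oplus> b \<otimes> v, s \<otimes> u) \<in> frac_pairs A"
      using fib_mem[OF *(2)] fib_mem[OF *(3)] by (simp add: frac_pairs_iff)
    then show "F = fib (r + r')" using * fib_mem fv_add[of a s b t u v] by (simp add: frac_eq_fib)
  qed
  then show "fib r \<oplus>\<^bsub>Frac A\<^esub> fib r' = fib (r + r')" by (simp add: Frac_def)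
  have "(\<Union>{frac A (c \<odot> a) s | a s. (a, s) \<in> fib r}) = fib (c *s r)"
  proof (rule union_fib)
    show "{frac A (c \<odot> a) s | a s. (a, s) \<in> fib r} \<noteq> {}" using as by blast
  next
    fix F assume "F \<in> {frac A (c \<odot> a) s | a s. (a, s) \<in> fib r}"
    then obtain a s where *: "F = frac A (c \<odot> a) s" "(a, s) \<in> fib r" by blast
    then have "(c \<odot> a, s) \<in> frac_pairs A" by (auto simp: fib_def frac_pairs_iff)
    then show "F = fib (c *s r)" using * fib_mem fv_smult[of a s c] by (simp add: frac_eq_fib)
  qed
  then show "c \<odot>\<^bsub>Frac A\<^esub> fib r = fib (c *s r)" by (simp add: Frac_def)
  show "\<one>\<^bsub>Frac A\<^esub> = fib 1"
    using frac_eq_fib[of \<one> \<one>] one_nonzero by (simp add: Frac_def frac_pairs_iff fv_one hom)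
qed

lemma represents_subset:
  assumes S: "S \<subseteq> Fr" "subalg S" and C: "carrier C = fib ` S" "monoid.mult C = monoid.mult (Frac A)" "add C = add (Frac A)"
     "one C = one (Frac A)" "module.smult C = module.smult (Frac A)"
  shows "represents \<Phi> C S"
proof -
  have \<Phi>: "\<Phi> (fib r) = r" if "r \<in> S" for r using that S \<Phi>_fib by blast
  have "bij_betw \<Phi> (carrier C) S"
    unfolding C by (rule bij_betw_byWitness[where f' = fib]) (use \<Phi> in auto)
  moreover have "\<one>\<^bsub>C\<^esub> = fib 1" "1 \<in> S"
    using Frac_ops(4)[OF subalg_1 subalg_1] C divsub_subalg[OF divsub_Fr] subalg_1 S by auto
  moreover have "fib r \<oplus>\<^bsub>C\<^esub> fib r' = fib (r + r')" "fib r \<otimes>\<^bsub>C\<^esub> fib r' = fib (r * r')" "c \<odot>\<^bsub>C\<^esub> fib r = fib (c *s r)"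
    if "r \<in> S" "r' \<in> S" for r r' c
    using that S(1) by (simp_all add: C Frac_ops(1-3)[of r r'] subset_iff)
  ultimately show ?thesis
    unfolding represents_def C(1) using S(2) \<Phi>
    by (auto simp: subalg_add subalg_mult subalg_scale)
qed

lemma represents_Frac: "represents \<Phi> (Frac A) Fr"
  by (rule represents_subset) (use divsub_subalg[OF divsub_Fr] carrier_Frac in auto)

text \<open>Universal property of the localization: equal fractions become equal after expansion by
  \<open>u\<close> and \<open>v\<close>, and this expansion is preserved by \<open>\<psi>'\<close>.
  With \<open>\<psi>'\<close> a twist of \<open>\<psi>\<close>, the map \<open>\<theta>\<close> is
  the action of a group element on fractions.\<close>

lemma extension:
  assumes "ore_hom scale A \<psi>'"
  shows "\<exists>\<theta>. (\<forall>a s. (a, s) \<in> frac_pairs A \<longrightarrow> \<theta> (fv a s) = ore_hom.fv \<psi>' a s) \<and>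
    (\<forall>a\<in>carrier A. \<theta> (\<psi> a) = \<psi>' a) \<and>
    (\<forall>x\<in>Fr. \<forall>y\<in>Fr. \<theta> (x + y) = \<theta> x + \<theta> y \<and> \<theta> (x * y) = \<theta> x * \<theta> y) \<and>
    (\<forall>x\<in>Fr. \<forall>c. \<theta> (c *s x) = c *s \<theta> x) \<and> (\<forall>x\<in>Fr. \<theta> (rinv x) = rinv (\<theta> x))"
proof -
  interpret B: ore_hom scale A \<psi>' by (rule assms)
  define \<theta> where "\<theta> r = (THE r'. \<exists>a s. (a, s) \<in> frac_pairs A \<and> r = fv a s \<and> r' = B.fv a s)" for r
  have \<theta>: "\<theta> (fv a s) = B.fv a s" if as: "(a, s) \<in> frac_pairs A" for a s
    unfolding \<theta>_def
  proof (rule the_equality)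
    fix r' assume "\<exists>b t. (b, t) \<in> frac_pairs A \<and> fv a s = fv b t \<and> r' = B.fv b t"
    then obtain b t where bt: "(b, t) \<in> frac_pairs A" "fv a s = fv b t" "r' = B.fv b t" by blast
    from frac_common[OF as bt(1,2)] show "r' = B.fv a s" using B.fv_eq_if[OF as bt(1)] bt(3) by metis
  qed (use as in blast)
  have "\<theta> (\<psi> a) = \<psi>' a" if "a \<in> carrier A" for a
    using \<theta>[of a \<one>] that one_nonzero by (simp add: frac_pairs_iff fv_one B.fv_one)
  moreover have "\<theta> (x + y) = \<theta> x + \<theta> y \<and> \<theta> (x * y) = \<theta> x * \<theta> y" if xy: "x \<in> Fr" "y \<in> Fr" for x y
  proof -
    obtain a s b t where *: "(a, s) \<in> frac_pairs A" "(b, t) \<in> frac_pairs A" "x = fv a s" "y = fv b t"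
      using xy by (rule FrE2)
    obtain u v where uv: "u \<in> carrier A" "v \<in> carrier A" "s \<otimes> u = t \<otimes> v" "s \<otimes> u \<noteq> \<zero>"
      using common_denominator *(1,2) by blast
    then have "(a \<otimes> u \<oplus> b \<otimes> v, s \<otimes> u) \<in> frac_pairs A" using * by (auto simp: frac_pairs_iff)
    then have "\<theta> (x + y) = \<theta> x + \<theta> y"
      using \<theta> fv_add[OF *(1,2) uv] B.fv_add[OF *(1,2) uv] * by metis
    moreover obtain u v where uv: "u \<in> carrier A" "v \<in> carrier A" "s \<otimes> u = b \<otimes> v" "v \<noteq> \<zero>"
      using common_numerator *(1,2) by blast
    then have "(a \<otimes> u, t \<otimes> v) \<in> frac_pairs A" using * nonzero_mult[of t v] by (simp add: frac_pairs_iff)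
    then have "\<theta> (x * y) = \<theta> x * \<theta> y"
      using \<theta> fv_mult[OF *(1,2) uv] B.fv_mult[OF *(1,2) uv] * by metis
    ultimately show ?thesis by blast
  qed
  moreover have "\<theta> (c *s x) = c *s \<theta> x" if x: "x \<in> Fr" for c x
  proof -
    obtain a s where *: "(a, s) \<in> frac_pairs A" "x = fv a s" using x by (rule FrE)
    then have "(c \<odot> a, s) \<in> frac_pairs A" by (auto simp: frac_pairs_iff)
    then show ?thesis using \<theta> fv_smult[OF *(1)] B.fv_smult[OF *(1)] * by metis
  qed
  moreover have "\<theta> (rinv x) = rinv (\<theta> x)" if x: "x \<in> Fr" for x
  proof -
    obtain a s where *: "(a, s) \<in> frac_pairs A" "x = fv a s" using x by (rule FrE)
    show ?thesis
    proof (cases "a = \<zero>")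
      case True
      then have "x = 0" "\<theta> x = 0" using * \<theta>[OF *(1)] by (auto simp: fv_def B.fv_def hom B.hom)
      then show ?thesis by (simp add: rinv_not_invt)
    next
      case False
      then have "(s, a) \<in> frac_pairs A" using * by (auto simp: frac_pairs_iff)
      then show ?thesis using \<theta> fv_rinv[OF *(1) False] B.fv_rinv[OF *(1) False] * by metis
    qed
  qed
  ultimately show ?thesis using \<theta> by blast
qed

lemma Frac_map_fib:
  assumes r: "r \<in> Fr" and \<phi>: "\<And>a. a \<in> carrier A \<Longrightarrow> \<phi> a \<in> carrier A" "\<And>a. a \<in> carrier A \<Longrightarrow> \<psi> (\<phi> a) = \<psi>' a"
    and \<psi>': "ore_hom scale A \<psi>'"
    and \<theta>: "\<And>a s. (a, s) \<in> frac_pairs A \<Longrightarrow> \<theta> (fv a s) = ore_hom.fv \<psi>' a s"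
  shows "Frac_map A \<phi> (fib r) = fib (\<theta> r)"
proof -
  interpret B: ore_hom scale A \<psi>' by (rule \<psi>')
  show ?thesis
    unfolding Frac_map_def
  proof (rule union_fib)
    show "{frac A (\<phi> a) (\<phi> s) |a s. (a, s) \<in> fib r} \<noteq> {}" using fib_nonempty[OF r] by blast
    fix F assume "F \<in> {frac A (\<phi> a) (\<phi> s) |a s. (a, s) \<in> fib r}"
    then obtain a s where *: "F = frac A (\<phi> a) (\<phi> s)" "(a, s) \<in> frac_pairs A" "fv a s = r"
      by (auto simp: fib_def)
    then have "a \<in> carrier A" "s \<in> carrier A" "s \<noteq> \<zero>" by (auto simp: frac_pairs_iff)
    moreover from this have "\<psi> (\<phi> s) \<noteq> 0" using B.unit \<phi>(2) invt_neq_0 by metis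
    moreover from this have "\<phi> s \<noteq> \<zero>" using hom(5) by auto
    ultimately have "(\<phi> a, \<phi> s) \<in> frac_pairs A" using \<phi>(1) by (simp add: frac_pairs_iff)
    moreover have "fv (\<phi> a) (\<phi> s) = \<theta> r"
      using \<theta>[OF *(2)] *(2,3) by (simp add: fv_def B.fv_def \<phi>(2) frac_pairs_iff)
    ultimately show "F = fib (\<theta> r)" using * frac_eq_fib by simp
  qed
qed

lemma fib_eq_iff: "r \<in> Fr \<Longrightarrow> r' \<in> Fr \<Longrightarrow> fib r = fib r' \<longleftrightarrow> r = r'"
  using \<Phi>_fib by metis

end

section \<open>The initial Lax pair\<close>

context assoc_algebra
begin

lemma power_mult_commuting:
  assumes "u * v = v * (u :: 'r)"
  shows "(u * v) ^ k = u ^ k * v ^ k"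
proof (induction k)
  case (Suc k)
  have "v * u ^ k = u ^ k * v" using power_commuting_commutes[OF assms, of k] by simp
  then have "v * (u ^ k * v ^ k) = u ^ k * (v * v ^ k)" by (metis mult.assoc)
  then show ?case by (simp add: Suc mult.assoc)
qed simp

lemma power_scale: "(c *s r) ^ k = c ^ k *s r ^ k"
  by (induction k) auto

text \<open>Multiplication of a coefficient sequence by \<open>z - Z i\<close>.\<close>

definition linear_factor :: "(nat \<Rightarrow> 'r) \<Rightarrow> nat \<Rightarrow> (nat \<Rightarrow> 'r) \<Rightarrow> nat \<Rightarrow> 'r" where
  "linear_factor Z i f k = prev f k - Z i * f k"

definition Pol :: "(nat \<Rightarrow> 'r) \<Rightarrow> nat set \<Rightarrow> nat \<Rightarrow> 'r" where
  "Pol Z S = Finite_Set.fold (linear_factor Z) (\<lambda>k. if k = 0 then 1 else 0) S"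

end

text \<open>\<open>Pol Z S\<close> is the coefficient sequence of \<open>\<Prod>i\<in>S. (z - Z i)\<close> for a commuting family \<open>Z\<close>.\<close>

locale commuting_family = assoc_algebra scale
  for scale :: "'f::field \<Rightarrow> 'r::ring_1 \<Rightarrow> 'r" (infixr \<open>*s\<close> 75) +
  fixes Z :: "nat \<Rightarrow> 'r" and T :: "nat set"
  assumes ZZ: "\<And>i j. i \<in> T \<Longrightarrow> j \<in> T \<Longrightarrow> Z i * Z j = Z j * Z i" and fin: "finite T"
begin

lemma Pol_empty: "Pol Z {} k = (if k = 0 then 1 else 0)"
  by (simp add: Pol_def)

lemma Pol_insert:
  assumes "insert i S \<subseteq> T" "i \<notin> S"
  shows "Pol Z (insert i S) k = prev (Pol Z S) k - Z i * Pol Z S k"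
proof -
  interpret comp_fun_commute_on T "linear_factor Z"
  proof
    fix i j assume ij: "i \<in> T" "j \<in> T"
    show "linear_factor Z j \<circ> linear_factor Z i = linear_factor Z i \<circ> linear_factor Z j"
    proof (intro ext)
      fix f :: "nat \<Rightarrow> 'r" and k
      have "Z i * (Z j * f k) = Z j * (Z i * f k)" using ZZ[OF ij] by (simp flip: mult.assoc)
      then show "(linear_factor Z j \<circ> linear_factor Z i) f k = (linear_factor Z i \<circ> linear_factor Z j) f k"
        by (cases k) (simp_all add: linear_factor_def right_diff_distrib)
    qed
  qed
  show ?thesis
    unfolding Pol_def using fold_insert[OF assms(1) _ assms(2)] finite_subset[OF _ fin] assms(1)
    by (simp add: linear_factor_def)
qed

lemma Pol_induct [consumes 1, case_names empty insert]:
  assumes "S \<subseteq> T" "P {}" "\<And>i S. insert i S \<subseteq> T \<Longrightarrow> i \<notin> S \<Longrightarrow> finite S \<Longrightarrow> P S \<Longrightarrow> P (insert i S)"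
  shows "P S"
proof -
  have "finite S" using assms(1) fin by (rule finite_subset)
  then show ?thesis using assms(1)
    by (induction S rule: finite_induct) (use assms(2,3) in auto)
qed

lemma Pol_commute:
  assumes "S \<subseteq> T" "\<And>i. i \<in> S \<Longrightarrow> z * Z i = Z i * z"
  shows "z * Pol Z S k = Pol Z S k * z"
  using assms
proof (induction arbitrary: k rule: Pol_induct)
  case (insert i S)
  have IH: "z * Pol Z S k = Pol Z S k * z" for k using insert by blast
  have "z * prev (Pol Z S) k = prev (Pol Z S) k * z" by (cases k) (simp_all add: IH)
  moreover have "z * (Z i * Pol Z S k) = Z i * Pol Z S k * z" using IH insert.prems[of i] by (metis insertI1 mult.assoc)
  ultimately show ?case using insert by (simp add: Pol_insert algebra_simps)
qed (simp add: Pol_empty)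

lemma Pol_in_subalg:
  assumes "subalg D" "S \<subseteq> T" "\<And>i. i \<in> S \<Longrightarrow> Z i \<in> D"
  shows "Pol Z S k \<in> D"
  using assms(2,3)
proof (induction arbitrary: k rule: Pol_induct)
  case (insert i S)
  have "prev (Pol Z S) k \<in> D" using insert assms(1) by (cases k) (auto intro: subalg_0)
  then show ?case using insert assms(1) by (auto simp: Pol_insert intro!: subalg_diff subalg_mult)
qed (simp add: Pol_empty subalg_1 subalg_0 assms(1))

lemma Pol_high: "S \<subseteq> T \<Longrightarrow> k > card S \<Longrightarrow> Pol Z S k = 0"
proof (induction arbitrary: k rule: Pol_induct)
  case (insert i S)
  then show ?case by (cases k) (simp_all add: Pol_insert)
qed (simp add: Pol_empty)

lemma Pol_lead: "S \<subseteq> T \<Longrightarrow> Pol Z S (card S) = 1"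
proof (induction rule: Pol_induct)
  case (insert i S)
  then show ?case by (simp add: Pol_insert Pol_high)
qed (simp add: Pol_empty)

text \<open>Evaluation with the argument to the right of the coefficients. It is multiplicative in
  the linear factors only for arguments commuting with the roots involved, as in
  \<open>ev_insert\<close>.\<close>

definition ev :: "nat set \<Rightarrow> 'r \<Rightarrow> 'r" where
  "ev S z = (\<Sum>k\<le>card S. Pol Z S k * z ^ k)"

lemma ev_insert:
  assumes "insert i S \<subseteq> T" "i \<notin> S" "z * Z i = Z i * z"
  shows "ev (insert i S) z = ev S z * (z - Z i)"
proof -
  have S: "finite S" "S \<subseteq> T" using assms(1) fin finite_subset by auto
  have Zi: "Z i * ev S z = ev S z * Z i"
  proof -
    have "Z i * Pol Z S k = Pol Z S k * Z i" for k
      using assms(1) S by (intro Pol_commute ZZ) auto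
    moreover have "Z i * z ^ k = z ^ k * Z i" for k using power_commuting_commutes[OF assms(3), of k] by simp
    ultimately have "Z i * (Pol Z S k * z ^ k) = Pol Z S k * z ^ k * Z i" for k by (metis mult.assoc)
    then show ?thesis by (simp add: ev_def sum_distrib_left sum_distrib_right)
  qed
  have "ev (insert i S) z = (\<Sum>k\<le>Suc (card S). prev (Pol Z S) k * z ^ k) - (\<Sum>k\<le>Suc (card S). Z i * (Pol Z S k * z ^ k))"
    unfolding ev_def using assms S
    by (simp add: Pol_insert left_diff_distrib sum_subtractf mult.assoc)
  also have "(\<Sum>k\<le>Suc (card S). prev (Pol Z S) k * z ^ k) = ev S z * z"
    by (subst sum.atMost_Suc_shift) (simp add: ev_def sum_distrib_right mult.assoc power_commutes)
  also have "(\<Sum>k\<le>Suc (card S). Z i * (Pol Z S k * z ^ k)) = Z i * ev S z"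
    using S by (simp add: ev_def Pol_high sum_distrib_left)
  finally show ?thesis by (simp add: Zi right_diff_distrib)
qed

lemma ev_empty: "ev {} z = 1"
  by (simp add: ev_def Pol_empty)

lemma ev_commute:
  assumes "S \<subseteq> T" "\<And>i. i \<in> S \<Longrightarrow> w * Z i = Z i * w" "w * z = z * w"
  shows "w * ev S z = ev S z * w"
proof -
  have "w * Pol Z S k = Pol Z S k * w" for k by (rule Pol_commute) (use assms in auto)
  moreover have "w * z ^ k = z ^ k * w" for k using power_commuting_commutes[OF assms(3)[symmetric], of k] by simp
  ultimately have "w * (Pol Z S k * z ^ k) = Pol Z S k * z ^ k * w" for k by (metis mult.assoc)
  then show ?thesis by (simp add: ev_def sum_distrib_left sum_distrib_right)
qed

lemma ev_root:
  assumes "S \<subseteq> T" "i \<in> S"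
  shows "ev S (Z i) = 0"
proof -
  have S: "S = insert i (S - {i})" using assms by blast
  have "ev (insert i (S - {i})) (Z i) = ev (S - {i}) (Z i) * (Z i - Z i)"
    by (rule ev_insert) (use assms in auto)
  then show ?thesis using S by simp
qed

lemma ev_invt:
  assumes "S \<subseteq> T" "\<And>i. i \<in> S \<Longrightarrow> z * Z i = Z i * z" "\<And>i. i \<in> S \<Longrightarrow> invt (z - Z i)"
  shows "invt (ev S z)"
  using assms
proof (induction rule: Pol_induct)
  case (insert i S)
  then show ?case by (simp add: ev_insert)
qed (simp add: ev_empty)

text \<open>If conjugation by \<open>Y\<close> scales all roots by \<open>t\<close>, it turns a
  monic polynomial \<open>P(z)\<close> of degree \<open>d\<close> into
  \<open>t^d P(z/t)\<close>.\<close>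

lemma Pol_weight:
  assumes "S \<subseteq> T" "\<And>i. i \<in> S \<Longrightarrow> Y * Z i = t *s (Z i * Y)"
  shows "t ^ k *s (Y * Pol Z S k) = t ^ card S *s (Pol Z S k * Y)"
  using assms
proof (induction arbitrary: k rule: Pol_induct)
  case (insert i S)
  have IH: "t ^ k *s (Y * Pol Z S k) = t ^ card S *s (Pol Z S k * Y)" for k using insert by blast
  have 1: "t ^ k *s (Y * prev (Pol Z S) k) = t ^ Suc (card S) *s (prev (Pol Z S) k * Y)"
  proof (cases k)
    case (Suc l)
    have "t ^ k *s (Y * prev (Pol Z S) k) = t *s t ^ l *s (Y * Pol Z S l)" by (simp add: Suc)
    also have "\<dots> = t ^ Suc (card S) *s (prev (Pol Z S) k * Y)" unfolding IH by (simp add: Suc)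
    finally show ?thesis .
  qed simp
  have 2: "t ^ k *s (Y * (Z i * Pol Z S k)) = t ^ Suc (card S) *s (Z i * Pol Z S k * Y)"
  proof -
    have "Y * (Z i * Pol Z S k) = t *s (Z i * (Y * Pol Z S k))"
      using insert.prems[of i] by (simp flip: mult.assoc)
    then have "t ^ k *s (Y * (Z i * Pol Z S k)) = t *s (Z i * (t ^ k *s (Y * Pol Z S k)))"
      by (simp add: mult.commute)
    also have "\<dots> = t ^ Suc (card S) *s (Z i * Pol Z S k * Y)" unfolding IH by (simp add: mult.assoc)
    finally show ?thesis .
  qed
  have "t ^ k *s (Y * Pol Z (insert i S) k) = t ^ Suc (card S) *s (Pol Z (insert i S) k * Y)"
    using 1 2 insert.hyps by (simp add: Pol_insert left_diff_distrib right_diff_distrib scale_right_diff_distrib)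
  then show ?case using insert.hyps by simp
qed (simp add: Pol_empty)

lemma Pol_0_twist:
  assumes "S \<subseteq> T" "i \<in> S" "Y * Z i = c *s (Z i * Y)" "\<And>j. j \<in> S \<Longrightarrow> j \<noteq> i \<Longrightarrow> Y * Z j = Z j * Y"
  shows "Y * Pol Z S 0 = c *s (Pol Z S 0 * Y)"
proof -
  have S: "insert i (S - {i}) = S" using assms by blast
  have P: "Pol Z S 0 = - (Z i * Pol Z (S - {i}) 0)"
    using Pol_insert[of i "S - {i}" 0] assms(1,2) unfolding S by auto
  have "Y * Pol Z (S - {i}) 0 = Pol Z (S - {i}) 0 * Y" by (rule Pol_commute) (use assms in auto)
  then have "Y * (Z i * Pol Z (S - {i}) 0) = c *s (Z i * Pol Z (S - {i}) 0 * Y)"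
    using assms(3) by (metis mult.assoc mult_scale_left)
  then show ?thesis by (simp add: P scale_minus_right)
qed

lemma Pol_0_invt:
  assumes "S \<subseteq> T" "\<And>i. i \<in> S \<Longrightarrow> invt (Z i)"
  shows "invt (Pol Z S 0)"
  using assms
proof (induction rule: Pol_induct)
  case (insert i S)
  then have "invt ((-1) *s (Z i * Pol Z S 0))" by (intro invt_scale) auto
  then show ?case using insert by (simp add: Pol_insert)
qed (simp add: Pol_empty)

text \<open>Up to sign both sides are the product of the \<open>m\<close>-th powers of the commuting
  roots.\<close>

lemma Pol_0_power:
  assumes "S \<subseteq> T"
  shows "\<exists>c. Pol (\<lambda>i. Z i ^ m) S 0 = c *s Pol Z S 0 ^ m"
  using assms
proof (induction rule: Pol_induct)
  case empty
  interpret m: commuting_family scale "\<lambda>i. Z i ^ m" T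
    by unfold_locales (use ZZ fin in \<open>metis power_commuting_commutes\<close>)+
  show ?case by (rule exI[of _ 1]) (simp add: Pol_empty m.Pol_empty)
next
  case (insert i S)
  interpret m: commuting_family scale "\<lambda>i. Z i ^ m" T
    by unfold_locales (use ZZ fin in \<open>metis power_commuting_commutes\<close>)+
  obtain c where c: "Pol (\<lambda>i. Z i ^ m) S 0 = c *s Pol Z S 0 ^ m" using insert by blast
  have comm: "Z i * Pol Z S 0 = Pol Z S 0 * Z i" using insert by (intro Pol_commute ZZ) auto
  have "Pol Z (insert i S) 0 = (-1) *s (Z i * Pol Z S 0)" using insert by (simp add: Pol_insert)
  then have "Pol Z (insert i S) 0 ^ m = (-1) ^ m *s (Z i ^ m * Pol Z S 0 ^ m)"
    by (simp only: power_scale power_mult_commuting[OF comm])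
  then have "(- c * (-1) ^ m) *s Pol Z (insert i S) 0 ^ m = (- c) *s (Z i ^ m * Pol Z S 0 ^ m)"
    by (simp flip: power_mult_distrib)
  also have "\<dots> = Pol (\<lambda>i. Z i ^ m) (insert i S) 0"
    using insert by (simp add: m.Pol_insert c)
  finally show ?case by metis
qed

lemma Pol_equivariant:
  assumes \<theta>: "\<And>r s. r \<in> D \<Longrightarrow> s \<in> D \<Longrightarrow> \<theta> (r + s) = \<theta> r + \<theta> s \<and> \<theta> (r * s) = \<theta> r * \<theta> s"
    "\<And>c r. r \<in> D \<Longrightarrow> \<theta> (c *s r) = c *s \<theta> r" "\<theta> 1 = 1"
    and D: "subalg D" "\<And>i. i \<in> T \<Longrightarrow> Z i \<in> D"
    and \<sigma>: "\<sigma> permutes T" and \<theta>Z: "\<And>i. i \<in> T \<Longrightarrow> \<theta> (Z i) = Z (\<sigma> i)" and S: "S \<subseteq> T"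
  shows "\<theta> (Pol Z S k) = Pol Z (\<sigma> ` S) k"
  using S
proof (induction arbitrary: k rule: Pol_induct)
  case empty
  have "\<theta> 0 = 0" using \<theta>(2)[of 0 0] D subalg_0 by simp
  then show ?case by (simp add: Pol_empty \<theta>(3))
next
  case (insert i S)
  have "\<theta> 0 = 0" using \<theta>(2)[of 0 0] D subalg_0 by simp
  then have prev: "\<theta> (prev (Pol Z S) k) = prev (Pol Z (\<sigma> ` S)) k" using insert by (cases k) simp_all
  have mem: "Pol Z S k \<in> D" for k by (rule Pol_in_subalg) (use D insert in auto)
  then have pm: "prev (Pol Z S) k \<in> D" using D subalg_0 by (cases k) simp_all
  have i: "i \<in> T" using insert by auto
  have "\<theta> (- r) = - \<theta> r" if "r \<in> D" for r using \<theta>(2)[OF that, of "-1"] by simp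
  then have "\<theta> (prev (Pol Z S) k + - (Z i * Pol Z S k)) = \<theta> (prev (Pol Z S) k) + - (\<theta> (Z i) * \<theta> (Pol Z S k))"
    using \<theta>(1)[OF pm subalg_uminus[OF D(1) subalg_mult[OF D(1) D(2)[OF i] mem[of k]]]]
      \<theta>(1)[OF D(2)[OF i] mem[of k]] subalg_mult[OF D(1) D(2)[OF i] mem[of k]] by simp
  then have "\<theta> (Pol Z (insert i S) k) = prev (Pol Z (\<sigma> ` S)) k - Z (\<sigma> i) * Pol Z (\<sigma> ` S) k"
    using insert i by (simp add: Pol_insert prev \<theta>Z)
  also have "\<dots> = Pol Z (insert (\<sigma> i) (\<sigma> ` S)) k"
  proof (rule Pol_insert[symmetric])
    show "insert (\<sigma> i) (\<sigma> ` S) \<subseteq> T" using \<sigma> insert(1) by (auto simp: permutes_in_image)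
    show "\<sigma> i \<notin> \<sigma> ` S" using permutes_inj[OF \<sigma>] insert(2) by (auto simp: inj_def)
  qed
  finally show ?case by simp
qed

lemma Pol_0_equivariant:
  assumes \<theta>: "\<And>r s. r \<in> D \<Longrightarrow> s \<in> D \<Longrightarrow> \<theta> (r + s) = \<theta> r + \<theta> s \<and> \<theta> (r * s) = \<theta> r * \<theta> s"
    "\<And>c r. r \<in> D \<Longrightarrow> \<theta> (c *s r) = c *s \<theta> r" "\<theta> 1 = 1"
    and D: "subalg D" "\<And>i. i \<in> T \<Longrightarrow> Z i \<in> D"
    and \<sigma>: "\<sigma> permutes T" and \<theta>Z: "\<And>i. i \<in> T \<Longrightarrow> \<theta> (Z i) = \<alpha> i *s Z (\<sigma> i)" and S: "S \<subseteq> T"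
  shows "\<theta> (Pol Z S 0) = (\<Prod>i\<in>S. \<alpha> i) *s Pol Z (\<sigma> ` S) 0"
  using S
proof (induction rule: Pol_induct)
  case empty
  then show ?case by (simp add: Pol_empty \<theta>(3))
next
  case (insert i S)
  have mem: "Pol Z S k \<in> D" for k by (rule Pol_in_subalg) (use D insert in auto)
  have i: "i \<in> T" using insert by auto
  have "\<theta> (- r) = - \<theta> r" if "r \<in> D" for r using \<theta>(2)[OF that, of "-1"] by simp
  then have "\<theta> (- (Z i * Pol Z S 0)) = - (\<theta> (Z i) * \<theta> (Pol Z S 0))"
    using \<theta>(1)[OF D(2)[OF i] mem[of 0]] subalg_mult[OF D(1) D(2)[OF i] mem[of 0]] by simp
  then have "\<theta> (Pol Z (insert i S) 0) = (\<Prod>i\<in>insert i S. \<alpha> i) *s (- (Z (\<sigma> i) * Pol Z (\<sigma> ` S) 0))"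
    using insert i by (simp add: Pol_insert \<theta>Z scale_minus_right mult.commute)
  also have "- (Z (\<sigma> i) * Pol Z (\<sigma> ` S) 0) = Pol Z (insert (\<sigma> i) (\<sigma> ` S)) 0"
  proof (subst Pol_insert)
    show "insert (\<sigma> i) (\<sigma> ` S) \<subseteq> T" using \<sigma> insert(1) by (auto simp: permutes_in_image)
    show "\<sigma> i \<notin> \<sigma> ` S" using permutes_inj[OF \<sigma>] insert(2) by (auto simp: inj_def)
  qed simp
  finally show ?case by simp
qed

end

section \<open>The interpolation polynomials attached to a q-commuting family\<close>

locale q_system = assoc_algebra scale
  for scale :: "'f::field_char_0 \<Rightarrow> 'r::ring_1 \<Rightarrow> 'r" (infixr \<open>*s\<close> 75) +
  fixes D :: "'r set" and q :: 'f and n m :: nat and x y :: "nat \<Rightarrow> 'r"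
  assumes D: "divsub D" and q0: "q \<noteq> 0" and q_generic: "\<not> root_of_unity q" and m: "m > 0" and n: "n > 0"
    and xyD: "\<And>i. i \<in> {1..n} \<Longrightarrow> x i \<in> D \<and> y i \<in> D \<and> x i \<noteq> 0 \<and> y i \<noteq> 0"
    and xx: "\<And>i j. i \<in> {1..n} \<Longrightarrow> j \<in> {1..n} \<Longrightarrow> x i * x j = x j * x i"
    and yy: "\<And>i j. i \<in> {1..n} \<Longrightarrow> j \<in> {1..n} \<Longrightarrow> y i * y j = y j * y i"
    and yx: "\<And>i j. i \<in> {1..n} \<Longrightarrow> j \<in> {1..n} \<Longrightarrow> y i * x j = (if i = j then q else 1) *s (x j * y i)"
begin

abbreviation "T \<equiv> {1..n}"

definition "t = q ^ m"
definition "X i = x i ^ m"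

lemmas subD = divsub_subalg[OF D]

lemma x_invt: "i \<in> T \<Longrightarrow> invt (x i)" and y_invt: "i \<in> T \<Longrightarrow> invt (y i)"
  using divsub_invt[OF D] xyD by auto

lemma q_pow: "k > 0 \<Longrightarrow> q ^ k \<noteq> 1"
  using q_generic unfolding root_of_unity_def by blast

lemma t0: "t \<noteq> 0" and t_pow: "k > 0 \<Longrightarrow> t ^ k \<noteq> 1"
  using q0 q_pow[of "m * k"] m by (auto simp: t_def power_mult)

lemma t1: "t \<noteq> 1" using t_pow[of 1] by simp

lemma X_comm_x: "i \<in> T \<Longrightarrow> j \<in> T \<Longrightarrow> X i * x j = x j * X i"
  unfolding X_def using power_commuting_commutes[OF xx] by blast

lemma XX: "i \<in> T \<Longrightarrow> j \<in> T \<Longrightarrow> X i * X j = X j * X i"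
  unfolding X_def[of j] using power_commuting_commutes[of "x j" "X i"] X_comm_x[of i j] by simp

sublocale XF: commuting_family scale X T
  by unfold_locales (use XX in auto)

sublocale xF: commuting_family scale x T
  by unfold_locales (use xx in auto)

sublocale yF: commuting_family scale y T
  by unfold_locales (use yy in auto)

lemma XD: "i \<in> T \<Longrightarrow> X i \<in> D"
  unfolding X_def using xyD subalg_power[OF subD] by blast

lemma X_invt: "i \<in> T \<Longrightarrow> invt (X i)"
  unfolding X_def using x_invt by simp

lemma twist_power: "b * a = c *s (a * b) \<Longrightarrow> b * a ^ k = c ^ k *s (a ^ k * b)"
proof (induction k)
  case (Suc k)
  have "b * a ^ Suc k = c *s (a * (b * a ^ k))" using Suc.prems by (simp flip: mult.assoc)
  then show ?case using Suc by (simp add: mult.assoc)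
qed simp

lemma yX: "i \<in> T \<Longrightarrow> j \<in> T \<Longrightarrow> y i * X j = (if i = j then t else 1) *s (X j * y i)"
  unfolding X_def t_def using twist_power[OF yx] by auto

text \<open>Conjugation by \<open>y'\<close> fixes \<open>w\<close> but multiplies \<open>z\<close>
  by \<open>s \<noteq> 1\<close>, so the two are not proportional.\<close>

lemma lin_comb_nonzero:
  assumes "y' * z = s *s (z * y')" "y' * w = w * y'" "s \<noteq> 1" "invt z" "invt y'" "c \<noteq> 0"
  shows "c *s z \<noteq> d *s w"
proof
  assume eq: "c *s z = d *s w"
  have "y' * (c *s z) = (c * s) *s (z * y')" using assms by simp
  moreover have "y' * (d *s w) = d *s w * y'" using assms by simp
  ultimately have "(c * s) *s (z * y') = c *s (z * y')" using eq by (metis mult_scale_left)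
  then have "(c * s - c) *s (z * y') = 0" by (simp add: scale_left_diff_distrib)
  moreover have "c * s - c \<noteq> 0" using assms(3,6) by simp
  moreover have "z * y' \<noteq> 0" by (rule invt_neq_0[OF invt_mult]) (use assms in auto)
  ultimately show False using scale_eq_0_iff by blast
qed

lemma lin_comb_invt:
  assumes "i \<in> T" "j \<in> T" "i \<noteq> j" "c \<noteq> 0"
  shows "invt (c *s X i - d *s X j)"
proof -
  have "c *s X i \<noteq> d *s X j"
    by (rule lin_comb_nonzero[of "y i" _ t]) (use assms yX[of i i] yX[of i j] t1 X_invt y_invt in auto)
  then have "c *s X i - d *s X j \<noteq> 0" by simp
  moreover have "c *s X i - d *s X j \<in> D"
    by (intro subalg_diff subalg_scale subD XD assms)
  ultimately show ?thesis by (rule divsub_invt[OF D, rotated])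
qed

lemma diff_invt: "i \<in> T \<Longrightarrow> j \<in> T \<Longrightarrow> i \<noteq> j \<Longrightarrow> invt (X i - X j)"
  using lin_comb_invt[of i j 1 1] by simp

text \<open>Lagrange interpolation: \<open>N i\<close> is \<open>A\<close> without its
  \<open>i\<close>-th root, \<open>d i\<close> is the value of \<open>N i\<close> at
  \<open>X i\<close>, and \<open>C(z)\<close> is the sum of the \<open>N i (z) (d i)^-1 y i\<close>.
  As the \<open>y i\<close> stand on the right, evaluation at \<open>X i\<close> gives
  \<open>y i\<close> only up to the factor \<open>\<kappa> i\<close> below.\<close>

definition "A = Pol X T"
definition "N i = Pol X (T - {i})"
definition "d i = XF.ev (T - {i}) (X i)"
definition "u i = rinv (d i) * y i"
definition "C k = (\<Sum>i\<in>T. N i k * u i)"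

lemma ev_in_subalg:
  "subalg S' \<Longrightarrow> S \<subseteq> T \<Longrightarrow> (\<And>i. i \<in> S \<Longrightarrow> X i \<in> S') \<Longrightarrow> z \<in> S' \<Longrightarrow> XF.ev S z \<in> S'"
  unfolding XF.ev_def by (intro subalg_sum subalg_mult subalg_power XF.Pol_in_subalg) auto

lemma ev_D: "S \<subseteq> T \<Longrightarrow> z \<in> D \<Longrightarrow> XF.ev S z \<in> D"
  by (rule ev_in_subalg[OF subD]) (auto intro: XD)

lemma ev_scaled_invt: "i \<in> T \<Longrightarrow> c \<noteq> 0 \<Longrightarrow> i \<notin> S \<Longrightarrow> S \<subseteq> T \<Longrightarrow> invt (XF.ev S (c *s X i))"
  by (rule XF.ev_invt) (use XX lin_comb_invt[of i _ c 1] in \<open>auto simp: subset_iff\<close>)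

lemma d_invt: "i \<in> T \<Longrightarrow> invt (d i)"
  unfolding d_def using ev_scaled_invt[of i 1 "T - {i}"] by auto

lemma dD: "i \<in> T \<Longrightarrow> d i \<in> D" and uD: "i \<in> T \<Longrightarrow> u i \<in> D"
  unfolding u_def d_def using ev_D XD xyD by (auto intro!: subalg_mult subD divsub_rinv D)

lemma ND: "N i k \<in> D"
  unfolding N_def by (rule XF.Pol_in_subalg[OF subD]) (auto intro: XD)

lemma NX: "j \<in> T \<Longrightarrow> N i k * X j = X j * N i k"
  unfolding N_def by (rule XF.Pol_commute[symmetric]) (auto intro: XX)

lemma Pol_Pol: "S \<subseteq> T \<Longrightarrow> S' \<subseteq> T \<Longrightarrow> Pol X S k * Pol X S' l = Pol X S' l * Pol X S k"
  by (rule XF.Pol_commute, simp, rule XF.Pol_commute[symmetric]) (auto intro: XX)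

lemma NN: "N i k * N j l = N j l * N i k"
  unfolding N_def by (rule Pol_Pol) auto

lemma A_N: "i \<in> T \<Longrightarrow> A k = prev (N i) k - X i * N i k"
  unfolding A_def N_def using XF.Pol_insert[of i "T - {i}"] by (simp add: insert_absorb)

lemma d_comm_X: "i \<in> T \<Longrightarrow> j \<in> T \<Longrightarrow> X j * d i = d i * X j"
  unfolding d_def by (rule XF.ev_commute) (auto intro: XX)

lemma uX: "i \<in> T \<Longrightarrow> j \<in> T \<Longrightarrow> u i * X j = (if i = j then t else 1) *s (X j * u i)"
proof -
  assume ij: "i \<in> T" "j \<in> T"
  have "X j * rinv (d i) = rinv (d i) * X j" using d_comm_X[OF ij] by (rule rinv_commute)
  then have "u i * X j = (if i = j then t else 1) *s (X j * rinv (d i) * y i)"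
    unfolding u_def by (simp add: mult.assoc yX[OF ij])
  then show ?thesis by (simp add: u_def mult.assoc)
qed

lemma u_N: "i \<in> T \<Longrightarrow> u i * N i k = N i k * u i"
  unfolding N_def by (rule XF.Pol_commute) (use uX in auto)

lemma u_prev_N: "i \<in> T \<Longrightarrow> u i * prev (N i) k = prev (N i) k * u i"
  by (cases k) (auto simp: u_N)

lemma uA: assumes "i \<in> T" shows "u i * A k = (prev (N i) k - t *s (X i * N i k)) * u i"
proof -
  have "u i * (X i * N i k) = t *s (X i * N i k * u i)"
    using uX[of i i] u_N assms by (simp flip: mult.assoc) (simp add: mult.assoc u_N)
  then show ?thesis using u_prev_N assms by (simp add: A_N[OF assms] algebra_simps)
qed

lemma prev_C: "prev C k = (\<Sum>i\<in>T. prev (N i) k * u i)"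
  by (cases k) (auto simp: C_def)

lemma u_prev_A: assumes "i \<in> T" shows "u i * prev A k = (prev (prev (N i)) k - t *s (X i * prev (N i) k)) * u i"
  using uA[OF assms] by (cases k) auto

lemma prev_A: "i \<in> T \<Longrightarrow> prev A k = prev (prev (N i)) k - X i * prev (N i) k"
  using A_N by (cases k) auto

text \<open>An identity between polynomials in commuting variables, to which the first relation
  reduces when \<open>u i\<close> is moved to the right; \<open>a\<close> stands for
  \<open>X i\<close> and the \<open>n1\<close> to \<open>n5\<close> for coefficients of
  \<open>N i\<close> and of its shifts. The next identity does the same for the second
  relation.\<close>

lemma rtt_identity1:
  fixes a n1 n2 n3 n4 n5 :: 'r
  assumes "\<And>r s. r \<in> {a, n1, n2, n3, n4, n5} \<Longrightarrow> s \<in> {a, n1, n2, n3, n4, n5} \<Longrightarrow> r * s = s * r"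
  shows "n1 * (n5 - t *s (a * n4)) - n2 * (n4 - t *s (a * n3))
    = (n5 - a * n4) * n1 - t *s ((n4 - a * n3) * n2) - (1 - t) *s ((n2 - a * n1) * n4)"
proof -
  have c: "n1 * a = a * n1" "n2 * a = a * n2" "n5 * n1 = n1 * n5" "n4 * n1 = n1 * n4" "n4 * n2 = n2 * n4" "n3 * n2 = n2 * n3"
    using assms by blast+
  have c': "n1 * (a * z) = a * (n1 * z)" "n2 * (a * z) = a * (n2 * z)" for z
    by (simp_all flip: mult.assoc add: c)
  show ?thesis by (simp add: algebra_simps c c')
qed

lemma rtt_identity2:
  fixes a n1 n2 n3 n4 n5 :: 'r
  assumes "\<And>r s. r \<in> {a, n1, n2, n3, n4, n5} \<Longrightarrow> s \<in> {a, n1, n2, n3, n4, n5} \<Longrightarrow> r * s = s * r"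
  shows "t *s ((n2 - a * n1) * n4) - t *s ((n5 - a * n2) * n3)
    = n4 * (n2 - t *s (a * n1)) - t *s (n3 * (n5 - t *s (a * n2))) - (1 - t) *s (n2 * (n4 - t *s (a * n3)))"
proof -
  have c: "n4 * a = a * n4" "n3 * a = a * n3" "n2 * a = a * n2" "n5 * n3 = n3 * n5" "n4 * n1 = n1 * n4" "n4 * n2 = n2 * n4" "n3 * n2 = n2 * n3"
    using assms by blast+
  have c': "n4 * (a * z) = a * (n4 * z)" "n3 * (a * z) = a * (n3 * z)" "n2 * (a * z) = a * (n2 * z)" for z
    by (simp_all flip: mult.assoc add: c)
  show ?thesis by (simp add: algebra_simps c c')
qed

text \<open>The identity behind commutativity of the \<open>C k\<close>: \<open>a\<close> and
  \<open>b\<close> are two of the \<open>X i\<close>, the \<open>m1\<close>, \<open>m2\<close> are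
  coefficients of the polynomial over the remaining roots, and \<open>p1\<close>, \<open>p2\<close>
  are their shifts.\<close>

lemma rtt_identity3:
  fixes a b p1 p2 m1 m2 :: 'r
  assumes "\<And>r s. r \<in> {a, b, p1, p2, m1, m2} \<Longrightarrow> s \<in> {a, b, p1, p2, m1, m2} \<Longrightarrow> r * s = s * r"
  shows "(p1 - b * m1) * (p2 - t *s (a * m2)) - (p2 - b * m2) * (p1 - t *s (a * m1))
    = (p1 * m2 - m1 * p2) * (b - t *s a)"
proof -
  have c: "p1 * a = a * p1" "p2 * a = a * p2" "m1 * a = a * m1" "m2 * a = a * m2"
    "p1 * b = b * p1" "p2 * b = b * p2" "m1 * b = b * m1" "m2 * b = b * m2" "b * a = a * b"
    "p2 * p1 = p1 * p2" "m2 * m1 = m1 * m2" "m1 * p2 = p2 * m1" "m2 * p1 = p1 * m2"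
    using assms by blast+
  have c': "p1 * (a * z) = a * (p1 * z)" "p2 * (a * z) = a * (p2 * z)" "m1 * (a * z) = a * (m1 * z)" "m2 * (a * z) = a * (m2 * z)"
    "p1 * (b * z) = b * (p1 * z)" "p2 * (b * z) = b * (p2 * z)" "m1 * (b * z) = b * (m1 * z)" "m2 * (b * z) = b * (m2 * z)"
    "b * (a * z) = a * (b * z)" for z
    by (simp_all flip: mult.assoc add: c)
  show ?thesis by (simp add: algebra_simps c c')
qed

lemma comm_all:
  assumes "i \<in> T" "r \<in> {X i, N i k, prev (N i) k, N i l, prev (N i) l, prev (prev (N i)) l, prev (prev (N i)) k}"
    "s \<in> {X i, N i k, prev (N i) k, N i l, prev (N i) l, prev (prev (N i)) l, prev (prev (N i)) k}"
  shows "r * s = s * r"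
proof -
  have r: "r = X i \<or> r = 0 \<or> (\<exists>k. r = N i k)" if "r \<in> {X i, N i k, prev (N i) k, N i l, prev (N i) l, prev (prev (N i)) l, prev (prev (N i)) k}" for r
    using that by (auto simp: prev_def split: nat.splits)
  show ?thesis using r[OF assms(2)] r[OF assms(3)] NX[OF assms(1)] NN by auto
qed

lemma N_u_A:
  assumes "l \<in> T"
  shows "N l a * u l * prev A b = N l a * (prev (prev (N l)) b - t *s (X l * prev (N l) b)) * u l"
    and "N l a * u l * A b = N l a * (prev (N l) b - t *s (X l * N l b)) * u l"
    and "prev (N l) a * u l * A b = prev (N l) a * (prev (N l) b - t *s (X l * N l b)) * u l"
  by (simp_all only: mult.assoc u_prev_A[OF assms] uA[OF assms])

text \<open>The relation is linear in \<open>C\<close>, so it can be checked for each summand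
  \<open>N l u l\<close> separately; only the powers of \<open>t\<close> from moving
  \<open>u l\<close> past \<open>X l\<close> make it noncommutative.\<close>

lemma form1: "C j * prev A i - prev C j * A i
    = prev A i * C j - t *s (A i * prev C j) - (1 - t) *s (A j * prev C i)"
proof -
  have "(N l j * u l) * prev A i - (prev (N l) j * u l) * A i
      = prev A i * (N l j * u l) - t *s (A i * (prev (N l) j * u l)) - (1 - t) *s (A j * (prev (N l) i * u l))"
    if l: "l \<in> T" for l
  proof -
    have "(N l j * (prev (prev (N l)) i - t *s (X l * prev (N l) i)) - prev (N l) j * (prev (N l) i - t *s (X l * N l i))) * u l
      = ((prev (prev (N l)) i - X l * prev (N l) i) * N l j - t *s ((prev (N l) i - X l * N l i) * prev (N l) j)
         - (1 - t) *s ((prev (N l) j - X l * N l j) * prev (N l) i)) * u l"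
      by (subst rtt_identity1) (use comm_all[OF l, where k = j and l = i] in blast, rule refl)
    then show ?thesis
      unfolding N_u_A[OF l]
      by (simp only: prev_A[OF l] A_N[OF l] mult.assoc left_diff_distrib mult_scale_left)
  qed
  then show ?thesis
    unfolding C_def prev_C sum_distrib_left sum_distrib_right scale_sum_right sum_subtractf[symmetric]
    by (intro sum.cong) auto
qed

lemma form2: "t *s (A j * prev C i) - t *s (prev A j * C i)
    = prev C i * A j - t *s (C i * prev A j) - (1 - t) *s (prev C j * A i)"
proof -
  have "t *s (A j * (prev (N l) i * u l)) - t *s (prev A j * (N l i * u l))
      = (prev (N l) i * u l) * A j - t *s ((N l i * u l) * prev A j) - (1 - t) *s ((prev (N l) j * u l) * A i)"
    if l: "l \<in> T" for l
  proof -
    have "(t *s ((prev (N l) j - X l * N l j) * prev (N l) i) - t *s ((prev (prev (N l)) j - X l * prev (N l) j) * N l i)) * u l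
      = (prev (N l) i * (prev (N l) j - t *s (X l * N l j)) - t *s (N l i * (prev (prev (N l)) j - t *s (X l * prev (N l) j)))
        - (1 - t) *s (prev (N l) j * (prev (N l) i - t *s (X l * N l i)))) * u l"
      by (subst rtt_identity2) (use comm_all[OF l, where k = j and l = i] in blast, rule refl)
    then show ?thesis
      unfolding N_u_A[OF l]
      by (simp only: prev_A[OF l] A_N[OF l] mult.assoc left_diff_distrib mult_scale_left)
  qed
  then show ?thesis
    unfolding C_def prev_C sum_distrib_left sum_distrib_right scale_sum_right sum_subtractf[symmetric]
    by (intro sum.cong) auto
qed

text \<open>The factor arises when \<open>y i\<close> passes the factor \<open>X j - X i\<close> of
  \<open>d j\<close> and turns it into \<open>X j - t X i\<close>. What remains is symmetric in
  \<open>i\<close> and \<open>j\<close> except for the sign of \<open>X i - X j\<close>.\<close>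

lemma u_u:
  assumes ij: "i \<in> T" "j \<in> T" "i \<noteq> j"
  shows "(X j - t *s X i) * (u i * u j) = - ((X i - t *s X j) * (u j * u i))"
proof -
  \<comment> \<open>The part of \<open>d k\<close> that involves neither \<open>X i - X j\<close>
    nor its negative; \<open>y\<close> with the other index commutes with it.\<close>
  define F where "F k = XF.ev (T - {i, j}) (X k)" for k
  have F_inv: "invt (F i)" "invt (F j)"
    unfolding F_def using ev_scaled_invt[of i 1 "T - {i, j}"] ev_scaled_invt[of j 1 "T - {i, j}"] ij by auto
  have FX: "X l * F k = F k * X l" if "l \<in> T" "k \<in> T" for k l
    unfolding F_def by (rule XF.ev_commute) (use that XX in auto)
  have FF: "F i * F j = F j * F i"
    unfolding F_def[of j] by (rule XF.ev_commute) (use FX ij in auto)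
  have dF: "d k = F k * (X k - X l)" if kl: "{k, l} = {i, j}" "k \<noteq> l" for k l
  proof -
    have T: "T - {k} = insert l (T - {i, j})" using kl ij by auto
    show ?thesis unfolding d_def F_def T
      by (rule XF.ev_insert) (use kl ij XX in \<open>auto simp: doubleton_eq_iff\<close>)
  qed
  \<comment> \<open>Exchanging \<open>k\<close> and \<open>l\<close> changes the sign of the
    right-hand side, because the \<open>F\<close> and the \<open>y\<close> commute among
    themselves.\<close>
  have main: "(X l - t *s X k) * (u k * u l) = rinv (X k - X l) * (rinv (F k) * (rinv (F l) * (y k * y l)))"
    if kl: "{k, l} = {i, j}" "k \<noteq> l" for k l
  proof -
    have k: "k \<in> T" "l \<in> T" using kl ij by (auto simp: doubleton_eq_iff)
    have Fk: "invt (F k)" "invt (F l)" using F_inv kl by (auto simp: doubleton_eq_iff)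
    define z where "z = X l - t *s X k"
    have z: "invt z" unfolding z_def using lin_comb_invt[of l k 1 t] k kl by auto
    have xkl: "invt (X k - X l)" "invt (X l - X k)" using diff_invt k kl by auto
    have "y k * F l = F l * y k" unfolding F_def
      by (rule XF.ev_commute) (use yX k kl ij in \<open>auto simp: doubleton_eq_iff\<close>)
    moreover have "y k * (X l - X k) = z * y k"
      unfolding z_def using yX[of k l] yX[of k k] k kl by (simp add: algebra_simps)
    ultimately have yd: "y k * d l = F l * (z * y k)"
      using dF[of l k] kl by (simp add: insert_commute) (metis mult.assoc)
    have dl: "invt (d l)" using d_invt k by blast
    have "y k * rinv (d l) = rinv (F l * z) * (F l * (z * y k)) * rinv (d l)"
      using Fk z by (simp add: rinv_mult mult.assoc)
    also have "\<dots> = rinv (F l * z) * y k" using dl by (simp add: mult.assoc flip: yd)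
    finally have yrd: "y k * rinv (d l) = rinv z * (rinv (F l) * y k)"
      using Fk z by (simp add: rinv_mult mult.assoc)
    have rd: "rinv (d k) = rinv (X k - X l) * rinv (F k)" using dF[OF kl] Fk xkl by (simp add: rinv_mult)
    have "z * rinv (d k) = rinv (d k) * z"
      by (rule rinv_commute) (use d_comm_X k in \<open>simp add: z_def left_diff_distrib right_diff_distrib\<close>)
    then have "z * (u k * u l) = rinv (d k) * (z * ((y k * rinv (d l)) * y l))"
      unfolding u_def by (metis mult.assoc)
    also have "\<dots> = rinv (d k) * (rinv (F l) * (y k * y l))" unfolding yrd using z by (simp add: mult.assoc)
    finally show ?thesis unfolding rd z_def by (simp add: mult.assoc)
  qed
  have neg: "rinv (X i - X j) = - rinv (X j - X i)"
    by (rule rinv_eqI) (use diff_invt[of j i] ij in \<open>simp_all add: minus_diff_eq[of "X j" "X i", symmetric] del: minus_diff_eq\<close>)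
  have FFinv: "rinv (F i) * rinv (F j) = rinv (F j) * rinv (F i)"
    using FF F_inv by (metis rinv_mult)
  have "rinv (F i) * (rinv (F j) * (y i * y j)) = rinv (F j) * (rinv (F i) * (y j * y i))"
    using FFinv yy[of i j] ij by (simp flip: mult.assoc)
  then show ?thesis
    using main[of i j] main[of j i] ij neg by (simp add: insert_commute)
qed

text \<open>The commutator is a double sum of terms \<open>f i j\<close> that are antisymmetric in
  \<open>i\<close> and \<open>j\<close>, so twice the commutator vanishes.\<close>

lemma C_C: "C k * C l = C l * C k"
proof -
  define f where "f i j = N i k * u i * (N j l * u j) - N i l * u i * (N j k * u j)" for i j
  have anti: "f i j = - f j i" if ij: "i \<in> T" "j \<in> T" for i j
  proof (cases "i = j")
    case True
    have c: "u i * (N i k * z) = N i k * (u i * z)" for k z using u_N[OF ij(1)] by (metis mult.assoc)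
    have "N i k * (N i l * z) = N i l * (N i k * z)" for z using NN by (metis mult.assoc)
    then have "f i i = 0" unfolding f_def by (simp add: mult.assoc c)
    then show ?thesis using True by simp
  next
    case False
    define M where "M = Pol X (T - {i, j})"
    define E where "E = prev M k * M l - M k * prev M l"
    have MM: "M a * M b = M b * M a" for a b unfolding M_def by (rule Pol_Pol) auto
    have pM: "prev M a * M b = M b * prev M a" "prev M a * prev M b = prev M b * prev M a" for a b
      by (auto simp: prev_def MM split: nat.splits)
    have MX: "M a * X r = X r * M a" if "r \<in> T" for a r
      unfolding M_def by (rule XF.Pol_commute[symmetric]) (use that XX in auto)
    have pMX: "prev M a * X r = X r * prev M a" if "r \<in> T" for a r
      using MX[OF that] by (cases a) auto
    \<comment> \<open>\<open>E\<close> does not depend on the order of the two indices, so the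
      antisymmetry of \<open>f\<close> reduces to \<open>u_u\<close>.\<close>
    have main: "f r s = E * ((X s - t *s X r) * (u r * u s))" if rs: "{r, s} = {i, j}" "r \<noteq> s" for r s
    proof -
      have r: "r \<in> T" "s \<in> T" using rs ij by (auto simp: doubleton_eq_iff)
      have Nr: "N r a = prev M a - X s * M a" and Ns: "N s a = prev M a - X r * M a" for a
      proof -
        have "T - {r} = insert s (T - {i, j})" "T - {s} = insert r (T - {i, j})" using rs ij by (auto simp: doubleton_eq_iff)
        then show "N r a = prev M a - X s * M a" "N s a = prev M a - X r * M a"
          unfolding N_def M_def using rs r by (auto intro!: XF.Pol_insert simp: doubleton_eq_iff)
      qed
      have uM: "u r * M a = M a * u r" for a
        unfolding M_def by (rule XF.Pol_commute) (use uX r rs in \<open>auto simp: doubleton_eq_iff\<close>)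
      then have upM: "u r * prev M a = prev M a * u r" for a by (cases a) auto
      have "u r * (X r * M a) = t *s (X r * M a * u r)" for a
      proof -
        have "u r * (X r * M a) = u r * X r * M a" by (simp add: mult.assoc)
        also have "\<dots> = t *s (X r * (u r * M a))" using uX[of r r] r by (simp add: mult.assoc)
        finally show ?thesis by (simp add: uM mult.assoc)
      qed
      then have uN: "u r * N s a = (prev M a - t *s (X r * M a)) * u r" for a
        unfolding Ns by (simp add: left_diff_distrib right_diff_distrib upM)
      have "f r s = (N r k * (prev M l - t *s (X r * M l)) - N r l * (prev M k - t *s (X r * M k))) * (u r * u s)"
      proof -
        have "N r a * u r * (N s b * u s) = N r a * (prev M b - t *s (X r * M b)) * (u r * u s)" for a b
          using uN[of b] by (metis mult.assoc)
        then show ?thesis unfolding f_def by (simp add: left_diff_distrib)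
      qed
      also have "N r k * (prev M l - t *s (X r * M l)) - N r l * (prev M k - t *s (X r * M k)) = E * (X s - t *s X r)"
      proof -
        have el: "w = X r \<or> w = X s \<or> w = 0 \<or> (\<exists>c. w = M c)"
          if "w \<in> {X r, X s, prev M k, prev M l, M k, M l}" for w
          using that by (auto simp: prev_def split: nat.splits)
        have "w * w' = w' * w" if "w \<in> {X r, X s, prev M k, prev M l, M k, M l}" "w' \<in> {X r, X s, prev M k, prev M l, M k, M l}" for w w'
          using el[OF that(1)] el[OF that(2)] MX[OF r(1)] MX[OF r(2)] XX[OF r] MM by auto
        from rtt_identity3[OF this] show ?thesis unfolding E_def Nr .
      qed
      finally show ?thesis by (simp add: mult.assoc)
    qed
    show ?thesis
      using main[of i j] main[of j i] u_u[OF ij False] False by (simp add: insert_commute)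
  qed
  have eq: "C k * C l - C l * C k = (\<Sum>i\<in>T. \<Sum>j\<in>T. f i j)"
    unfolding C_def f_def by (simp add: sum_product sum_subtractf)
  have "(\<Sum>i\<in>T. \<Sum>j\<in>T. f i j) = (\<Sum>i\<in>T. \<Sum>j\<in>T. - f j i)" by (intro sum.cong refl anti)
  also have "\<dots> = - (\<Sum>j\<in>T. \<Sum>i\<in>T. f j i)" by (subst sum.swap) (simp add: sum_negf)
  finally have "(\<Sum>i\<in>T. \<Sum>j\<in>T. f i j) + (\<Sum>i\<in>T. \<Sum>j\<in>T. f i j) = 0"
    by (simp only: eq_neg_iff_add_eq_0)
  \<comment> \<open>Characteristic zero lets the factor 2 be cancelled.\<close>
  then have "2 *s (\<Sum>i\<in>T. \<Sum>j\<in>T. f i j) = 0"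
    using scale_left_distrib[of 1 1 "\<Sum>i\<in>T. \<Sum>j\<in>T. f i j"] by simp
  then show ?thesis using eq by simp
qed

lemma lax_AC: "lax D t n A C"
  unfolding lax_def
proof (intro conjI allI impI)
  show "A i \<in> D" for i unfolding A_def by (rule XF.Pol_in_subalg[OF subD]) (auto intro: XD)
  show "C i \<in> D" for i unfolding C_def by (intro subalg_sum subalg_mult subD ND uD)
  show "A i * A j = A j * A i" for i j unfolding A_def by (rule Pol_Pol) auto
  show "C i * C j = C j * C i" for i j by (rule C_C)
  show "A n = 1" unfolding A_def using XF.Pol_lead[of T] by simp
  show "A i = 0" if "i > n" for i unfolding A_def using XF.Pol_high[of T i] that by simp
  show "C i = 0" if "i \<ge> n" for i
    unfolding C_def N_def using that n by (intro sum.neutral) (auto simp: XF.Pol_high)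
qed (rule form1 form2)+

end

section \<open>Generators of the invariant division ring\<close>

context assoc_algebra
begin

text \<open>Index sets inside the natural numbers let all levels of the tower be described by spans
  of one type.\<close>

lemma lspan_reindex:
  assumes "finite I"
  shows "\<exists>(K::nat) e'. lspan Q I e = lspan Q {..<K} e'"
proof -
  obtain h where h: "bij_betw h {0..<card I} I" using ex_bij_betw_nat_finite[OF assms] by blast
  then have h: "bij_betw h {..<card I} I" by (simp add: atLeast0LessThan)
  have inj: "inj_on h {..<card I}" and im: "h ` {..<card I} = I" using h by (auto simp: bij_betw_def)
  have "lspan Q I e = lspan Q {..<card I} (e \<circ> h)"
  proof (intro equalityI subsetI)
    fix r assume "r \<in> lspan Q I e"
    then obtain c where c: "\<forall>i\<in>I. c i \<in> Q" "r = (\<Sum>i\<in>I. c i * e i)" by (auto simp: lspan_def)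
    then have "r = (\<Sum>k<card I. (c \<circ> h) k * (e \<circ> h) k)"
      using sum.reindex[OF inj, of "\<lambda>i. c i * e i"] im by (simp add: o_def)
    then show "r \<in> lspan Q {..<card I} (e \<circ> h)" using c im unfolding lspan_def by fastforce
  next
    fix r assume "r \<in> lspan Q {..<card I} (e \<circ> h)"
    then obtain c where c: "\<forall>k\<in>{..<card I}. c k \<in> Q" "r = (\<Sum>k<card I. c k * (e \<circ> h) k)" by (auto simp: lspan_def)
    define c' where "c' i = c (inv_into {..<card I} h i)" for i
    have "r = (\<Sum>k<card I. (\<lambda>i. c' i * e i) (h k))"
      unfolding c(2) c'_def by (intro sum.cong refl) (simp add: inv_into_f_f[OF inj])
    then have "r = (\<Sum>i\<in>I. c' i * e i)"
      using sum.reindex[OF inj, of "\<lambda>i. c' i * e i"] im by (simp add: o_def)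
    moreover have "\<forall>i\<in>I. c' i \<in> Q" using c(1) im unfolding c'_def by (metis inv_into_into)
    ultimately show "r \<in> lspan Q I e" unfolding lspan_def by blast
  qed
  then show ?thesis by blast
qed

end

locale q_noether = q_system scale D q n m x y
  for scale :: "'f::field_char_0 \<Rightarrow> 'r::ring_1 \<Rightarrow> 'r" (infixr \<open>*s\<close> 75) and D q n m x y +
  fixes p :: nat and \<zeta> :: 'f and \<theta> :: "(nat \<Rightarrow> nat) \<times> (nat \<Rightarrow> 'f) \<Rightarrow> 'r \<Rightarrow> 'r"
  assumes p: "p > 0" "p dvd m" and \<zeta>: "primitive_root_of_unity m \<zeta>"
    and D_gen: "D = dgen (x ` {1..n} \<union> y ` {1..n})"
    and \<theta>_hom: "\<And>g r s. g \<in> carrier (G_group m p n) \<Longrightarrow> r \<in> D \<Longrightarrow> s \<in> D \<Longrightarrow> \<theta> g (r + s) = \<theta> g r + \<theta> g s \<and> \<theta> g (r * s) = \<theta> g r * \<theta> g s"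
    and \<theta>_scale: "\<And>g c r. g \<in> carrier (G_group m p n) \<Longrightarrow> r \<in> D \<Longrightarrow> \<theta> g (c *s r) = c *s \<theta> g r"
    and \<theta>_one: "\<And>g. g \<in> carrier (G_group m p n) \<Longrightarrow> \<theta> g 1 = 1"
    and \<theta>_rinv: "\<And>g r. g \<in> carrier (G_group m p n) \<Longrightarrow> r \<in> D \<Longrightarrow> \<theta> g (rinv r) = rinv (\<theta> g r)"
    and \<theta>_xy: "\<And>\<sigma> \<alpha> i. (\<sigma>, \<alpha>) \<in> carrier (G_group m p n) \<Longrightarrow> i \<in> {1..n} \<Longrightarrow> \<theta> (\<sigma>, \<alpha>) (x i) = \<alpha> i *s x (\<sigma> i) \<and> \<theta> (\<sigma>, \<alpha>) (y i) = y (\<sigma> i)"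
begin

abbreviation "G \<equiv> carrier (G_group m p n) :: ((nat \<Rightarrow> nat) \<times> (nat \<Rightarrow> 'f)) set"

definition "l = m div p"
text \<open>Up to the sign \<open>(-1)^n\<close> this is \<open>x_1 ... x_n\<close>, and
  \<open>Y\<close> below is \<open>y_1 ... y_n\<close>; as constant terms of \<open>Pol\<close> they
  inherit its commutation and equivariance properties.\<close>

definition "\<Pi>x = Pol x T 0"
definition "e = \<Pi>x ^ l"
definition "Y = Pol y T 0"

lemma l: "p * l = m" "l > 0"
  using p m by (auto simp: l_def)

lemma G_iff: "(\<sigma>, \<alpha>) \<in> G \<longleftrightarrow> \<sigma> permutes T \<and> \<alpha> \<in> T \<rightarrow>\<^sub>E {z. z ^ m = 1} \<and> (\<Prod>i\<in>T. \<alpha> i) ^ l = 1"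
  by (auto simp: G_group_def A_tuples_def sym_group_def l_def)

lemma \<Pi>x_D: "\<Pi>x \<in> D" and Y_D: "Y \<in> D"
  unfolding \<Pi>x_def Y_def using xyD
  by (auto intro!: xF.Pol_in_subalg[OF subD] yF.Pol_in_subalg[OF subD])

lemma eD: "e \<in> D" unfolding e_def by (intro subalg_power subD \<Pi>x_D)

lemma \<Pi>x_invt: "invt \<Pi>x" and Y_invt: "invt Y"
  unfolding \<Pi>x_def Y_def using x_invt y_invt
  by (auto intro!: xF.Pol_0_invt yF.Pol_0_invt)

lemma e_invt: "invt e" unfolding e_def using \<Pi>x_invt by simp

lemma x_\<Pi>x: "i \<in> T \<Longrightarrow> x i * \<Pi>x = \<Pi>x * x i"
  unfolding \<Pi>x_def by (rule xF.Pol_commute) (auto intro: xx)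

lemma x_e: "i \<in> T \<Longrightarrow> x i * e = e * x i"
  unfolding e_def using power_commuting_commutes[of \<Pi>x "x i"] x_\<Pi>x[of i] by simp

lemma X_e: "i \<in> T \<Longrightarrow> e * X i = X i * e"
  unfolding X_def using power_commuting_commutes[of "x i" e] x_e[of i] by simp

lemma y_e: assumes "i \<in> T" shows "y i * e = q ^ l *s (e * y i)"
proof -
  have "y i * \<Pi>x = q *s (\<Pi>x * y i)"
    unfolding \<Pi>x_def by (rule xF.Pol_0_twist[of _ i]) (use assms yx in auto)
  then show ?thesis unfolding e_def by (rule twist_power)
qed

lemma A0_power: "\<exists>c. A 0 = c *s e ^ p"
proof -
  have "(\<Pi>x ^ l) ^ p = \<Pi>x ^ m" using l(1) by (simp add: mult.commute flip: power_mult)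
  then show ?thesis using xF.Pol_0_power[of T m] unfolding A_def e_def X_def[abs_def] \<Pi>x_def by simp
qed

lemma A0_invt: "invt (A 0)"
  unfolding A_def by (rule XF.Pol_0_invt) (auto intro: X_invt)

lemma e_A: "e * A k = A k * e"
  unfolding A_def by (rule XF.Pol_commute) (auto intro: X_e)

lemma C_e: "C k * e = q ^ l *s (e * C k)"
proof -
  have "N i k * u i * e = q ^ l *s (e * (N i k * u i))" if i: "i \<in> T" for i
  proof -
    have "e * d i = d i * e" unfolding d_def by (rule XF.ev_commute) (use X_e i in auto)
    then have d: "e * rinv (d i) = rinv (d i) * e" by (rule rinv_commute)
    have N: "e * N i k = N i k * e" unfolding N_def by (rule XF.Pol_commute) (use X_e in auto)
    have "N i k * u i * e = q ^ l *s (N i k * (rinv (d i) * e) * y i)"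
      unfolding u_def using y_e[OF i] by (simp add: mult.assoc)
    also have "N i k * (rinv (d i) * e) * y i = (N i k * e) * (rinv (d i) * y i)"
      unfolding d[symmetric] by (simp add: mult.assoc)
    also have "\<dots> = e * (N i k * u i)" unfolding N[symmetric] by (simp add: u_def mult.assoc)
    finally show ?thesis .
  qed
  then show ?thesis by (simp add: C_def sum_distrib_left sum_distrib_right scale_sum_right)
qed

lemma Y_X: assumes "i \<in> T" shows "Y * X i = t *s (X i * Y)"
proof -
  have "X i * Y = inverse t *s (Y * X i)"
    unfolding Y_def
  proof (rule yF.Pol_0_twist[of _ i])
    show "X i * y i = inverse t *s (y i * X i)" using yX[of i i] assms t0 by simp
    show "X i * y j = y j * X i" if "j \<in> T" "j \<noteq> i" for j using yX[of j i] that assms by simp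
  qed (use assms in auto)
  then show ?thesis using t0 by simp
qed

lemma Y_y: "i \<in> T \<Longrightarrow> Y * y i = y i * Y"
  unfolding Y_def by (rule yF.Pol_commute[symmetric]) (auto intro: yy)

lemma Y_A: "t ^ k *s (Y * A k) = t ^ n *s (A k * Y)"
  unfolding A_def using XF.Pol_weight[of T Y t k] Y_X by simp

text \<open>The coefficients \<open>N i k\<close> and the element \<open>d i\<close> are homogeneous
  of degrees \<open>n - 1 - k\<close> and \<open>n - 1\<close> in the \<open>X j\<close>, and
  \<open>Y\<close> commutes with \<open>y i\<close>; so conjugation by \<open>Y\<close> multiplies
  \<open>C k\<close> by \<open>t^(-k)\<close>.\<close>

lemma Y_C: "t ^ k *s (Y * C k) = 1 *s (C k * Y)"
proof -
  have "t ^ k *s (Y * (N i k * u i)) = N i k * u i * Y" if i: "i \<in> T" for i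
  proof -
    have YN: "t ^ k *s (Y * N i k) = t ^ (n - 1) *s (N i k * Y)" for k
      unfolding N_def using XF.Pol_weight[of "T - {i}" Y t k] Y_X i by simp
    have "Y * d i = t ^ (n - 1) *s (d i * Y)"
    proof -
      have "Y * (N i k * X i ^ k) = t ^ (n - 1) *s (N i k * X i ^ k * Y)" for k
      proof -
        have NXk: "N i k * X i ^ k = X i ^ k * N i k"
          using power_commuting_commutes[of "X i" "N i k" k] NX[OF i] by simp
        have "Y * (X i ^ k * N i k) = X i ^ k * (t ^ k *s (Y * N i k))"
          using twist_power[OF Y_X[OF i], of k] by (simp flip: mult.assoc)
        then show ?thesis unfolding NXk YN by (simp add: mult.assoc)
      qed
      then show ?thesis
        unfolding d_def XF.ev_def N_def[symmetric] by (simp add: sum_distrib_left sum_distrib_right scale_sum_right)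
    qed
    then have Yd: "Y * rinv (d i) = inverse (t ^ (n - 1)) *s (rinv (d i) * Y)"
      by (rule rinv_twist) (use d_invt[OF i] t0 in auto)
    have "t ^ k *s (Y * (N i k * u i)) = (t ^ k *s (Y * N i k)) * u i" by (simp add: mult.assoc)
    also have "\<dots> = t ^ (n - 1) *s (N i k * (Y * rinv (d i)) * y i)" unfolding YN by (simp add: u_def mult.assoc)
    also have "\<dots> = N i k * u i * Y" unfolding Yd using t0 by (simp add: u_def mult.assoc Y_y[OF i])
    finally show ?thesis .
  qed
  then show ?thesis by (simp add: C_def sum_distrib_left sum_distrib_right scale_sum_right)
qed

text \<open>Moving \<open>y i\<close> to the left of \<open>d i\<close> replaces \<open>X i\<close>
  by \<open>inverse t *s X i\<close> there; \<open>\<kappa> i\<close> is the quotient of the two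
  versions of \<open>d i\<close> and involves only the \<open>X j\<close>.\<close>

definition "\<kappa> i = d i * rinv (XF.ev (T - {i}) (inverse t *s X i))"

lemma \<kappa>_invt: "i \<in> T \<Longrightarrow> invt (\<kappa> i)"
  unfolding \<kappa>_def using d_invt[of i] ev_scaled_invt[of i "inverse t" "T - {i}"] t0 by auto

text \<open>The interpolation property, with the argument on the right. It is what recovers
  \<open>y i\<close> from the invariants \<open>C k\<close> and the \<open>x j\<close>.\<close>

lemma C_X: assumes i: "i \<in> T" shows "(\<Sum>k<n. C k * X i ^ k) = y i * \<kappa> i"
proof -
  have card: "{..card (T - {j})} = {..<n}" if "j \<in> T" for j using that n by auto
  \<comment> \<open>For \<open>j \<noteq> i\<close> the factor \<open>u j\<close> commutes with
    \<open>X i\<close>, and \<open>X i\<close> is a root of \<open>N j\<close>.\<close>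
  have zero: "(\<Sum>k<n. N j k * u j * X i ^ k) = 0" if j: "j \<in> T" "j \<noteq> i" for j
  proof -
    have "u j * X i ^ k = X i ^ k * u j" for k
      using power_commuting_commutes[of "X i" "u j" k] uX[OF j(1) i] j by simp
    then have "(\<Sum>k<n. N j k * u j * X i ^ k) = XF.ev (T - {j}) (X i) * u j"
      unfolding XF.ev_def card[OF j(1)] N_def by (simp add: sum_distrib_right mult.assoc)
    also have "XF.ev (T - {j}) (X i) = 0" by (rule XF.ev_root) (use i j in auto)
    finally show ?thesis by simp
  qed
  define d' where "d' = XF.ev (T - {i}) (inverse t *s X i)"
  have d': "invt d'" unfolding d'_def using ev_scaled_invt[of i "inverse t" "T - {i}"] t0 i by auto
  have yN: "y i * N i k = N i k * y i" for k
    unfolding N_def by (rule XF.Pol_commute) (use yX i in auto)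
  have "y i * (N i k * (inverse t *s X i) ^ k) = N i k * X i ^ k * y i" for k
  proof -
    have "y i * (inverse t *s X i) = 1 *s (X i * y i)" using yX[OF i i] t0 by simp
    have "y i * X i ^ k = t ^ k *s (X i ^ k * y i)" using twist_power[of "y i" "X i" t k] yX[OF i i] by simp
    then have "y i * (inverse t *s X i) ^ k = X i ^ k * y i"
      using t0 by (simp add: power_scale power_inverse)
    then have "N i k * y i * (inverse t *s X i) ^ k = N i k * X i ^ k * y i" by (simp only: mult.assoc)
    then show ?thesis by (simp only: yN flip: mult.assoc)
  qed
  then have "y i * d' = d i * y i"
    unfolding d'_def d_def XF.ev_def N_def[symmetric] by (simp add: sum_distrib_left sum_distrib_right)
  then have "rinv (d i) * (y i * d') * rinv d' = rinv (d i) * (d i * y i) * rinv d'" by simp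
  then have ui: "u i = y i * rinv d'" unfolding u_def using d' d_invt[OF i] by (simp add: mult.assoc)
  have "X i * d' = d' * X i" unfolding d'_def by (rule XF.ev_commute) (use XX i in auto)
  then have Xd: "X i ^ k * rinv d' = rinv d' * X i ^ k" for k
    using power_commuting_commutes[of "X i" "rinv d'" k] rinv_commute[of "X i" d'] by simp
  have "(\<Sum>k<n. N i k * u i * X i ^ k) = y i * (\<Sum>k<n. N i k * X i ^ k) * rinv d'"
  proof -
    have "N i k * u i * X i ^ k = y i * (N i k * X i ^ k) * rinv d'" for k
      unfolding ui by (simp add: mult.assoc Xd) (simp only: yN flip: mult.assoc)
    then show ?thesis by (simp add: sum_distrib_left sum_distrib_right)
  qed
  also have "(\<Sum>k<n. N i k * X i ^ k) = d i" unfolding d_def XF.ev_def card[OF i] N_def by simp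
  finally have one: "(\<Sum>k<n. N i k * u i * X i ^ k) = y i * \<kappa> i" by (simp add: \<kappa>_def d'_def mult.assoc)
  have "(\<Sum>k<n. C k * X i ^ k) = (\<Sum>j\<in>T. \<Sum>k<n. N j k * u j * X i ^ k)"
    unfolding C_def sum_distrib_right by (rule sum.swap)
  also have "\<dots> = (\<Sum>k<n. N i k * u i * X i ^ k)"
    using i zero by (subst sum.remove[OF _ i]) auto
  finally show ?thesis using one by simp
qed

subsection \<open>Invariance\<close>

definition DG :: "'r set" where
  "DG = {r \<in> D. \<forall>g\<in>G. \<theta> g r = r}"

lemma \<theta>_0: "g \<in> G \<Longrightarrow> \<theta> g 0 = 0"
  using \<theta>_scale[of g 0 0] subalg_0[OF subD] by simp

lemma \<theta>_power: "g \<in> G \<Longrightarrow> r \<in> D \<Longrightarrow> \<theta> g (r ^ k) = \<theta> g r ^ k"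
  by (induction k) (simp_all add: \<theta>_one \<theta>_hom subalg_power[OF subD])

lemma \<theta>_sum: "g \<in> G \<Longrightarrow> (\<And>i. i \<in> I \<Longrightarrow> f i \<in> D) \<Longrightarrow> \<theta> g (\<Sum>i\<in>I. f i) = (\<Sum>i\<in>I. \<theta> g (f i))"
  by (induction I rule: infinite_finite_induct) (simp_all add: \<theta>_0 \<theta>_hom subalg_sum[OF subD])

lemma \<theta>_lin_comb:
  assumes g: "g \<in> G" and z: "z \<in> D" and c: "\<And>k. k \<in> I \<Longrightarrow> c k \<in> D"
  shows "\<theta> g (\<Sum>k\<in>I. c k * z ^ k) = (\<Sum>k\<in>I. \<theta> g (c k) * \<theta> g z ^ k)"
proof -
  have zk: "z ^ k \<in> D" for k using z by (rule subalg_power[OF subD])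
  have "\<theta> g (\<Sum>k\<in>I. c k * z ^ k) = (\<Sum>k\<in>I. \<theta> g (c k * z ^ k))"
    by (rule \<theta>_sum[OF g]) (use c zk subalg_mult[OF subD] in blast)
  also have "\<dots> = (\<Sum>k\<in>I. \<theta> g (c k) * \<theta> g z ^ k)"
    using \<theta>_hom[OF g c zk] \<theta>_power[OF g z] by (intro sum.cong refl) simp
  finally show ?thesis .
qed

lemma divsub_DG: "divsub DG"
  unfolding divsub_def subalg_def DG_def
  using \<theta>_hom \<theta>_scale \<theta>_one \<theta>_rinv D divsub_invt[OF D] divsub_rinv[OF D]
  by (auto intro: subalg_closed[OF subD] subalg_scalar[OF subD] simp: subalg_1[OF subD])

lemma \<theta>_X: "(\<sigma>, \<alpha>) \<in> G \<Longrightarrow> i \<in> T \<Longrightarrow> \<theta> (\<sigma>, \<alpha>) (X i) = X (\<sigma> i)"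
proof -
  assume g: "(\<sigma>, \<alpha>) \<in> G" and i: "i \<in> T"
  have "\<alpha> i ^ m = 1" using g i unfolding G_iff by auto
  then show ?thesis using \<theta>_power[OF g, of "x i" m] \<theta>_xy[OF g i] xyD[OF i]
    by (simp add: X_def power_scale)
qed

lemma \<theta>_Pol:
  assumes g: "(\<sigma>, \<alpha>) \<in> G" and S: "S \<subseteq> T"
  shows "\<theta> (\<sigma>, \<alpha>) (Pol X S k) = Pol X (\<sigma> ` S) k"
proof (rule XF.Pol_equivariant[OF _ _ _ subD _ _ _ S])
  show "\<sigma> permutes T" using g by (simp add: G_iff)
qed (use g \<theta>_hom \<theta>_scale \<theta>_one XD \<theta>_X in auto)

lemma A_in_DG: "A k \<in> DG"
proof -
  have "A k \<in> D" using lax_AC by (auto simp: lax_def)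
  moreover have "\<theta> g (A k) = A k" if "g \<in> G" for g
  proof -
    obtain \<sigma> \<alpha> where g: "g = (\<sigma>, \<alpha>)" by (cases g)
    then have "\<sigma> ` T = T" using that permutes_image[of \<sigma> T] by (simp add: G_iff)
    then show ?thesis using \<theta>_Pol[of \<sigma> \<alpha> T] that g by (simp add: A_def)
  qed
  ultimately show ?thesis by (simp add: DG_def)
qed

lemma C_in_DG: "C k \<in> DG"
proof -
  have CD: "C k \<in> D" using lax_AC by (auto simp: lax_def)
  moreover have "\<theta> g (C k) = C k" if gG: "g \<in> G" for g
  proof -
    obtain \<sigma> \<alpha> where g: "g = (\<sigma>, \<alpha>)" by (cases g)
    then have \<sigma>: "\<sigma> permutes T" using gG by (simp add: G_iff)
    have \<sigma>T: "\<sigma> i \<in> T" if "i \<in> T" for i using permutes_in_image[OF \<sigma>] that by simp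
    have im: "\<sigma> ` (T - {i}) = T - {\<sigma> i}" for i
      using permutes_image[OF \<sigma>] image_set_diff[OF permutes_inj[OF \<sigma>]] by simp
    have \<theta>N: "\<theta> g (N i k) = N (\<sigma> i) k" for i k
      unfolding N_def using \<theta>_Pol[of \<sigma> \<alpha> "T - {i}" k] gG g im[of i] by auto
    have \<theta>d: "\<theta> g (d i) = d (\<sigma> i)" if i: "i \<in> T" for i
    proof -
      have "\<theta> g (d i) = (\<Sum>k\<le>card (T - {i}). N (\<sigma> i) k * X (\<sigma> i) ^ k)"
        unfolding d_def XF.ev_def N_def[symmetric]
        using \<theta>_lin_comb[OF gG XD[OF i], of _ "N i"] ND \<theta>_X[of \<sigma> \<alpha> i] gG g i \<theta>N by simp
      also have "card (T - {i}) = card (T - {\<sigma> i})" using i \<sigma>T by simp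
      finally show ?thesis by (simp add: d_def XF.ev_def N_def)
    qed
    have \<theta>u: "\<theta> g (u i) = u (\<sigma> i)" if i: "i \<in> T" for i
      unfolding u_def using \<theta>_hom[OF gG] \<theta>_rinv[OF gG] \<theta>d[OF i] \<theta>_xy[of \<sigma> \<alpha> i] dD[OF i] divsub_rinv[OF D] xyD[OF i] gG g i
      by simp
    have "\<theta> g (C k) = (\<Sum>i\<in>T. \<theta> g (N i k * u i))"
      unfolding C_def by (rule \<theta>_sum[OF gG]) (use ND uD subalg_mult[OF subD] in blast)
    also have "\<dots> = (\<Sum>i\<in>T. N (\<sigma> i) k * u (\<sigma> i))"
      using \<theta>_hom[OF gG ND uD] \<theta>N \<theta>u by (intro sum.cong refl) simp
    also have "\<dots> = C k" unfolding C_def by (rule sum.permute[OF \<sigma>, symmetric, unfolded o_def])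
    finally show ?thesis .
  qed
  ultimately show ?thesis by (simp add: DG_def)
qed

lemma e_in_DG: "e \<in> DG"
proof -
  have "\<theta> g e = e" if gG: "g \<in> G" for g
  proof -
    obtain \<sigma> \<alpha> where g: "g = (\<sigma>, \<alpha>)" by (cases g)
    then have \<sigma>: "\<sigma> permutes T" and \<alpha>: "(\<Prod>i\<in>T. \<alpha> i) ^ l = 1" using gG by (auto simp: G_iff)
    have "\<theta> g \<Pi>x = (\<Prod>i\<in>T. \<alpha> i) *s Pol x (\<sigma> ` T) 0"
      unfolding \<Pi>x_def
      by (rule xF.Pol_0_equivariant[OF _ _ _ subD _ \<sigma>]) (use gG g \<theta>_hom \<theta>_scale \<theta>_one xyD \<theta>_xy in auto)
    then have "\<theta> g \<Pi>x = (\<Prod>i\<in>T. \<alpha> i) *s \<Pi>x" using permutes_image[OF \<sigma>] by (simp add: \<Pi>x_def)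
    then show ?thesis using \<theta>_power[OF gG \<Pi>x_D, of l] \<alpha> by (simp add: e_def power_scale)
  qed
  then show ?thesis using eD by (simp add: DG_def)
qed

lemma Y_in_DG: "Y \<in> DG"
proof -
  have "\<theta> g Y = Y" if gG: "g \<in> G" for g
  proof -
    obtain \<sigma> \<alpha> where g: "g = (\<sigma>, \<alpha>)" by (cases g)
    then have \<sigma>: "\<sigma> permutes T" using gG by (auto simp: G_iff)
    have "\<theta> g Y = Pol y (\<sigma> ` T) 0"
      unfolding Y_def
      by (rule yF.Pol_equivariant[OF _ _ _ subD _ \<sigma>]) (use gG g \<theta>_hom \<theta>_scale \<theta>_one xyD \<theta>_xy in auto)
    then show ?thesis using permutes_image[OF \<sigma>] by (simp add: Y_def)
  qed
  then show ?thesis using Y_D by (simp add: DG_def)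
qed

definition Q :: "'r set" where
  "Q = dgen ({e} \<union> range A \<union> range C)"

lemma Q_DG: "Q \<subseteq> DG"
  unfolding Q_def by (rule dgen_subset[OF divsub_DG]) (auto intro: e_in_DG A_in_DG C_in_DG)

lemma DG_D: "DG \<subseteq> D" by (auto simp: DG_def)

lemma divsub_Q: "divsub Q"
  unfolding Q_def by (rule divsub_dgen[OF divsub_DG]) (auto intro: e_in_DG A_in_DG C_in_DG)

lemma Q_gens: "e \<in> Q" "A k \<in> Q" "C k \<in> Q"
  unfolding Q_def by (auto intro: dgen_base)

subsection \<open>A tower of extensions\<close>

text \<open>The \<open>j\<close>-th step adjoins \<open>x j\<close>, whose degree over the previous step is the length of its orbit
  under the stabilizer of \<open>x 1, \<dots>, x (j - 1)\<close>.\<close>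

definition deg :: "nat \<Rightarrow> nat" where
  "deg j = (if j < n then m * (n - j + 1) else l)"

lemma deg_pos: "deg j > 0"
  using m l by (auto simp: deg_def)

primrec tower :: "nat \<Rightarrow> 'r set" where
  "tower 0 = Q"
| "tower (Suc j) = {\<Sum>k<deg (Suc j). c k * x (Suc j) ^ k | c. \<forall>k<deg (Suc j). c k \<in> tower j}"

lemma tower_SucI:
  "(\<And>k. k < deg (Suc j) \<Longrightarrow> c k \<in> tower j) \<Longrightarrow> (\<Sum>k<deg (Suc j). c k * x (Suc j) ^ k) \<in> tower (Suc j)"
  by auto

lemma tower_lspan: "\<exists>(K::nat) b. tower j = lspan Q {..<K} b"
proof (induction j)
  case 0
  have "lspan Q {..<Suc 0} (\<lambda>_. 1) = Q"
  proof
    show "Q \<subseteq> lspan Q {..<Suc 0} (\<lambda>_. 1)" unfolding lspan_def by (auto intro: exI[of _ "\<lambda>_. _"])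
  qed (auto simp: lspan_def)
  then show ?case by (simp only: tower.simps) metis
next
  case (Suc j)
  then obtain K :: nat and b where "tower j = lspan Q {..<K} b" by blast
  then have "tower (Suc j) = lspan Q ({..<K} \<times> {..<deg (Suc j)}) (\<lambda>(i, k). b i * x (Suc j) ^ k)"
    using lspan_tower[where I = "{..<K}" and N = "deg (Suc j)" and Q = Q and e = b and x = "x (Suc j)"] by simp
  then show ?case using lspan_reindex[of "{..<K} \<times> {..<deg (Suc j)}"] by (metis finite_SigmaI finite_lessThan)
qed

lemma tower_add: "a \<in> tower j \<Longrightarrow> b \<in> tower j \<Longrightarrow> a + b \<in> tower j"
  and tower_mult: "c \<in> Q \<Longrightarrow> a \<in> tower j \<Longrightarrow> c * a \<in> tower j"
  and tower_zero: "0 \<in> tower j"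
  using tower_lspan[of j] lspan_add[OF divsub_Q] lspan_mult[OF divsub_Q] lspan_zero[OF divsub_Q] by metis+

lemma tower_sum: "(\<And>i. i \<in> I \<Longrightarrow> f i \<in> tower j) \<Longrightarrow> (\<Sum>i\<in>I. f i) \<in> tower j"
  by (induction I rule: infinite_finite_induct) (auto intro: tower_add tower_zero)

lemma tower_scale: "a \<in> tower j \<Longrightarrow> c *s a \<in> tower j"
  using tower_mult[of "c *s 1" a j] subalg_scalar[OF divsub_subalg[OF divsub_Q]] by simp

lemma tower_Suc: "tower j \<subseteq> tower (Suc j)"
proof
  fix a assume a: "a \<in> tower j"
  define c where "c k = (if k = (0::nat) then a else 0)" for k
  have "(\<Sum>k<deg (Suc j). c k * x (Suc j) ^ k) = (\<Sum>k\<in>{0}. c k * x (Suc j) ^ k)"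
    by (rule sum.mono_neutral_right) (use deg_pos in \<open>auto simp: c_def\<close>)
  then have "a = (\<Sum>k<deg (Suc j). c k * x (Suc j) ^ k)" by (simp add: c_def)
  moreover have "\<forall>k<deg (Suc j). c k \<in> tower j" using a tower_zero by (simp add: c_def)
  ultimately show "a \<in> tower (Suc j)" unfolding tower.simps by blast
qed

lemma Q_tower: "Q \<subseteq> tower j"
  by (induction j) (use tower_Suc in auto)

lemma one_tower: "1 \<in> tower j"
  using Q_tower subalg_1[OF divsub_subalg[OF divsub_Q]] by blast

text \<open>A level of the tower is at first only a left vector space over \<open>Q\<close>. Its
  right multipliers form a subalgebra closed under inverses, so it suffices to show that the
  generators of \<open>D\<close> are multipliers of the top level; then \<open>D\<close> lies in
  that level because 1 does.\<close>

definition St :: "nat \<Rightarrow> 'r set" where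
  "St j = {r. \<forall>a\<in>tower j. a * r \<in> tower j}"

lemma subalg_St: "subalg (St j)"
  unfolding subalg_def St_def
  by (auto simp: distrib_left tower_scale simp flip: mult.assoc intro: tower_add)

text \<open>The level has finite left dimension over \<open>Q\<close>, so a multiplier that is a
  unit has its inverse among the multipliers, by \<open>lspan_rinv\<close>.\<close>

lemma St_rinv: "r \<in> St j \<Longrightarrow> rinv r \<in> St j"
  unfolding St_def using lspan_rinv[OF divsub_Q finite_lessThan] tower_lspan[of j] by force

text \<open>An element commuting with the new generator moves past its powers and acts on the
  coefficients, which lie in the previous level.\<close>

lemma St_lift:
  assumes "r \<in> St j" "r * x (Suc j) = x (Suc j) * r"
  shows "r \<in> St (Suc j)"
  unfolding St_def
proof (intro CollectI ballI)
  fix a assume "a \<in> tower (Suc j)"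
  then obtain c where c: "a = (\<Sum>k<deg (Suc j). c k * x (Suc j) ^ k)" "\<forall>k<deg (Suc j). c k \<in> tower j" by auto
  have "x (Suc j) ^ k * r = r * x (Suc j) ^ k" for k using power_commuting_commutes[OF assms(2)[symmetric]] by simp
  then have "a * r = (\<Sum>k<deg (Suc j). c k * r * x (Suc j) ^ k)" by (simp add: c(1) sum_distrib_right mult.assoc)
  moreover have "c k * r \<in> tower j" if "k < deg (Suc j)" for k using that c(2) assms(1) by (auto simp: St_def)
  ultimately show "a * r \<in> tower (Suc j)" using tower_SucI[of j "\<lambda>k. c k * r"] by simp
qed

lemma St_x:
  assumes "\<forall>k<deg (Suc j). b k \<in> St j" "x (Suc j) ^ deg (Suc j) = (\<Sum>k<deg (Suc j). b k * x (Suc j) ^ k)"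
  shows "x (Suc j) \<in> St (Suc j)"
  unfolding St_def
proof (intro CollectI ballI)
  fix a assume "a \<in> tower (Suc j)"
  then obtain c where c: "a = (\<Sum>k<deg (Suc j). c k * x (Suc j) ^ k)" "\<forall>k<deg (Suc j). c k \<in> tower j" by auto
  obtain d where d: "deg (Suc j) = Suc d" using deg_pos[of "Suc j"] by (cases "deg (Suc j)") auto
  have "a * x (Suc j) = (\<Sum>k<Suc d. c k * x (Suc j) ^ Suc k)"
    by (simp only: c(1) d sum_distrib_right mult.assoc power_Suc2)
  also have "\<dots> = (\<Sum>k<d. c k * x (Suc j) ^ Suc k) + c d * x (Suc j) ^ Suc d" by simp
  \<comment> \<open>Multiplication by the generator shifts the coefficients; the overflowing top
    power is then reduced by the monic relation.\<close>
  also have "(\<Sum>k<d. c k * x (Suc j) ^ Suc k) = (\<Sum>k<Suc d. prev c k * x (Suc j) ^ k)"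
    by (subst sum.lessThan_Suc_shift) simp
  also have "c d * x (Suc j) ^ Suc d = (\<Sum>k<Suc d. c d * b k * x (Suc j) ^ k)"
    using assms(2) unfolding d by (simp only: sum_distrib_left mult.assoc)
  finally have "a * x (Suc j) = (\<Sum>k<deg (Suc j). (prev c k + c d * b k) * x (Suc j) ^ k)"
    unfolding d by (simp only: sum.distrib distrib_right)
  moreover have "prev c k + c d * b k \<in> tower j" if "k < deg (Suc j)" for k
  proof -
    have "prev c k \<in> tower j" using c(2) that tower_zero by (cases k) auto
    moreover have "c d * b k \<in> tower j" using assms(1) c(2) that d by (auto simp: St_def)
    ultimately show ?thesis by (rule tower_add)
  qed
  ultimately show "a * x (Suc j) \<in> tower (Suc j)" using tower_SucI[of j "\<lambda>k. prev c k + c d * b k"] by simp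
qed

text \<open>Dividing \<open>A(z)\<close> by the linear factors of the known roots
  \<open>X 1, ..., X j\<close> keeps the coefficients in the subalgebra.\<close>

lemma St_Pol:
  assumes S: "subalg S" "\<And>k. A k \<in> S" "\<And>i. i \<in> {1..j} \<Longrightarrow> X i \<in> S" and j: "j < n"
  shows "Pol X {Suc j..n} k \<in> S"
  using S(3) j
proof (induction j arbitrary: k)
  case 0
  then show ?case using S(2) by (simp add: A_def One_nat_def)
next
  case (Suc j)
  define P where "P = Pol X {Suc (Suc j)..n}"
  have ins: "{Suc j..n} = insert (Suc j) {Suc (Suc j)..n}" using Suc.prems by auto
  have "Pol X {Suc j..n} k \<in> S" for k using Suc by simp
  then have step: "P k + X (Suc j) * 0 - X (Suc j) * P (Suc k) \<in> S" for k
    using XF.Pol_insert[of "Suc j" "{Suc (Suc j)..n}" "Suc k"] Suc.prems unfolding ins P_def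
    by (auto simp: subset_iff) (metis)
  \<comment> \<open>Synthetic division: the coefficients of the quotient are obtained from the top
    degree downwards, starting with those that vanish.\<close>
  show ?case unfolding P_def[symmetric]
  proof (induction "n - k" arbitrary: k rule: less_induct)
    case less
    show ?case
    proof (cases "k > n")
      case True
      then have "P k = 0" unfolding P_def by (intro XF.Pol_high) auto
      then show ?thesis using subalg_0[OF S(1)] by simp
    next
      case False
      have "P (Suc k) \<in> S"
      proof (cases "k = n")
        case True
        then have "P (Suc k) = 0" unfolding P_def by (intro XF.Pol_high) auto
        then show ?thesis using subalg_0[OF S(1)] by simp
      qed (use less False in auto)
      moreover have "X (Suc j) \<in> S" using Suc.prems by auto
      ultimately have "(P k - X (Suc j) * P (Suc k)) + X (Suc j) * P (Suc k) \<in> S"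
        using step[of k] by (intro subalg_add subalg_mult S(1)) simp_all
      then show ?thesis by simp
    qed
  qed
qed

lemma X_in_subalg: "subalg S \<Longrightarrow> x i \<in> S \<Longrightarrow> X i \<in> S"
  unfolding X_def by (rule subalg_power)

text \<open>Before the last step, \<open>X (Suc j)\<close> is a root of the polynomial over the
  remaining roots, whose degree is \<open>n - j\<close>. At the last step only one \<open>x\<close>
  is left, and \<open>e\<close> determines its \<open>l\<close>-th power up to sign and division by
  the others, which is where the degree falls to \<open>l\<close>.\<close>

lemma x_relation:
  assumes S: "subalg S" "\<And>r. r \<in> S \<Longrightarrow> rinv r \<in> S" "\<And>k. A k \<in> S" "e \<in> S" "\<And>i. i \<in> {1..j} \<Longrightarrow> x i \<in> S" and j: "j < n"
  shows "\<exists>b. (\<forall>k<deg (Suc j). b k \<in> S) \<and> x (Suc j) ^ deg (Suc j) = (\<Sum>k<deg (Suc j). b k * x (Suc j) ^ k)"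
proof (cases "Suc j < n")
  case True
  define J where "J = Suc j"
  define B where "B = Pol X {J..n}"
  define K where "K = n - J + 1"
  have card: "card {J..n} = K" using True by (auto simp: K_def J_def)
  have deg: "deg J = m * K" using True by (simp add: deg_def K_def J_def)
  have J: "J \<in> {J..n}" "{J..n} \<subseteq> T" using True by (auto simp: J_def)
  have BS: "B k \<in> S" for k
    unfolding B_def J_def by (rule St_Pol[OF S(1,3)]) (use S(5) X_in_subalg[OF S(1)] j in auto)
  have "0 = XF.ev {J..n} (X J)" using XF.ev_root[OF J(2,1)] by simp
  also have "\<dots> = (\<Sum>k<K. B k * X J ^ k) + X J ^ K"
    unfolding XF.ev_def card B_def[symmetric] using XF.Pol_lead[OF J(2)] unfolding card B_def[symmetric]
    by (simp add: lessThan_Suc_atMost[symmetric])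
  finally have rel: "X J ^ K = (\<Sum>k<K. - B k * X J ^ k)"
    by (simp add: sum_negf eq_neg_iff_add_eq_0 add.commute)
  \<comment> \<open>A relation of degree \<open>K\<close> for \<open>X J = x J ^ m\<close> is one of
    degree \<open>m * K\<close> for \<open>x J\<close>, with coefficients at multiples of
    \<open>m\<close> only.\<close>
  define b where "b k = (if m dvd k then - B (k div m) else 0)" for k
  have "(\<Sum>k<m * K. b k * x J ^ k) = (\<Sum>k\<in>(\<lambda>k. m * k) ` {..<K}. b k * x J ^ k)"
    by (rule sum.mono_neutral_right) (use m in \<open>auto simp: b_def\<close>)
  also have "\<dots> = (\<Sum>k<K. b (m * k) * x J ^ (m * k))"
    by (subst sum.reindex) (use m in \<open>auto simp: inj_on_def\<close>)
  also have "\<dots> = X J ^ K" unfolding rel using m by (simp add: b_def X_def power_mult)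
  finally have "x J ^ deg J = (\<Sum>k<deg J. b k * x J ^ k)" unfolding deg by (simp add: X_def power_mult)
  moreover have "b k \<in> S" for k using BS subalg_uminus[OF S(1)] subalg_0[OF S(1)] by (simp add: b_def)
  ultimately show ?thesis unfolding J_def by blast
next
  case False
  then have nj: "n = Suc j" using j by simp
  define P where "P = Pol x {1..j} 0"
  have ins: "T = insert (Suc j) {1..j}" using nj by auto
  have "Pol x (insert (Suc j) {1..j}) 0 = - (x (Suc j) * P)"
    unfolding P_def by (subst xF.Pol_insert) (use nj in auto)
  then have "\<Pi>x = - (x n * P)" unfolding \<Pi>x_def ins by (simp only: nj)
  then have \<Pi>: "\<Pi>x = (-1) *s (x n * P)" by simp
  have PS: "P \<in> S" unfolding P_def by (rule xF.Pol_in_subalg[OF S(1)]) (use S(5) nj in auto)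
  have P_inv: "invt P" unfolding P_def by (rule xF.Pol_0_invt) (use x_invt nj in auto)
  have xP: "x n * P = P * x n" unfolding P_def by (rule xF.Pol_commute) (use xx nj in auto)
  have "e = (-1) ^ l *s (x n ^ l * P ^ l)" unfolding e_def \<Pi> by (simp only: power_scale power_mult_commuting[OF xP])
  moreover have "x n ^ l * P ^ l = P ^ l * x n ^ l" using power_mult_commuting[OF xP] power_mult_commuting[OF xP[symmetric]] xP by metis
  ultimately have "rinv (P ^ l) * e = (-1) ^ l *s x n ^ l" using P_inv by simp
  then have "(-1) ^ l *s (rinv (P ^ l) * e) = ((-1) ^ l * (-1) ^ l) *s x n ^ l" by simp
  also have "(-1) ^ l * (-1) ^ l = (1 :: 'f)" by (simp flip: power_mult_distrib)
  finally have xl: "x n ^ l = (-1) ^ l *s (rinv (P ^ l) * e)" by simp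
  define b where "b k = (if k = 0 then x n ^ l else 0)" for k :: nat
  have "b k \<in> S" for k
    unfolding b_def xl using PS S by (auto intro!: subalg_scale subalg_mult subalg_power subalg_0)
  moreover have "(\<Sum>k<l. b k * x n ^ k) = (\<Sum>k\<in>{0}. b k * x n ^ k)"
    by (rule sum.mono_neutral_right) (use l in \<open>auto simp: b_def\<close>)
  moreover have "deg (Suc j) = l" unfolding deg_def using nj by simp
  ultimately have "x n ^ deg (Suc j) = (\<Sum>k<deg (Suc j). b k * x n ^ k)" "\<And>k. b k \<in> S" by (auto simp: b_def)
  then show ?thesis unfolding nj[symmetric] by blast
qed

lemma St_all:
  assumes "j \<le> n"
  shows "(\<forall>i\<in>{1..j}. x i \<in> St j) \<and> (\<forall>k. A k \<in> St j) \<and> e \<in> St j"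
  using assms
proof (induction j)
  case 0
  have "q \<in> St 0" if "q \<in> Q" for q
    using that subalg_mult[OF divsub_subalg[OF divsub_Q]] by (simp add: St_def)
  then show ?case using Q_gens by simp
next
  case (Suc j)
  then have IH: "\<And>i. i \<in> {1..j} \<Longrightarrow> x i \<in> St j" "\<And>k. A k \<in> St j" "e \<in> St j" by auto
  have J: "Suc j \<in> T" using Suc.prems by auto
  obtain b where "\<forall>k<deg (Suc j). b k \<in> St j" "x (Suc j) ^ deg (Suc j) = (\<Sum>k<deg (Suc j). b k * x (Suc j) ^ k)"
    using x_relation[OF subalg_St St_rinv IH(2,3,1)] Suc.prems by (metis Suc_le_lessD)
  then have "x (Suc j) \<in> St (Suc j)" by (rule St_x)
  moreover have "x i \<in> St (Suc j)" if "i \<in> {1..j}" for i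
    using St_lift[OF IH(1)[OF that]] xx[of i "Suc j"] that Suc.prems by auto
  moreover have "A k \<in> St (Suc j)" for k
  proof (rule St_lift[OF IH(2)])
    show "A k * x (Suc j) = x (Suc j) * A k"
      unfolding A_def by (rule XF.Pol_commute[symmetric]) (use X_comm_x J in auto)
  qed
  moreover have "e \<in> St (Suc j)" using St_lift[OF IH(3)] x_e[OF J] by simp
  ultimately show ?case by (auto simp: atLeastAtMostSuc_conv le_Suc_eq)
qed

lemma St_n: "i \<in> T \<Longrightarrow> x i \<in> St n"
  using St_all[of n] by simp

text \<open>\<open>C_X\<close> puts \<open>y i * \<kappa> i\<close> into the top level, and the
  inverse of \<open>\<kappa> i\<close>, built from the \<open>x j\<close>, is a multiplier of
  it.\<close>

lemma y_in_tower: assumes i: "i \<in> T" shows "y i \<in> tower n"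
proof -
  have X: "X j \<in> St n" if "j \<in> T" for j using St_n[OF that] X_in_subalg[OF subalg_St] by blast
  have "\<kappa> i \<in> St n"
    unfolding \<kappa>_def d_def
    by (intro subalg_mult[OF subalg_St] St_rinv ev_in_subalg[OF subalg_St] subalg_scale[OF subalg_St] X i) auto
  then have inv: "rinv (\<kappa> i) \<in> St n" by (rule St_rinv)
  have "C k * X i ^ k \<in> tower n" for k
  proof -
    have "C k \<in> tower n" using Q_tower Q_gens by blast
    then show ?thesis using subalg_power[OF subalg_St X[OF i], of k] by (simp add: St_def)
  qed
  then have "(\<Sum>k<n. C k * X i ^ k) \<in> tower n" by (intro tower_sum)
  then have "y i * \<kappa> i * rinv (\<kappa> i) \<in> tower n" using inv unfolding C_X[OF i] by (simp add: St_def)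
  then show ?thesis using \<kappa>_invt[OF i] by (simp add: mult.assoc)
qed

text \<open>\<open>y i\<close> commutes with the \<open>x j\<close> only up to scalars, so
  \<open>St_lift\<close> does not apply. Instead the powers of \<open>x\<close> are moved to its
  right, level by level, always with the top level as the target.\<close>

lemma St_y: assumes i: "i \<in> T" shows "y i \<in> St n"
proof -
  have step: "a * y i \<in> tower n" if "j \<le> n" "a \<in> tower j" for j a
    using that
  proof (induction j arbitrary: a)
    case 0
    then show ?case using tower_mult y_in_tower[OF i] by simp
  next
    case (Suc j)
    then obtain c where c: "a = (\<Sum>k<deg (Suc j). c k * x (Suc j) ^ k)" "\<forall>k<deg (Suc j). c k \<in> tower j" by auto
    have J: "Suc j \<in> T" using Suc.prems by auto
    have "c k * x (Suc j) ^ k * y i \<in> tower n" if "k < deg (Suc j)" for k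
    proof -
      define s where "s = (if i = Suc j then q else 1) ^ k"
      have s0: "s \<noteq> 0" using q0 by (simp add: s_def)
      have "y i * x (Suc j) ^ k = s *s (x (Suc j) ^ k * y i)"
        unfolding s_def by (rule twist_power) (rule yx[OF i J])
      then have "x (Suc j) ^ k * y i = inverse s *s (y i * x (Suc j) ^ k)" using s0 by simp
      then have "c k * x (Suc j) ^ k * y i = inverse s *s (c k * y i * x (Suc j) ^ k)" by (simp add: mult.assoc)
      moreover have "c k * y i \<in> tower n" using Suc.IH Suc.prems c(2) that by simp
      then have "c k * y i * x (Suc j) ^ k \<in> tower n"
        using subalg_power[OF subalg_St St_n[OF J], of k] by (simp add: St_def)
      ultimately show ?thesis using tower_scale by simp
    qed
    then show ?case unfolding c(1) sum_distrib_right by (intro tower_sum) auto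
  qed
  show ?thesis unfolding St_def using step[OF order_refl] by blast
qed

lemma D_tower: "D \<subseteq> tower n"
proof
  fix r assume "r \<in> D"
  then have "r \<in> St n" unfolding D_gen
    by (induction rule: dgen.induct)
       (use St_n St_y subalg_St[of n] St_rinv in \<open>auto intro: subalg_add subalg_mult subalg_scalar\<close>)
  then show "r \<in> tower n" using one_tower[of n] by (force simp: St_def)
qed

lemma tower_D: "j \<le> n \<Longrightarrow> tower j \<subseteq> D"
proof (induction j)
  case 0
  then show ?case using Q_DG DG_D by auto
next
  case (Suc j)
  have "x (Suc j) \<in> D" using xyD[of "Suc j"] Suc.prems by simp
  then show ?case using Suc by (auto intro!: subalg_sum[OF subD] subalg_mult[OF subD] subalg_power[OF subD])
qed

lemma tower_fixed:
  assumes g: "g \<in> G" "\<And>i. i \<in> {1..j} \<Longrightarrow> \<theta> g (x i) = x i" and j: "j \<le> n" and a: "a \<in> tower j"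
  shows "\<theta> g a = a"
  using g(2) j a
proof (induction j arbitrary: a)
  case 0
  then show ?case using Q_DG g(1) by (auto simp: DG_def)
next
  case (Suc j)
  then obtain c where c: "a = (\<Sum>k<deg (Suc j). c k * x (Suc j) ^ k)" "\<forall>k<deg (Suc j). c k \<in> tower j" by auto
  have xD: "x (Suc j) \<in> D" using xyD[of "Suc j"] Suc.prems by simp
  have cD: "c k \<in> D" if "k < deg (Suc j)" for k using c(2) that tower_D[of j] Suc.prems by auto
  have "\<theta> g a = (\<Sum>k<deg (Suc j). \<theta> g (c k) * \<theta> g (x (Suc j)) ^ k)"
    unfolding c(1) using cD xD g(1)
    by (intro \<theta>_lin_comb) auto
  also have "\<dots> = a" unfolding c(1) using Suc c(2) by (intro sum.cong) auto
  finally show ?case .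
qed

text \<open>The images of \<open>x (Suc j)\<close> under the stabilizer of the earlier ones:
  permutations of the remaining indices together with scalings. Their number equals the degree of
  the step.\<close>

lemma orbit:
  assumes j: "j < n"
  shows "\<exists>Z. finite Z \<and> card Z = deg (Suc j) \<and> (\<forall>z\<in>Z. \<exists>g\<in>G. \<theta> g (x (Suc j)) = z \<and> (\<forall>i\<in>{1..j}. \<theta> g (x i) = x i))
     \<and> (\<forall>z\<in>Z. \<exists>c. \<exists>i\<in>T. z = c *s x i)"
proof (cases "Suc j < n")
  case True
  define z where "z = (\<lambda>(k, i). \<zeta> ^ k *s x i)"
  define I where "I = {..<m} \<times> {Suc j..n}"
  have \<zeta>0: "\<zeta> \<noteq> 0" using \<zeta> m unfolding primitive_root_of_unity_def by (metis power_0_left zero_neq_one neq0_conv)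
  have \<zeta>_inj: "k = k'" if "\<zeta> ^ k = \<zeta> ^ k'" "k < m" "k' < m" for k k'
    using that
  proof (induction k k' rule: linorder_wlog)
    case (le k k')
    have "\<zeta> ^ k * \<zeta> ^ (k' - k) = \<zeta> ^ k * 1" using le by (metis le_add_diff_inverse mult.right_neutral power_add)
    then have "\<zeta> ^ (k' - k) = 1" using \<zeta>0 by (simp only: mult_cancel_left) simp
    then show ?case using \<zeta> le unfolding primitive_root_of_unity_def
      by (metis diff_is_0_eq' diff_less_mono2 le_neq_implies_less less_imp_diff_less zero_less_diff)
  qed auto
  have inj: "inj_on z I"
  proof (rule inj_onI, clarify)
    fix k i k' i' assume *: "(k, i) \<in> I" "(k', i') \<in> I" "z (k, i) = z (k', i')"
    then have ii: "i \<in> T" "i' \<in> T" by (auto simp: I_def)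
    have "i = i'"
    proof (rule ccontr)
      assume "i \<noteq> i'"
      then have "\<zeta> ^ k *s x i \<noteq> \<zeta> ^ k' *s x i'"
        using yx[of i i] yx[of i i'] ii x_invt y_invt q_pow[of 1] \<zeta>0
        by (intro lin_comb_nonzero[of "y i" _ q]) auto
      then show False using * by (simp add: z_def)
    qed
    moreover have "k = k'"
    proof (rule \<zeta>_inj)
      show "\<zeta> ^ k = \<zeta> ^ k'" using *(3) \<open>i = i'\<close> x_invt[OF ii(1)] invt_neq_0 by (auto simp: z_def scale_cancel_right)
    qed (use * in \<open>auto simp: I_def\<close>)
    ultimately show "k = k' \<and> i = i'" by simp
  qed
  have card: "card (z ` I) = deg (Suc j)"
    using card_image[OF inj] True by (simp add: I_def deg_def card_cartesian_product)
  have orb: "\<exists>g\<in>G. \<theta> g (x (Suc j)) = z (k, i) \<and> (\<forall>i\<in>{1..j}. \<theta> g (x i) = x i)" if "(k, i) \<in> I" for k i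
  proof -
    have i: "Suc j \<le> i" "i \<le> n" using that by (auto simp: I_def)
    define \<sigma> where "\<sigma> = transpose (Suc j) i"
    \<comment> \<open>The scaling is compensated at index \<open>n\<close>, so that the product of
      the entries is 1; this is possible because \<open>Suc j < n\<close>.\<close>
    define \<alpha> where "\<alpha> = (\<lambda>h\<in>T. if h = Suc j then \<zeta> ^ k else if h = n then inverse (\<zeta> ^ k) else 1)"
    have "(\<Prod>h\<in>T. \<alpha> h) = (\<Prod>h\<in>{Suc j, n}. \<alpha> h)"
      by (rule prod.mono_neutral_right) (use True in \<open>auto simp: \<alpha>_def\<close>)
    also have "\<dots> = 1" using True \<zeta>0 by (simp add: \<alpha>_def)
    finally have prod: "(\<Prod>h\<in>T. \<alpha> h) = 1" .
    have \<zeta>m: "(\<zeta> ^ k) ^ m = 1" using \<zeta> unfolding primitive_root_of_unity_def by (metis power_mult mult.commute power_one)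
    have g: "(\<sigma>, \<alpha>) \<in> G"
      unfolding G_iff using prod i True \<zeta>m
      by (auto simp: \<sigma>_def \<alpha>_def power_inverse intro!: permutes_swap_id)
    moreover have "\<theta> (\<sigma>, \<alpha>) (x (Suc j)) = z (k, i)"
      using \<theta>_xy[OF g, of "Suc j"] True by (simp add: \<sigma>_def \<alpha>_def z_def)
    moreover have "\<theta> (\<sigma>, \<alpha>) (x h) = x h" if "h \<in> {1..j}" for h
      using \<theta>_xy[OF g, of h] that True i by (simp add: \<sigma>_def \<alpha>_def transpose_apply_other)
    ultimately show ?thesis by blast
  qed
  have "\<exists>c. \<exists>i'\<in>T. z ki = c *s x i'" if "ki \<in> I" for ki
    using that unfolding I_def z_def
    by (cases ki, intro exI[of _ "\<zeta> ^ fst ki"] bexI[of _ "snd ki"]) auto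
  then show ?thesis using card orb
    by (intro exI[of _ "z ` I"]) (auto simp: I_def)
next
  case False
  then have nj: "Suc j = n" using j by simp
  \<comment> \<open>No other index is free to compensate, so the scaling must satisfy the product
    condition by itself; this leaves the powers of \<open>\<zeta> ^ p\<close>.\<close>
  define z where "z k = \<zeta> ^ (p * k) *s x n" for k
  have nT: "n \<in> T" using n by simp
  have \<zeta>0: "\<zeta> \<noteq> 0" using \<zeta> m unfolding primitive_root_of_unity_def by (metis power_0_left zero_neq_one neq0_conv)
  have \<zeta>_inj: "k = k'" if "\<zeta> ^ (p * k) = \<zeta> ^ (p * k')" "k < l" "k' < l" for k k'
    using that
  proof (induction k k' rule: linorder_wlog)
    case (le k k')
    have "k + (k' - k) = k'" using le by simp
    then have "p * k + p * (k' - k) = p * k'" by (simp only: flip: add_mult_distrib2)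
    then have "\<zeta> ^ (p * k) * \<zeta> ^ (p * (k' - k)) = \<zeta> ^ (p * k')" by (simp only: flip: power_add)
    also have "\<zeta> ^ (p * k') = \<zeta> ^ (p * k)" using le by argo
    also have "\<zeta> ^ (p * k) = \<zeta> ^ (p * k) * 1" by simp
    finally have "\<zeta> ^ (p * k) * \<zeta> ^ (p * (k' - k)) = \<zeta> ^ (p * k) * 1" .
    then have one: "\<zeta> ^ (p * (k' - k)) = 1" using \<zeta>0 by (simp only: mult_cancel_left) simp
    have "p * (k' - k) < p * l" using le p by simp
    then have "p * (k' - k) < m" by (simp only: l)
    moreover have "i = 0" if "\<zeta> ^ i = 1" "i < m" for i
      using \<zeta> that by (cases i) (auto simp: primitive_root_of_unity_def)
    ultimately have "p * (k' - k) = 0" using one by (simp only:)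
    then have "k' - k = 0" using p(1) by (simp only: mult_eq_0_iff) simp
    then show ?case using \<open>k + (k' - k) = k'\<close> by (simp only: add_0_right)
  qed auto
  have inj: "inj_on z {..<l}"
    using \<zeta>_inj x_invt[OF nT] invt_neq_0 by (auto simp: inj_on_def z_def scale_cancel_right)
  have orb: "\<exists>g\<in>G. \<theta> g (x (Suc j)) = z k \<and> (\<forall>i\<in>{1..j}. \<theta> g (x i) = x i)" for k
  proof -
    define \<alpha> where "\<alpha> = (\<lambda>h\<in>T. if h = n then \<zeta> ^ (p * k) else 1)"
    have "(\<Prod>h\<in>T. \<alpha> h) = (\<Prod>h\<in>{n}. \<alpha> h)"
      by (rule prod.mono_neutral_right) (use nT in \<open>auto simp: \<alpha>_def\<close>)
    then have prod: "(\<Prod>h\<in>T. \<alpha> h) = \<zeta> ^ (p * k)" using nT by (simp add: \<alpha>_def)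
    have \<zeta>m: "(\<zeta> ^ k) ^ m = 1" for k using \<zeta> unfolding primitive_root_of_unity_def by (metis power_mult mult.commute power_one)
    have "(\<zeta> ^ (p * k)) ^ l = (\<zeta> ^ k) ^ (p * l)" by (simp add: mult_ac flip: power_mult)
    then have "(\<zeta> ^ (p * k)) ^ l = (\<zeta> ^ k) ^ m" by (simp only: l)
    then have g: "(id, \<alpha>) \<in> G"
      unfolding G_iff prod using \<zeta>m by (auto simp: \<alpha>_def permutes_id)
    moreover have "\<theta> (id, \<alpha>) (x (Suc j)) = z k"
      using \<theta>_xy[OF g nT] nT by (simp add: nj \<alpha>_def z_def)
    moreover have "\<theta> (id, \<alpha>) (x h) = x h" if "h \<in> {1..j}" for h
      using \<theta>_xy[OF g, of h] that nj by (auto simp: \<alpha>_def)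
    ultimately show ?thesis by blast
  qed
  have "\<exists>c. \<exists>i\<in>T. z k = c *s x i" for k unfolding z_def using nT by blast
  moreover have "deg (Suc j) = l" unfolding deg_def using nj by simp
  ultimately show ?thesis using orb card_image[OF inj]
    by (intro exI[of _ "z ` {..<l}"]) auto
qed

lemma fixed_descends:
  assumes j: "j < n" and r: "r \<in> DG" "r \<in> tower (Suc j)"
  shows "r \<in> tower j"
proof -
  obtain c where c: "r = (\<Sum>k<deg (Suc j). c k * x (Suc j) ^ k)" "\<forall>k<deg (Suc j). c k \<in> tower j" using r(2) by auto
  obtain Z where Z: "finite Z" "card Z = deg (Suc j)"
    "\<And>z. z \<in> Z \<Longrightarrow> \<exists>g\<in>G. \<theta> g (x (Suc j)) = z \<and> (\<forall>i\<in>{1..j}. \<theta> g (x i) = x i)"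
    "\<And>z. z \<in> Z \<Longrightarrow> \<exists>c. \<exists>i\<in>T. z = c *s x i" using orbit[OF j] by metis
  have xD: "x (Suc j) \<in> D" using xyD[of "Suc j"] j by simp
  have cD: "c k \<in> D" if "k < deg (Suc j)" for k using c(2) that tower_D[of j] j by auto
  \<comment> \<open>Invariance says that the polynomial takes the value \<open>r\<close> on the
    whole orbit; subtracting \<open>r\<close> from the constant coefficient turns these points into
    roots.\<close>
  define c' where "c' k = c k - (if k = 0 then r else 0)" for k
  have root: "(\<Sum>k<deg (Suc j). c' k * z ^ k) = 0" if z: "z \<in> Z" for z
  proof -
    obtain g where g: "g \<in> G" "\<theta> g (x (Suc j)) = z" "\<And>i. i \<in> {1..j} \<Longrightarrow> \<theta> g (x i) = x i" using Z(3)[OF z] by blast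
    have "r = \<theta> g r" using r(1) g(1) by (simp add: DG_def)
    also have "\<dots> = (\<Sum>k<deg (Suc j). \<theta> g (c k) * \<theta> g (x (Suc j)) ^ k)"
      unfolding c(1) using cD xD g(1)
      by (intro \<theta>_lin_comb) auto
    also have "\<dots> = (\<Sum>k<deg (Suc j). c k * z ^ k)"
      using tower_fixed[OF g(1,3) order_less_imp_le[OF j]] c(2) g(2) by (intro sum.cong) auto
    finally have eq: "r = (\<Sum>k<deg (Suc j). c k * z ^ k)" .
    have "(\<Sum>k<deg (Suc j). (if k = 0 then r else 0) * z ^ k) = (\<Sum>k\<in>{0}. (if k = 0 then r else 0) * z ^ k)"
      by (rule sum.mono_neutral_right) (use deg_pos in auto)
    then have "(\<Sum>k<deg (Suc j). (if k = 0 then r else 0) * z ^ k) = r" by simp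
    then show ?thesis unfolding c'_def left_diff_distrib sum_subtractf using eq by simp
  qed
  have "\<forall>k<deg (Suc j). c' k = 0"
  proof (rule commuting_roots[OF Z(1,2) _ _ root])
    fix z z' assume zz: "z \<in> Z" "z' \<in> Z"
    obtain c i c' i' where *: "i \<in> T" "i' \<in> T" "z = c *s x i" "z' = c' *s x i'" using Z(4) zz by metis
    then show "z * z' = z' * z" using xx by (simp add: mult.commute)
    assume "z \<noteq> z'"
    then have "z - z' \<noteq> 0" by simp
    moreover have "z - z' \<in> D" unfolding * using * xyD by (intro subalg_diff subalg_scale subD) auto
    ultimately show "invt (z - z')" by (rule divsub_invt[OF D, rotated])
  qed
  then have "c 0 = r" using deg_pos[of "Suc j"] by (force simp: c'_def)
  then show ?thesis using c(2) deg_pos by metis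
qed

theorem DG_eq_Q: "DG = Q"
proof
  show "Q \<subseteq> DG" by (rule Q_DG)
  show "DG \<subseteq> Q"
  proof
    fix r assume r: "r \<in> DG"
    have "r \<in> tower (n - k)" if "k \<le> n" for k
      using that
    proof (induction k)
      case 0
      then show ?case using r DG_D D_tower by auto
    next
      case (Suc k)
      then have "r \<in> tower (Suc (n - Suc k))" by (simp add: Suc_diff_Suc)
      then show ?case using fixed_descends[OF _ r] Suc.prems by simp
    qed
    from this[of n] show "r \<in> Q" by simp
  qed
qed

text \<open>The first Euclidean step is carried out separately, with \<open>e\<close> in the place
  of \<open>A 0\<close>: that pair has the factor \<open>q ^ l\<close>, and the remaining
  \<open>n - 1\<close> pairs come from the general factorization.\<close>

theorem DG_generators:
  "\<exists>a b. (\<forall>i\<in>T. a i \<in> D \<and> b i \<in> D \<and> a i \<noteq> 0 \<and> b i \<noteq> 0) \<and>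
    (\<forall>i\<in>T. b i * a i = (if i = 1 then q ^ l else q ^ m) *s (a i * b i)) \<and>
    (\<forall>i\<in>T. \<forall>j\<in>T. i \<noteq> j \<longrightarrow> a i * a j = a j * a i \<and> b i * b j = b j * b i \<and> b i * a j = a j * b i) \<and>
    DG = dgen (a ` T \<union> b ` T)"
proof -
  have nS: "Suc (n - 1) = n" using n by simp
  have Cnz: "\<exists>i. C i \<noteq> 0"
  proof (rule ccontr)
    assume "\<not> ?thesis"
    then have "y 1 * \<kappa> 1 = 0" using C_X[of 1] n by simp
    then show False using y_invt[of 1] \<kappa>_invt[of 1] n by simp
  qed
  interpret L: lax_pair scale D t "n - 1" A C
    by unfold_locales (use D t0 t1 lax_AC nS invt_neq_0[OF A0_invt] Cnz in simp_all)
  note eL = L.e_A'[OF _ e_A C_e] L.e_C'[OF _ e_A C_e]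
  have ql0: "q ^ l \<noteq> 0" using q0 by simp
  have comm: "g * L.A' i = L.A' i * g" "g * L.C' i = L.C' i * g" if "g \<in> {L.\<rho>, e}" for g i
    using that L.A'_rho[of i] L.rho_C'[of i] eL[OF ql0, of i] by auto
  \<comment> \<open>\<open>A 0\<close> is a scalar multiple of a power of \<open>e\<close>, so
    replacing one by the other loses no generators.\<close>
  have A0e: "A 0 \<in> dgen {e}"
    using A0_power subalg_scale[OF subalg_dgen subalg_power[OF subalg_dgen dgen_base]] by auto
  have gen: "dgen ({L.\<rho>, e} \<union> range L.A' \<union> range L.C') = Q"
  proof -
    have "dgen ({e} \<union> {L.\<rho>, A 0} \<union> range L.A' \<union> range L.C') = dgen ({e} \<union> {A 0} \<union> range A \<union> range C)"
      by (rule L.dgen_step)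
    moreover have "{e} \<union> {A 0} \<union> range A \<union> range C = {e} \<union> range A \<union> range C" by auto
    moreover have "dgen ({e} \<union> {L.\<rho>, A 0} \<union> range L.A' \<union> range L.C') = dgen ({L.\<rho>, e} \<union> range L.A' \<union> range L.C')"
    proof
      have "A 0 \<in> dgen ({L.\<rho>, e} \<union> range L.A' \<union> range L.C')"
        using A0e dgen_mono[of "{e}" "{L.\<rho>, e} \<union> range L.A' \<union> range L.C'"] by auto
      then show "dgen ({e} \<union> {L.\<rho>, A 0} \<union> range L.A' \<union> range L.C') \<subseteq> dgen ({L.\<rho>, e} \<union> range L.A' \<union> range L.C')"
        by (intro dgen_subset_dgen) (auto intro: dgen_base)
    qed (rule dgen_mono, auto)
    ultimately show ?thesis by (simp add: Q_def)
  qed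
  have \<rho>D: "L.\<rho> \<in> D" using L.mem by (simp add: L.\<rho>_def)
  have "\<exists>\<rho> a. (\<forall>i<n - 1. \<rho> i \<in> D \<and> a i \<in> D \<and> \<rho> i \<noteq> 0 \<and> a i \<noteq> 0 \<and> \<rho> i * a i = t *s (a i * \<rho> i)) \<and>
    (\<forall>i<n - 1. \<forall>j<n - 1. i \<noteq> j \<longrightarrow> \<rho> i * a j = a j * \<rho> i \<and> \<rho> i * \<rho> j = \<rho> j * \<rho> i \<and> a i * a j = a j * a i) \<and>
    (\<forall>i<n - 1. \<forall>g\<in>{L.\<rho>, e}. g * \<rho> i = \<rho> i * g \<and> g * a i = a i * g) \<and>
    dgen ({L.\<rho>, e} \<union> \<rho> ` {..<n - 1} \<union> a ` {..<n - 1}) = dgen ({L.\<rho>, e} \<union> range L.A' \<union> range L.C')"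
  proof (rule lax_factorization[OF D t0 t_pow L.lax_step])
    show "L.A' 0 \<noteq> 0" by (rule invt_neq_0[OF L.A'0_unit])
    show "{L.\<rho>, e} \<subseteq> D" using \<rho>D eD by simp
    \<comment> \<open>The place where generation of the invariants enters: \<open>Y\<close> is
      invariant, hence lies in the division ring generated by the coefficients.\<close>
    show "Y \<in> dgen ({L.\<rho>, e} \<union> range L.A' \<union> range L.C')" unfolding gen using DG_eq_Q Y_in_DG by simp
    show "t ^ i *s (Y * L.A' i) = t ^ (n - 1) *s (L.A' i * Y)" "t ^ i *s (Y * L.C' i) = inverse t *s (L.C' i * Y)" for i
      using L.weight_step[of Y 1, OF _ Y_C] Y_A nS by simp_all
  qed (use comm Y_invt t0 in auto)
  then obtain \<rho> a where *: "\<forall>i<n - 1. \<rho> i \<in> D \<and> a i \<in> D \<and> \<rho> i \<noteq> 0 \<and> a i \<noteq> 0 \<and> \<rho> i * a i = t *s (a i * \<rho> i)"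
    "\<forall>i<n - 1. \<forall>j<n - 1. i \<noteq> j \<longrightarrow> \<rho> i * a j = a j * \<rho> i \<and> \<rho> i * \<rho> j = \<rho> j * \<rho> i \<and> a i * a j = a j * a i"
    "\<forall>i<n - 1. \<forall>g\<in>{L.\<rho>, e}. g * \<rho> i = \<rho> i * g \<and> g * a i = a i * g"
    "dgen ({L.\<rho>, e} \<union> \<rho> ` {..<n - 1} \<union> a ` {..<n - 1}) = Q"
    unfolding gen by blast
  \<comment> \<open>Index 1 is taken by the special pair, and the others are numbered from 0, whence
    the offset 2.\<close>
  define a' where "a' i = (if i = 1 then e else a (i - 2))" for i :: nat
  define b' where "b' i = (if i = 1 then L.\<rho> else \<rho> (i - 2))" for i :: nat
  have idx: "i = 1 \<or> (i - 2 < n - 1 \<and> i \<noteq> 1)" if "i \<in> T" for i using that by auto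
  have idx_inj: "i - 2 \<noteq> j - 2" if "i \<in> T" "j \<in> T" "i \<noteq> j" "i \<noteq> 1" "j \<noteq> 1" for i j :: nat using that by auto
  have img: "a' ` T \<union> b' ` T = {L.\<rho>, e} \<union> \<rho> ` {..<n - 1} \<union> a ` {..<n - 1}"
  proof -
    have "T = insert 1 ((\<lambda>i. i + 2) ` {..<n - 1})"
    proof (intro equalityI subsetI)
      fix i assume "i \<in> T"
      then show "i \<in> insert 1 ((\<lambda>i. i + 2) ` {..<n - 1})"
        by (cases "i = 1") (auto intro!: image_eqI[of _ _ "i - 2"])
    qed (use n in auto)
    then have "a' ` T = insert e (a ` {..<n - 1})" "b' ` T = insert L.\<rho> (\<rho> ` {..<n - 1})"
      by (simp_all only: image_insert image_image) (simp_all add: a'_def b'_def)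
    then show ?thesis by auto
  qed
  have \<rho>e: "L.\<rho> * e = q ^ l *s (e * L.\<rho>)" unfolding L.\<rho>_def by (rule C_e)
  show ?thesis
  proof (rule exI[of _ a'], rule exI[of _ b'], intro conjI ballI impI)
    fix i assume i: "i \<in> T"
    show "a' i \<in> D" "b' i \<in> D" "a' i \<noteq> 0" "b' i \<noteq> 0"
      using idx[OF i] *(1) eD \<rho>D invt_neq_0[OF e_invt] invt_neq_0[OF L.rho_unit] by (auto simp: a'_def b'_def)
    show "b' i * a' i = (if i = 1 then q ^ l else q ^ m) *s (a' i * b' i)"
      using idx[OF i] *(1) \<rho>e by (auto simp: a'_def b'_def t_def)
  next
    fix i j assume ij: "i \<in> T" "j \<in> T" "i \<noteq> j"
    show "a' i * a' j = a' j * a' i" "b' i * b' j = b' j * b' i" "b' i * a' j = a' j * b' i"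
      using idx[OF ij(1)] idx[OF ij(2)] idx_inj[OF ij] ij(3) *(2) *(3) by (auto simp: a'_def b'_def)
  qed (simp only: DG_eq_Q img *(4))
qed

end

section \<open>The action on the division ring of fractions\<close>

context qfamily
begin

lemma a_in_W: "i \<in> {1..n} \<Longrightarrow> a i \<in> W" and b_in_W: "i \<in> {1..n} \<Longrightarrow> b i \<in> W"
  using mon_in_W mon_single by metis+

lemma W_subset:
  assumes S: "subalg S" and ab: "\<And>i. i \<in> {1..n} \<Longrightarrow> a i \<in> S \<and> b i \<in> S"
  shows "W \<subseteq> S"
proof -
  have "mon \<mu> \<in> S" for \<mu>
    unfolding mon_def blk_def using ab
    by (auto intro!: subalg_prod_list[OF S] subalg_mult[OF S] subalg_power[OF S] simp del: upt_Suc)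
  then show ?thesis unfolding W_def by (intro span_minimal subspace_subalg S) auto
qed

end

context generic_qfamily
begin

lemma ore_embedding_TA:
  assumes unit: "\<And>r. r \<in> W \<Longrightarrow> r \<noteq> 0 \<Longrightarrow> invt r"
    and \<psi>: "rhom (TA n t) \<psi>" "inj_on \<psi> (carrier (TA n t))" "\<psi> ` carrier (TA n t) = W"
  shows "ore_embedding scale (TA n t) \<psi>"
proof -
  interpret A: ralg "TA n t" by (rule ralg_TA)
  note hom = rhomD[OF \<psi>(1)] rhom_zero_minus[OF A.ralg_axioms \<psi>(1)]
  have W: "\<psi> c \<in> W" if "c \<in> carrier (TA n t)" for c using that \<psi>(3) by blast
  have nz: "\<psi> c \<noteq> 0" if "c \<in> carrier (TA n t)" "c \<noteq> \<zero>\<^bsub>TA n t\<^esub>" for c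
    using inj_onD[OF \<psi>(2), of c "\<zero>\<^bsub>TA n t\<^esub>"] that hom(5) by auto
  show ?thesis
  proof unfold_locales
    show "invt (\<psi> c)" if "c \<in> carrier (TA n t)" "c \<noteq> \<zero>\<^bsub>TA n t\<^esub>" for c
      using unit W nz that by blast
  next
    fix c d assume cd: "c \<in> carrier (TA n t)" "d \<in> carrier (TA n t)" "c \<noteq> \<zero>\<^bsub>TA n t\<^esub>" "d \<noteq> \<zero>\<^bsub>TA n t\<^esub>"
    obtain r s where "r \<in> W" "s \<in> W" and rs: "\<psi> c * r = \<psi> d * s" "\<psi> c * r \<noteq> 0"
      using ore[OF unit W[OF cd(1)] W[OF cd(2)] nz[OF cd(1,3)] nz[OF cd(2,4)]] by blast
    obtain u where u: "u \<in> carrier (TA n t)" "r = \<psi> u" using \<open>r \<in> W\<close> unfolding \<psi>(3)[symmetric] by (rule imageE)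
    obtain v where v: "v \<in> carrier (TA n t)" "s = \<psi> v" using \<open>s \<in> W\<close> unfolding \<psi>(3)[symmetric] by (rule imageE)
    note uv = u v
    have "\<psi> (c \<otimes>\<^bsub>TA n t\<^esub> u) = \<psi> (d \<otimes>\<^bsub>TA n t\<^esub> v)" "\<psi> (c \<otimes>\<^bsub>TA n t\<^esub> u) \<noteq> 0"
      using rs cd uv by (simp_all add: hom(3))
    then have "c \<otimes>\<^bsub>TA n t\<^esub> u = d \<otimes>\<^bsub>TA n t\<^esub> v" "c \<otimes>\<^bsub>TA n t\<^esub> u \<noteq> \<zero>\<^bsub>TA n t\<^esub>"
      using inj_onD[OF \<psi>(2)] cd uv hom(5) by auto
    then show "\<exists>u\<in>carrier (TA n t). \<exists>v\<in>carrier (TA n t). c \<otimes>\<^bsub>TA n t\<^esub> u = d \<otimes>\<^bsub>TA n t\<^esub> v \<and>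
        c \<otimes>\<^bsub>TA n t\<^esub> u \<noteq> \<zero>\<^bsub>TA n t\<^esub>" using uv by blast
  qed (use \<psi> in auto)
qed

lemma Fr_TA:
  assumes "ore_embedding scale (TA n t) \<psi>" and im: "\<psi> ` carrier (TA n t) = W"
    and gens: "\<And>i. i \<in> {1..n} \<Longrightarrow> \<psi> (gen n t Gx i) = a i \<and> \<psi> (gen n t Gy i) = b i"
  shows "ore_hom.Fr (TA n t) \<psi> = dgen (a ` {1..n} \<union> b ` {1..n})" (is "?F = dgen ?S")
proof -
  interpret E: ore_embedding scale "TA n t" \<psi> by (rule assms)
  have "W \<subseteq> dgen ?S" by (rule W_subset[OF subalg_dgen]) (auto intro: dgen_base)
  then have "\<psi> c \<in> dgen ?S" if "c \<in> carrier (TA n t)" for c using that im by blast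
  then have "?F \<subseteq> dgen ?S"
    by (auto simp: E.Fr_def E.fv_def E.frac_pairs_iff intro!: dgen_mult dgen_rinv)
  moreover have "?S \<subseteq> ?F"
    using gens E.\<psi>_in_Fr[OF gen_carrier] by (auto simp: image_subset_iff) metis+
  ultimately show ?thesis using dgen_subset[OF E.divsub_Fr] by blast
qed

end

locale plane_action = ore_embedding scale "plane_power q n" \<psi> + Q: generic_qfamily scale n "\<lambda>_. q" a b
  for scale :: "'f::field \<Rightarrow> 'r::ring_1 \<Rightarrow> 'r" (infixr \<open>*s\<close> 75) and n q a b \<psi> +
  assumes image: "\<psi> ` carrier (plane_power q n) = Q.W"
    and gens: "\<And>i. i \<in> {1..n} \<Longrightarrow> \<psi> (power_gen q n Gx i) = a i \<and> \<psi> (power_gen q n Gy i) = b i"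
begin

abbreviation "P \<equiv> plane_power q n"

lemma P_eq: "P = TA n (\<lambda>_. q)"
  by (simp add: plane_power_def)

lemma power_gen_eq: "power_gen q n v i = gen n (\<lambda>_. q) v i"
  by (simp add: power_gen_def gen_def)

lemma power_gen_carrier: "power_gen q n v i \<in> carrier P"
  unfolding P_eq power_gen_eq by (rule gen_carrier)

text \<open>The elements \<open>\<alpha> i *s a (\<sigma> i)\<close> and
  \<open>b (\<sigma> i)\<close> form again a family with the same scalars, so the universal property
  gives the composite of \<open>\<psi>\<close> with the group element without constructing the
  automorphism first.\<close>

lemma twisted_embedding:
  assumes \<sigma>: "\<sigma> permutes {1..n}" and \<alpha>: "\<And>i. i \<in> {1..n} \<Longrightarrow> \<alpha> i \<noteq> 0"
  shows "\<exists>\<psi>'. ore_embedding scale P \<psi>' \<and> \<psi>' ` carrier P = Q.W \<and>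
    (\<forall>i\<in>{1..n}. \<psi>' (power_gen q n Gx i) = \<alpha> i *s a (\<sigma> i) \<and> \<psi>' (power_gen q n Gy i) = b (\<sigma> i))"
proof -
  have \<sigma>T: "\<sigma> i \<in> {1..n} \<longleftrightarrow> i \<in> {1..n}" for i using permutes_in_image[OF \<sigma>] .
  have inj: "\<sigma> i = \<sigma> j \<longleftrightarrow> i = j" for i j using permutes_inj[OF \<sigma>] by (simp add: inj_eq)
  interpret Q': generic_qfamily scale n "\<lambda>_. q" "\<lambda>i. \<alpha> i *s a (\<sigma> i)" "\<lambda>i. b (\<sigma> i)"
  proof unfold_locales
    fix i assume i: "i \<in> {1..n}"
    show "invt (\<alpha> i *s a (\<sigma> i))" "invt (b (\<sigma> i))"
      using Q.unit_ab \<sigma>T[of i] i \<alpha> by (auto intro: invt_scale)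
    show "b (\<sigma> i) * (\<alpha> i *s a (\<sigma> i)) = q *s (\<alpha> i *s a (\<sigma> i) * b (\<sigma> i))"
      using Q.b_a[of "\<sigma> i"] \<sigma>T[of i] i by (simp add: mult.commute)
  next
    fix i j assume "i \<in> {1..n}" "j \<in> {1..n}" "i \<noteq> j"
    then show "\<alpha> i *s a (\<sigma> i) * \<alpha> j *s a (\<sigma> j) = \<alpha> j *s a (\<sigma> j) * \<alpha> i *s a (\<sigma> i) \<and>
        b (\<sigma> i) * b (\<sigma> j) = b (\<sigma> j) * b (\<sigma> i) \<and> b (\<sigma> i) * \<alpha> j *s a (\<sigma> j) = \<alpha> j *s a (\<sigma> j) * b (\<sigma> i)"
      using Q.comm_ab[of "\<sigma> i" "\<sigma> j"] \<sigma>T[of i] \<sigma>T[of j] inj[of i j] by (simp add: mult.commute)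
  qed (use Q.generic in auto)
  have "Q'.W \<subseteq> Q.W"
    by (rule Q'.W_subset[OF Q.subalg_W]) (use \<sigma>T Q.a_in_W Q.b_in_W subalg_scale[OF Q.subalg_W] in auto)
  moreover have "Q.W \<subseteq> Q'.W"
  proof (rule Q.W_subset[OF Q'.subalg_W])
    fix i assume i: "i \<in> {1..n}"
    then obtain j where j: "j \<in> {1..n}" "\<sigma> j = i" using permutes_image[OF \<sigma>] by (metis imageE)
    have "inverse (\<alpha> j) *s \<alpha> j *s a (\<sigma> j) \<in> Q'.W"
      by (rule subalg_scale[OF Q'.subalg_W Q'.a_in_W[OF j(1)]])
    then show "a i \<in> Q'.W \<and> b i \<in> Q'.W" using Q'.b_in_W[OF j(1)] j \<alpha> by simp
  qed
  ultimately have W: "Q'.W = Q.W" by (rule equalityI)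
  have unit': "invt r" if r: "r \<in> Q.W" "r \<noteq> 0" for r
  proof -
    obtain c where c: "c \<in> carrier P" "r = \<psi> c" using r(1) image by blast
    then have "c \<noteq> \<zero>\<^bsub>P\<^esub>" using r(2) hom(5) by auto
    then show ?thesis using unit c by blast
  qed
  obtain \<psi>' where \<psi>': "rhom P \<psi>'" "inj_on \<psi>' (carrier P)" "\<psi>' ` carrier P = Q.W"
    "\<And>i. i \<in> {1..n} \<Longrightarrow> \<psi>' (power_gen q n Gx i) = \<alpha> i *s a (\<sigma> i) \<and> \<psi>' (power_gen q n Gy i) = b (\<sigma> i)"
    using Q'.tensor_embedding unfolding P_eq power_gen_eq W by blast
  have "ore_embedding scale P \<psi>'"
    unfolding P_eq by (rule Q'.ore_embedding_TA) (use unit' \<psi>' W in \<open>auto simp: P_eq\<close>)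
  then show ?thesis using \<psi>' by blast
qed

text \<open>The automorphism is \<open>\<psi>'\<close> followed by the inverse of
  \<open>\<psi>\<close>; since homomorphisms are determined on generators, it is the only one, and
  the description in \<open>G_act\<close> is meaningful.\<close>

lemma G_act_twist:
  assumes \<sigma>: "\<sigma> permutes {1..n}"
    and \<psi>': "ore_embedding scale P \<psi>'" "\<psi>' ` carrier P = Q.W"
      "\<And>i. i \<in> {1..n} \<Longrightarrow> \<psi>' (power_gen q n Gx i) = \<alpha> i *s a (\<sigma> i) \<and> \<psi>' (power_gen q n Gy i) = b (\<sigma> i)"
    and c: "c \<in> carrier P"
  shows "G_act q n (\<sigma>, \<alpha>) c \<in> carrier P \<and> \<psi> (G_act q n (\<sigma>, \<alpha>) c) = \<psi>' c"
proof -
  interpret E: ore_embedding scale P \<psi>' by (rule \<psi>')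
  have \<sigma>T: "\<sigma> i \<in> {1..n}" if "i \<in> {1..n}" for i using permutes_in_image[OF \<sigma>] that by simp
  define \<phi> where "\<phi> = restrict (inv_into (carrier P) \<psi> \<circ> \<psi>') (carrier P)"
  have b1: "bij_betw \<psi> (carrier P) Q.W" using inj image by (simp add: bij_betw_def)
  have b2: "bij_betw \<psi>' (carrier P) Q.W" using E.inj \<psi>'(2) by (simp add: bij_betw_def)
  have "bij_betw (inv_into (carrier P) \<psi> \<circ> \<psi>') (carrier P) (carrier P)"
    by (rule bij_betw_trans[OF b2 bij_betw_inv_into[OF b1]])
  then have bij: "bij_betw \<phi> (carrier P) (carrier P)"
    by (rule bij_betw_cong[THEN iffD1, rotated]) (simp add: \<phi>_def)
  have \<phi>C: "\<phi> c \<in> carrier P" if "c \<in> carrier P" for c using bij that by (auto simp: bij_betw_def)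
  have \<psi>\<phi>: "\<psi> (\<phi> c) = \<psi>' c" if "c \<in> carrier P" for c
    using that image \<psi>'(2) unfolding \<phi>_def by (auto intro!: f_inv_into_f)
  have \<psi>_eqI: "c = d" if "\<psi> c = \<psi> d" "c \<in> carrier P" "d \<in> carrier P" for c d
    using inj_onD[OF inj] that by blast
  have "G_act q n (\<sigma>, \<alpha>) = \<phi>"
    unfolding G_act_def prod.case
  proof (rule the_equality)
    have "\<phi> (c \<oplus>\<^bsub>P\<^esub> d) = \<phi> c \<oplus>\<^bsub>P\<^esub> \<phi> d" "\<phi> (c \<otimes>\<^bsub>P\<^esub> d) = \<phi> c \<otimes>\<^bsub>P\<^esub> \<phi> d"
      if "c \<in> carrier P" "d \<in> carrier P" for c d
      by (rule \<psi>_eqI; simp add: that \<phi>C \<psi>\<phi> hom(2,3) E.hom(2,3))+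
    moreover have "\<phi> (k \<odot>\<^bsub>P\<^esub> c) = k \<odot>\<^bsub>P\<^esub> \<phi> c" if "c \<in> carrier P" for k c
      by (rule \<psi>_eqI; simp add: that \<phi>C \<psi>\<phi> hom(4) E.hom(4))
    moreover have "\<phi> \<one>\<^bsub>P\<^esub> = \<one>\<^bsub>P\<^esub>"
      by (rule \<psi>_eqI; simp add: \<phi>C \<psi>\<phi> hom(1) E.hom(1))
    ultimately have "\<phi> \<in> alg_hom P P" using \<phi>C unfolding alg_hom_def ring_hom_def by simp
    then have "\<phi> \<in> alg_aut P" using bij by (simp add: alg_aut_def alg_iso_def \<phi>_def)
    moreover have "\<phi> (power_gen q n Gx i) = \<alpha> i \<odot>\<^bsub>P\<^esub> power_gen q n Gx (\<sigma> i) \<and>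
        \<phi> (power_gen q n Gy i) = power_gen q n Gy (\<sigma> i)" if i: "i \<in> {1..n}" for i
      using \<psi>'(3)[OF i] gens[OF \<sigma>T[OF i]]
      by (intro conjI \<psi>_eqI; simp add: power_gen_carrier \<psi>\<phi> hom(4) \<phi>C)
    ultimately show "\<phi> \<in> alg_aut P \<and> (\<forall>i\<in>{1..n}. \<phi> (power_gen q n Gx i) = \<alpha> i \<odot>\<^bsub>P\<^esub> power_gen q n Gx (\<sigma> i) \<and>
        \<phi> (power_gen q n Gy i) = power_gen q n Gy (\<sigma> i))" by blast
  next
    fix \<chi> assume *: "\<chi> \<in> alg_aut P \<and> (\<forall>i\<in>{1..n}. \<chi> (power_gen q n Gx i) = \<alpha> i \<odot>\<^bsub>P\<^esub> power_gen q n Gx (\<sigma> i) \<and>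
        \<chi> (power_gen q n Gy i) = power_gen q n Gy (\<sigma> i))"
    then have \<chi>: "\<chi> \<in> ring_hom P P" "\<And>c d. d \<in> carrier P \<Longrightarrow> \<chi> (c \<odot>\<^bsub>P\<^esub> d) = c \<odot>\<^bsub>P\<^esub> \<chi> d" "\<chi> \<in> extensional (carrier P)"
      by (auto simp: alg_aut_def alg_iso_def alg_hom_def)
    have \<chi>C: "\<chi> c \<in> carrier P" if "c \<in> carrier P" for c using ring_hom_closed[OF \<chi>(1) that] .
    have r: "rhom (TA n (\<lambda>_. q)) (\<psi> \<circ> \<chi>)"
      unfolding rhom_def P_eq[symmetric] using ring_hom_add[OF \<chi>(1)] ring_hom_mult[OF \<chi>(1)] ring_hom_one[OF \<chi>(1)] \<chi>(2) hom \<chi>C by simp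
    have "(\<psi> \<circ> \<chi>) c = \<psi>' c" if "c \<in> carrier P" for c
    proof (rule tensor_hom_unique[OF r])
      show "rhom (TA n (\<lambda>_. q)) \<psi>'" using E.\<psi> by (simp only: P_eq)
      show "(\<psi> \<circ> \<chi>) (gen n (\<lambda>_. q) v i) = \<psi>' (gen n (\<lambda>_. q) v i)" if i: "i \<in> {1..n}" for i v
        unfolding power_gen_eq[symmetric]
        using * i \<psi>'(3)[OF i] gens[OF \<sigma>T[OF i]] power_gen_carrier hom(4) by (cases v) auto
    qed (use that in \<open>simp only: P_eq\<close>)
    then have "\<chi> c = \<phi> c" if "c \<in> carrier P" for c using \<psi>_eqI[OF _ \<chi>C \<phi>C] \<psi>\<phi> that by simp
    then show "\<chi> = \<phi>" using \<chi>(3) by (intro extensionalityI[of _ "carrier P"]) (simp_all add: \<phi>_def)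
  qed
  then show ?thesis using \<phi>C \<psi>\<phi> c by simp
qed

lemma G_act_Frac_extension:
  assumes \<sigma>: "\<sigma> permutes {1..n}" and \<alpha>: "\<And>i. i \<in> {1..n} \<Longrightarrow> \<alpha> i \<noteq> 0"
  shows "\<exists>\<theta>. (\<forall>r\<in>Fr. \<forall>s\<in>Fr. \<theta> (r + s) = \<theta> r + \<theta> s \<and> \<theta> (r * s) = \<theta> r * \<theta> s) \<and>
    (\<forall>r\<in>Fr. \<forall>c. \<theta> (c *s r) = c *s \<theta> r) \<and> \<theta> 1 = 1 \<and> (\<forall>r\<in>Fr. \<theta> (rinv r) = rinv (\<theta> r)) \<and>
    (\<forall>i\<in>{1..n}. \<theta> (a i) = \<alpha> i *s a (\<sigma> i) \<and> \<theta> (b i) = b (\<sigma> i)) \<and>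
    (\<forall>r\<in>Fr. \<theta> r \<in> Fr \<and> G_act_Frac q n (\<sigma>, \<alpha>) (fib r) = fib (\<theta> r))"
proof -
  obtain \<psi>' where \<psi>': "ore_embedding scale P \<psi>'" "\<psi>' ` carrier P = Q.W"
    "\<And>i. i \<in> {1..n} \<Longrightarrow> \<psi>' (power_gen q n Gx i) = \<alpha> i *s a (\<sigma> i) \<and> \<psi>' (power_gen q n Gy i) = b (\<sigma> i)"
    using twisted_embedding[of \<sigma> \<alpha>, OF \<sigma> \<alpha>] by blast
  interpret E: ore_embedding scale P \<psi>' by (rule \<psi>')
  obtain \<theta> where \<theta>': "\<forall>c s. (c, s) \<in> frac_pairs P \<longrightarrow> \<theta> (fv c s) = E.fv c s" "\<forall>c\<in>carrier P. \<theta> (\<psi> c) = \<psi>' c"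
    "\<forall>r\<in>Fr. \<forall>s\<in>Fr. \<theta> (r + s) = \<theta> r + \<theta> s \<and> \<theta> (r * s) = \<theta> r * \<theta> s"
    "\<forall>r\<in>Fr. \<forall>c. \<theta> (c *s r) = c *s \<theta> r" "\<forall>r\<in>Fr. \<theta> (rinv r) = rinv (\<theta> r)"
    using extension[OF E.ore_hom_axioms] by (elim exE conjE)
  note \<theta> = \<theta>'(1)[rule_format] \<theta>'(2)[rule_format] \<theta>'(3-5)
  have "\<theta> 1 = 1" using \<theta>(2)[of "\<one>\<^bsub>P\<^esub>"] hom(1) E.hom(1) by simp
  moreover have "\<theta> (a i) = \<alpha> i *s a (\<sigma> i) \<and> \<theta> (b i) = b (\<sigma> i)" if i: "i \<in> {1..n}" for i
    using gens[OF i] \<psi>'(3)[OF i] \<theta>(2)[OF power_gen_carrier[of _ i]] by metis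
  moreover have "\<theta> r \<in> Fr" if r: "r \<in> Fr" for r
  proof -
    obtain c s where cs: "(c, s) \<in> frac_pairs P" "r = fv c s" using r by (rule FrE)
    have mem: "\<psi>' d \<in> Fr" if d: "d \<in> carrier P" for d
    proof -
      have "\<psi>' d \<in> \<psi> ` carrier P" unfolding image \<psi>'(2)[symmetric] using d by (rule imageI)
      then show ?thesis by (auto intro: \<psi>_in_Fr)
    qed
    show ?thesis unfolding cs(2) \<theta>(1)[OF cs(1)] E.fv_def
      using cs(1) mem divsub_rinv[OF divsub_Fr] subalg_mult[OF divsub_subalg[OF divsub_Fr]]
      by (simp add: frac_pairs_iff)
  qed
  moreover have "G_act_Frac q n (\<sigma>, \<alpha>) (fib r) = fib (\<theta> r)" if "r \<in> Fr" for r
    unfolding G_act_Frac_def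
    by (rule Frac_map_fib[OF that _ _ E.ore_hom_axioms]) (use G_act_twist[OF \<sigma> \<psi>'] \<theta>(1) in auto)
  ultimately show ?thesis using \<theta>(3-5) by blast
qed

end

section \<open>Comparison of the two division rings inside the operator ring\<close>

theorem theorem1p1:
  fixes m p n :: nat and q :: "'f::field_char_0"
  assumes "m > 0" and "p > 0" and "n > 0" and "p dvd m"
    and "\<exists>\<zeta>::'f. primitive_root_of_unity m \<zeta>"
    and "q \<noteq> 0" and "\<not> root_of_unity q"
  shows "fixed_algebra (G_group m p n) (G_act_Frac q n) (Frac (plane_power q n))
     \<cong>\<^sub>a\<^sub>l\<^sub>g Frac (tensor_alg {1..n} (\<lambda>i. quantum_plane (if i = 1 then q ^ (m div p) else q ^ m)))"
proof -
  let ?G = "carrier (G_group m p n) :: ((nat \<Rightarrow> nat) \<times> (nat \<Rightarrow> 'f)) set"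
  interpret Q: qfamily scale_operator n "\<lambda>_. q" x_op "y_op q" by (rule operator_qfamily[OF \<open>q \<noteq> 0\<close>])
  interpret Q: generic_qfamily scale_operator n "\<lambda>_. q" x_op "y_op q" by unfold_locales (rule assms)
  obtain \<psi> where \<psi>: "operator.rhom (TA n (\<lambda>_. q)) \<psi>" "inj_on \<psi> (carrier (TA n (\<lambda>_. q)))" "\<psi> ` carrier (TA n (\<lambda>_. q)) = Q.W"
    "\<And>i. i \<in> {1..n} \<Longrightarrow> \<psi> (gen n (\<lambda>_. q) Gx i) = x_op i \<and> \<psi> (gen n (\<lambda>_. q) Gy i) = y_op q i"
    using Q.tensor_embedding by blast
  have emb: "ore_embedding scale_operator (TA n (\<lambda>_. q)) \<psi>"
    by (rule Q.ore_embedding_TA) (use operator_W_invt[OF \<open>q \<noteq> 0\<close>] \<psi> in auto)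
  interpret E: ore_embedding scale_operator "plane_power q n" \<psi>
    using emb by (simp only: plane_power_def)
  interpret E: plane_action scale_operator n q x_op "y_op q" \<psi>
    by unfold_locales (use \<psi> in \<open>simp_all add: plane_power_def power_gen_def gen_def\<close>)
  define D where "D = E.Fr"
  have D: "operator.divsub D" unfolding D_def by (rule E.divsub_Fr)
  have D_gen: "D = operator.dgen (x_op ` {1..n} \<union> y_op q ` {1..n})"
    unfolding D_def plane_power_def by (rule Q.Fr_TA[OF emb \<psi>(3,4)])
  have G: "\<sigma> permutes {1..n}" "\<And>i. i \<in> {1..n} \<Longrightarrow> \<alpha> i \<noteq> 0" if "(\<sigma>, \<alpha>) \<in> ?G" for \<sigma> \<alpha>
  proof -
    show "\<sigma> permutes {1..n}" using that by (simp add: G_group_def sym_group_def)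
    fix i assume "i \<in> {1..n}"
    then have "\<alpha> i ^ m = 1" using that by (auto simp: G_group_def A_tuples_def)
    then show "\<alpha> i \<noteq> 0" using \<open>m > 0\<close> by (auto simp: zero_power)
  qed
  \<comment> \<open>All properties of one extension are bundled, so that a single choice over the
    group provides the whole action \<open>\<theta>\<close>.\<close>
  define H where "H g \<theta> \<longleftrightarrow> (\<forall>r\<in>D. \<forall>s\<in>D. \<theta> (r + s) = \<theta> r + \<theta> s \<and> \<theta> (r * s) = \<theta> r * \<theta> s) \<and>
    (\<forall>r\<in>D. \<forall>c. \<theta> (scale_operator c r) = scale_operator c (\<theta> r)) \<and> \<theta> 1 = 1 \<and> (\<forall>r\<in>D. \<theta> (rinv r) = rinv (\<theta> r)) \<and>
    (\<forall>i\<in>{1..n}. \<theta> (x_op i) = scale_operator (snd g i) (x_op (fst g i)) \<and> \<theta> (y_op q i) = y_op q (fst g i)) \<and>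
    (\<forall>r\<in>D. \<theta> r \<in> D \<and> G_act_Frac q n g (E.fib r) = E.fib (\<theta> r))" for g \<theta>
  have "\<exists>\<theta>. H g \<theta>" if "g \<in> ?G" for g
  proof -
    obtain \<sigma> \<alpha> where g: "g = (\<sigma>, \<alpha>)" by (cases g)
    show ?thesis
      using E.G_act_Frac_extension[of \<sigma> \<alpha>, OF G[of \<sigma> \<alpha>]] that unfolding H_def g D_def fst_conv snd_conv by blast
  qed
  then have "\<forall>g\<in>?G. \<exists>\<theta>. H g \<theta>" by blast
  then obtain \<theta> where "\<forall>g\<in>?G. H g (\<theta> g)" unfolding bchoice_iff by (rule exE)
  then have \<theta>:
    "\<And>g r s. g \<in> ?G \<Longrightarrow> r \<in> D \<Longrightarrow> s \<in> D \<Longrightarrow> \<theta> g (r + s) = \<theta> g r + \<theta> g s \<and> \<theta> g (r * s) = \<theta> g r * \<theta> g s"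
    "\<And>g c r. g \<in> ?G \<Longrightarrow> r \<in> D \<Longrightarrow> \<theta> g (scale_operator c r) = scale_operator c (\<theta> g r)"
    "\<And>g. g \<in> ?G \<Longrightarrow> \<theta> g 1 = 1"
    "\<And>g r. g \<in> ?G \<Longrightarrow> r \<in> D \<Longrightarrow> \<theta> g (rinv r) = rinv (\<theta> g r)"
    "\<And>g i. g \<in> ?G \<Longrightarrow> i \<in> {1..n} \<Longrightarrow> \<theta> g (x_op i) = scale_operator (snd g i) (x_op (fst g i)) \<and> \<theta> g (y_op q i) = y_op q (fst g i)"
    "\<And>g r. g \<in> ?G \<Longrightarrow> r \<in> D \<Longrightarrow> \<theta> g r \<in> D \<and> G_act_Frac q n g (E.fib r) = E.fib (\<theta> g r)"
    unfolding H_def by blast+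
  obtain \<zeta> :: 'f where \<zeta>: "primitive_root_of_unity m \<zeta>" using assms by blast
  have xyD: "x_op i \<in> D" "y_op q i \<in> D" if "i \<in> {1..n}" for i
    unfolding D_gen using that by (auto intro: operator.dgen_base)
  have yx: "y_op q i * x_op j = scale_operator (if i = j then q else 1) (x_op j * y_op q i)"
    "x_op i * x_op j = (x_op j * x_op i :: 'f operator)" "y_op q i * y_op q j = y_op q j * y_op q i"
    if "i \<in> {1..n}" "j \<in> {1..n}" for i j
    using Q.b_a[OF that(1)] Q.comm_ab[OF that] by (cases "i = j"; simp)+
  interpret N: q_noether scale_operator D q n m x_op "y_op q" p \<zeta> \<theta>
  proof unfold_locales
    show "x_op i \<in> D \<and> y_op q i \<in> D \<and> x_op i \<noteq> (0 :: 'f operator) \<and> y_op q i \<noteq> 0" if "i \<in> {1..n}" for i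
      using that xyD Q.unit_ab invt_neq_0 by blast
    show "\<theta> (\<sigma>, \<alpha>) (x_op i) = scale_operator (\<alpha> i) (x_op (\<sigma> i)) \<and> \<theta> (\<sigma>, \<alpha>) (y_op q i) = y_op q (\<sigma> i)"
      if "(\<sigma>, \<alpha>) \<in> ?G" "i \<in> {1..n}" for \<sigma> \<alpha> i
      using \<theta>(5)[OF that] by (simp only: fst_conv snd_conv)
  qed (fact assms D D_gen \<zeta> \<theta>(1) \<theta>(2) \<theta>(3) \<theta>(4) yx)+
  obtain a b where ab: "\<And>i. i \<in> {1..n} \<Longrightarrow> a i \<in> D \<and> b i \<in> D \<and> a i \<noteq> 0 \<and> b i \<noteq> 0"
    "\<And>i. i \<in> {1..n} \<Longrightarrow> b i * a i = scale_operator (if i = 1 then q ^ N.l else q ^ m) (a i * b i)"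
    "\<And>i j. i \<in> {1..n} \<Longrightarrow> j \<in> {1..n} \<Longrightarrow> i \<noteq> j \<Longrightarrow> a i * a j = a j * a i \<and> b i * b j = b j * b i \<and> b i * a j = a j * b i"
    "N.DG = operator.dgen (a ` {1..n} \<union> b ` {1..n})"
    using N.DG_generators by blast
  define t where "t i = (if i = (1::nat) then q ^ (m div p) else q ^ m)" for i
  have generic: "\<not> root_of_unity (t i)" for i
  proof
    assume "root_of_unity (t i)"
    then obtain k where k: "k > 0" "t i ^ k = 1" by (auto simp: root_of_unity_def)
    then have "q ^ ((if i = 1 then m div p else m) * k) = 1" by (cases "i = 1") (simp_all add: t_def power_mult)
    moreover have "(if i = 1 then m div p else m) * k > 0" using k N.l(2) \<open>m > 0\<close> by (simp add: N.l_def)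
    ultimately show False using assms(7) unfolding root_of_unity_def by blast
  qed
  interpret B: generic_qfamily scale_operator n t a b
    by unfold_locales (use ab N.l_def generic operator.divsub_invt[OF D] in \<open>auto simp: t_def\<close>)
  obtain \<psi>B where \<psi>B: "operator.rhom (TA n t) \<psi>B" "inj_on \<psi>B (carrier (TA n t))" "\<psi>B ` carrier (TA n t) = B.W"
    "\<And>i. i \<in> {1..n} \<Longrightarrow> \<psi>B (gen n t Gx i) = a i \<and> \<psi>B (gen n t Gy i) = b i"
    using B.tensor_embedding by blast
  have "B.W \<subseteq> D" by (rule B.W_subset) (use operator.divsub_subalg[OF D] ab in auto)
  then have embB: "ore_embedding scale_operator (TA n t) \<psi>B"
    by (intro B.ore_embedding_TA \<psi>B) (use operator.divsub_invt[OF D] in auto)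
  interpret F: ore_embedding scale_operator "TA n t" \<psi>B by (rule embB)
  \<comment> \<open>The fractions of the target algebra and the invariants are now the same set of
    operators.\<close>
  have "F.Fr = N.DG" using B.Fr_TA[OF embB \<psi>B(3,4)] ab(4) by simp
  then have 1: "operator.represents F.\<Phi> (Frac (TA n t)) N.DG" using F.represents_Frac by simp
  have DG: "N.DG \<subseteq> D" by (auto simp: N.DG_def)
  have fixed: "G_act_Frac q n g (E.fib r) = E.fib r \<longleftrightarrow> \<theta> g r = r" if "g \<in> ?G" "r \<in> D" for g r
    using \<theta>(6)[OF that] E.fib_eq_iff[of "\<theta> g r" r] that(2) unfolding D_def by metis
  have "operator.represents E.\<Phi> (fixed_algebra (G_group m p n) (G_act_Frac q n) (Frac (plane_power q n))) N.DG"
  \<comment> \<open>Taking fibres intertwines the given action on fractions with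
    \<open>\<theta>\<close>, so fixed classes correspond to fixed elements.\<close>
  proof (rule E.represents_subset)
    show "carrier (fixed_algebra (G_group m p n) (G_act_Frac q n) (Frac (plane_power q n))) = E.fib ` N.DG"
    proof -
      have "carrier (fixed_algebra (G_group m p n) (G_act_Frac q n) (Frac (plane_power q n)))
          = {P \<in> E.fib ` D. \<forall>g\<in>?G. G_act_Frac q n g P = P}"
        by (simp add: fixed_algebra_def E.carrier_Frac D_def)
      also have "\<dots> = E.fib ` {r \<in> D. \<forall>g\<in>?G. G_act_Frac q n g (E.fib r) = E.fib r}" by blast
      also have "{r \<in> D. \<forall>g\<in>?G. G_act_Frac q n g (E.fib r) = E.fib r} = N.DG"
        unfolding N.DG_def using fixed by blast
      finally show ?thesis .
    qed
  qed (use DG operator.divsub_subalg[OF N.divsub_DG] in \<open>auto simp: fixed_algebra_def D_def\<close>)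
  from operator.represents_isomorphic[OF this 1] show ?thesis by (simp add: t_def)
qed

end
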